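(* Work in the proportional block dependent linear model described in the context, where the design $\mathcal{X}=X\Lambda^{1/2}$ satisfies Assumption 1 and $\beta_0$ satisfies Assumption 2, and let $\mathcal{G}=G\Lambda^{1/2}$, where $G\in\mathbb{R}^{n\times p}$ has i.i.d. standard Gaussian entries. Let $\psi:\mathbb{R}\to\mathbb{R}$ be a bounded differentiable function with bounded Lipschitz derivative. Let $K\in\{R,L\}$, and if $K=L$ assume in addition Assumption 3. Then $$\Big|E\,\psi\Big(\min_{\varphi\in\mathbb{R}^p}R^{K}(\varphi,\mathcal{X})\Big)-E\,\psi\Big(\min_{\varphi\in\mathbb{R}^p}R^{K}(\varphi,\mathcal{G})\Big)\Big|\le\gamma_n$$ for some $\gamma_n=o(1)$. In particular, writing $R^K(\mathcal{A})=\min_{\varphi\in\mathbb{R}^p}R^K(\varphi,\mathcal{A})$, if $R^K(\mathcal{G})\to\rho$ in probability for a constant $\rho$, then $R^K(\mathcal{X})\to\rho$ in probability as well.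
   Context: Model. For each $n$ there is $p=p(n)$ with $p/n\to\kappa\in(0,\infty)$, a deterministic signal $\beta_0=\beta_0(n)\in\mathbb{R}^p$, a random design $\mathcal{X}\in\mathbb{R}^{n\times p}$ and a noise vector $\xi\in\mathbb{R}^n$ with independent, centered, uniformly sub-Gaussian entries of variance $\sigma^2$ (not necessarily identically distributed), independent of the design; $Y=\mathcal{X}\beta_0+\xi$. When $\mathcal{X}$ is replaced by $\mathcal{G}$, the response is $\mathcal{G}\beta_0+\xi$, with $\xi$ independent of $\mathcal{G}$. The tuning parameter $\lambda>0$ does not depend on $n$. Constants in the assumptions do not depend on $n$. $\|\cdot\|$ is the Euclidean norm. Block dependence. A $p$-dimensional random vector $W$ is block dependent with dependence parameter $d$ if there is a partition $S_1,\dots,S_{k_p}$ of $\{1,\dots,p\}$ with $|S_j|\le d$ for all $j$ such that $W_l$ and $W_k$ are independent whenever $l\in S_i$, $k\in S_j$, $i\ne j$ (that is, the blocks of coordinates are independent). Assumption 1. The rows of $\mathcal{X}$ are i.i.d. and each is block dependent with dependence parameter $d$, where $d=o((n/\log n)^{1/5})$. Moreover $\mathcal{X}=X\Lambda^{1/2}$, where the rows $X_i$ of $X$ satisfy $E[X_i]=0$, $E[X_{ij}X_{ik}]=\delta_{jk}$, $E|X_{ij}|^4\le K_0$ for a constant $K_0$, and are sub-Gaussian random vectors (with sub-Gaussian norm bounded uniformly in $n$). $\Lambda=\mathrm{diag}(\lambda_1,\dots,\lambda_p)$ with $c\le\lambda_i\le C$ for positive constants $c,C$. Assumption 2. $\beta_0^T\Lambda\beta_0\le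 C$; with $v_i=\sqrt{n\lambda_i}\,\beta_{0,i}$, the empirical measures $\frac1p\sum_{i=1}^p\delta_{(\lambda_i,v_i)}$ converge in Wasserstein-2 distance to a measure $\mu$ on $\mathbb{R}^{\ge0}\times\mathbb{R}$; and $\|v\|_\infty\le C$. Assumption 3. $\lambda\ge\lambda_0$, where $\lambda_0$ is a sufficiently large constant (not depending on $n$). Risks. With $\varphi=\beta-\beta_0$, for a design $\mathcal{A}\in\{\mathcal{X},\mathcal{G}\}$, $$R^K(\varphi,\mathcal{A})=\frac1{2n}\|\mathcal{A}\varphi-\xi\|^2+\lambda f_K(\varphi+\beta_0),\qquad f_R(\beta)=\tfrac12\|\beta\|_2^2\ (\text{ridge}),\quad f_L(\beta)=\tfrac1{\sqrt n}\|\beta\|_1\ (\text{Lasso}).$$ *)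

theory Defs
  imports "HOL-Probability.Probability" "HOL-Library.Disjoint_Sets" "HOL-Library.Landau_Symbols"
begin

text \<open>
  Conventions.  The sizes \<open>n\<close>, \<open>p n\<close> vary inside the statements, so a vector of \<open>\<real>\<^sup>p\<close> is a function
  \<open>nat \<Rightarrow> real\<close> of which only the coordinates below \<open>p\<close> are used (as a set, \<open>\<real>\<^sup>p\<close> is
  \<open>{..<p} \<rightarrow>\<^sub>E UNIV\<close>), an \<open>n \<times> p\<close> matrix is a function \<open>nat \<Rightarrow> nat \<Rightarrow> real\<close> of row and column, and
  a random vector or matrix takes the sample point as its first argument.
\<close>

section \<open>Risks\<close>

datatype penalty_kind = Ridge | Lasso

fun penalty :: "penalty_kind \<Rightarrow> nat \<Rightarrow> nat \<Rightarrow> (nat \<Rightarrow> real) \<Rightarrow> real" where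
  "penalty Ridge n p \<beta> = (1/2) * (\<Sum>j<p. (\<beta> j)\<^sup>2)"
| "penalty Lasso n p \<beta> = (1 / sqrt (real n)) * (\<Sum>j<p. \<bar>\<beta> j\<bar>)"

definition risk :: "penalty_kind \<Rightarrow> real \<Rightarrow> nat \<Rightarrow> nat \<Rightarrow> (nat \<Rightarrow> real) \<Rightarrow>
    (nat \<Rightarrow> nat \<Rightarrow> real) \<Rightarrow> (nat \<Rightarrow> real) \<Rightarrow> (nat \<Rightarrow> real) \<Rightarrow> real" where
  "risk K lam n p \<beta>\<^sub>0 A \<xi> \<phi> =
     (1 / (2 * real n)) * (\<Sum>i<n. ((\<Sum>j<p. A i j * \<phi> j) - \<xi> i)\<^sup>2)
     + lam * penalty K n p (\<lambda>j. \<phi> j + \<beta>\<^sub>0 j)"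

text \<open>The infimum below is a minimum whenever \<open>n > 0\<close> and \<open>lam > 0\<close>: see \<open>min_risk_attained\<close>.\<close>

definition min_risk :: "penalty_kind \<Rightarrow> real \<Rightarrow> nat \<Rightarrow> nat \<Rightarrow> (nat \<Rightarrow> real) \<Rightarrow>
    (nat \<Rightarrow> nat \<Rightarrow> real) \<Rightarrow> (nat \<Rightarrow> real) \<Rightarrow> real" where
  "min_risk K lam n p \<beta>\<^sub>0 A \<xi> = (INF \<phi>\<in>{..<p} \<rightarrow>\<^sub>E UNIV. risk K lam n p \<beta>\<^sub>0 A \<xi> \<phi>)"

lemma penalty_nonneg: "0 \<le> penalty K n p \<beta>"
  by (cases K) (auto intro!: sum_nonneg mult_nonneg_nonneg)

lemma abs_le_penalty:
  assumes "0 < n" "j < p"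
  shows "\<bar>\<beta> j\<bar> \<le> 1 + (2 + sqrt (real n)) * penalty K n p \<beta>"
proof (cases K)
  case Ridge
  have "(\<beta> j)\<^sup>2 \<le> (\<Sum>j<p. (\<beta> j)\<^sup>2)"
    using assms by (intro member_le_sum) auto
  then have 1: "(\<beta> j)\<^sup>2 \<le> 2 * penalty K n p \<beta>"
    by (simp add: Ridge)
  have 2: "0 \<le> (\<bar>\<beta> j\<bar> - 1)\<^sup>2"
    by simp
  have 3: "\<bar>\<beta> j\<bar> \<le> 1 + (\<beta> j)\<^sup>2"
    using 2 zero_le_power2[of "\<beta> j"] unfolding power2_diff power2_abs by simp
  have 4: "0 \<le> sqrt (real n) * penalty K n p \<beta>"
    by (simp add: penalty_nonneg)
  show ?thesis
    using 1 3 4 by (simp add: algebra_simps)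
next
  case Lasso
  have "\<bar>\<beta> j\<bar> \<le> (\<Sum>j<p. \<bar>\<beta> j\<bar>)"
    using assms by (intro member_le_sum) auto
  then have 1: "\<bar>\<beta> j\<bar> \<le> sqrt (real n) * penalty K n p \<beta>"
    using assms by (simp add: Lasso)
  show ?thesis
    using 1 penalty_nonneg[of K n p \<beta>] by (simp add: algebra_simps)
qed

lemma continuous_on_risk:
  assumes "0 < n"
  shows "continuous_on S (risk K lam n p \<beta>\<^sub>0 A \<xi>)"
proof -
  have c: "continuous_on S (\<lambda>\<phi>. \<phi> j)" for j :: nat and S :: "(nat \<Rightarrow> real) set"
    by (rule continuous_on_product_coordinates[THEN continuous_on_subset]) simp
  show ?thesis
    unfolding risk_def using assms by (cases K) (auto intro!: continuous_intros c)
qed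

lemma min_risk_attained:
  assumes "0 < n" "0 < lam"
  obtains \<phi> where "\<phi> \<in> {..<p} \<rightarrow>\<^sub>E UNIV"
    and "risk K lam n p \<beta>\<^sub>0 A \<xi> \<phi> = min_risk K lam n p \<beta>\<^sub>0 A \<xi>"
    and "\<And>\<phi>'. risk K lam n p \<beta>\<^sub>0 A \<xi> \<phi> \<le> risk K lam n p \<beta>\<^sub>0 A \<xi> \<phi>'"
proof -
  let ?r = "risk K lam n p \<beta>\<^sub>0 A \<xi>"
  define z where "z = (\<lambda>j\<in>{..<p}. - \<beta>\<^sub>0 j)"
  define b where "b = 1 + (2 + sqrt (real n)) * (?r z / lam)"
  define C where "C = (\<Pi>\<^sub>E j\<in>UNIV. if j < p then {- \<beta>\<^sub>0 j - b .. - \<beta>\<^sub>0 j + b} else {undefined})"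
  have pen: "lam * penalty K n p (\<lambda>j. \<phi> j + \<beta>\<^sub>0 j) \<le> ?r \<phi>" for \<phi>
    unfolding risk_def by (simp add: sum_nonneg)
  have rz: "0 \<le> ?r z"
    using pen[of z] assms penalty_nonneg[of K n p "\<lambda>j. z j + \<beta>\<^sub>0 j"]
    by (smt (verit) mult_nonneg_nonneg)
  have b: "0 \<le> b"
    using rz assms unfolding b_def by auto
  have "compactin (product_topology (\<lambda>_. euclidean) UNIV) C"
    unfolding C_def by (subst compactin_PiE) (auto simp del: PiE_UNIV_domain)
  then have C: "compact C"
    by (simp add: euclidean_product_topology)
  have zC: "z \<in> C"
    using b by (auto simp: C_def z_def)
  obtain \<phi> where \<phi>: "\<phi> \<in> C" and min: "\<forall>y\<in>C. ?r \<phi> \<le> ?r y"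
    using continuous_attains_inf[OF C _ continuous_on_risk[OF assms(1)]] zC by blast
  have dom: "\<phi> \<in> {..<p} \<rightarrow>\<^sub>E UNIV"
    using \<phi> by (force simp: C_def PiE_def Pi_def extensional_def split: if_splits)
  have le: "?r \<phi> \<le> ?r \<phi>'" for \<phi>'
  proof (cases "?r \<phi>' \<le> ?r z")
    case True
    have eq: "?r (restrict \<phi>' {..<p}) = ?r \<phi>'"
      unfolding risk_def by (cases K) auto
    have "penalty K n p (\<lambda>j. \<phi>' j + \<beta>\<^sub>0 j) \<le> ?r z / lam"
      using pen[of \<phi>'] True assms by (simp add: field_simps)
    then have "(2 + sqrt (real n)) * penalty K n p (\<lambda>j. \<phi>' j + \<beta>\<^sub>0 j)
        \<le> (2 + sqrt (real n)) * (?r z / lam)"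
      by (intro mult_left_mono) auto
    then have "\<bar>\<phi>' j + \<beta>\<^sub>0 j\<bar> \<le> b" if "j < p" for j
      using abs_le_penalty[OF assms(1) that, of "\<lambda>j. \<phi>' j + \<beta>\<^sub>0 j" K] unfolding b_def by linarith
    then have "restrict \<phi>' {..<p} \<in> C"
      by (fastforce simp: C_def abs_le_iff)
    then show ?thesis
      using min eq by metis
  next
    case False
    then show ?thesis
      using min zC by fastforce
  qed
  have "(INF \<phi>\<in>{..<p} \<rightarrow>\<^sub>E UNIV. ?r \<phi>) = ?r \<phi>"
    by (rule cInf_eq_minimum) (use dom le in auto)
  then show thesis
    using that dom le unfolding min_risk_def by metis
qed


section \<open>Random vectors\<close>

definition random_matrix :: "nat \<Rightarrow> nat \<Rightarrow> ('a \<Rightarrow> nat \<Rightarrow> nat \<Rightarrow> real) \<Rightarrow> 'a \<Rightarrow> nat \<times> nat \<Rightarrow> real" where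
  "random_matrix n p A \<omega> = (\<lambda>(i, j)\<in>{..<n} \<times> {..<p}. A \<omega> i j)"

definition random_vector :: "nat set \<Rightarrow> ('a \<Rightarrow> nat \<Rightarrow> real) \<Rightarrow> 'a \<Rightarrow> nat \<Rightarrow> real" where
  "random_vector I W \<omega> = restrict (W \<omega>) I"

definition iid_rows :: "'a measure \<Rightarrow> nat \<Rightarrow> nat \<Rightarrow> ('a \<Rightarrow> nat \<Rightarrow> nat \<Rightarrow> real) \<Rightarrow> bool" where
  "iid_rows M n p A \<longleftrightarrow>
     prob_space.indep_vars M (\<lambda>_. PiM {..<p} (\<lambda>_. borel))
       (\<lambda>i. random_vector {..<p} (\<lambda>\<omega>. A \<omega> i)) {..<n} \<and>
     (\<forall>i<n. \<forall>i'<n.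
        distr M (PiM {..<p} (\<lambda>_. borel)) (random_vector {..<p} (\<lambda>\<omega>. A \<omega> i)) =
        distr M (PiM {..<p} (\<lambda>_. borel)) (random_vector {..<p} (\<lambda>\<omega>. A \<omega> i')))"

text \<open>The subvectors over the blocks of the partition are mutually independent.\<close>

definition block_dependent :: "'a measure \<Rightarrow> nat \<Rightarrow> nat \<Rightarrow> ('a \<Rightarrow> nat \<Rightarrow> real) \<Rightarrow> bool" where
  "block_dependent M p d W \<longleftrightarrow>
     (\<exists>\<S>. partition_on {..<p} \<S> \<and> (\<forall>S\<in>\<S>. card S \<le> d) \<and>
          prob_space.indep_vars M (\<lambda>S. PiM S (\<lambda>_. borel)) (\<lambda>S. random_vector S W) \<S>)"

text \<open>
  The sub-Gaussian norms are extended nonnegative reals; the infimum over the empty set is \<open>\<infinity>\<close>,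
  so a finite bound on the norm entails that all moments are finite.
\<close>

definition psi2_norm :: "'a measure \<Rightarrow> ('a \<Rightarrow> real) \<Rightarrow> ennreal" where
  "psi2_norm M Z =
     (INF t\<in>{t::real. 0 < t \<and> (\<integral>\<^sup>+\<omega>. ennreal (exp ((Z \<omega> / t)\<^sup>2)) \<partial>M) \<le> 2}. ennreal t)"

definition psi2_norm_vec :: "'a measure \<Rightarrow> nat \<Rightarrow> ('a \<Rightarrow> nat \<Rightarrow> real) \<Rightarrow> ennreal" where
  "psi2_norm_vec M p W =
     (SUP u\<in>{u::nat \<Rightarrow> real. (\<Sum>j<p. (u j)\<^sup>2) = 1}. psi2_norm M (\<lambda>\<omega>. \<Sum>j<p. u j * W \<omega> j))"

definition converges_in_probability :: "(nat \<Rightarrow> 'a measure) \<Rightarrow> (nat \<Rightarrow> 'a \<Rightarrow> real) \<Rightarrow> real \<Rightarrow> bool" where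
  "converges_in_probability M Z \<rho> \<longleftrightarrow>
     (\<forall>\<epsilon>>0. (\<lambda>n. measure (M n) {\<omega> \<in> space (M n). \<bar>Z n \<omega> - \<rho>\<bar> > \<epsilon>}) \<longlonglongrightarrow> 0)"


section \<open>Wasserstein-2 distance\<close>

definition couplings :: "(real \<times> real) measure \<Rightarrow> (real \<times> real) measure \<Rightarrow>
    ((real \<times> real) \<times> (real \<times> real)) measure set" where
  "couplings \<mu> \<nu> = {\<pi>. sets \<pi> = sets borel \<and> distr \<pi> borel fst = \<mu> \<and> distr \<pi> borel snd = \<nu>}"

text \<open>
  Meant for Borel probability measures with finite second moment, for which couplings exist and
  the integrand is integrable under each of them.
\<close>

definition wasserstein2 :: "(real \<times> real) measure \<Rightarrow> (real \<times> real) measure \<Rightarrow> real" where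
  "wasserstein2 \<mu> \<nu> = sqrt (INF \<pi>\<in>couplings \<mu> \<nu>. \<integral>z. (dist (fst z) (snd z))\<^sup>2 \<partial>\<pi>)"

definition empirical_measure :: "nat \<Rightarrow> (nat \<Rightarrow> real \<times> real) \<Rightarrow> (real \<times> real) measure" where
  "empirical_measure p x = distr (uniform_count_measure {..<p}) borel x"


section \<open>The model\<close>

text \<open>\<open>scale_columns \<Lambda> A\<close> is the matrix \<open>A \<Lambda>\<^sup>1\<^sup>/\<^sup>2\<close> for the diagonal matrix with entries \<open>\<Lambda> j\<close>.\<close>

definition scale_columns :: "(nat \<Rightarrow> real) \<Rightarrow> (nat \<Rightarrow> nat \<Rightarrow> real) \<Rightarrow> nat \<Rightarrow> nat \<Rightarrow> real" where
  "scale_columns \<Lambda> A i j = A i j * sqrt (\<Lambda> j)"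

text \<open>
  Independence of a random matrix and a random vector is stated through the generated
  sigma-algebras, because \<^term>\<open>prob_space.indep_var\<close> needs variables of the same type.
\<close>

definition independent_of_design ::
    "'a measure \<Rightarrow> nat \<Rightarrow> nat \<Rightarrow> ('a \<Rightarrow> nat \<Rightarrow> nat \<Rightarrow> real) \<Rightarrow> ('a \<Rightarrow> nat \<Rightarrow> real) \<Rightarrow> bool" where
  "independent_of_design M n p A \<xi> \<longleftrightarrow>
     prob_space.indep_set M
       (sets (vimage_algebra (space M) (random_matrix n p A) (PiM ({..<n} \<times> {..<p}) (\<lambda>_. borel))))
       (sets (vimage_algebra (space M) (random_vector {..<n} \<xi>) (PiM {..<n} (\<lambda>_. borel))))"

definition noise_assumption ::
    "real \<Rightarrow> real \<Rightarrow> (nat \<Rightarrow> 'a measure) \<Rightarrow> (nat \<Rightarrow> 'a \<Rightarrow> nat \<Rightarrow> real) \<Rightarrow> bool" where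
  "noise_assumption \<sigma> K\<^sub>\<xi> M \<xi> \<longleftrightarrow>
     (\<forall>n>0.
        prob_space.indep_vars (M n) (\<lambda>_. borel) (\<lambda>i \<omega>. \<xi> n \<omega> i) {..<n} \<and>
        (\<forall>i<n. (\<integral>\<omega>. \<xi> n \<omega> i \<partial>M n) = 0 \<and>
               (\<integral>\<omega>. (\<xi> n \<omega> i)\<^sup>2 \<partial>M n) = \<sigma>\<^sup>2 \<and>
               psi2_norm (M n) (\<lambda>\<omega>. \<xi> n \<omega> i) \<le> ennreal K\<^sub>\<xi>))"

definition design_assumption ::
    "real \<Rightarrow> real \<Rightarrow> real \<Rightarrow> real \<Rightarrow> (nat \<Rightarrow> 'a measure) \<Rightarrow> (nat \<Rightarrow> nat) \<Rightarrow> (nat \<Rightarrow> nat) \<Rightarrow>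
     (nat \<Rightarrow> nat \<Rightarrow> real) \<Rightarrow> (nat \<Rightarrow> 'a \<Rightarrow> nat \<Rightarrow> nat \<Rightarrow> real) \<Rightarrow> bool" where
  "design_assumption K\<^sub>0 K\<^sub>X c C M p d \<Lambda> X \<longleftrightarrow>
     (\<lambda>n. real (d n)) \<in> o(\<lambda>n. (real n / ln (real n)) powr (1/5)) \<and>
     (\<forall>n>0.
        iid_rows (M n) n (p n) (\<lambda>\<omega>. scale_columns (\<Lambda> n) (X n \<omega>)) \<and>
        (\<forall>i<n. block_dependent (M n) (p n) (d n) (\<lambda>\<omega>. scale_columns (\<Lambda> n) (X n \<omega>) i)) \<and>
        (\<forall>i<n. \<forall>j<p n. (\<integral>\<omega>. X n \<omega> i j \<partial>M n) = 0) \<and>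
        (\<forall>i<n. \<forall>j<p n. \<forall>k<p n. (\<integral>\<omega>. X n \<omega> i j * X n \<omega> i k \<partial>M n) = (if j = k then 1 else 0)) \<and>
        (\<forall>i<n. \<forall>j<p n. (\<integral>\<omega>. \<bar>X n \<omega> i j\<bar> ^ 4 \<partial>M n) \<le> K\<^sub>0) \<and>
        (\<forall>i<n. psi2_norm_vec (M n) (p n) (\<lambda>\<omega>. X n \<omega> i) \<le> ennreal K\<^sub>X) \<and>
        (\<forall>j<p n. c \<le> \<Lambda> n j \<and> \<Lambda> n j \<le> C))"

definition signal_assumption ::
    "real \<Rightarrow> (nat \<Rightarrow> nat) \<Rightarrow> (nat \<Rightarrow> nat \<Rightarrow> real) \<Rightarrow> (nat \<Rightarrow> nat \<Rightarrow> real) \<Rightarrow>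
     (real \<times> real) measure \<Rightarrow> bool" where
  "signal_assumption C p \<Lambda> \<beta>\<^sub>0 \<mu> \<longleftrightarrow>
     (\<forall>n>0. (\<Sum>j<p n. \<Lambda> n j * (\<beta>\<^sub>0 n j)\<^sup>2) \<le> C \<and>
            (\<forall>j<p n. \<bar>sqrt (real n * \<Lambda> n j) * \<beta>\<^sub>0 n j\<bar> \<le> C)) \<and>
     prob_space \<mu> \<and> sets \<mu> = sets borel \<and> (AE x in \<mu>. 0 \<le> fst x) \<and>
     integrable \<mu> (\<lambda>x. (norm x)\<^sup>2) \<and>
     (\<lambda>n. wasserstein2
            (empirical_measure (p n) (\<lambda>j. (\<Lambda> n j, sqrt (real n * \<Lambda> n j) * \<beta>\<^sub>0 n j))) \<mu>) \<longlonglongrightarrow> 0"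

definition gaussian_design ::
    "(nat \<Rightarrow> 'a measure) \<Rightarrow> (nat \<Rightarrow> nat) \<Rightarrow> (nat \<Rightarrow> 'a \<Rightarrow> nat \<Rightarrow> nat \<Rightarrow> real) \<Rightarrow> bool" where
  "gaussian_design M p G \<longleftrightarrow>
     (\<forall>n>0.
        prob_space.indep_vars (M n) (\<lambda>_. borel) (\<lambda>(i, j) \<omega>. G n \<omega> i j) ({..<n} \<times> {..<p n}) \<and>
        (\<forall>i<n. \<forall>j<p n. distributed (M n) lborel (\<lambda>\<omega>. G n \<omega> i j) std_normal_density))"

text \<open>
  The \<open>n\<close>-th experiment lives on its own probability space \<open>M n\<close>.  The designs \<open>X n\<close> and \<open>G n\<close> are
  defined on the same space only for convenience: nothing is assumed about their joint law.
\<close>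

definition block_dependent_model ::
    "real \<Rightarrow> real \<Rightarrow> real \<Rightarrow> real \<Rightarrow> real \<Rightarrow> real \<Rightarrow> real \<Rightarrow>
     (nat \<Rightarrow> 'a measure) \<Rightarrow> (nat \<Rightarrow> nat) \<Rightarrow> (nat \<Rightarrow> nat) \<Rightarrow>
     (nat \<Rightarrow> nat \<Rightarrow> real) \<Rightarrow> (nat \<Rightarrow> nat \<Rightarrow> real) \<Rightarrow> (real \<times> real) measure \<Rightarrow>
     (nat \<Rightarrow> 'a \<Rightarrow> nat \<Rightarrow> nat \<Rightarrow> real) \<Rightarrow> (nat \<Rightarrow> 'a \<Rightarrow> nat \<Rightarrow> nat \<Rightarrow> real) \<Rightarrow>
     (nat \<Rightarrow> 'a \<Rightarrow> nat \<Rightarrow> real) \<Rightarrow> bool" where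
  "block_dependent_model \<kappa> \<sigma> K\<^sub>\<xi> K\<^sub>0 K\<^sub>X c C M p d \<Lambda> \<beta>\<^sub>0 \<mu> X G \<xi> \<longleftrightarrow>
     (\<forall>n. prob_space (M n)) \<and>
     (\<lambda>n. real (p n) / real n) \<longlonglongrightarrow> \<kappa> \<and>
     noise_assumption \<sigma> K\<^sub>\<xi> M \<xi> \<and>
     design_assumption K\<^sub>0 K\<^sub>X c C M p d \<Lambda> X \<and>
     signal_assumption C p \<Lambda> \<beta>\<^sub>0 \<mu> \<and>
     gaussian_design M p G \<and>
     (\<forall>n>0. independent_of_design (M n) n (p n) (\<lambda>\<omega>. scale_columns (\<Lambda> n) (X n \<omega>)) (\<xi> n) \<and>
            independent_of_design (M n) n (p n) (\<lambda>\<omega>. scale_columns (\<Lambda> n) (G n \<omega>)) (\<xi> n))"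

end

theory Submission
  imports Defs "HOL-Real_Asymp.Real_Asymp"
begin

text \<open>
  In the variable \<open>b = sqrt n * (\<phi> + \<beta>\<^sub>0)\<close> the risk is \<open>1 / n\<close> times a sum of \<open>n\<close> squared
  residuals plus a separable penalty, and the rows of the design are exchanged one at a time.  For a
  smooth strongly convex penalty, adding the row \<open>z\<close> to a problem with minimizer \<open>b\<close> and inverse
  Hessian \<open>B\<close> raises the minimum by \<open>r\<^sup>2 / (2 * (1 + q))\<close> up to a negligible error, where \<open>r\<close> is the
  residual of the new row at \<open>b\<close> and \<open>q = z\<^sup>T B z\<close>.  The second moment of \<open>r\<close> and the mean of \<open>q\<close>
  depend on the covariance of the row only, and \<open>q\<close> concentrates because a quadratic form in
  independent blocks has small variance; so each exchange costs \<open>o(1 / n)\<close>.  This settles ridge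
  regression, where the expansion is exact.

  The Lasso penalty is replaced by \<open>lam * sqrt (t\<^sup>2 + e\<^sup>2) + e * t\<^sup>2 / 2\<close>.  This changes the minimum by
  \<open>O(e)\<close>, since the Lasso minimizer has Euclidean norm \<open>O(sqrt n)\<close> in the variable \<open>b\<close>: a
  sub-Gaussian design is bounded below on vectors of small \<open>\<ell>\<^sub>1\<close> norm, by a union bound over the
  integer points of an \<open>\<ell>\<^sub>1\<close> ball.  Convergence in probability follows by testing with \<open>(x - \<rho>)\<^sup>2 / (1 + (x - \<rho>)\<^sup>2)\<close>.
\<close>

section \<open>Vectors and Hessians\<close>

text \<open>The new row is independent of the leave-one-out minimizer, so each coordinate of the
  shift that it causes is of order n^(-1/2) in the eighth moment. The cubic Taylor error of the
  penalty, summed over p coordinates, is therefore of order p n^(-3/2), that is n^(-1/2) for each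
  row; the factor 1/n of the risk pays for the sum over the n rows. This argument needs a second
  derivative that is Lipschitz and bounded away from 0, and the Lasso penalty has neither. For the
  smoothed penalty the Lipschitz constant is 3 lam / e^2, which explodes as e tends to 0; hence e is
  fixed first, n tends to infinity, and only a bias of order e is left.

  The noise stays fixed during the exchange and is integrated out afterwards; it enters the bounds
  only through averages of eighth powers. The exponent 8 comes from splitting |r s|^4 into r^8 and
  s^8. The fluctuation of q is traded against moments of r with a weight \<eta>, later n^(-1/4).
  Both designs are handled by the same abstract row law, the Gaussian one with blocks of size
  1.\<close>

definition dot :: "nat \<Rightarrow> (nat \<Rightarrow> real) \<Rightarrow> (nat \<Rightarrow> real) \<Rightarrow> real" where
  "dot p u v = (\<Sum>j<p. u j * v j)"

definition mv :: "nat \<Rightarrow> (nat \<Rightarrow> nat \<Rightarrow> real) \<Rightarrow> (nat \<Rightarrow> real) \<Rightarrow> nat \<Rightarrow> real" where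
  "mv p B v j = dot p (B j) v"

lemma dot_commute: "dot p u v = dot p v u"
  by (simp add: dot_def mult.commute)

lemma dot_cong: "(\<And>j. j < p \<Longrightarrow> u j = u' j) \<Longrightarrow> (\<And>j. j < p \<Longrightarrow> v j = v' j) \<Longrightarrow> dot p u v = dot p u' v'"
  by (simp add: dot_def)

lemma dot_add_right: "dot p u (\<lambda>j. v j + w j) = dot p u v + dot p u w"
  by (simp add: dot_def distrib_left sum.distrib)

lemma dot_diff_right: "dot p u (\<lambda>j. v j - w j) = dot p u v - dot p u w"
  by (simp add: dot_def right_diff_distrib sum_subtractf)

lemma dot_scale_right: "dot p u (\<lambda>j. c * v j) = c * dot p u v"
  by (simp add: dot_def sum_distrib_left algebra_simps)

lemma dot_scale_left: "dot p (\<lambda>j. c * u j) v = c * dot p u v"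
  by (simp add: dot_def sum_distrib_left algebra_simps)

lemma dot_zero_right [simp]: "dot p u (\<lambda>j. 0) = 0"
  by (simp add: dot_def)

lemma dot_self_nonneg [simp]: "0 \<le> dot p u u"
  by (simp add: dot_def sum_nonneg)

lemma dot_cs: "(dot p u v)\<^sup>2 \<le> dot p u u * dot p v v"
  using Cauchy_Schwarz_ineq_sum[of u v "{..<p}"] by (simp add: dot_def power2_eq_square)

lemma dot_mv_sym:
  assumes "\<And>j k. B j k = B k j"
  shows "dot p u (mv p B v) = dot p (mv p B u) v"
proof -
  have "dot p u (mv p B v) = (\<Sum>j<p. \<Sum>k<p. u j * (B j k * v k))"
    by (simp add: dot_def mv_def sum_distrib_left)
  also have "\<dots> = (\<Sum>k<p. \<Sum>j<p. u j * (B j k * v k))"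
    by (rule sum.swap)
  also have "\<dots> = dot p (mv p B u) v"
    unfolding dot_def mv_def sum_distrib_right by (intro sum.cong refl) (simp add: assms mult_ac)
  finally show ?thesis .
qed

lemma mv_unit: "k < p \<Longrightarrow> mv p B (\<lambda>j. if j = k then 1 else 0) j = B j k"
  by (simp add: mv_def dot_def if_distrib cong: if_cong)

text \<open>This is the matrix Z^T Z + diag(D), with the \<open>z i\<close> as the rows of Z,
  applied to \<open>v\<close>: the Hessian of the penalized loss when \<open>D\<close> lists the
  second derivatives of the penalty.\<close>

definition hess :: "nat \<Rightarrow> 'i set \<Rightarrow> ('i \<Rightarrow> nat \<Rightarrow> real) \<Rightarrow> (nat \<Rightarrow> real) \<Rightarrow> (nat \<Rightarrow> real) \<Rightarrow> nat \<Rightarrow> real" where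
  "hess p I z D v j = (\<Sum>i\<in>I. z i j * dot p (z i) v) + D j * v j"

lemma dot_hess: "dot p u (hess p I z D v) = (\<Sum>i\<in>I. dot p (z i) u * dot p (z i) v) + (\<Sum>j<p. D j * u j * v j)"
proof -
  have "dot p u (hess p I z D v) = (\<Sum>j<p. \<Sum>i\<in>I. u j * (z i j * dot p (z i) v)) + (\<Sum>j<p. D j * u j * v j)"
    by (simp add: dot_def[of p u] hess_def distrib_left sum.distrib sum_distrib_left mult_ac)
  also have "(\<Sum>j<p. \<Sum>i\<in>I. u j * (z i j * dot p (z i) v)) = (\<Sum>i\<in>I. \<Sum>j<p. u j * (z i j * dot p (z i) v))"
    by (rule sum.swap)
  also have "\<dots> = (\<Sum>i\<in>I. dot p (z i) u * dot p (z i) v)"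
    by (intro sum.cong refl) (simp add: dot_def[of p _ u] sum_distrib_left mult_ac)
  finally show ?thesis .
qed

lemma dot_hess_ge:
  assumes "\<And>j. j < p \<Longrightarrow> \<mu> \<le> D j"
  shows "\<mu> * dot p v v \<le> dot p v (hess p I z D v)"
proof -
  have "\<mu> * dot p v v = (\<Sum>j<p. \<mu> * v j * v j)"
    by (simp add: dot_def sum_distrib_left mult.assoc)
  also have "\<dots> \<le> (\<Sum>j<p. D j * v j * v j)"
    using assms by (intro sum_mono) (simp add: mult.assoc mult_right_mono)
  also have "\<dots> \<le> dot p v (hess p I z D v)"
    by (simp add: dot_hess sum_nonneg)
  finally show ?thesis .
qed

text \<open>The inverse is built by one Sherman--Morrison update per row.\<close>

lemma hess_inverse_exists:
  assumes "finite I" "0 < \<mu>" "\<And>j. j < p \<Longrightarrow> \<mu> \<le> D j"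
  shows "\<exists>B. (\<forall>j k. B j k = B k j) \<and> (\<forall>v. \<forall>j<p. hess p I z D (mv p B v) j = v j)"
  using assms(1)
proof (induction I)
  case empty
  have "D j \<noteq> 0" if "j < p" for j
    using assms that by force
  then show ?case
    by (intro exI[of _ "\<lambda>j k. if j = k then 1 / D j else 0"])
       (auto simp: hess_def mv_def dot_def if_distrib if_distribR cong: if_cong)
next
  case (insert i I)
  then obtain B where sym: "\<And>j k. B j k = B k j"
    and inv: "\<And>v j. j < p \<Longrightarrow> hess p I z D (mv p B v) j = v j"
    by blast
  \<comment> \<open>Here w = B z_i and q = z_i^T B z_i. Writing q as w^T H w, with H the Hessian
    before the update, shows that q is nonnegative, so the denominator 1 + q is at least 1.\<close>
  define w where "w = mv p B (z i)"
  define q where "q = dot p (z i) w"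
  have "q = dot p w (hess p I z D w)"
    unfolding q_def w_def by (subst dot_commute) (intro dot_cong refl, simp add: inv)
  then have q: "0 \<le> q"
    using dot_hess_ge[of p \<mu> D w I z] assms by (smt (verit) dot_self_nonneg mult_nonneg_nonneg)
  define B' where "B' = (\<lambda>j k. B j k - w j * w k / (1 + q))"
  have B': "mv p B' v j = mv p B v j - dot p w v / (1 + q) * w j" for v j
    unfolding mv_def B'_def dot_def by (simp add: algebra_simps diff_divide_distrib sum_subtractf sum_distrib_left sum_divide_distrib)
  have "hess p (insert i I) z D (mv p B' v) j = v j" if "j < p" for v j
  proof -
    define s where "s = dot p w v / (1 + q)"
    have s: "s * (1 + q) = dot p w v"
      using q by (simp add: s_def)
    have fn: "mv p B' v = (\<lambda>j. mv p B v j - s * w j)"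
      unfolding s_def by (rule ext) (rule B')
    have lin: "hess p I z D (\<lambda>j. x j - s * w j) j = hess p I z D x j - s * hess p I z D w j" for x
      by (simp add: hess_def dot_diff_right dot_scale_right algebra_simps sum_subtractf sum_distrib_left)
    have "hess p (insert i I) z D (mv p B' v) j = z i j * dot p (z i) (mv p B' v) + hess p I z D (mv p B' v) j"
      using insert by (simp add: hess_def)
    also have "dot p (z i) (mv p B' v) = dot p w v - s * q"
      unfolding fn dot_diff_right dot_scale_right q_def using dot_mv_sym[OF sym, where u = "z i"] by (simp add: w_def)
    also have "hess p I z D (mv p B' v) j = v j - s * z i j"
      unfolding fn lin using inv that by (simp add: w_def)
    finally show ?thesis
      unfolding s[symmetric] by (simp add: algebra_simps)
  qed
  then show ?case
    using sym by (intro exI[of _ B']) (auto simp: B'_def mult.commute)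
qed

text \<open>For w = B v, strong convexity gives \<mu> |w|^2 \<le> w^T H w = v^T w, and
  Cauchy-Schwarz turns this into \<mu> |w| \<le> |v|.\<close>

lemma hess_inverse_bound:
  assumes "0 < \<mu>" "\<And>j. j < p \<Longrightarrow> \<mu> \<le> D j" "\<And>j. j < p \<Longrightarrow> hess p I z D (mv p B v) j = v j"
  shows "0 \<le> dot p v (mv p B v)" and "\<mu>\<^sup>2 * dot p (mv p B v) (mv p B v) \<le> dot p v v"
proof -
  let ?w = "mv p B v"
  have "dot p ?w (hess p I z D ?w) = dot p v ?w"
    by (subst dot_commute) (intro dot_cong refl, simp add: assms)
  then have 1: "\<mu> * dot p ?w ?w \<le> dot p v ?w"
    using dot_hess_ge[of p \<mu> D ?w I z] assms by simp
  then show 0: "0 \<le> dot p v ?w"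
    using assms(1) by (smt (verit) dot_self_nonneg mult_nonneg_nonneg)
  have 2: "(\<mu> * dot p ?w ?w)\<^sup>2 \<le> dot p v v * dot p ?w ?w"
    using power_mono[OF 1, of 2] dot_cs[of p v ?w] assms(1) by (smt (verit) dot_self_nonneg mult_nonneg_nonneg)
  show "\<mu>\<^sup>2 * dot p ?w ?w \<le> dot p v v"
  proof (cases "dot p ?w ?w = 0")
    case False
    then have "0 < dot p ?w ?w"
      by (smt (verit) dot_self_nonneg)
    then show ?thesis
      using 2 by (simp add: power2_eq_square mult_ac)
  qed simp
qed

section \<open>Penalized least squares and the effect of one row\<close>

definition ploss :: "(real \<Rightarrow> real) \<Rightarrow> nat \<Rightarrow> 'i set \<Rightarrow> ('i \<Rightarrow> nat \<Rightarrow> real) \<Rightarrow> ('i \<Rightarrow> real) \<Rightarrow> (nat \<Rightarrow> real) \<Rightarrow> real" where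
  "ploss \<rho> p I z y b = (\<Sum>i\<in>I. (dot p (z i) b - y i)\<^sup>2) / 2 + (\<Sum>j<p. \<rho> (b j))"

definition pmin :: "(real \<Rightarrow> real) \<Rightarrow> nat \<Rightarrow> 'i set \<Rightarrow> ('i \<Rightarrow> nat \<Rightarrow> real) \<Rightarrow> ('i \<Rightarrow> real) \<Rightarrow> real" where
  "pmin \<rho> p I z y = (INF b. ploss \<rho> p I z y b)"

text \<open>Only linear growth is asked for, so that existence and measurability of the minimum
  cover the absolute value as well as the strongly convex penalties.\<close>

definition coercive :: "(real \<Rightarrow> real) \<Rightarrow> bool" where
  "coercive \<rho> \<longleftrightarrow> continuous_on UNIV \<rho> \<and> (\<exists>m>0. \<exists>c. \<forall>t. m * \<bar>t\<bar> - c \<le> \<rho> t)"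

lemma ploss_cong:
  "(\<And>j. j < p \<Longrightarrow> b j = b' j) \<Longrightarrow> ploss \<rho> p I z y b = ploss \<rho> p I z y b'"
  unfolding ploss_def by (auto intro!: arg_cong2[where f = "(+)"] sum.cong dot_cong cong: dot_cong)

lemma continuous_on_ploss:
  assumes "continuous_on UNIV \<rho>"
  shows "continuous_on S (ploss \<rho> p I z y)"
proof -
  have c: "continuous_on S (\<lambda>b. b j)" for j :: nat and S :: "(nat \<Rightarrow> real) set"
    by (rule continuous_on_product_coordinates[THEN continuous_on_subset]) simp
  show ?thesis
    unfolding ploss_def dot_def by (intro continuous_intros c continuous_on_compose2[OF assms c]) auto
qed

text \<open>A vector whose loss does not exceed the loss at 0 has all its coordinates below
  \<open>p\<close> in [-R, R] by linear growth, so the minimum over that cube is global.\<close>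

lemma ploss_minimizer:
  assumes "coercive \<rho>"
  obtains b where "\<And>b'. ploss \<rho> p I z y b \<le> ploss \<rho> p I z y b'" and "pmin \<rho> p I z y = ploss \<rho> p I z y b"
proof -
  let ?f = "ploss \<rho> p I z y"
  obtain m c where m: "0 < m" and c: "\<And>t. m * \<bar>t\<bar> - c \<le> \<rho> t" and cont: "continuous_on UNIV \<rho>"
    using assms unfolding coercive_def by blast
  define R where "R = (\<bar>?f (\<lambda>_. 0)\<bar> + p * \<bar>c\<bar>) / m"
  \<comment> \<open>The coordinates from \<open>p\<close> on do not affect the loss; pinning them to
    0 makes the cube compact in the product topology.\<close>
  define C where "C = (\<Pi>\<^sub>E j\<in>UNIV. if j < p then {- R .. R} else {0::real})"
  have R: "0 \<le> R"
    using m by (simp add: R_def)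
  have "compactin (product_topology (\<lambda>_. euclidean) UNIV) C"
    unfolding C_def by (subst compactin_PiE) (auto simp del: PiE_UNIV_domain)
  then have C: "compact C"
    by (simp add: euclidean_product_topology)
  have zC: "(\<lambda>_. 0) \<in> C"
    using R by (auto simp: C_def)
  obtain b where b: "b \<in> C" and min: "\<forall>y\<in>C. ?f b \<le> ?f y"
    using continuous_attains_inf[OF C _ continuous_on_ploss[OF cont]] zC by blast
  have le: "?f b \<le> ?f b'" for b'
  proof (cases "?f b' \<le> ?f (\<lambda>_. 0)")
    case True
    let ?b = "\<lambda>j. if j < p then b' j else 0"
    have bd: "\<bar>b' j\<bar> \<le> R" if "j < p" for j
    proof -
      have "m * \<bar>b' j\<bar> \<le> (\<Sum>j<p. m * \<bar>b' j\<bar>)"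
        using that m by (intro member_le_sum) auto
      also have "\<dots> \<le> (\<Sum>j<p. \<rho> (b' j) + \<bar>c\<bar>)"
        using c by (intro sum_mono) (smt (verit))
      also have "\<dots> = (\<Sum>j<p. \<rho> (b' j)) + p * \<bar>c\<bar>"
        by (simp add: sum.distrib)
      also have "(\<Sum>j<p. \<rho> (b' j)) \<le> ?f b'"
        unfolding ploss_def by (simp add: sum_nonneg)
      finally have "m * \<bar>b' j\<bar> \<le> \<bar>?f (\<lambda>_. 0)\<bar> + p * \<bar>c\<bar>"
        using True by simp
      then show ?thesis
        using m by (simp add: R_def field_simps)
    qed
    then have "?b \<in> C"
      by (fastforce simp: C_def abs_le_iff)
    then have "?f b \<le> ?f ?b"
      using min by blast
    also have "?f ?b = ?f b'"
      by (rule ploss_cong) simp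
    finally show ?thesis .
  next
    case False
    then show ?thesis
      using min zC by fastforce
  qed
  have "pmin \<rho> p I z y = ?f b"
    unfolding pmin_def by (rule cInf_eq_minimum) (use le in auto)
  then show thesis
    using that le by blast
qed

lemma pmin_le:
  assumes "coercive \<rho>"
  shows "pmin \<rho> p I z y \<le> ploss \<rho> p I z y b"
  by (metis ploss_minimizer[OF assms])

lemma pmin_ge:
  assumes "\<And>b. c \<le> ploss \<rho> p I z y b"
  shows "c \<le> pmin \<rho> p I z y"
  unfolding pmin_def by (rule cINF_greatest) (use assms in auto)

lemma ploss_insert:
  assumes "finite I" "k \<notin> I"
  shows "ploss \<rho> p (insert k I) (z(k := \<zeta>)) (y(k := \<eta>)) b = ploss \<rho> p I z y b + (dot p \<zeta> b - \<eta>)\<^sup>2 / 2"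
proof -
  have "(\<Sum>i\<in>I. (dot p ((z(k := \<zeta>)) i) b - (y(k := \<eta>)) i)\<^sup>2) = (\<Sum>i\<in>I. (dot p (z i) b - y i)\<^sup>2)"
    using assms by (intro sum.cong) auto
  then show ?thesis
    using assms by (simp add: ploss_def)
qed

text \<open>\<open>L\<close> is the Lipschitz constant of the second derivative.
  \<open>stationary_0\<close> puts the minimum of the penalty at 0, which bounds the minimizers by
  comparison with the zero vector.\<close>

locale smooth_penalty =
  fixes \<rho> \<rho>1 \<rho>2 :: "real \<Rightarrow> real" and \<mu> L :: real
  assumes deriv1: "(\<rho> has_real_derivative \<rho>1 x) (at x)"
    and deriv2: "(\<rho>1 has_real_derivative \<rho>2 x) (at x)"
    and mu_pos: "0 < \<mu>" and mu_le: "\<mu> \<le> \<rho>2 x"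
    and lipschitz: "\<bar>\<rho>2 x - \<rho>2 y\<bar> \<le> L * \<bar>x - y\<bar>"
    and stationary_0: "\<rho>1 0 = 0"
begin

lemma L_nonneg: "0 \<le> L"
  using lipschitz[of 1 0] by simp

lemma second_order:
  obtains c where "\<bar>c - t\<bar> \<le> \<bar>x\<bar>" "\<rho> (t + x) = \<rho> t + \<rho>1 t * x + \<rho>2 c * x\<^sup>2 / 2"
proof (cases "x = 0")
  case False
  define diff where "diff = (\<lambda>m::nat. if m = 0 then \<rho> else if m = 1 then \<rho>1 else \<rho>2)"
  have "\<exists>s. (if t + x < t then t + x < s \<and> s < t else t < s \<and> s < t + x) \<and>
     \<rho> (t + x) = (\<Sum>m<2. diff m t / fact m * (t + x - t) ^ m) + diff 2 s / fact 2 * (t + x - t) ^ 2"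
    by (rule Taylor[where a = "t - \<bar>x\<bar>" and b = "t + \<bar>x\<bar>"])
       (use False in \<open>auto simp: diff_def less_2_cases_iff intro: deriv1 deriv2\<close>)
  then show thesis
    by (elim exE conjE) (rule that, auto simp: diff_def numeral_2_eq_2 split: if_splits)
qed (use that[of t] in auto)

lemma strongly_convex: "\<rho> t + \<rho>1 t * x + \<mu> * x\<^sup>2 / 2 \<le> \<rho> (t + x)"
proof -
  obtain c where "\<rho> (t + x) = \<rho> t + \<rho>1 t * x + \<rho>2 c * x\<^sup>2 / 2"
    using second_order by blast
  moreover have "\<mu> * x\<^sup>2 \<le> \<rho>2 c * x\<^sup>2"
    using mu_le by (intro mult_right_mono) auto
  ultimately show ?thesis
    by simp
qed

lemma quadratic_approx: "\<bar>\<rho> (t + x) - \<rho> t - \<rho>1 t * x - \<rho>2 t * x\<^sup>2 / 2\<bar> \<le> L * \<bar>x\<bar> ^ 3"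
proof -
  obtain c where c: "\<bar>c - t\<bar> \<le> \<bar>x\<bar>" "\<rho> (t + x) = \<rho> t + \<rho>1 t * x + \<rho>2 c * x\<^sup>2 / 2"
    using second_order by blast
  have "\<bar>\<rho> (t + x) - \<rho> t - \<rho>1 t * x - \<rho>2 t * x\<^sup>2 / 2\<bar> = \<bar>(\<rho>2 c - \<rho>2 t) * x\<^sup>2 / 2\<bar>"
    by (simp add: c left_diff_distrib diff_divide_distrib)
  also have "\<dots> = \<bar>\<rho>2 c - \<rho>2 t\<bar> * x\<^sup>2 / 2"
    by (simp add: abs_mult)
  also have "\<dots> \<le> (L * \<bar>x\<bar>) * x\<^sup>2"
  proof -
    have "\<bar>\<rho>2 c - \<rho>2 t\<bar> * x\<^sup>2 \<le> (L * \<bar>x\<bar>) * x\<^sup>2"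
      using lipschitz[of c t] c(1) L_nonneg
      by (intro mult_right_mono) (auto intro: order_trans mult_left_mono)
    moreover have "0 \<le> (L * \<bar>x\<bar>) * x\<^sup>2"
      using L_nonneg by simp
    ultimately show ?thesis
      by linarith
  qed
  also have "\<dots> = L * \<bar>x\<bar> ^ 3"
    by (simp add: power2_eq_square power3_eq_cube abs_mult_self_eq mult.assoc)
  finally show ?thesis .
qed

lemma linear_approx: "\<bar>\<rho>1 (t + x) - \<rho>1 t - \<rho>2 t * x\<bar> \<le> L * x\<^sup>2"
proof -
  have "\<exists>c. \<bar>c - t\<bar> \<le> \<bar>x\<bar> \<and> \<rho>1 (t + x) - \<rho>1 t = \<rho>2 c * x"
  proof (cases "x = 0")
    case False
    then consider "t < t + x" | "t + x < t"
      by linarith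
    then show ?thesis
    proof cases
      case 1
      then obtain c where "t < c" "c < t + x" "\<rho>1 (t + x) - \<rho>1 t = (t + x - t) * \<rho>2 c"
        using MVT2[of t "t + x" \<rho>1 \<rho>2] deriv2 by blast
      then show ?thesis
        by (intro exI[of _ c]) (auto simp: mult.commute)
    next
      case 2
      then obtain c where "t + x < c" "c < t" "\<rho>1 t - \<rho>1 (t + x) = (t - (t + x)) * \<rho>2 c"
        using MVT2[of "t + x" t \<rho>1 \<rho>2] deriv2 by blast
      then show ?thesis
        by (intro exI[of _ c]) (auto simp: algebra_simps)
    qed
  qed auto
  then obtain c where c: "\<bar>c - t\<bar> \<le> \<bar>x\<bar>" "\<rho>1 (t + x) - \<rho>1 t = \<rho>2 c * x"
    by blast
  have "\<bar>\<rho>1 (t + x) - \<rho>1 t - \<rho>2 t * x\<bar> = \<bar>\<rho>2 c - \<rho>2 t\<bar> * \<bar>x\<bar>"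
    by (simp add: c left_diff_distrib flip: abs_mult)
  also have "\<dots> \<le> (L * \<bar>x\<bar>) * \<bar>x\<bar>"
    using lipschitz[of c t] c(1) L_nonneg
    by (intro mult_right_mono) (auto intro: order_trans mult_left_mono)
  also have "\<dots> = L * x\<^sup>2"
    by (simp add: power2_eq_square mult.assoc)
  finally show ?thesis .
qed

lemma quadratic_growth: "\<rho> 0 + \<mu> * x\<^sup>2 / 2 \<le> \<rho> x"
  using strongly_convex[of 0 x] by (simp add: stationary_0)

lemma coercive: "coercive \<rho>"
proof -
  have "\<mu> * \<bar>t\<bar> - (\<mu> / 2 - \<rho> 0) \<le> \<rho> t" for t
  proof -
    have "0 \<le> \<mu> * (\<bar>t\<bar> - 1)\<^sup>2"
      using mu_pos by simp
    then show ?thesis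
      using quadratic_growth[of t] by (simp add: power2_diff algebra_simps)
  qed
  moreover have "continuous_on UNIV \<rho>"
    using deriv1 DERIV_isCont continuous_at_imp_continuous_on by blast
  ultimately show ?thesis
    unfolding coercive_def using mu_pos by blast
qed

text \<open>The Bregman divergence of \<open>\<rho>\<close>: what the penalty contributes around a
  minimizer once the first-order terms have cancelled.\<close>

definition remainder :: "real \<Rightarrow> real \<Rightarrow> real" where
  "remainder t x = \<rho> (t + x) - \<rho> t - \<rho>1 t * x"

text \<open>Strong convexity at t + x gives a tangent bound with slope \<rho>1 (t + x) - \<rho>1 t
  in place of the slope \<rho>2 t * x of the quadratic model. The difference of the slopes is at
  most L x^2, and completing the square against \<mu> h^2 / 2 absorbs it at the stated cost.\<close>

lemma remainder_lower:
  "remainder t x - (L * x\<^sup>2)\<^sup>2 / (2 * \<mu>) + \<rho>2 t * x * (x' - x) \<le> remainder t x'"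
proof -
  define h g where "h = x' - x" and "g = \<rho>1 (t + x) - \<rho>1 t - \<rho>2 t * x"
  have "\<rho> (t + x) + \<rho>1 (t + x) * h + \<mu> * h\<^sup>2 / 2 \<le> \<rho> (t + x')"
    using strongly_convex[of "t + x" h] by (simp add: h_def)
  then have 1: "remainder t x + \<rho>2 t * x * h + g * h + \<mu> * h\<^sup>2 / 2 \<le> remainder t x'"
    by (simp add: remainder_def g_def h_def algebra_simps)
  have "0 \<le> (g + \<mu> * h)\<^sup>2 / (2 * \<mu>)"
    using mu_pos by simp
  also have "\<dots> = g\<^sup>2 / (2 * \<mu>) + g * h + \<mu> * h\<^sup>2 / 2"
    using mu_pos by (simp add: field_simps power2_eq_square)
  finally have 2: "- (g\<^sup>2 / (2 * \<mu>)) \<le> g * h + \<mu> * h\<^sup>2 / 2"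
    by simp
  have "g\<^sup>2 \<le> (L * x\<^sup>2)\<^sup>2"
    using linear_approx[of t x] by (simp add: g_def abs_le_square_iff[symmetric] L_nonneg)
  then have "g\<^sup>2 / (2 * \<mu>) \<le> (L * x\<^sup>2)\<^sup>2 / (2 * \<mu>)"
    using mu_pos by (intro divide_right_mono) auto
  then show ?thesis
    using 1 2 by (simp add: h_def)
qed

text \<open>The squared residuals expand exactly, and all terms linear in \<open>d\<close> add up to
  the directional derivative at the minimizer, which is 0.\<close>

lemma minimizer_expansion:
  assumes "finite I" "\<And>b. ploss \<rho> p I z y bh \<le> ploss \<rho> p I z y b"
  shows "ploss \<rho> p I z y (\<lambda>j. bh j + d j) =
    ploss \<rho> p I z y bh + (\<Sum>i\<in>I. (dot p (z i) d)\<^sup>2) / 2 + (\<Sum>j<p. remainder (bh j) (d j))"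
proof -
  define l where "l = (\<Sum>i\<in>I. (dot p (z i) bh - y i) * dot p (z i) d) + (\<Sum>j<p. \<rho>1 (bh j) * d j)"
  \<comment> \<open>Restricting to the line through \<open>bh\<close> in direction \<open>d\<close>
    reduces stationarity to a local minimum of a function of one real variable.\<close>
  have "((\<lambda>t. ploss \<rho> p I z y (\<lambda>j. bh j + t * d j)) has_real_derivative l) (at 0)"
    unfolding ploss_def dot_add_right dot_scale_right l_def
    by (auto intro!: derivative_eq_intros DERIV_sum DERIV_chain'[OF _ deriv1] simp: sum_divide_distrib
        sum_distrib_left sum.distrib mult_ac)
  then have "l = 0"
    by (rule DERIV_local_min[of _ _ _ 1]) (use assms in auto)
  have "(\<Sum>i\<in>I. (dot p (z i) (\<lambda>j. bh j + d j) - y i)\<^sup>2) =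
      (\<Sum>i\<in>I. (dot p (z i) bh - y i)\<^sup>2) + 2 * (\<Sum>i\<in>I. (dot p (z i) bh - y i) * dot p (z i) d) + (\<Sum>i\<in>I. (dot p (z i) d)\<^sup>2)"
    unfolding sum_distrib_left sum.distrib[symmetric]
    by (intro sum.cong refl) (simp add: dot_add_right power2_eq_square algebra_simps)
  moreover have "(\<Sum>j<p. \<rho> (bh j + d j)) =
      (\<Sum>j<p. \<rho> (bh j)) + (\<Sum>j<p. \<rho>1 (bh j) * d j) + (\<Sum>j<p. remainder (bh j) (d j))"
    by (simp add: remainder_def sum.distrib[symmetric])
  ultimately show ?thesis
    using \<open>l = 0\<close> by (simp add: ploss_def l_def add_divide_distrib)
qed

text \<open>The loss at the minimizer is compared with the loss at the zero vector; the terms \<rho>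
  0 cancel.\<close>

lemma minimizer_bound:
  assumes "\<And>b. ploss \<rho> p I z y bh \<le> ploss \<rho> p I z y b"
  shows "\<mu> * dot p bh bh \<le> (\<Sum>i\<in>I. (y i)\<^sup>2)"
proof -
  have "(\<Sum>j<p. \<rho> 0 + \<mu> * (bh j)\<^sup>2 / 2) \<le> (\<Sum>j<p. \<rho> (bh j))"
    by (intro sum_mono quadratic_growth)
  also have "\<dots> \<le> ploss \<rho> p I z y bh"
    by (simp add: ploss_def sum_nonneg)
  also have "\<dots> \<le> ploss \<rho> p I z y (\<lambda>_. 0)"
    by (rule assms)
  finally show ?thesis
    by (simp add: ploss_def sum.distrib dot_def sum_distrib_left sum_divide_distrib[symmetric] power2_eq_square mult.assoc)
qed

text \<open>
  The minimum over \<open>insert k I\<close> is compared with the minimum of the quadratic model at the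
  leave-one-out minimizer: the minimizer of the model bounds it from above, and strong convexity
  at that point bounds it from below.
\<close>

lemma add_row:
  assumes "finite I" "k \<notin> I" and min: "\<And>b. ploss \<rho> p I z y bh \<le> ploss \<rho> p I z y b"
  obtains B where "\<And>j k. B j k = B k j" and "\<And>v. 0 \<le> dot p v (mv p B v)"
    and "\<And>v. \<mu>\<^sup>2 * dot p (mv p B v) (mv p B v) \<le> dot p v v"
    and "\<And>\<zeta> \<eta>. \<bar>pmin \<rho> p (insert k I) (z(k := \<zeta>)) (y(k := \<eta>)) - ploss \<rho> p I z y bh
        - (dot p \<zeta> bh - \<eta>)\<^sup>2 / (2 * (1 + dot p \<zeta> (mv p B \<zeta>)))\<bar>
      \<le> (\<Sum>j<p. L * \<bar>(dot p \<zeta> bh - \<eta>) * mv p B \<zeta> j\<bar> ^ 3 + L\<^sup>2 / (2 * \<mu>) * \<bar>(dot p \<zeta> bh - \<eta>) * mv p B \<zeta> j\<bar> ^ 4)"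
    and "\<And>\<zeta> \<eta>. ploss \<rho> p I z y bh \<le> pmin \<rho> p (insert k I) (z(k := \<zeta>)) (y(k := \<eta>))"
    and "\<And>\<zeta> \<eta>. pmin \<rho> p (insert k I) (z(k := \<zeta>)) (y(k := \<eta>)) \<le> ploss \<rho> p I z y bh + (dot p \<zeta> bh - \<eta>)\<^sup>2 / 2"
proof -
  define D where "D = (\<lambda>j. \<rho>2 (bh j))"
  have D: "\<mu> \<le> D j" for j
    by (simp add: D_def mu_le)
  obtain B where sym: "\<And>j k. B j k = B k j"
    and inv: "\<And>v j. j < p \<Longrightarrow> hess p I z D (mv p B v) j = v j"
    using hess_inverse_exists[where D = D and p = p and z = z, OF assms(1) mu_pos D] by blast
  note Bpos = hess_inverse_bound(1)[where I = I and z = z and D = D, OF mu_pos D inv]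
  note Bbd = hess_inverse_bound(2)[where I = I and z = z and D = D, OF mu_pos D inv]
  let ?F = "ploss \<rho> p I z y bh"
  have est: "\<bar>pmin \<rho> p (insert k I) (z(k := \<zeta>)) (y(k := \<eta>)) - ?F - (dot p \<zeta> bh - \<eta>)\<^sup>2 / (2 * (1 + dot p \<zeta> (mv p B \<zeta>)))\<bar>
      \<le> (\<Sum>j<p. L * \<bar>(dot p \<zeta> bh - \<eta>) * mv p B \<zeta> j\<bar> ^ 3 + L\<^sup>2 / (2 * \<mu>) * \<bar>(dot p \<zeta> bh - \<eta>) * mv p B \<zeta> j\<bar> ^ 4)"
    for \<zeta> \<eta>
  proof -
    define r x q where "r = dot p \<zeta> bh - \<eta>" and "x = mv p B \<zeta>" and "q = dot p \<zeta> x"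
    have q: "0 \<le> q"
      unfolding q_def x_def by (rule Bpos)
    \<comment> \<open>The quadratic model is minimized by the shift \<delta> = -s B \<zeta>, a
      Newton step; \<open>s\<close> is the residual of the new row after that shift.\<close>
    define s where "s = r / (1 + q)"
    have s: "r = s * (1 + q)"
      using q by (simp add: s_def)
    define \<delta> where "\<delta> = (\<lambda>j. - s * x j)"
    have z\<delta>: "dot p \<zeta> \<delta> = - s * q"
      unfolding \<delta>_def dot_scale_right q_def ..
    have h\<delta>: "hess p I z D \<delta> j = - s * \<zeta> j" if "j < p" for j
    proof -
      have "hess p I z D \<delta> j = - s * hess p I z D x j"
        unfolding \<delta>_def hess_def dot_scale_right by (simp add: sum_distrib_left algebra_simps)
      then show ?thesis
        using inv[OF that] by (simp add: x_def)
    qed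
    have dh: "dot p d (hess p I z D \<delta>) = - s * dot p \<zeta> d" for d
    proof -
      have "dot p d (hess p I z D \<delta>) = dot p d (\<lambda>j. - s * \<zeta> j)"
        by (intro dot_cong refl h\<delta>)
      then show ?thesis
        unfolding dot_scale_right by (simp add: dot_commute)
    qed
    let ?\<Phi> = "ploss \<rho> p (insert k I) (z(k := \<zeta>)) (y(k := \<eta>))"
    have \<Phi>: "?\<Phi> (\<lambda>j. bh j + d j) = ?F + (\<Sum>i\<in>I. (dot p (z i) d)\<^sup>2) / 2
        + (\<Sum>j<p. remainder (bh j) (d j)) + (r + dot p \<zeta> d)\<^sup>2 / 2" for d
      unfolding ploss_insert[OF assms(1,2)] minimizer_expansion[OF assms(1) min]
      by (simp add: dot_add_right r_def algebra_simps)
    define e3 e4 where "e3 = (\<Sum>j<p. L * \<bar>\<delta> j\<bar> ^ 3)" and "e4 = (\<Sum>j<p. (L * (\<delta> j)\<^sup>2)\<^sup>2 / (2 * \<mu>))"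
    \<comment> \<open>At \<delta> the Hessian energy s^2 q and the squared residual (r - s q)^2 =
      s^2 add up to r^2 / (1 + q). Only the cubic Taylor error of the penalty is left.\<close>
    have \<Phi>\<delta>: "\<bar>?\<Phi> (\<lambda>j. bh j + \<delta> j) - ?F - r\<^sup>2 / (2 * (1 + q))\<bar> \<le> e3"
    proof -
      have "(\<Sum>i\<in>I. (dot p (z i) \<delta>)\<^sup>2) + (\<Sum>j<p. D j * (\<delta> j)\<^sup>2) = s\<^sup>2 * q"
        using dh[of \<delta>] unfolding dot_hess z\<delta> by (simp add: power2_eq_square mult.assoc)
      moreover have "s\<^sup>2 * q / 2 + (r - s * q)\<^sup>2 / 2 = r\<^sup>2 / (2 * (1 + q))"
        using q unfolding s by (simp add: field_simps power2_eq_square)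
      ultimately have "?\<Phi> (\<lambda>j. bh j + \<delta> j) - ?F - r\<^sup>2 / (2 * (1 + q)) =
          (\<Sum>j<p. remainder (bh j) (\<delta> j)) - (\<Sum>j<p. D j * (\<delta> j)\<^sup>2) / 2"
        unfolding \<Phi> z\<delta> by (simp add: algebra_simps add_divide_distrib)
      also have "\<dots> = (\<Sum>j<p. remainder (bh j) (\<delta> j) - D j * (\<delta> j)\<^sup>2 / 2)"
        by (simp add: sum_subtractf sum_divide_distrib)
      also have "\<bar>\<dots>\<bar> \<le> e3"
        unfolding e3_def remainder_def D_def by (intro order_trans[OF sum_abs] sum_mono quadratic_approx)
      finally show ?thesis .
    qed
    \<comment> \<open>Each of the three parts of the loss is bounded below by its value at \<delta>
      plus a term linear in h = d - \<delta>. The linear terms cancel because \<delta> is stationary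
      for the quadratic model (\<open>dh\<close>), so the bound is uniform in \<open>b\<close> and
      costs only \<open>e4\<close>.\<close>
    have lower: "?\<Phi> (\<lambda>j. bh j + \<delta> j) - e4 \<le> ?\<Phi> b" for b
    proof -
      define d h where "d = (\<lambda>j. b j - bh j)" and "h = (\<lambda>j. d j - \<delta> j)"
      have sq: "u\<^sup>2 / 2 + u * (w - u) \<le> w\<^sup>2 / 2" for u w :: real
        using zero_le_power2[of "w - u"] by (simp add: power2_eq_square algebra_simps)
      have zh: "dot p v h = dot p v d - dot p v \<delta>" for v
        by (simp add: h_def dot_diff_right)
      have "(\<Sum>i\<in>I. (dot p (z i) \<delta>)\<^sup>2 / 2 + dot p (z i) \<delta> * dot p (z i) h) \<le> (\<Sum>i\<in>I. (dot p (z i) d)\<^sup>2 / 2)"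
        unfolding zh by (intro sum_mono sq)
      then have 1: "(\<Sum>i\<in>I. (dot p (z i) \<delta>)\<^sup>2) / 2 + (\<Sum>i\<in>I. dot p (z i) h * dot p (z i) \<delta>) \<le> (\<Sum>i\<in>I. (dot p (z i) d)\<^sup>2) / 2"
        by (simp add: sum.distrib sum_divide_distrib mult.commute)
      have "(\<Sum>j<p. remainder (bh j) (\<delta> j) - (L * (\<delta> j)\<^sup>2)\<^sup>2 / (2 * \<mu>) + \<rho>2 (bh j) * \<delta> j * (d j - \<delta> j))
          \<le> (\<Sum>j<p. remainder (bh j) (d j))"
        by (intro sum_mono remainder_lower)
      then have 2: "(\<Sum>j<p. remainder (bh j) (\<delta> j)) - e4 + (\<Sum>j<p. D j * h j * \<delta> j) \<le> (\<Sum>j<p. remainder (bh j) (d j))"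
        by (simp add: sum.distrib sum_subtractf D_def h_def e4_def mult_ac)
      have 3: "(r + dot p \<zeta> \<delta>)\<^sup>2 / 2 + (r + dot p \<zeta> \<delta>) * dot p \<zeta> h \<le> (r + dot p \<zeta> d)\<^sup>2 / 2"
        using sq[of "r + dot p \<zeta> \<delta>" "r + dot p \<zeta> d"] by (simp add: zh)
      have 4: "r + dot p \<zeta> \<delta> = s"
        using s unfolding z\<delta> by (simp add: algebra_simps)
      have "(\<Sum>i\<in>I. dot p (z i) h * dot p (z i) \<delta>) + (\<Sum>j<p. D j * h j * \<delta> j) = - s * dot p \<zeta> h"
        using dh[of h] unfolding dot_hess .
      then have "?\<Phi> (\<lambda>j. bh j + \<delta> j) - e4 \<le> ?\<Phi> (\<lambda>j. bh j + d j)"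
        unfolding \<Phi> using 1 2 3 unfolding 4 by linarith
      then show ?thesis
        by (simp add: d_def)
    qed
    have "?\<Phi> (\<lambda>j. bh j + \<delta> j) - e4 \<le> pmin \<rho> p (insert k I) (z(k := \<zeta>)) (y(k := \<eta>))"
      by (rule pmin_ge) (rule lower)
    moreover have "pmin \<rho> p (insert k I) (z(k := \<zeta>)) (y(k := \<eta>)) \<le> ?\<Phi> (\<lambda>j. bh j + \<delta> j)"
      by (rule pmin_le) (rule coercive)
    moreover have "0 \<le> e4"
      unfolding e4_def using mu_pos by (intro sum_nonneg) auto
    ultimately have "\<bar>pmin \<rho> p (insert k I) (z(k := \<zeta>)) (y(k := \<eta>)) - ?F - r\<^sup>2 / (2 * (1 + q))\<bar> \<le> e3 + e4"
      using \<Phi>\<delta> by linarith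
    also have "e3 + e4 = (\<Sum>j<p. L * \<bar>\<delta> j\<bar> ^ 3 + L\<^sup>2 / (2 * \<mu>) * \<bar>\<delta> j\<bar> ^ 4)"
      unfolding e3_def e4_def sum.distrib
      by (intro arg_cong2[where f = "(+)"] sum.cong refl) (simp add: power_mult_distrib flip: power_mult)
    also have "\<dots> \<le> (\<Sum>j<p. L * \<bar>r * x j\<bar> ^ 3 + L\<^sup>2 / (2 * \<mu>) * \<bar>r * x j\<bar> ^ 4)"
    proof (intro sum_mono add_mono mult_left_mono power_mono)
      fix j
      \<comment> \<open>Dropping the factor 1 / (1 + q) makes the error a polynomial in the entries
        of the new row, so that moments suffice to bound it.\<close>
      have "\<bar>s\<bar> \<le> \<bar>r\<bar>"
        using q by (simp add: s_def abs_divide divide_le_eq mult_le_cancel_left1)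
      then show "\<bar>\<delta> j\<bar> \<le> \<bar>r * x j\<bar>" "\<bar>\<delta> j\<bar> \<le> \<bar>r * x j\<bar>"
        by (simp_all add: \<delta>_def abs_mult mult_right_mono)
    qed (use L_nonneg mu_pos in auto)
    finally show ?thesis
      by (simp add: r_def x_def q_def)
  qed
  have ge: "?F \<le> pmin \<rho> p (insert k I) (z(k := \<zeta>)) (y(k := \<eta>))" for \<zeta> \<eta>
    by (rule pmin_ge) (use min in \<open>simp add: ploss_insert[OF assms(1,2)] add_increasing2\<close>)
  have le: "pmin \<rho> p (insert k I) (z(k := \<zeta>)) (y(k := \<eta>)) \<le> ?F + (dot p \<zeta> bh - \<eta>)\<^sup>2 / 2" for \<zeta> \<eta>
    using pmin_le[OF coercive, of p "insert k I" "z(k := \<zeta>)" "y(k := \<eta>)" bh] by (simp add: ploss_insert[OF assms(1,2)])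
  show thesis
    by (rule that[OF sym Bpos Bbd est ge le])
qed

end

section \<open>Sub-Gaussian laws of a row\<close>

text \<open>The minimum lies below c exactly when some vector has loss below c. Such vectors form an
  open set, so one of them can be taken from a fixed countable dense set.\<close>

lemma pmin_measurable:
  assumes \<rho>: "coercive \<rho>"
    and z: "\<And>i j. i \<in> I \<Longrightarrow> j < p \<Longrightarrow> (\<lambda>w. z w i j) \<in> borel_measurable N"
    and y: "\<And>i. i \<in> I \<Longrightarrow> (\<lambda>w. y w i) \<in> borel_measurable N"
  shows "(\<lambda>w. pmin \<rho> p I (z w) (y w)) \<in> borel_measurable N"
  unfolding borel_measurable_iff_less
proof
  fix c :: real
  obtain D :: "(nat \<Rightarrow> real) set" where D: "countable D"
    and dense: "\<And>X. open X \<Longrightarrow> X \<noteq> {} \<Longrightarrow> \<exists>d\<in>D. d \<in> X"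
    using countable_dense_setE by blast
  have cont: "continuous_on UNIV \<rho>"
    using \<rho> by (simp add: coercive_def)
  have "pmin \<rho> p I (z w) (y w) < c \<longleftrightarrow> (\<exists>b\<in>D. ploss \<rho> p I (z w) (y w) b < c)" for w
  proof
    assume "pmin \<rho> p I (z w) (y w) < c"
    then obtain b where "ploss \<rho> p I (z w) (y w) b < c"
      by (metis ploss_minimizer[OF \<rho>])
    moreover have "open {b. ploss \<rho> p I (z w) (y w) b < c}"
      by (intro open_Collect_less continuous_on_ploss cont continuous_on_const)
    ultimately show "\<exists>b\<in>D. ploss \<rho> p I (z w) (y w) b < c"
      using dense by blast
  next
    assume "\<exists>b\<in>D. ploss \<rho> p I (z w) (y w) b < c"
    then show "pmin \<rho> p I (z w) (y w) < c"
      using pmin_le[OF \<rho>] le_less_trans by blast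
  qed
  then have "{w \<in> space N. pmin \<rho> p I (z w) (y w) < c} = (\<Union>b\<in>D. {w \<in> space N. ploss \<rho> p I (z w) (y w) b < c})"
    by auto
  also have "\<dots> \<in> sets N"
  proof (rule sets.countable_UN''[OF D])
    fix b
    have [measurable]: "(\<lambda>w. ploss \<rho> p I (z w) (y w) b) \<in> borel_measurable N"
      unfolding ploss_def dot_def using z y by measurable
    show "{w \<in> space N. ploss \<rho> p I (z w) (y w) b < c} \<in> sets N"
      by measurable
  qed
  finally show "{w \<in> space N. pmin \<rho> p I (z w) (y w) < c} \<in> sets N" .
qed

text \<open>The inequality t \<le> exp t at t = x^2 / 4, raised to the fourth power; 256 is
  4^4.\<close>

lemma power8_le_exp: "x ^ 8 \<le> 256 * exp ((x::real)\<^sup>2)"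
proof -
  have "x\<^sup>2 / 4 \<le> exp (x\<^sup>2 / 4)"
    using exp_ge_add_one_self[of "x\<^sup>2 / 4"] by linarith
  then have "(x\<^sup>2 / 4) ^ 4 \<le> exp (x\<^sup>2 / 4) ^ 4"
    by (intro power_mono) auto
  also have "\<dots> = exp (x\<^sup>2)"
    by (simp flip: exp_of_nat_mult)
  finally show ?thesis
    by (simp add: power_divide flip: power_mult)
qed

text \<open>Eighth moments are the only high moments carried along; lower powers are traded for 1 +
  t^8.\<close>

lemma power_le_power8: "m \<le> 8 \<Longrightarrow> \<bar>t\<bar> ^ m \<le> 1 + (t::real) ^ 8"
proof (cases "\<bar>t\<bar> \<le> 1")
  case True
  have "0 \<le> t ^ 8"
    by simp
  then show ?thesis
    using power_le_one[of "\<bar>t\<bar>" m] True by linarith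
next
  case False
  assume "m \<le> 8"
  then have "\<bar>t\<bar> ^ m \<le> \<bar>t\<bar> ^ 8"
    using False by (intro power_increasing) auto
  then show ?thesis
    by (simp add: power_even_abs)
qed

lemma power2_sum_le: "(x + y :: real)\<^sup>2 \<le> 2 * (x\<^sup>2 + y\<^sup>2)"
  using zero_le_power2[of "x - y"] by (simp add: power2_eq_square algebra_simps)

text \<open>The bound for a squared sum is applied three times, which accounts for the constant
  2^7.\<close>

lemma power8_diff_le: "(x - y :: real) ^ 8 \<le> 128 * (x ^ 8 + y ^ 8)"
proof -
  have p4: "(2 * s) ^ 4 = 16 * (s\<^sup>2)\<^sup>2" for s :: real
    by (simp add: power_mult_distrib flip: power_mult)
  have "(x - y)\<^sup>2 \<le> 2 * (x\<^sup>2 + y\<^sup>2)"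
    using power2_sum_le[of x "- y"] by simp
  then have "((x - y)\<^sup>2) ^ 4 \<le> (2 * (x\<^sup>2 + y\<^sup>2)) ^ 4"
    by (intro power_mono) auto
  also have "\<dots> = 16 * ((x\<^sup>2 + y\<^sup>2)\<^sup>2)\<^sup>2"
    by (rule p4)
  also have "\<dots> \<le> 16 * (2 * ((x\<^sup>2)\<^sup>2 + (y\<^sup>2)\<^sup>2))\<^sup>2"
    by (intro mult_left_mono power_mono power2_sum_le) auto
  also have "\<dots> = 64 * ((x\<^sup>2)\<^sup>2 + (y\<^sup>2)\<^sup>2)\<^sup>2"
    by (subst power_mult_distrib) simp
  also have "\<dots> \<le> 64 * (2 * (((x\<^sup>2)\<^sup>2)\<^sup>2 + ((y\<^sup>2)\<^sup>2)\<^sup>2))"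
    by (intro mult_left_mono power2_sum_le) auto
  finally show ?thesis
    by (simp flip: power_mult)
qed

lemma cube_prod_le: "\<bar>r * s\<bar> ^ 3 \<le> 1 + r ^ 8 + (s::real) ^ 8"
proof -
  have p: "0 \<le> r ^ 8" "0 \<le> s ^ 8"
    by simp_all
  have "\<bar>r * s\<bar> ^ 3 = \<bar>r\<bar> ^ 3 * \<bar>s\<bar> ^ 3"
    by (simp add: abs_mult power_mult_distrib)
  also have "2 * \<dots> \<le> (\<bar>r\<bar> ^ 3)\<^sup>2 + (\<bar>s\<bar> ^ 3)\<^sup>2"
    using sum_squares_bound by (metis mult.assoc)
  also have "\<dots> = r ^ 6 + s ^ 6"
    by (simp flip: power_mult)
  finally have "2 * \<bar>r * s\<bar> ^ 3 \<le> r ^ 6 + s ^ 6"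
    by simp
  moreover have "r ^ 6 \<le> 1 + r ^ 8" "s ^ 6 \<le> 1 + s ^ 8"
    using power_le_power8[of 6 r] power_le_power8[of 6 s] by simp_all
  ultimately show ?thesis
    using p by linarith
qed

lemma fourth_prod_le: "\<bar>r * s\<bar> ^ 4 \<le> 1 + r ^ 8 + (s::real) ^ 8"
proof -
  have p: "0 \<le> r ^ 8" "0 \<le> s ^ 8"
    by simp_all
  have "\<bar>r * s\<bar> ^ 4 = r ^ 4 * s ^ 4"
    by (simp add: power_mult_distrib abs_mult)
  also have "2 * \<dots> \<le> (r ^ 4)\<^sup>2 + (s ^ 4)\<^sup>2"
    using sum_squares_bound by (metis mult.assoc)
  also have "\<dots> = r ^ 8 + s ^ 8"
    by (simp flip: power_mult)
  finally show ?thesis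
    using p by linarith
qed

lemma dot_measurable [measurable]:
  assumes "\<And>j. j < p \<Longrightarrow> (\<lambda>w. f w j) \<in> borel_measurable N" "\<And>j. j < p \<Longrightarrow> (\<lambda>w. g w j) \<in> borel_measurable N"
  shows "(\<lambda>w. dot p (f w) (g w)) \<in> borel_measurable N"
  unfolding dot_def using assms by measurable

lemma mv_measurable [measurable]:
  assumes "\<And>j. j < p \<Longrightarrow> (\<lambda>w. g w j) \<in> borel_measurable N"
  shows "(\<lambda>w. mv p B (g w) j) \<in> borel_measurable N"
  unfolding mv_def using assms by measurable

lemma (in finite_measure) integrable_of_nn_integral_bound:
  fixes f :: "'a \<Rightarrow> real"
  assumes f: "f \<in> borel_measurable M" "\<And>x. 0 \<le> f x" and "\<And>x. f x \<le> c * g x" "0 \<le> c"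
    and g: "\<And>x. 0 \<le> g x" "(\<integral>\<^sup>+x. ennreal (g x) \<partial>M) \<le> ennreal b" "0 \<le> b"
    and [measurable]: "g \<in> borel_measurable M"
  shows "integrable M f" and "integral\<^sup>L M f \<le> c * b"
proof -
  have "(\<integral>\<^sup>+x. ennreal (f x) \<partial>M) \<le> (\<integral>\<^sup>+x. ennreal c * ennreal (g x) \<partial>M)"
    using assms by (intro nn_integral_mono) (simp flip: ennreal_mult)
  also have "\<dots> = ennreal c * (\<integral>\<^sup>+x. ennreal (g x) \<partial>M)"
    by (rule nn_integral_cmult) measurable
  also have "\<dots> \<le> ennreal c * ennreal b"
    by (intro mult_left_mono g) auto
  also have "\<dots> = ennreal (c * b)"
    using assms by (simp add: ennreal_mult)
  finally have le: "(\<integral>\<^sup>+x. ennreal (f x) \<partial>M) \<le> ennreal (c * b)" .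
  then show int: "integrable M f"
    using f by (intro integrableI_nonneg) (auto intro: le_less_trans)
  have "ennreal (integral\<^sup>L M f) \<le> ennreal (c * b)"
    using le int f by (simp add: nn_integral_eq_integral)
  then show "integral\<^sup>L M f \<le> c * b"
    using assms by (simp add: ennreal_le_iff)
qed

text \<open>The law of a single row, detached from the probability space of the experiment. The
  exponential moment is a nonnegative integral, so that integrability of the polynomial moments is a
  consequence and need not be assumed.\<close>

locale subgaussian_law = prob_space M for M :: "(nat \<Rightarrow> real) measure" +
  fixes p :: nat and T :: real and \<Lambda> :: "nat \<Rightarrow> real"
  assumes sets_M [measurable_cong]: "sets M = sets (PiM {..<p} (\<lambda>_. borel))"
    and T_pos: "0 < T"
    and mean: "j < p \<Longrightarrow> (\<integral>a. a j \<partial>M) = 0"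
    and cov: "j < p \<Longrightarrow> k < p \<Longrightarrow> (\<integral>a. a j * a k \<partial>M) = (if j = k then \<Lambda> j else 0)"
    and subgaussian: "dot p u u \<le> 1 \<Longrightarrow> (\<integral>\<^sup>+a. ennreal (exp ((dot p a u / T)\<^sup>2)) \<partial>M) \<le> 2"
begin

lemma coord_measurable [measurable]: "j < p \<Longrightarrow> (\<lambda>a. a j) \<in> borel_measurable M"
  by simp

text \<open>After normalizing \<open>u\<close> the eighth power is dominated by the exponential
  moment; homogeneity restores the factor |u|^8. The constant 512 is 256 times the bound 2 on that
  moment.\<close>

lemma moment8:
  shows integrable_dot_power8: "integrable M (\<lambda>a. (dot p a u) ^ 8)"
    and dot_power8_le: "(\<integral>a. (dot p a u) ^ 8 \<partial>M) \<le> 512 * T ^ 8 * (dot p u u) ^ 4"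
proof -
  have "integrable M (\<lambda>a. (dot p a u) ^ 8) \<and> (\<integral>a. (dot p a u) ^ 8 \<partial>M) \<le> 512 * T ^ 8 * (dot p u u) ^ 4"
  proof (cases "dot p u u = 0")
    case True
    have "(dot p a u)\<^sup>2 \<le> 0" for a
      using dot_cs[of p a u] True by simp
    then show ?thesis
      by (simp add: True)
  next
    case False
    define s where "s = sqrt (dot p u u)"
    have s: "0 < s" "s\<^sup>2 = dot p u u"
      using False dot_self_nonneg[of p u] by (auto simp: s_def less_le simp del: dot_self_nonneg)
    define v where "v = (\<lambda>j. (1/s) * u j)"
    have dv: "dot p a v = dot p a u / s" for a
      unfolding v_def dot_scale_right by simp
    have "dot p v v = 1"
      unfolding dv unfolding v_def dot_scale_left using s False by (simp add: power2_eq_square flip: s(2))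
    then have e: "(\<integral>\<^sup>+a. ennreal (exp ((dot p a v / T)\<^sup>2)) \<partial>M) \<le> ennreal 2"
      using subgaussian[of v] by simp
    have b: "(dot p a u) ^ 8 \<le> (256 * T ^ 8 * s ^ 8) * exp ((dot p a v / T)\<^sup>2)" for a
    proof -
      have "dot p a u = (dot p a v / T) * (T * s)"
        using s T_pos by (simp add: dv)
      then have "(dot p a u) ^ 8 = (dot p a v / T) ^ 8 * (T * s) ^ 8"
        by (metis power_mult_distrib)
      also have "\<dots> \<le> (256 * exp ((dot p a v / T)\<^sup>2)) * (T * s) ^ 8"
        using T_pos s by (intro mult_right_mono power8_le_exp) auto
      finally show ?thesis
        by (simp add: power_mult_distrib mult_ac)
    qed
    have "integrable M (\<lambda>a. (dot p a u) ^ 8)" "(\<integral>a. (dot p a u) ^ 8 \<partial>M) \<le> (256 * T ^ 8 * s ^ 8) * 2"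
      by (rule integrable_of_nn_integral_bound[OF _ _ b _ _ e]; use T_pos s in \<open>simp; measurable\<close>)+
    moreover have "s ^ 8 = (dot p u u) ^ 4"
      using s(2) by (metis mult_2 numeral_Bit0 power_mult)
    ultimately show ?thesis
      by simp
  qed
  then show "integrable M (\<lambda>a. (dot p a u) ^ 8)" "(\<integral>a. (dot p a u) ^ 8 \<partial>M) \<le> 512 * T ^ 8 * (dot p u u) ^ 4"
    by auto
qed

lemma integrable_coord_power8: "j < p \<Longrightarrow> integrable M (\<lambda>a. (a j) ^ 8)"
  using integrable_dot_power8[of "\<lambda>i. if i = j then 1 else 0"] by (simp add: dot_def if_distrib cong: if_cong)

lemma integrable_power8_bound:
  fixes f :: "(nat \<Rightarrow> real) \<Rightarrow> real"
  assumes "f \<in> borel_measurable M" "\<And>a. \<bar>f a\<bar> \<le> c + (\<Sum>j<p. d * (a j) ^ 8)"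
  shows "integrable M f"
proof (rule Bochner_Integration.integrable_bound)
  show "integrable M (\<lambda>a. c + (\<Sum>j<p. d * (a j) ^ 8))"
    by (intro Bochner_Integration.integrable_add Bochner_Integration.integrable_sum integrable_mult_right
        integrable_coord_power8 integrable_const) auto
  show "AE a in M. norm (f a) \<le> norm (c + (\<Sum>j<p. d * (a j) ^ 8))"
    by (intro AE_I2) (metis abs_ge_self assms(2) order_trans real_norm_def)
qed (rule assms)

lemma integrable_coord: 
  assumes "j < p"
  shows "integrable M (\<lambda>a. a j)"
proof (rule integrable_power8_bound)
  fix a :: "nat \<Rightarrow> real"
  have "\<bar>a j\<bar> \<le> 1 + (a j) ^ 8"
    using power_le_power8[of 1 "a j"] by simp
  also have "(a j) ^ 8 \<le> (\<Sum>j<p. (a j) ^ 8)"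
    using assms by (intro member_le_sum) auto
  finally show "\<bar>a j\<bar> \<le> 1 + (\<Sum>j<p. 1 * (a j) ^ 8)"
    by simp
qed (use assms in measurable)

lemma integrable_coord_prod:
  assumes "j < p" "k < p"
  shows "integrable M (\<lambda>a. a j * a k)"
proof (rule integrable_power8_bound)
  fix a :: "nat \<Rightarrow> real"
  have "2 * \<bar>a j * a k\<bar> \<le> \<bar>a j\<bar>\<^sup>2 + \<bar>a k\<bar>\<^sup>2"
    using sum_squares_bound[of "\<bar>a j\<bar>" "\<bar>a k\<bar>"] by (simp add: abs_mult)
  then have "\<bar>a j * a k\<bar> \<le> 2 + (a j) ^ 8 + (a k) ^ 8"
    using power_le_power8[of 2 "a j"] power_le_power8[of 2 "a k"] abs_ge_zero[of "a j * a k"] by linarith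
  moreover have "(a j) ^ 8 \<le> (\<Sum>j<p. (a j) ^ 8)" "(a k) ^ 8 \<le> (\<Sum>j<p. (a j) ^ 8)"
    using assms by (auto intro!: member_le_sum)
  ultimately show "\<bar>a j * a k\<bar> \<le> 2 + (\<Sum>j<p. 2 * (a j) ^ 8)"
    unfolding sum_distrib_left[symmetric] by linarith
qed (use assms in measurable)

lemma dot_self_sq_le: "(dot p a a)\<^sup>2 \<le> real p * (\<Sum>j<p. (a j) ^ 4)"
proof -
  have "(dot p (\<lambda>_. 1) (\<lambda>j. (a j)\<^sup>2))\<^sup>2 \<le> dot p (\<lambda>_. 1) (\<lambda>_. 1) * dot p (\<lambda>j. (a j)\<^sup>2) (\<lambda>j. (a j)\<^sup>2)"
    by (rule dot_cs)
  then show ?thesis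
    by (simp add: dot_def power2_eq_square power4_eq_xxxx mult.assoc)
qed

lemma integrable_dot_self_sq: "integrable M (\<lambda>a. (dot p a a)\<^sup>2)"
proof (rule integrable_power8_bound)
  fix a :: "nat \<Rightarrow> real"
  have "(dot p a a)\<^sup>2 \<le> p * (\<Sum>j<p. (a j) ^ 4)"
    by (rule dot_self_sq_le)
  also have "(\<Sum>j<p. (a j) ^ 4) \<le> (\<Sum>j<p. 1 + (a j) ^ 8)"
    using power_le_power8[of 4] by (intro sum_mono) (simp add: power_even_abs)
  finally show "\<bar>(dot p a a)\<^sup>2\<bar> \<le> p * p + (\<Sum>j<p. p * (a j) ^ 8)"
    by (simp add: sum.distrib distrib_left mult_left_mono flip: sum_distrib_left)
qed measurable

lemma dot_mv_sq_le:
  assumes "\<And>v. dot p (mv p B v) (mv p B v) \<le> dot p v v"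
  shows "(dot p a (mv p B a))\<^sup>2 \<le> (dot p a a)\<^sup>2"
proof -
  have "(dot p a (mv p B a))\<^sup>2 \<le> dot p a a * dot p (mv p B a) (mv p B a)"
    by (rule dot_cs)
  also have "\<dots> \<le> dot p a a * dot p a a"
    by (intro mult_left_mono assms) auto
  finally show ?thesis
    by (simp add: power2_eq_square)
qed

lemma integrable_quadratic_form:
  assumes "\<And>v. dot p (mv p B v) (mv p B v) \<le> dot p v v"
  shows "integrable M (\<lambda>a. (dot p a (mv p B a) - c)\<^sup>2)"
proof (rule Bochner_Integration.integrable_bound)
  show "integrable M (\<lambda>a. 2 * (dot p a a)\<^sup>2 + 2 * c\<^sup>2)"
    by (intro Bochner_Integration.integrable_add integrable_mult_right integrable_dot_self_sq integrable_const)
  have "(dot p a (mv p B a) - c)\<^sup>2 \<le> 2 * (dot p a a)\<^sup>2 + 2 * c\<^sup>2" for a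
  proof -
    have "0 \<le> (dot p a (mv p B a) + c)\<^sup>2"
      by simp
    then have "(dot p a (mv p B a) - c)\<^sup>2 \<le> 2 * (dot p a (mv p B a))\<^sup>2 + 2 * c\<^sup>2"
      by (simp add: power2_diff power2_sum)
    then show ?thesis
      using dot_mv_sq_le[OF assms, of a] by linarith
  qed
  then show "AE a in M. norm ((dot p a (mv p B a) - c)\<^sup>2) \<le> norm (2 * (dot p a a)\<^sup>2 + 2 * c\<^sup>2)"
    by (intro AE_I2) simp
qed measurable

text \<open>Only the mean and the covariance of the row survive when the square is expanded. This is
  why two row laws with the same \<open>\<Lambda>\<close> agree in the leading term of the
  exchange.\<close>

lemma residual_square:
  shows integrable_residual_square: "integrable M (\<lambda>a. (dot p a u - x)\<^sup>2)"
    and residual_square_eq: "(\<integral>a. (dot p a u - x)\<^sup>2 \<partial>M) = (\<Sum>j<p. (u j)\<^sup>2 * \<Lambda> j) + x\<^sup>2"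
proof -
  have eq: "(dot p a u - x)\<^sup>2 = (\<Sum>j<p. \<Sum>k<p. u j * u k * (a j * a k)) - (\<Sum>j<p. 2 * x * u j * a j) + x\<^sup>2" for a
  proof -
    have "(dot p a u)\<^sup>2 = (\<Sum>j<p. \<Sum>k<p. u j * u k * (a j * a k))"
      unfolding dot_def power2_eq_square sum_product by (simp add: mult_ac)
    moreover have "2 * x * dot p a u = (\<Sum>j<p. 2 * x * u j * a j)"
      unfolding dot_def sum_distrib_left by (simp add: mult_ac)
    ultimately show ?thesis
      by (simp add: power2_diff mult_ac)
  qed
  have i: "integrable M (\<lambda>a. \<Sum>j<p. \<Sum>k<p. u j * u k * (a j * a k))" "integrable M (\<lambda>a. \<Sum>j<p. 2 * x * u j * a j)"
    by (intro Bochner_Integration.integrable_sum integrable_mult_right integrable_coord_prod integrable_coord; simp)+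
  then show "integrable M (\<lambda>a. (dot p a u - x)\<^sup>2)"
    unfolding eq by (intro Bochner_Integration.integrable_add Bochner_Integration.integrable_diff integrable_const)
  have "(\<integral>a. (dot p a u - x)\<^sup>2 \<partial>M) = (\<integral>a. (\<Sum>j<p. \<Sum>k<p. u j * u k * (a j * a k)) \<partial>M)
      - (\<integral>a. (\<Sum>j<p. 2 * x * u j * a j) \<partial>M) + x\<^sup>2"
    unfolding eq using i by (simp add: prob_space)
  also have "(\<integral>a. (\<Sum>j<p. \<Sum>k<p. u j * u k * (a j * a k)) \<partial>M) = (\<Sum>j<p. \<Sum>k<p. u j * u k * (if j = k then \<Lambda> j else 0))"
  proof -
    have "(\<integral>a. (\<Sum>j<p. \<Sum>k<p. u j * u k * (a j * a k)) \<partial>M) = (\<Sum>j<p. (\<integral>a. (\<Sum>k<p. u j * u k * (a j * a k)) \<partial>M))"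
      by (intro Bochner_Integration.integral_sum Bochner_Integration.integrable_sum integrable_mult_right integrable_coord_prod) auto
    also have "\<dots> = (\<Sum>j<p. \<Sum>k<p. (\<integral>a. u j * u k * (a j * a k) \<partial>M))"
      by (intro sum.cong refl Bochner_Integration.integral_sum integrable_mult_right integrable_coord_prod) auto
    also have "\<dots> = (\<Sum>j<p. \<Sum>k<p. u j * u k * (if j = k then \<Lambda> j else 0))"
      by (intro sum.cong refl) (simp add: cov)
    finally show ?thesis .
  qed
  also have "\<dots> = (\<Sum>j<p. (u j)\<^sup>2 * \<Lambda> j)"
    by (simp add: if_distrib power2_eq_square cong: if_cong)
  also have "(\<integral>a. (\<Sum>j<p. 2 * x * u j * a j) \<partial>M) = 0"
    by (simp add: Bochner_Integration.integral_sum integrable_coord mean)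
  finally show "(\<integral>a. (dot p a u - x)\<^sup>2 \<partial>M) = (\<Sum>j<p. (u j)\<^sup>2 * \<Lambda> j) + x\<^sup>2"
    by simp
qed

lemma Lambda_nonneg: "j < p \<Longrightarrow> 0 \<le> \<Lambda> j"
  using cov[of j j] by (metis (no_types, lifting) Bochner_Integration.integral_nonneg zero_le_square)

end

text \<open>The bound \<open>V\<close> is required for symmetric contractions only; it is later
  applied to \<mu> times the inverse Hessian, which is one.\<close>

locale row_law = subgaussian_law M p T \<Lambda> for M and p :: nat and T V :: real and \<Lambda> :: "nat \<Rightarrow> real" +
  assumes quadratic_form: "(\<And>j k. B j k = B k j) \<Longrightarrow> (\<And>v. dot p (mv p B v) (mv p B v) \<le> dot p v v) \<Longrightarrow>
        (\<integral>a. (dot p a (mv p B a) - (\<Sum>j<p. B j j * \<Lambda> j))\<^sup>2 \<partial>M) \<le> V"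

section \<open>Exchanging the rows of the design\<close>

locale test_function =
  fixes \<psi> :: "real \<Rightarrow> real" and C\<psi> L\<psi> :: real
  assumes differentiable: "\<psi> differentiable (at x)"
    and bounded: "\<bar>\<psi> x\<bar> \<le> C\<psi>" and deriv_bounded: "\<bar>deriv \<psi> x\<bar> \<le> C\<psi>"
    and deriv_lipschitz: "\<bar>deriv \<psi> x - deriv \<psi> y\<bar> \<le> L\<psi> * \<bar>x - y\<bar>"
begin

lemma C_nonneg: "0 \<le> C\<psi>"
  using bounded[of 0] by linarith

lemma L_nonneg: "0 \<le> L\<psi>"
  using deriv_lipschitz[of 1 0] by simp

lemma has_deriv: "(\<psi> has_real_derivative deriv \<psi> x) (at x)"
  using differentiable DERIV_deriv_iff_real_differentiable by blast

lemma measurable_test [measurable]: "\<psi> \<in> borel_measurable borel"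
  using has_deriv DERIV_isCont by (intro borel_measurable_continuous_onI) (auto intro!: continuous_at_imp_continuous_on)

lemma mean_value:
  obtains c where "\<bar>c - x\<bar> \<le> \<bar>h\<bar>" "\<psi> (x + h) - \<psi> x = deriv \<psi> c * h"
proof -
  consider "h = 0" | "x < x + h" | "x + h < x"
    by linarith
  then show thesis
  proof cases
    case 2
    then obtain c where "x < c" "c < x + h" "\<psi> (x + h) - \<psi> x = (x + h - x) * deriv \<psi> c"
      using MVT2[of x "x + h" \<psi> "deriv \<psi>"] has_deriv by blast
    then show thesis
      by (intro that[of c]) (auto simp: mult.commute)
  next
    case 3
    then obtain c where "x + h < c" "c < x" "\<psi> x - \<psi> (x + h) = (x - (x + h)) * deriv \<psi> c"
      using MVT2[of "x + h" x \<psi> "deriv \<psi>"] has_deriv by blast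
    then show thesis
      by (intro that[of c]) (auto simp: algebra_simps)
  qed (use that[of x] in auto)
qed

lemma lipschitz: "\<bar>\<psi> x - \<psi> y\<bar> \<le> C\<psi> * \<bar>x - y\<bar>"
proof -
  obtain c where "\<psi> (y + (x - y)) - \<psi> y = deriv \<psi> c * (x - y)"
    using mean_value by blast
  then show ?thesis
    using deriv_bounded[of c] by (simp add: abs_mult mult_right_mono)
qed

lemma first_order: "\<bar>\<psi> (x + h) - \<psi> x - deriv \<psi> x * h\<bar> \<le> L\<psi> * h\<^sup>2"
proof -
  obtain c where c: "\<bar>c - x\<bar> \<le> \<bar>h\<bar>" "\<psi> (x + h) - \<psi> x = deriv \<psi> c * h"
    using mean_value by blast
  have "\<bar>\<psi> (x + h) - \<psi> x - deriv \<psi> x * h\<bar> = \<bar>deriv \<psi> c - deriv \<psi> x\<bar> * \<bar>h\<bar>"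
    unfolding c(2) by (simp add: left_diff_distrib flip: abs_mult)
  also have "\<dots> \<le> (L\<psi> * \<bar>h\<bar>) * \<bar>h\<bar>"
    using deriv_lipschitz[of c x] c(1) L_nonneg
    by (intro mult_right_mono) (auto intro: order_trans mult_left_mono)
  also have "\<dots> = L\<psi> * h\<^sup>2"
    by (simp add: power2_eq_square mult.assoc)
  finally show ?thesis .
qed

end

lemma inverse_one_plus_diff:
  assumes "0 \<le> q" "0 \<le> (q'::real)" "0 \<le> t"
  shows "\<bar>t / (1 + q) - t / (1 + q')\<bar> \<le> t * \<bar>q - q'\<bar>"
proof -
  have "t / (1 + q) - t / (1 + q') = t * (q' - q) / ((1 + q) * (1 + q'))"
    using assms by (simp add: field_simps)
  also have "\<bar>\<dots>\<bar> = t * \<bar>q - q'\<bar> / ((1 + q) * (1 + q'))"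
    using assms by (simp add: abs_mult abs_minus_commute)
  also have "\<dots> \<le> t * \<bar>q - q'\<bar> / 1"
    using assms mult_mono[of 1 "1 + q" 1 "1 + q'"] by (intro divide_left_mono) auto
  finally show ?thesis
    by simp
qed

text \<open>
  \<open>W\<close> collects the eighth moments of the residual and of the inverse Hessian rows.  The centering
  \<open>c\<close> depends on the law of the new row through its covariance only.
\<close>

lemma (in smooth_penalty) one_row_expectation:
  fixes n p :: nat and y :: "'i \<Rightarrow> real" and \<beta> \<Lambda> :: "nat \<Rightarrow> real" and x T V :: real
  assumes "test_function \<psi> C\<psi> L\<psi>" and I: "finite I" "k \<notin> I" and n: "0 < n" and \<eta>: "0 < \<eta>"
  defines "S \<equiv> 2 * (\<Sum>i\<in>I. (y i)\<^sup>2) / (\<mu> * n) + 2 * dot p \<beta> \<beta>"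
  defines "W \<equiv> 1 + 512 * T ^ 8 / \<mu> ^ 8 + 128 * (512 * T ^ 8 * S ^ 4 + x ^ 8)"
  shows "\<exists>c. \<forall>M. row_law M p T V \<Lambda> \<longrightarrow>
    \<bar>(\<integral>a. \<psi> (pmin \<rho> p (insert k I) (z(k := \<lambda>j. a j / sqrt n)) (y(k := x + dot p a \<beta>)) / n) \<partial>M) - c\<bar> \<le>
      W / n * (C\<psi> * (p * (L + L\<^sup>2 / (2 * \<mu>)) / (n * sqrt n) + \<eta> + V / (\<eta> * \<mu>\<^sup>2 * (real n)\<^sup>2)) + L\<psi> / n)"
proof -
  interpret test_function \<psi> C\<psi> L\<psi> by fact
  obtain bh where bh: "\<And>b. ploss \<rho> p I z y bh \<le> ploss \<rho> p I z y b"
    using ploss_minimizer[OF coercive] by metis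
  define F where "F = ploss \<rho> p I z y bh"
  obtain B where sym: "\<And>j k. B j k = B k j" and Bpos: "\<And>v. 0 \<le> dot p v (mv p B v)"
    and Bbd: "\<And>v. \<mu>\<^sup>2 * dot p (mv p B v) (mv p B v) \<le> dot p v v"
    and est: "\<And>\<zeta> \<eta>. \<bar>pmin \<rho> p (insert k I) (z(k := \<zeta>)) (y(k := \<eta>)) - F
        - (dot p \<zeta> bh - \<eta>)\<^sup>2 / (2 * (1 + dot p \<zeta> (mv p B \<zeta>)))\<bar>
      \<le> (\<Sum>j<p. L * \<bar>(dot p \<zeta> bh - \<eta>) * mv p B \<zeta> j\<bar> ^ 3 + L\<^sup>2 / (2 * \<mu>) * \<bar>(dot p \<zeta> bh - \<eta>) * mv p B \<zeta> j\<bar> ^ 4)"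
    and ge: "\<And>\<zeta> \<eta>. F \<le> pmin \<rho> p (insert k I) (z(k := \<zeta>)) (y(k := \<eta>))"
    and le: "\<And>\<zeta> \<eta>. pmin \<rho> p (insert k I) (z(k := \<zeta>)) (y(k := \<eta>)) \<le> F + (dot p \<zeta> bh - \<eta>)\<^sup>2 / 2"
    by (rule add_row[OF I bh, folded F_def]) (rule that, assumption+)
  \<comment> \<open>The new row occurs in the design and also in the response through
    \<open>dot p a \<beta>\<close>. Hence the residual at \<open>bh\<close> is linear in the
    unscaled row \<open>a\<close>, with coefficient vector \<open>u\<close>.\<close>
  define u where "u = (\<lambda>j. (1 / sqrt n) * bh j - \<beta> j)"
  define r where "r = (\<lambda>a. dot p a u - x)"
  define Q where "Q = (\<lambda>a. dot p a (mv p B a))"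
  \<comment> \<open>The mean of \<open>Q\<close> under every row law with covariance
    \<open>\<Lambda>\<close>; \<open>qb\<close> is the resulting deterministic substitute for
    q.\<close>
  define q0 where "q0 = (\<Sum>j<p. B j j * \<Lambda> j)"
  define qb where "qb = q0 / n"
  define f where "f = (\<lambda>a. pmin \<rho> p (insert k I) (z(k := \<lambda>j. a j / sqrt n)) (y(k := x + dot p a \<beta>)))"
  define K where "K = L + L\<^sup>2 / (2 * \<mu>)"
  define c3 where "c3 = K / (n * sqrt n)"
  \<comment> \<open>The four terms dominate, in this order: the Taylor error of the penalty, the two
    halves of the error from replacing q by \<open>qb\<close>, and the second-order error of
    \<open>\<psi>\<close>.\<close>
  define G where "G = (\<lambda>a. C\<psi> / n * ((\<Sum>j<p. c3 * (1 + (r a) ^ 8 + (dot p a (B j)) ^ 8)) + \<eta> * (1 + (r a) ^ 8)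
      + (Q a - q0)\<^sup>2 / (\<eta> * (real n)\<^sup>2)) + L\<psi> / (real n)\<^sup>2 * (1 + (r a) ^ 8))"
  \<comment> \<open>The leading term. It is affine in r^2, so its integral \<open>c\<close> is fixed
    by the covariance and is the same for all row laws considered.\<close>
  define h where "h = (\<lambda>a. \<psi> (F / n) + deriv \<psi> (F / n) / (n * (2 * (1 + qb))) * (r a)\<^sup>2)"
  define c where "c = \<psi> (F / n) + deriv \<psi> (F / n) / (n * (2 * (1 + qb))) * ((\<Sum>j<p. (u j)\<^sup>2 * \<Lambda> j) + x\<^sup>2)"
  have K: "0 \<le> K"
    using L_nonneg mu_pos by (simp add: K_def smooth_penalty.L_nonneg[OF smooth_penalty_axioms])
  have c3: "0 \<le> c3"
    using K by (simp add: c3_def)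
  have sn: "1 \<le> sqrt n" "sqrt n \<le> n"
    using n real_sqrt_le_iff[of 1 n] sqrt_le_D by (auto simp: real_le_lsqrt power2_eq_square)
  have Brow: "dot p (B j) (B j) \<le> 1 / \<mu>\<^sup>2" if "j < p" for j
  proof -
    have "mv p B (\<lambda>i. if i = j then 1 else 0) = B j"
      using that by (auto simp: mv_unit sym)
    moreover have "dot p (\<lambda>i. if i = j then 1 else 0) (\<lambda>i. if i = j then 1 else 0) = 1"
      using that by (simp add: dot_def if_distrib cong: if_cong)
    ultimately show ?thesis
      using Bbd[of "\<lambda>i. if i = j then 1 else 0"] mu_pos by (simp add: field_simps)
  qed
  have Bdiag: "0 \<le> B j j" if "j < p" for j
    using Bpos[of "\<lambda>i. if i = j then 1 else 0"] that by (simp add: dot_def mv_def if_distrib if_distribR cong: if_cong)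
  \<comment> \<open>By \<open>minimizer_bound\<close>, the squared norm of \<open>bh\<close> is at
    most the sum of squared responses over \<mu>; the scaling by 1 / sqrt n turns that sum into an
    average.\<close>
  have uS: "dot p u u \<le> S"
  proof -
    have "(u j)\<^sup>2 \<le> 2 * (bh j)\<^sup>2 / n + 2 * (\<beta> j)\<^sup>2" for j
    proof -
      have "0 \<le> ((1 / sqrt n) * bh j + \<beta> j)\<^sup>2"
        by simp
      then have "(u j)\<^sup>2 \<le> 2 * ((1 / sqrt n) * bh j)\<^sup>2 + 2 * (\<beta> j)\<^sup>2"
        by (simp add: u_def power2_diff power2_sum)
      then show ?thesis
        using n by (simp add: power_divide)
    qed
    then have "dot p u u \<le> (\<Sum>j<p. 2 * (bh j)\<^sup>2 / n + 2 * (\<beta> j)\<^sup>2)"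
      unfolding dot_def by (intro sum_mono) (simp add: power2_eq_square)
    also have "\<dots> = 2 * dot p bh bh / n + 2 * dot p \<beta> \<beta>"
      by (simp add: dot_def sum.distrib sum_distrib_left sum_divide_distrib power2_eq_square)
    also have "dot p bh bh \<le> (\<Sum>i\<in>I. (y i)\<^sup>2) / \<mu>"
      using minimizer_bound[OF bh] mu_pos by (simp add: field_simps)
    finally show ?thesis
      using n by (simp add: S_def divide_right_mono field_simps)
  qed
  have pt: "\<bar>\<psi> (f a / n) - h a\<bar> \<le> G a" if qb: "0 \<le> qb" for a
  proof -
    define \<zeta> where "\<zeta> = (\<lambda>j. (1 / sqrt n) * a j)"
    have r: "dot p \<zeta> bh - (x + dot p a \<beta>) = r a"
      unfolding \<zeta>_def u_def r_def dot_diff_right dot_scale_left dot_scale_right by simp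
    have w: "mv p B \<zeta> j = dot p a (B j) / sqrt n" for j
      unfolding \<zeta>_def mv_def dot_scale_right by (simp add: dot_commute)
    have q: "dot p \<zeta> (mv p B \<zeta>) = Q a / n"
    proof -
      have "mv p B \<zeta> = (\<lambda>j. (1 / sqrt n) * mv p B a j)"
        unfolding \<zeta>_def mv_def dot_scale_right ..
      then have "dot p \<zeta> (mv p B \<zeta>) = (1 / sqrt n) * ((1 / sqrt n) * Q a)"
        unfolding Q_def by (simp only: dot_scale_right) (simp only: \<zeta>_def dot_scale_left)
      then show ?thesis
        by simp
    qed
    have f: "f a = pmin \<rho> p (insert k I) (z(k := \<zeta>)) (y(k := x + dot p a \<beta>))"
      by (simp add: f_def \<zeta>_def)
    have Qn: "0 \<le> Q a / n"
      using Bpos[of a] by (simp add: Q_def)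
    define \<Delta> where "\<Delta> = f a - F"
    have \<Delta>: "0 \<le> \<Delta>" "\<Delta> \<le> (r a)\<^sup>2 / 2"
      using ge[of \<zeta> "x + dot p a \<beta>"] le[of \<zeta> "x + dot p a \<beta>"] by (auto simp: \<Delta>_def f r)
    have "\<bar>\<Delta> - (r a)\<^sup>2 / (2 * (1 + Q a / n))\<bar> \<le>
        (\<Sum>j<p. L * \<bar>r a * (dot p a (B j) / sqrt n)\<bar> ^ 3 + L\<^sup>2 / (2 * \<mu>) * \<bar>r a * (dot p a (B j) / sqrt n)\<bar> ^ 4)"
      using est[of \<zeta> "x + dot p a \<beta>"] unfolding r w q f[symmetric] \<Delta>_def .
    also have "\<dots> \<le> (\<Sum>j<p. c3 * (1 + (r a) ^ 8 + (dot p a (B j)) ^ 8))"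
    proof (rule sum_mono)
      fix j
      define s where "s = dot p a (B j)"
      define P where "P = 1 + (r a) ^ 8 + s ^ 8"
      have P: "0 \<le> P"
        unfolding P_def by (intro add_nonneg_nonneg) auto
      have 3: "\<bar>r a * (s / sqrt n)\<bar> ^ 3 \<le> P / (n * sqrt n)"
      proof -
        have "\<bar>r a * (s / sqrt n)\<bar> ^ 3 = \<bar>r a * s\<bar> ^ 3 / (n * sqrt n)"
          by (simp add: power_divide abs_mult power3_eq_cube)
        also have "\<dots> \<le> P / (n * sqrt n)"
          unfolding P_def by (intro divide_right_mono cube_prod_le) auto
        finally show ?thesis .
      qed
      \<comment> \<open>The quartic term gains the better rate n^(-2); it is weakened to n^(-3/2) to
        be merged with the cubic one.\<close>
      have 4: "\<bar>r a * (s / sqrt n)\<bar> ^ 4 \<le> P / (n * sqrt n)"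
      proof -
        have "(sqrt n) ^ 4 = (real n)\<^sup>2"
          by (simp add: power4_eq_xxxx power2_eq_square)
        then have "\<bar>r a * (s / sqrt n)\<bar> ^ 4 = \<bar>r a * s\<bar> ^ 4 / (n * n)"
          by (simp add: power_divide abs_mult power_mult_distrib power2_eq_square)
        also have "\<dots> \<le> P / (n * n)"
          unfolding P_def by (intro divide_right_mono fourth_prod_le) auto
        also have "\<dots> \<le> P / (n * sqrt n)"
          using P n sn by (intro divide_left_mono mult_left_mono mult_pos_pos) auto
        finally show ?thesis .
      qed
      have "L * \<bar>r a * (s / sqrt n)\<bar> ^ 3 + L\<^sup>2 / (2 * \<mu>) * \<bar>r a * (s / sqrt n)\<bar> ^ 4
          \<le> L * (P / (n * sqrt n)) + L\<^sup>2 / (2 * \<mu>) * (P / (n * sqrt n))"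
        using mu_pos smooth_penalty.L_nonneg[OF smooth_penalty_axioms] by (intro add_mono mult_left_mono 3 4) auto
      also have "\<dots> = c3 * P"
        by (simp add: c3_def K_def algebra_simps add_divide_distrib)
      finally show "L * \<bar>r a * (dot p a (B j) / sqrt n)\<bar> ^ 3 + L\<^sup>2 / (2 * \<mu>) * \<bar>r a * (dot p a (B j) / sqrt n)\<bar> ^ 4
          \<le> c3 * (1 + (r a) ^ 8 + (dot p a (B j)) ^ 8)"
        by (simp add: P_def s_def)
    qed
    finally have 1: "\<bar>\<Delta> - (r a)\<^sup>2 / (2 * (1 + Q a / n))\<bar> \<le> (\<Sum>j<p. c3 * (1 + (r a) ^ 8 + (dot p a (B j)) ^ 8))" .
    have r4: "(r a) ^ 4 \<le> 1 + (r a) ^ 8"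
      using power_le_power8[of 4 "r a"] by simp
    have 2: "\<bar>(r a)\<^sup>2 / (2 * (1 + Q a / n)) - (r a)\<^sup>2 / (2 * (1 + qb))\<bar> \<le> \<eta> * (1 + (r a) ^ 8) + (Q a - q0)\<^sup>2 / (\<eta> * (real n)\<^sup>2)"
    proof -
      have "\<bar>(r a)\<^sup>2 / (2 * (1 + Q a / n)) - (r a)\<^sup>2 / (2 * (1 + qb))\<bar> =
          \<bar>((r a)\<^sup>2 / 2) / (1 + Q a / n) - ((r a)\<^sup>2 / 2) / (1 + qb)\<bar>"
        by simp
      also have "\<dots> \<le> (r a)\<^sup>2 / 2 * \<bar>Q a / n - qb\<bar>"
        using Qn qb by (intro inverse_one_plus_diff) auto
      also have "\<dots> \<le> \<eta> * (r a) ^ 4 + (Q a / n - qb)\<^sup>2 / \<eta>"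
      proof -
        \<comment> \<open>A weighted product inequality separates r^2 from the deviation of q, so
          that the moments of r and the variance of Q can be taken separately, although both depend
          on the same row.\<close>
        define s t where "s = sqrt \<eta> * (r a)\<^sup>2" and "t = \<bar>Q a / n - qb\<bar> / sqrt \<eta>"
        have "0 \<le> s * t"
          using \<eta> by (simp add: s_def t_def)
        then have "s * t / 2 \<le> s\<^sup>2 + t\<^sup>2"
          using sum_squares_bound[of s t] by (simp add: mult.assoc)
        moreover have "s * t = (r a)\<^sup>2 * \<bar>Q a / n - qb\<bar>" "s\<^sup>2 = \<eta> * (r a) ^ 4" "t\<^sup>2 = (Q a / n - qb)\<^sup>2 / \<eta>"
          using \<eta> by (simp_all add: s_def t_def power_mult_distrib power_divide flip: power_mult)
        ultimately show ?thesis
          by (simp only: times_divide_eq_left)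
      qed
      also have "\<dots> \<le> \<eta> * (1 + (r a) ^ 8) + (Q a - q0)\<^sup>2 / (\<eta> * (real n)\<^sup>2)"
        using \<eta> n r4 by (intro add_mono mult_left_mono) (auto simp: qb_def power_divide mult.commute simp flip: diff_divide_distrib)
      finally show ?thesis .
    qed
    have "\<bar>\<psi> (F / n + \<Delta> / n) - \<psi> (F / n) - deriv \<psi> (F / n) * (\<Delta> / n)\<bar> \<le> L\<psi> * (\<Delta> / n)\<^sup>2"
      by (rule first_order)
    also have "\<dots> \<le> L\<psi> * ((1 + (r a) ^ 8) / (real n)\<^sup>2)"
    proof -
      have "\<Delta>\<^sup>2 \<le> ((r a)\<^sup>2 / 2)\<^sup>2"
        using \<Delta> by (intro power_mono)
      also have "\<dots> = (r a) ^ 4 / 4"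
        by (simp add: power_divide flip: power_mult)
      also have "\<dots> \<le> 1 + (r a) ^ 8"
      proof -
        have "0 \<le> (r a) ^ 8"
          by simp
        then show ?thesis
          using r4 by linarith
      qed
      finally have "(\<Delta> / n)\<^sup>2 \<le> (1 + (r a) ^ 8) / (real n)\<^sup>2"
        unfolding power_divide by (rule divide_right_mono) simp
      then show ?thesis
        using L_nonneg by (rule mult_left_mono)
    qed
    finally have 3: "\<bar>\<psi> (f a / n) - \<psi> (F / n) - deriv \<psi> (F / n) * (\<Delta> / n)\<bar> \<le> L\<psi> / (real n)\<^sup>2 * (1 + (r a) ^ 8)"
      by (simp add: \<Delta>_def diff_divide_distrib)
    let ?E = "(\<Sum>j<p. c3 * (1 + (r a) ^ 8 + (dot p a (B j)) ^ 8)) + \<eta> * (1 + (r a) ^ 8) + (Q a - q0)\<^sup>2 / (\<eta> * (real n)\<^sup>2)"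
    have "\<bar>\<Delta> - (r a)\<^sup>2 / (2 * (1 + qb))\<bar> \<le> ?E"
      using 1 2 by linarith
    then have "\<bar>deriv \<psi> (F / n) / n * (\<Delta> - (r a)\<^sup>2 / (2 * (1 + qb)))\<bar> \<le> C\<psi> / n * ?E"
      unfolding abs_mult using deriv_bounded[of "F / n"] C_nonneg
      by (intro mult_mono) (auto simp: divide_right_mono)
    moreover have "\<psi> (f a / n) - h a = (\<psi> (f a / n) - \<psi> (F / n) - deriv \<psi> (F / n) * (\<Delta> / n))
        + deriv \<psi> (F / n) / n * (\<Delta> - (r a)\<^sup>2 / (2 * (1 + qb)))"
      by (simp add: h_def right_diff_distrib)
    moreover have "\<bar>w\<bar> \<le> d + e" if "\<bar>v\<bar> \<le> d" "w = u + v" "\<bar>u\<bar> \<le> e" for u v w d e :: real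
      using that by linarith
    ultimately show ?thesis
      using 3 unfolding G_def by blast
  qed
  show ?thesis
  proof (intro exI[of _ c] allI impI)
    fix M assume "row_law M p T V \<Lambda>"
    then interpret R: row_law M p T V \<Lambda> .
    have qb: "0 \<le> qb"
      unfolding qb_def q0_def using Bdiag R.Lambda_nonneg by (intro divide_nonneg_nonneg sum_nonneg mult_nonneg_nonneg) auto
    \<comment> \<open>Since \<open>B\<close> has operator norm at most 1 / \<mu>, the matrix \<mu> B
      is a contraction, as the variance bound of \<open>row_law\<close> demands.\<close>
    have Bop: "dot p (mv p (\<lambda>j k. \<mu> * B j k) v) (mv p (\<lambda>j k. \<mu> * B j k) v) \<le> dot p v v" for v
    proof -
      have "mv p (\<lambda>j k. \<mu> * B j k) v = (\<lambda>j. \<mu> * mv p B v j)"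
        by (rule ext) (simp add: mv_def dot_scale_left)
      then show ?thesis
        using Bbd[of v] by (simp only:) (simp add: dot_scale_left dot_scale_right power2_eq_square mult.assoc)
    qed
    have Qeq: "(dot p a (mv p (\<lambda>j k. \<mu> * B j k) a) - (\<Sum>j<p. \<mu> * B j j * \<Lambda> j))\<^sup>2 = \<mu>\<^sup>2 * (Q a - q0)\<^sup>2" for a
    proof -
      have "mv p (\<lambda>j k. \<mu> * B j k) a = (\<lambda>j. \<mu> * mv p B a j)"
        by (rule ext) (simp add: mv_def dot_scale_left)
      then have "dot p a (mv p (\<lambda>j k. \<mu> * B j k) a) = \<mu> * Q a"
        by (simp only:) (simp add: dot_scale_right Q_def)
      moreover have "(\<Sum>j<p. \<mu> * B j j * \<Lambda> j) = \<mu> * q0"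
        by (simp add: q0_def sum_distrib_left mult.assoc)
      ultimately show ?thesis
        by (simp flip: right_diff_distrib power_mult_distrib)
    qed
    have Qint: "integrable M (\<lambda>a. (Q a - q0)\<^sup>2)"
      using R.integrable_quadratic_form[OF Bop, of "\<Sum>j<p. \<mu> * B j j * \<Lambda> j"] mu_pos unfolding Qeq by simp
    have QV: "(\<integral>a. (Q a - q0)\<^sup>2 \<partial>M) \<le> V / \<mu>\<^sup>2"
      using R.quadratic_form[of "\<lambda>j k. \<mu> * B j k", OF _ Bop] mu_pos sym unfolding Qeq
      by (simp add: field_simps)
    define \<R> where "\<R> = 128 * (512 * T ^ 8 * S ^ 4 + x ^ 8)"
    have r8: "(r a) ^ 8 \<le> 128 * ((dot p a u) ^ 8 + x ^ 8)" for a
      unfolding r_def by (rule power8_diff_le)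
    have rm [measurable]: "r \<in> borel_measurable M"
      unfolding r_def by measurable
    have rint': "integrable M (\<lambda>a. 128 * ((dot p a u) ^ 8 + x ^ 8))"
      by (intro integrable_mult_right Bochner_Integration.integrable_add R.integrable_dot_power8 R.integrable_const)
    have rint: "integrable M (\<lambda>a. (r a) ^ 8)"
      by (rule Bochner_Integration.integrable_bound[OF rint']) (use r8 in \<open>auto intro!: AE_I2 intro: order_trans[OF _ abs_ge_self]\<close>)
    have r\<R>: "(\<integral>a. (r a) ^ 8 \<partial>M) \<le> \<R>"
    proof -
      have "(\<integral>a. (r a) ^ 8 \<partial>M) \<le> (\<integral>a. 128 * ((dot p a u) ^ 8 + x ^ 8) \<partial>M)"
        by (intro integral_mono rint rint' r8)
      also have "\<dots> = 128 * ((\<integral>a. (dot p a u) ^ 8 \<partial>M) + x ^ 8)"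
        by (simp add: R.integrable_dot_power8 R.prob_space)
      also have "\<dots> \<le> \<R>"
        using R.dot_power8_le[of u] power_mono[OF uS, of 4] R.T_pos unfolding \<R>_def
        by (intro mult_left_mono add_right_mono) (auto intro: order_trans mult_left_mono)
      finally show ?thesis .
    qed
    have B8: "(\<integral>a. (dot p a (B j)) ^ 8 \<partial>M) \<le> 512 * T ^ 8 / \<mu> ^ 8" if "j < p" for j
    proof -
      have "(\<integral>a. (dot p a (B j)) ^ 8 \<partial>M) \<le> 512 * T ^ 8 * (dot p (B j) (B j)) ^ 4"
        by (rule R.dot_power8_le)
      also have "\<dots> \<le> 512 * T ^ 8 * (1 / \<mu>\<^sup>2) ^ 4"
        using Brow[OF that] by (intro mult_left_mono power_mono) auto
      also have "\<dots> = 512 * T ^ 8 / \<mu> ^ 8"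
        by (simp add: power_divide flip: power_mult)
      finally show ?thesis .
    qed
    have Gint: "integrable M G"
      unfolding G_def
      by (intro Bochner_Integration.integrable_add integrable_mult_right Bochner_Integration.integrable_sum integrable_divide
          R.integrable_const rint R.integrable_dot_power8 Qint)
    have hint: "integrable M h"
      unfolding h_def r_def
      by (intro Bochner_Integration.integrable_add integrable_mult_right R.integrable_const R.integrable_residual_square)
    have "(\<integral>a. h a \<partial>M) = c"
      using R.residual_square_eq[of u x] R.integrable_residual_square[of u x] by (simp add: h_def r_def c_def R.prob_space)
    have [measurable]: "f \<in> borel_measurable M"
      unfolding f_def
    proof (rule pmin_measurable[OF coercive])
      fix i j assume "i \<in> insert k I" "j < p"
      then have "(\<lambda>w. w j / sqrt (real n)) \<in> borel_measurable M"
        by measurable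
      then show "(\<lambda>w. (z(k := \<lambda>j. w j / sqrt (real n))) i j) \<in> borel_measurable M"
        by (cases "i = k") auto
    next
      fix i
      show "(\<lambda>w. (y(k := x + dot p w \<beta>)) i) \<in> borel_measurable M"
        by (cases "i = k") auto
    qed
    have fint: "integrable M (\<lambda>a. \<psi> (f a / n))"
      by (rule R.integrable_const_bound[of _ C\<psi>]) (auto simp: bounded)
    have "\<bar>(\<integral>a. \<psi> (f a / n) \<partial>M) - c\<bar> = \<bar>\<integral>a. \<psi> (f a / n) - h a \<partial>M\<bar>"
      using fint hint \<open>(\<integral>a. h a \<partial>M) = c\<close> by simp
    also have "\<dots> \<le> (\<integral>a. \<bar>\<psi> (f a / n) - h a\<bar> \<partial>M)"
      by (rule integral_abs_bound)
    also have "\<dots> \<le> (\<integral>a. G a \<partial>M)"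
      using fint hint Gint by (intro integral_mono pt[OF qb]) auto
    also have "\<dots> = C\<psi> / n * ((\<Sum>j<p. c3 * (1 + (\<integral>a. (r a) ^ 8 \<partial>M) + (\<integral>a. (dot p a (B j)) ^ 8 \<partial>M)))
        + \<eta> * (1 + (\<integral>a. (r a) ^ 8 \<partial>M)) + (\<integral>a. (Q a - q0)\<^sup>2 \<partial>M) / (\<eta> * (real n)\<^sup>2)) + L\<psi> / (real n)\<^sup>2 * (1 + (\<integral>a. (r a) ^ 8 \<partial>M))"
      unfolding G_def using rint Qint by (simp add: R.integrable_dot_power8 R.prob_space)
    also have "\<dots> \<le> C\<psi> / n * ((\<Sum>j<p. c3 * W) + \<eta> * W + (V / \<mu>\<^sup>2) / (\<eta> * (real n)\<^sup>2) * W) + L\<psi> / (real n)\<^sup>2 * W"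
    proof -
      have t8: "0 \<le> 512 * T ^ 8 / \<mu> ^ 8"
        by simp
      have "0 \<le> \<R>"
        by (rule order_trans[OF _ r\<R>]) (rule Bochner_Integration.integral_nonneg, simp)
      moreover have W_eq: "W = 1 + 512 * T ^ 8 / \<mu> ^ 8 + \<R>"
        by (simp only: W_def \<R>_def)
      ultimately have W: "1 + (\<integral>a. (r a) ^ 8 \<partial>M) \<le> W" "1 \<le> W"
        using r\<R> t8 by linarith+
      have WB: "1 + (\<integral>a. (r a) ^ 8 \<partial>M) + (\<integral>a. (dot p a (B j)) ^ 8 \<partial>M) \<le> W" if "j < p" for j
        using r\<R> B8[OF that] W_eq by linarith
      have "0 \<le> V / \<mu>\<^sup>2"
        by (rule order_trans[OF _ QV]) (rule Bochner_Integration.integral_nonneg, simp)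
      then have "0 \<le> V / \<mu>\<^sup>2 / (\<eta> * (real n)\<^sup>2)"
        by (rule divide_nonneg_nonneg) (use \<eta> in simp)
      then have "V / \<mu>\<^sup>2 / (\<eta> * (real n)\<^sup>2) * 1 \<le> V / \<mu>\<^sup>2 / (\<eta> * (real n)\<^sup>2) * W"
        using W by (intro mult_left_mono)
      moreover have "(\<integral>a. (Q a - q0)\<^sup>2 \<partial>M) / (\<eta> * (real n)\<^sup>2) \<le> V / \<mu>\<^sup>2 / (\<eta> * (real n)\<^sup>2)"
        using QV \<eta> by (intro divide_right_mono) auto
      ultimately have "(\<integral>a. (Q a - q0)\<^sup>2 \<partial>M) / (\<eta> * (real n)\<^sup>2) \<le> V / \<mu>\<^sup>2 / (\<eta> * (real n)\<^sup>2) * W"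
        by linarith
      then show ?thesis
        using C_nonneg L_nonneg c3 \<eta> W by (intro add_mono mult_left_mono sum_mono WB) auto
    qed
    also have "\<dots> = W / n * (C\<psi> * (p * K / (n * sqrt n) + \<eta> + V / (\<eta> * \<mu>\<^sup>2 * (real n)\<^sup>2)) + L\<psi> / n)"
      using n by (simp add: c3_def field_simps power2_eq_square)
    finally show "\<bar>(\<integral>a. \<psi> (pmin \<rho> p (insert k I) (z(k := \<lambda>j. a j / sqrt n)) (y(k := x + dot p a \<beta>)) / n) \<partial>M) - c\<bar> \<le>
      W / n * (C\<psi> * (p * (L + L\<^sup>2 / (2 * \<mu>)) / (n * sqrt n) + \<eta> + V / (\<eta> * \<mu>\<^sup>2 * (real n)\<^sup>2)) + L\<psi> / n)"
      by (simp add: f_def K_def)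
  qed
qed

section \<open>Exchanging all rows while the noise is fixed\<close>

definition opt_risk :: "(real \<Rightarrow> real) \<Rightarrow> nat \<Rightarrow> nat \<Rightarrow> (nat \<Rightarrow> real) \<Rightarrow> (nat \<Rightarrow> real) \<Rightarrow> (nat \<Rightarrow> nat \<Rightarrow> real) \<Rightarrow> real" where
  "opt_risk \<rho> n p \<beta> \<xi> R = pmin \<rho> p {..<n} (\<lambda>i j. R i j / sqrt n) (\<lambda>i. \<xi> i + dot p (R i) \<beta>) / n"

lemma opt_risk_measurable:
  assumes "coercive \<rho>" "\<And>i j. i < n \<Longrightarrow> j < p \<Longrightarrow> (\<lambda>w. R w i j) \<in> borel_measurable N"
    "\<And>i. i < n \<Longrightarrow> (\<lambda>w. x w i) \<in> borel_measurable N"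
  shows "(\<lambda>w. opt_risk \<rho> n p \<beta> (x w) (R w)) \<in> borel_measurable N"
  unfolding opt_risk_def using assms
  by (intro borel_measurable_divide pmin_measurable borel_measurable_add dot_measurable borel_measurable_const) auto

lemma row_coord_measurable:
  assumes "i \<in> I" "(\<lambda>a. a j) \<in> borel_measurable (N i)"
  shows "(\<lambda>R. R i j) \<in> borel_measurable (PiM I N)"
  by (rule measurable_compose[where f = "\<lambda>R. R i" and g = "\<lambda>a. a j", OF measurable_component_singleton[OF assms(1), of N] assms(2)])

text \<open>No integrability is asked for: the integral of a non-integrable function is 0 by
  convention, and c is nonnegative.\<close>

lemma (in prob_space) abs_integral_le_const:
  assumes "\<And>x. \<bar>f x\<bar> \<le> (c::real)"
  shows "\<bar>\<integral>x. f x \<partial>M\<bar> \<le> c"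
proof (cases "integrable M f")
  case True
  have "\<bar>\<integral>x. f x \<partial>M\<bar> \<le> (\<integral>x. \<bar>f x\<bar> \<partial>M)"
    by (rule integral_abs_bound)
  also have "\<dots> \<le> (\<integral>x. c \<partial>M)"
    using True assms by (intro integral_mono) auto
  finally show ?thesis
    by (simp add: prob_space)
next
  case False
  then show ?thesis
    using assms[of undefined] by (simp add: not_integrable_integral_eq)
qed

lemma PiM_component_integral:
  fixes f :: "_ \<Rightarrow> real"
  assumes N: "\<And>i. i \<in> I \<Longrightarrow> prob_space (N i)" and i: "i \<in> I" and f: "integrable (N i) f"
  shows "integrable (PiM I N) (\<lambda>R. f (R i))" and "(\<integral>R. f (R i) \<partial>PiM I N) = (\<integral>a. f a \<partial>N i)"
proof -
  have m: "(\<lambda>R. R i) \<in> measurable (PiM I N) (N i)"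
    by (rule measurable_component_singleton[OF i])
  have d: "distr (PiM I N) (N i) (\<lambda>R. R i) = N i"
    by (rule distr_PiM_component[OF N i])
  have "integrable (distr (PiM I N) (N i) (\<lambda>R. R i)) f"
    unfolding d by (rule f)
  then show "integrable (PiM I N) (\<lambda>R. f (R i))"
    by (rule integrable_distr[OF m])
  show "(\<integral>R. f (R i) \<partial>PiM I N) = (\<integral>a. f a \<partial>N i)"
    using integral_distr[OF m borel_measurable_integrable[OF f]] by (simp only: d)
qed

lemma sum_power4_le:
  assumes "\<And>i. i \<in> I \<Longrightarrow> 0 \<le> (t i :: real)"
  shows "(\<Sum>i\<in>I. t i) ^ 4 \<le> real (card I) ^ 3 * (\<Sum>i\<in>I. (t i) ^ 4)"
proof -
  have "(\<Sum>i\<in>I. t i) ^ 4 = ((\<Sum>i\<in>I. t i)\<^sup>2)\<^sup>2"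
    by (simp flip: power_mult)
  also have "\<dots> \<le> ((\<Sum>i\<in>I. (t i)\<^sup>2) * card I)\<^sup>2"
    by (intro power_mono sum_squared_le_sum_of_squares) auto
  also have "\<dots> = (\<Sum>i\<in>I. (t i)\<^sup>2)\<^sup>2 * (real (card I))\<^sup>2"
    by (rule power_mult_distrib)
  also have "\<dots> \<le> ((\<Sum>i\<in>I. ((t i)\<^sup>2)\<^sup>2) * card I) * (real (card I))\<^sup>2"
    by (intro mult_right_mono sum_squared_le_sum_of_squares) auto
  also have "\<dots> = real (card I) ^ 3 * (\<Sum>i\<in>I. (t i) ^ 4)"
    by (simp add: power2_eq_square power3_eq_cube power4_eq_xxxx mult_ac)
  finally show ?thesis .
qed

lemma power4_sum_le: "(u + v :: real) ^ 4 \<le> 8 * (u ^ 4 + v ^ 4)"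
proof -
  have "((u + v)\<^sup>2)\<^sup>2 \<le> (2 * (u\<^sup>2 + v\<^sup>2))\<^sup>2"
    by (intro power_mono power2_sum_le) auto
  also have "\<dots> = 4 * (u\<^sup>2 + v\<^sup>2)\<^sup>2"
    by (subst power_mult_distrib) simp
  also have "\<dots> \<le> 4 * (2 * ((u\<^sup>2)\<^sup>2 + (v\<^sup>2)\<^sup>2))"
    by (intro mult_left_mono power2_sum_le) auto
  finally show ?thesis
    by (simp flip: power_mult)
qed

text \<open>The expected one-row bound is affine in the average X of the eighth powers of the noise
  and in the eighth power v of the k-th noise entry. This constant is the sum of the coefficients of
  that affine bound, so the bound is at most the constant times 1 + X + v.\<close>

definition moment_const :: "real \<Rightarrow> real \<Rightarrow> real \<Rightarrow> real" where
  "moment_const \<mu> T b = 129 + 512 * T ^ 8 / \<mu> ^ 8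
     + 128 * (512 * T ^ 8 * (128 * (128 / \<mu> ^ 4 * (1 + 512 * T ^ 8 * b ^ 4) + b ^ 4)))"

lemma (in subgaussian_law) response_power8:
  shows integrable_response_power8: "integrable M (\<lambda>a. (x + dot p a \<beta>) ^ 8)"
    and response_power8_le: "(\<integral>a. (x + dot p a \<beta>) ^ 8 \<partial>M) \<le> 128 * (x ^ 8 + 512 * T ^ 8 * (dot p \<beta> \<beta>) ^ 4)"
proof -
  have le: "(x + dot p a \<beta>) ^ 8 \<le> 128 * ((dot p a \<beta>) ^ 8 + x ^ 8)" for a
    using power8_diff_le[of "dot p a \<beta>" "- x"] by (simp add: add.commute)
  have i: "integrable M (\<lambda>a. 128 * ((dot p a \<beta>) ^ 8 + x ^ 8))"
    by (intro integrable_mult_right Bochner_Integration.integrable_add integrable_dot_power8 integrable_const)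
  show j: "integrable M (\<lambda>a. (x + dot p a \<beta>) ^ 8)"
    by (rule Bochner_Integration.integrable_bound[OF i]) (use le in \<open>auto intro!: AE_I2 intro: order_trans[OF _ abs_ge_self]\<close>)
  have "(\<integral>a. (x + dot p a \<beta>) ^ 8 \<partial>M) \<le> (\<integral>a. 128 * ((dot p a \<beta>) ^ 8 + x ^ 8) \<partial>M)"
    by (intro integral_mono i j le)
  also have "\<dots> = 128 * ((\<integral>a. (dot p a \<beta>) ^ 8 \<partial>M) + x ^ 8)"
    by (simp add: integrable_dot_power8 prob_space)
  finally show "(\<integral>a. (x + dot p a \<beta>) ^ 8 \<partial>M) \<le> 128 * (x ^ 8 + 512 * T ^ 8 * (dot p \<beta> \<beta>) ^ 4)"
    using dot_power8_le[of \<beta>] by simp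
qed

text \<open>Fubini isolates row k. For the other rows fixed, \<open>one_row_expectation\<close>
  places the integrals over both candidate laws near the same centering, so they differ by at most
  twice the error; that error is then averaged over the other rows.\<close>

lemma (in smooth_penalty) swap_one_row:
  fixes N :: "nat \<Rightarrow> (nat \<Rightarrow> real) measure" and n p :: nat and \<beta> \<xi> \<Lambda> :: "nat \<Rightarrow> real"
  assumes \<psi>: "test_function \<psi> C\<psi> L\<psi>" and k: "k < n" and \<eta>: "0 < \<eta>" and V: "0 \<le> V" and b: "dot p \<beta> \<beta> \<le> b"
    and N: "\<And>i. row_law (N i) p T V \<Lambda>" and M: "row_law M1 p T V \<Lambda>" "row_law M2 p T V \<Lambda>"
  defines "\<omega> \<equiv> C\<psi> * (p * (L + L\<^sup>2 / (2 * \<mu>)) / (n * sqrt n) + \<eta> + V / (\<eta> * \<mu>\<^sup>2 * (real n)\<^sup>2)) + L\<psi> / n"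
  shows "\<bar>(\<integral>R. \<psi> (opt_risk \<rho> n p \<beta> \<xi> R) \<partial>PiM {..<n} (N(k := M1))) - (\<integral>R. \<psi> (opt_risk \<rho> n p \<beta> \<xi> R) \<partial>PiM {..<n} (N(k := M2)))\<bar>
    \<le> 2 * \<omega> * moment_const \<mu> T b * (1 + (\<Sum>i<n. (\<xi> i) ^ 8) / n + (\<xi> k) ^ 8) / n"
proof -
  interpret test_function \<psi> C\<psi> L\<psi> by fact
  have n: "0 < n"
    using k by simp
  define I where "I = {..<n} - {k}"
  have I: "finite I" "k \<notin> I" "{..<n} = insert k I"
    using k by (auto simp: I_def)
  have Lp: "0 \<le> L"
    using smooth_penalty_axioms by (rule smooth_penalty.L_nonneg)
  have \<omega>: "0 \<le> \<omega>"
    unfolding \<omega>_def using Lp mu_pos \<eta> V C_nonneg L_nonneg by auto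
  define y where "y = (\<lambda>R i. \<xi> i + dot p (R i) \<beta>)"
  define G where "G = (\<lambda>M R. \<integral>a. \<psi> (opt_risk \<rho> n p \<beta> \<xi> (R(k := a))) \<partial>M)"
  \<comment> \<open>The factor \<open>W\<close> of the one-row estimate, with S^4 replaced by an
    average of eighth powers of the responses. That average is a sum of functions of single rows, so
    its integral under the product measure is immediate.\<close>
  define bd where "bd = (\<lambda>R. 1 + 512 * T ^ 8 / \<mu> ^ 8
      + 128 * (512 * T ^ 8 * (128 * ((\<Sum>i\<in>I. (y R i) ^ 8) / n / \<mu> ^ 4 + b ^ 4)) + (\<xi> k) ^ 8))"
  have b0: "0 \<le> b"
    using b order_trans[OF dot_self_nonneg] by blast
  have diff: "\<bar>G M1 R - G M2 R\<bar> \<le> 2 * (\<omega> / n) * bd R" for R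
  proof -
    let ?S = "2 * (\<Sum>i\<in>I. (y R i)\<^sup>2) / (\<mu> * n) + 2 * dot p \<beta> \<beta>"
    let ?W = "1 + 512 * T ^ 8 / \<mu> ^ 8 + 128 * (512 * T ^ 8 * ?S ^ 4 + (\<xi> k) ^ 8)"
    have "(\<lambda>i j. (R(k := a)) i j / sqrt n) = (\<lambda>i j. R i j / sqrt n)(k := \<lambda>j. a j / sqrt n)"
      "(\<lambda>i. \<xi> i + dot p ((R(k := a)) i) \<beta>) = (y R)(k := \<xi> k + dot p a \<beta>)" for a
      by (auto simp: fun_eq_iff y_def)
    then have eq: "opt_risk \<rho> n p \<beta> \<xi> (R(k := a)) =
        pmin \<rho> p (insert k I) ((\<lambda>i j. R i j / sqrt n)(k := \<lambda>j. a j / sqrt n)) ((y R)(k := \<xi> k + dot p a \<beta>)) / n" for a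
      unfolding opt_risk_def I(3) by simp
    obtain c where c: "\<And>M. row_law M p T V \<Lambda> \<Longrightarrow> \<bar>G M R - c\<bar> \<le> ?W / n * \<omega>"
      using one_row_expectation[OF \<psi> I(1,2) n \<eta>, of p T V \<Lambda> "\<lambda>i j. R i j / sqrt n" "y R" "\<xi> k" \<beta>]
      unfolding G_def eq \<omega>_def by blast
    have "\<bar>G M1 R - G M2 R\<bar> \<le> 2 * (?W / n * \<omega>)"
      using c[OF M(1)] c[OF M(2)] by linarith
    also have "\<dots> = 2 * (\<omega> / n) * ?W"
      by simp
    also have "\<dots> \<le> 2 * (\<omega> / n) * bd R"
    proof -
      let ?Y = "(\<Sum>i\<in>I. (y R i)\<^sup>2) / n"
      have "?S ^ 4 = (2 * (?Y / \<mu>) + 2 * dot p \<beta> \<beta>) ^ 4"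
        by (simp add: mult.commute)
      also have "\<dots> \<le> 8 * ((2 * (?Y / \<mu>)) ^ 4 + (2 * dot p \<beta> \<beta>) ^ 4)"
        by (rule power4_sum_le)
      also have "\<dots> = 128 * (?Y ^ 4 / \<mu> ^ 4 + (dot p \<beta> \<beta>) ^ 4)"
        by (simp only: power_mult_distrib power_divide) simp
      also have "\<dots> \<le> 128 * ((\<Sum>i\<in>I. (y R i) ^ 8) / n / \<mu> ^ 4 + b ^ 4)"
      proof -
        have "(\<Sum>i\<in>I. (y R i)\<^sup>2) ^ 4 \<le> real (card I) ^ 3 * (\<Sum>i\<in>I. ((y R i)\<^sup>2) ^ 4)"
          by (rule sum_power4_le) simp
        also have "\<dots> \<le> real n ^ 3 * (\<Sum>i\<in>I. ((y R i)\<^sup>2) ^ 4)"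
          using k by (intro mult_right_mono power_mono sum_nonneg) (auto simp: I_def)
        also have "\<dots> = real n ^ 3 * (\<Sum>i\<in>I. (y R i) ^ 8)"
          by (simp flip: power_mult)
        finally have "?Y ^ 4 \<le> (real n ^ 3 * (\<Sum>i\<in>I. (y R i) ^ 8)) / real n ^ 4"
          unfolding power_divide by (rule divide_right_mono) simp
        also have "\<dots> = (\<Sum>i\<in>I. (y R i) ^ 8) / n"
          using n by (simp add: power3_eq_cube power4_eq_xxxx)
        finally have "?Y ^ 4 / \<mu> ^ 4 \<le> (\<Sum>i\<in>I. (y R i) ^ 8) / n / \<mu> ^ 4"
          by (rule divide_right_mono) simp
        moreover have "(dot p \<beta> \<beta>) ^ 4 \<le> b ^ 4"
          by (rule power_mono[OF b]) simp
        ultimately show ?thesis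
          by simp
      qed
      finally have "512 * T ^ 8 * ?S ^ 4 \<le> 512 * T ^ 8 * (128 * ((\<Sum>i\<in>I. (y R i) ^ 8) / n / \<mu> ^ 4 + b ^ 4))"
        by (rule mult_left_mono) simp
      then show ?thesis
        unfolding bd_def using \<omega> by (intro mult_left_mono) simp_all
    qed
    finally show ?thesis .
  qed
  have prob: "prob_space (N i)" "prob_space M1" "prob_space M2" for i
    using N M by (auto simp: row_law_def subgaussian_law_def)
  interpret P: product_prob_space N I
    by (intro product_prob_spaceI prob)
  have ps: "product_prob_space (N(k := M'))" if "prob_space M'" for M'
    using that prob by (intro product_prob_spaceI) auto
  have meas: "(\<lambda>R. \<psi> (opt_risk \<rho> n p \<beta> \<xi> R)) \<in> borel_measurable (PiM {..<n} N')"
    if "\<And>i. row_law (N' i) p T V \<Lambda>" for N'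
  proof (intro measurable_compose[OF opt_risk_measurable measurable_test] coercive borel_measurable_const)
    fix i j assume ij: "i < n" "j < p"
    show "(\<lambda>R. R i j) \<in> borel_measurable (PiM {..<n} N')"
      using ij by (intro row_coord_measurable subgaussian_law.coord_measurable[OF row_law.axioms(1)[OF that]]) auto
  qed
  have measG: "G M' \<in> borel_measurable (PiM I N)" if M': "row_law M' p T V \<Lambda>" for M'
  proof -
    interpret M': row_law M' p T V \<Lambda> by fact
    have "(\<lambda>(R, a). \<psi> (opt_risk \<rho> n p \<beta> \<xi> (R(k := a)))) \<in> borel_measurable (PiM I N \<Otimes>\<^sub>M M')"
      unfolding case_prod_beta
    proof (intro measurable_compose[OF opt_risk_measurable measurable_test] coercive borel_measurable_const)
      fix i j assume ij: "i < n" "j < p"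
      show "(\<lambda>w. ((fst w)(k := snd w)) i j) \<in> borel_measurable (PiM I N \<Otimes>\<^sub>M M')"
      proof (cases "i = k")
        case True
        then show ?thesis
          using measurable_compose[OF measurable_snd M'.coord_measurable[OF ij(2)]] by simp
      next
        case False
        then have "i \<in> I"
          using ij by (simp add: I_def)
        then show ?thesis
          using False measurable_compose[OF measurable_fst row_coord_measurable[of i I j N, OF _ subgaussian_law.coord_measurable[OF row_law.axioms(1)[OF N] ij(2)]]]
          by simp
      qed
    qed
    then show ?thesis
      unfolding G_def by (rule M'.borel_measurable_lebesgue_integral)
  qed
  have intG: "integrable (PiM I N) (G M')" if M': "row_law M' p T V \<Lambda>" for M'
  proof (rule P.integrable_const_bound[of _ C\<psi>])
    interpret M': row_law M' p T V \<Lambda> by fact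
    have "\<bar>G M' R\<bar> \<le> C\<psi>" for R
      unfolding G_def
      by (rule M'.abs_integral_le_const) (rule bounded)
    then show "AE R in PiM I N. norm (G M' R) \<le> C\<psi>"
      by simp
  qed (rule measG[OF M'])
  have fubini: "(\<integral>R. \<psi> (opt_risk \<rho> n p \<beta> \<xi> R) \<partial>PiM {..<n} (N(k := M'))) = (\<integral>R. G M' R \<partial>PiM I N)"
    if M': "row_law M' p T V \<Lambda>" for M'
  proof -
    have pM': "prob_space M'"
      using M' by (simp add: row_law_def subgaussian_law_def)
    interpret Q: product_prob_space "N(k := M')" "insert k I"
      by (rule product_prob_spaceI) (use pM' prob in auto)
    have "integrable (PiM (insert k I) (N(k := M'))) (\<lambda>R. \<psi> (opt_risk \<rho> n p \<beta> \<xi> R))"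
      by (rule Q.integrable_const_bound[of _ C\<psi>])
         (use meas[of "N(k := M')"] N M' in \<open>auto simp: bounded I(3)\<close>)
    then have "(\<integral>R. \<psi> (opt_risk \<rho> n p \<beta> \<xi> R) \<partial>PiM (insert k I) (N(k := M'))) =
        (\<integral>R. \<integral>a. \<psi> (opt_risk \<rho> n p \<beta> \<xi> (R(k := a))) \<partial>(N(k := M')) k \<partial>PiM I (N(k := M')))"
      by (rule Q.product_integral_insert[OF I(1,2)])
    also have "PiM I (N(k := M')) = PiM I N"
      using I(2) by (intro PiM_cong) auto
    finally show ?thesis
      unfolding I(3) G_def fun_upd_same .
  qed
  have y8: "integrable (PiM I N) (\<lambda>R. (y R i) ^ 8)"
    "(\<integral>R. (y R i) ^ 8 \<partial>PiM I N) \<le> 128 * ((\<xi> i) ^ 8 + 512 * T ^ 8 * b ^ 4)" if i: "i \<in> I" for i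
  proof -
    interpret R: row_law "N i" p T V \<Lambda> by (rule N)
    note comp = PiM_component_integral[of I N, OF prob(1) i R.integrable_response_power8]
    show "integrable (PiM I N) (\<lambda>R. (y R i) ^ 8)"
      unfolding y_def by (rule comp(1))
    have "(\<integral>R. (y R i) ^ 8 \<partial>PiM I N) \<le> 128 * ((\<xi> i) ^ 8 + 512 * T ^ 8 * (dot p \<beta> \<beta>) ^ 4)"
      unfolding y_def comp(2) by (rule R.response_power8_le)
    also have "\<dots> \<le> 128 * ((\<xi> i) ^ 8 + 512 * T ^ 8 * b ^ 4)"
      by (intro mult_left_mono add_left_mono power_mono b) auto
    finally show "(\<integral>R. (y R i) ^ 8 \<partial>PiM I N) \<le> 128 * ((\<xi> i) ^ 8 + 512 * T ^ 8 * b ^ 4)" .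
  qed
  have intbd: "integrable (PiM I N) bd"
    unfolding bd_def
    by (intro Bochner_Integration.integrable_add integrable_mult_right Bochner_Integration.integrable_sum integrable_divide
          P.integrable_const y8)
  define X where "X = (\<Sum>i<n. (\<xi> i) ^ 8) / n"
  have X0: "0 \<le> X"
    unfolding X_def by (intro divide_nonneg_nonneg sum_nonneg) auto
  have "(\<integral>R. bd R \<partial>PiM I N) = 1 + 512 * T ^ 8 / \<mu> ^ 8
      + 128 * (512 * T ^ 8 * (128 * ((\<Sum>i\<in>I. (\<integral>R. (y R i) ^ 8 \<partial>PiM I N)) / n / \<mu> ^ 4 + b ^ 4)) + (\<xi> k) ^ 8)"
    unfolding bd_def using y8(1) by (simp add: P.P.prob_space)
  also have "\<dots> \<le> 1 + 512 * T ^ 8 / \<mu> ^ 8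
      + 128 * (512 * T ^ 8 * (128 * ((128 * (X + 512 * T ^ 8 * b ^ 4)) / \<mu> ^ 4 + b ^ 4)) + (\<xi> k) ^ 8)"
  proof (intro add_left_mono mult_left_mono add_right_mono divide_right_mono)
    have "(\<Sum>i\<in>I. (\<integral>R. (y R i) ^ 8 \<partial>PiM I N)) \<le> (\<Sum>i\<in>I. 128 * ((\<xi> i) ^ 8 + 512 * T ^ 8 * b ^ 4))"
      by (intro sum_mono y8(2))
    also have "\<dots> \<le> (\<Sum>i<n. 128 * ((\<xi> i) ^ 8 + 512 * T ^ 8 * b ^ 4))"
      using b0 by (intro sum_mono2) (auto simp: I_def)
    also have "\<dots> = 128 * (X + 512 * T ^ 8 * b ^ 4) * n"
    proof -
      have "(\<Sum>i<n. (\<xi> i) ^ 8) = X * n"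
        using n by (simp add: X_def)
      then show ?thesis
        unfolding sum_distrib_left[symmetric] sum.distrib by (simp add: algebra_simps)
    qed
    finally show "(\<Sum>i\<in>I. (\<integral>R. (y R i) ^ 8 \<partial>PiM I N)) / n \<le> 128 * (X + 512 * T ^ 8 * b ^ 4)"
      using n by (simp add: field_simps)
  qed auto
  also have "\<dots> \<le> moment_const \<mu> T b * (1 + X + (\<xi> k) ^ 8)"
  proof -
    define u v c1 c2 where "u = 512 * T ^ 8 / \<mu> ^ 8" and "v = (\<xi> k) ^ 8"
      and "c1 = 128 * (512 * T ^ 8 * (128 * (128 / \<mu> ^ 4)))"
      and "c2 = 128 * (512 * T ^ 8 * (128 * (128 / \<mu> ^ 4 * (512 * T ^ 8 * b ^ 4) + b ^ 4)))"
    have nn: "0 \<le> u" "0 \<le> v" "0 \<le> c1" "0 \<le> c2"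
      by (simp_all add: u_def v_def c1_def c2_def)
    have "1 + 512 * T ^ 8 / \<mu> ^ 8
      + 128 * (512 * T ^ 8 * (128 * ((128 * (X + 512 * T ^ 8 * b ^ 4)) / \<mu> ^ 4 + b ^ 4)) + (\<xi> k) ^ 8)
      = 1 + u + c1 * X + c2 + 128 * v"
      by (simp add: u_def v_def c1_def c2_def algebra_simps add_divide_distrib)
    also have "\<dots> \<le> 1 + u + c1 * X + c2 + 128 * v + (128 + (129 + u + c2) * X + c1 + (1 + u + c1 + c2) * v)"
      using nn X0 by simp
    also have "\<dots> = (129 + u + c1 + c2) * (1 + X + v)"
      by (simp add: algebra_simps)
    also have "129 + u + c1 + c2 = moment_const \<mu> T b"
      by (simp add: moment_const_def u_def c1_def c2_def algebra_simps)
    finally show ?thesis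
      by (simp only: v_def)
  qed
  finally have Ebd: "(\<integral>R. bd R \<partial>PiM I N) \<le> moment_const \<mu> T b * (1 + X + (\<xi> k) ^ 8)" .
  have "\<bar>(\<integral>R. G M1 R \<partial>PiM I N) - (\<integral>R. G M2 R \<partial>PiM I N)\<bar> = \<bar>\<integral>R. G M1 R - G M2 R \<partial>PiM I N\<bar>"
    using intG M by simp
  also have "\<dots> \<le> (\<integral>R. \<bar>G M1 R - G M2 R\<bar> \<partial>PiM I N)"
    by (rule integral_abs_bound)
  also have "\<dots> \<le> (\<integral>R. 2 * (\<omega> / n) * bd R \<partial>PiM I N)"
    using intG[OF M(1)] intG[OF M(2)] intbd by (intro integral_mono diff) auto
  also have "\<dots> = 2 * (\<omega> / n) * (\<integral>R. bd R \<partial>PiM I N)"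
    by simp
  also have "\<dots> \<le> 2 * (\<omega> / n) * (moment_const \<mu> T b * (1 + X + (\<xi> k) ^ 8))"
    using \<omega> by (intro mult_left_mono Ebd) auto
  also have "\<dots> = 2 * \<omega> * moment_const \<mu> T b * (1 + X + (\<xi> k) ^ 8) / n"
    by simp
  finally show ?thesis
    unfolding fubini[OF M(1)] fubini[OF M(2)] by (simp add: X_def)
qed

text \<open>Lindeberg telescoping along the hybrid products whose first m rows follow
  \<open>M1\<close> and whose remaining rows follow \<open>M2\<close>. The noise terms of the
  individual steps add up to another copy of the average X.\<close>

lemma (in smooth_penalty) swap_all_rows:
  fixes M1 M2 :: "(nat \<Rightarrow> real) measure" and n p :: nat and \<beta> \<xi> \<Lambda> :: "nat \<Rightarrow> real"
  assumes \<psi>: "test_function \<psi> C\<psi> L\<psi>" and n: "0 < n" and \<eta>: "0 < \<eta>" and V: "0 \<le> V" and b: "dot p \<beta> \<beta> \<le> b"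
    and M: "row_law M1 p T V \<Lambda>" "row_law M2 p T V \<Lambda>"
  defines "\<omega> \<equiv> C\<psi> * (p * (L + L\<^sup>2 / (2 * \<mu>)) / (n * sqrt n) + \<eta> + V / (\<eta> * \<mu>\<^sup>2 * (real n)\<^sup>2)) + L\<psi> / n"
  shows "\<bar>(\<integral>R. \<psi> (opt_risk \<rho> n p \<beta> \<xi> R) \<partial>PiM {..<n} (\<lambda>_. M1)) - (\<integral>R. \<psi> (opt_risk \<rho> n p \<beta> \<xi> R) \<partial>PiM {..<n} (\<lambda>_. M2))\<bar>
    \<le> 2 * \<omega> * moment_const \<mu> T b * (1 + 2 * ((\<Sum>i<n. (\<xi> i) ^ 8) / n))"
proof -
  define X where "X = (\<Sum>i<n. (\<xi> i) ^ 8) / n"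
  define \<Phi> where "\<Phi> = (\<lambda>m. \<integral>R. \<psi> (opt_risk \<rho> n p \<beta> \<xi> R) \<partial>PiM {..<n} (\<lambda>i. if i < m then M1 else M2))"
  let ?c = "2 * \<omega> * moment_const \<mu> T b"
  have step: "\<bar>\<Phi> (Suc k) - \<Phi> k\<bar> \<le> ?c * (1 + X + (\<xi> k) ^ 8) / n" if "k < n" for k
  proof -
    let ?N = "\<lambda>i. if i < k then M1 else M2"
    have "(\<lambda>i. if i < Suc k then M1 else M2) = ?N(k := M1)" "?N = ?N(k := M2)"
      by (auto simp: fun_eq_iff)
    moreover have "row_law (?N i) p T V \<Lambda>" for i
      using M by simp
    ultimately show ?thesis
      using swap_one_row[where N = ?N, OF \<psi> that \<eta> V b _ M(1) M(2), of \<xi>] unfolding \<Phi>_def \<omega>_def X_def by simp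
  qed
  have "\<bar>\<Phi> m - \<Phi> 0\<bar> \<le> (\<Sum>k<m. ?c * (1 + X + (\<xi> k) ^ 8) / n)" if "m \<le> n" for m
    using that
  proof (induction m)
    case (Suc m)
    then show ?case
      using step[of m] by simp
  qed simp
  from this[of n] have "\<bar>\<Phi> n - \<Phi> 0\<bar> \<le> (\<Sum>k<n. ?c * (1 + X + (\<xi> k) ^ 8) / n)"
    by simp
  also have "\<dots> = ?c * (\<Sum>k<n. 1 + X + (\<xi> k) ^ 8) / n"
    by (simp add: sum_distrib_left sum_divide_distrib)
  also have "(\<Sum>k<n. 1 + X + (\<xi> k) ^ 8) = n * (1 + 2 * X)"
    using n by (simp add: sum.distrib X_def algebra_simps)
  also have "?c * (n * (1 + 2 * X)) / n = ?c * (1 + 2 * X)"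
    using n by simp
  also have "\<Phi> n = (\<integral>R. \<psi> (opt_risk \<rho> n p \<beta> \<xi> R) \<partial>PiM {..<n} (\<lambda>_. M1))"
    unfolding \<Phi>_def by (intro arg_cong2[where f = "integral\<^sup>L"] PiM_cong) auto
  finally show ?thesis
    by (simp add: \<Phi>_def X_def)
qed

section \<open>Restricted lower bounds for the design\<close>

text \<open>The subtracted power is slack for the induction: each step adds 2 x^(m+1), and x \<le>
  1/2 makes the slack shrink by at least that much.\<close>

lemma sum_geometric_int_le:
  fixes x :: real
  assumes "0 \<le> x" "x \<le> 1/2"
  shows "(\<Sum>i\<in>{- int m..int m}. x ^ nat \<bar>i\<bar>) \<le> 1 + 4 * x - 4 * x ^ Suc m"
proof (induction m)
  case (Suc m)
  have "{- int (Suc m)..int (Suc m)} = insert (int (Suc m)) (insert (- int (Suc m)) {- int m..int m})"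
    by auto
  then have "(\<Sum>i\<in>{- int (Suc m)..int (Suc m)}. x ^ nat \<bar>i\<bar>) = 2 * x ^ Suc m + (\<Sum>i\<in>{- int m..int m}. x ^ nat \<bar>i\<bar>)"
    by (simp add: nat_add_distrib)
  moreover have "x ^ Suc (Suc m) \<le> 1/2 * x ^ Suc m"
    using assms mult_right_mono[of x "1/2" "x ^ Suc m"] by simp
  ultimately show ?case
    using Suc by linarith
qed simp

definition int_grid :: "nat \<Rightarrow> real \<Rightarrow> (nat \<Rightarrow> int) set" where
  "int_grid p r = {k \<in> {..<p} \<rightarrow>\<^sub>E UNIV. (\<Sum>j<p. \<bar>real_of_int (k j)\<bar>) \<le> r}"

text \<open>Each grid point is weighted by \<open>exp (s * (r - \<Sum>j<p. \<bar>k j\<bar>)) \<ge> 1\<close>, which factorizes over the coordinates.\<close>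

lemma int_grid:
  assumes "1 \<le> s" "0 \<le> r"
  shows finite_int_grid: "finite (int_grid p r)"
    and card_int_grid: "card (int_grid p r) \<le> exp (s * r + 4 * exp (- s) * p)"
proof -
  define m where "m = nat \<lfloor>r\<rfloor>"
  define P where "P = ({..<p} \<rightarrow>\<^sub>E {- int m..int m})"
  have fin: "finite P"
    unfolding P_def by (intro finite_PiE) auto
  have sub: "int_grid p r \<subseteq> P"
  proof
    fix k assume k: "k \<in> int_grid p r"
    have "\<bar>k j\<bar> \<le> int m" if "j < p" for j
    proof -
      have "\<bar>real_of_int (k j)\<bar> \<le> (\<Sum>j<p. \<bar>real_of_int (k j)\<bar>)"
        using that by (intro member_le_sum) auto
      then have "real_of_int \<bar>k j\<bar> \<le> r"
        using k by (simp add: int_grid_def)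
      then show ?thesis
        using assms by (simp add: m_def le_floor_iff)
    qed
    then show "k \<in> P"
      using k by (fastforce simp: P_def int_grid_def PiE_def abs_le_iff)
  qed
  show "finite (int_grid p r)"
    using fin sub finite_subset by blast
  have x: "exp (- s) \<le> 1/2"
  proof -
    have "2 \<le> exp s"
      using exp_ge_add_one_self[of s] assms by linarith
    then show ?thesis
      by (simp add: exp_minus field_simps)
  qed
  have e: "exp (- s * \<bar>real_of_int i\<bar>) = exp (- s) ^ nat \<bar>i\<bar>" for i
    by (simp flip: exp_of_nat_mult add: mult.commute)
  have "real (card (int_grid p r)) = (\<Sum>k\<in>int_grid p r. 1)"
    by simp
  also have "\<dots> \<le> (\<Sum>k\<in>int_grid p r. exp (s * r) * (\<Prod>j<p. exp (- s * \<bar>real_of_int (k j)\<bar>)))"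
  proof (rule sum_mono)
    fix k assume "k \<in> int_grid p r"
    then have "0 \<le> s * (r - (\<Sum>j<p. \<bar>real_of_int (k j)\<bar>))"
      using assms by (simp add: int_grid_def)
    then have "1 \<le> exp (s * (r - (\<Sum>j<p. \<bar>real_of_int (k j)\<bar>)))"
      by simp
    also have "\<dots> = exp (s * r) * (\<Prod>j<p. exp (- s * \<bar>real_of_int (k j)\<bar>))"
      by (simp add: exp_sum[symmetric] exp_add[symmetric] sum_distrib_left sum_negf right_diff_distrib)
    finally show "1 \<le> exp (s * r) * (\<Prod>j<p. exp (- s * \<bar>real_of_int (k j)\<bar>))" .
  qed
  also have "\<dots> \<le> (\<Sum>k\<in>P. exp (s * r) * (\<Prod>j<p. exp (- s * \<bar>real_of_int (k j)\<bar>)))"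
    using fin sub by (intro sum_mono2) (auto intro!: mult_nonneg_nonneg prod_nonneg)
  also have "\<dots> = exp (s * r) * (\<Prod>j<p. \<Sum>i\<in>{- int m..int m}. exp (- s * \<bar>real_of_int i\<bar>))"
    unfolding P_def sum_distrib_left[symmetric] by (subst prod_sum_PiE) auto
  also have "\<dots> \<le> exp (s * r) * (\<Prod>j<p. exp (4 * exp (- s)))"
  proof (intro mult_left_mono prod_mono conjI sum_nonneg)
    have "(\<Sum>i\<in>{- int m..int m}. exp (- s * \<bar>real_of_int i\<bar>)) \<le> 1 + 4 * exp (- s) - 4 * exp (- s) ^ Suc m"
      unfolding e by (rule sum_geometric_int_le) (use x in auto)
    also have "\<dots> \<le> 1 + 4 * exp (- s)"
      by simp
    also have "\<dots> \<le> exp (4 * exp (- s))"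
      by (rule exp_ge_add_one_self)
    finally show "(\<Sum>i\<in>{- int m..int m}. exp (- s * \<bar>real_of_int i\<bar>)) \<le> exp (4 * exp (- s))" .
  qed auto
  also have "\<dots> = exp (s * r + 4 * exp (- s) * p)"
    by (simp add: exp_add mult.commute flip: exp_of_nat_mult)
  finally show "card (int_grid p r) \<le> exp (s * r + 4 * exp (- s) * p)" .
qed

text \<open>Because (1 - y + y^2) (1 + y) = 1 + y^3 \<ge> 1 and 1 + y \<le> exp y.\<close>

lemma exp_neg_le: "0 \<le> y \<Longrightarrow> exp (- y) \<le> 1 - y + (y::real)\<^sup>2"
proof -
  assume y: "0 \<le> y"
  have "1 \<le> (1 - y + y\<^sup>2) * (1 + y)"
    using y by (simp add: algebra_simps power2_eq_square)
  also have "\<dots> \<le> (1 - y + y\<^sup>2) * exp y"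
  proof (rule mult_left_mono)
    have "0 \<le> (y - 1)\<^sup>2"
      by simp
    then show "0 \<le> 1 - y + y\<^sup>2"
      using y by (simp add: power2_eq_square algebra_simps)
  qed (use exp_ge_add_one_self[of y] in simp)
  finally show ?thesis
    by (simp add: exp_minus field_simps)
qed

section \<open>Exponential tail bounds for independent rows\<close>

context subgaussian_law
begin

text \<open>The Chernoff bound: the exponential of the sum factorizes over the rows. The upper tail
  uses a positive and the lower tail a negative multiple of the squared linear form as
  \<open>f\<close>.\<close>

lemma product_markov:
  fixes f :: "(nat \<Rightarrow> real) \<Rightarrow> real" and n :: nat and c s :: real
  assumes f [measurable]: "f \<in> borel_measurable M" and le: "(\<integral>\<^sup>+a. ennreal (exp (f a)) \<partial>M) \<le> ennreal (exp c)"
  shows "{R \<in> space (PiM {..<n} (\<lambda>_. M)). s \<le> (\<Sum>i<n. f (R i))} \<in> sets (PiM {..<n} (\<lambda>_. M))" (is "?A \<in> _")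
    and "measure (PiM {..<n} (\<lambda>_. M)) {R \<in> space (PiM {..<n} (\<lambda>_. M)). s \<le> (\<Sum>i<n. f (R i))} \<le> exp (n * c - s)"
proof -
  interpret P: product_prob_space "\<lambda>_. M" "{..<n}"
    by (intro product_prob_spaceI prob_space_axioms)
  have [measurable]: "(\<lambda>R. f (R i)) \<in> borel_measurable (PiM {..<n} (\<lambda>_. M))" if "i \<in> {..<n}" for i
    using that by (rule measurable_compose[OF measurable_component_singleton[of i "{..<n}" "\<lambda>_. M"] f])
  show A [measurable]: "?A \<in> sets (PiM {..<n} (\<lambda>_. M))"
    by measurable
  have eq: "ennreal (exp (- s)) * (\<Prod>i<n. ennreal (exp (f (R i)))) = ennreal (exp (- s + (\<Sum>i<n. f (R i))))" for R
  proof -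
    have "(\<Prod>i<n. ennreal (exp (f (R i)))) = ennreal (exp (\<Sum>i<n. f (R i)))"
      by (simp add: prod_ennreal exp_sum)
    then show ?thesis
      by (simp only: exp_add) (simp only: ennreal_mult exp_ge_zero)
  qed
  have "emeasure (PiM {..<n} (\<lambda>_. M)) ?A = (\<integral>\<^sup>+R. indicator ?A R \<partial>PiM {..<n} (\<lambda>_. M))"
    using A by simp
  also have "\<dots> \<le> (\<integral>\<^sup>+R. ennreal (exp (- s)) * (\<Prod>i<n. ennreal (exp (f (R i)))) \<partial>PiM {..<n} (\<lambda>_. M))"
    unfolding eq by (intro nn_integral_mono) (auto simp: indicator_def)
  also have "\<dots> = ennreal (exp (- s)) * (\<integral>\<^sup>+R. (\<Prod>i<n. ennreal (exp (f (R i)))) \<partial>PiM {..<n} (\<lambda>_. M))"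
    by (rule nn_integral_cmult) measurable
  also have "(\<integral>\<^sup>+R. (\<Prod>i<n. ennreal (exp (f (R i)))) \<partial>PiM {..<n} (\<lambda>_. M)) = (\<Prod>i<n. (\<integral>\<^sup>+a. ennreal (exp (f a)) \<partial>M))"
    by (rule P.product_nn_integral_prod) auto
  also have "ennreal (exp (- s)) * \<dots> \<le> ennreal (exp (- s)) * (\<Prod>i<n. ennreal (exp c))"
    by (intro mult_left_mono prod_mono_ennreal le) auto
  also have "\<dots> = ennreal (exp (n * c - s))"
    by (simp add: exp_diff exp_minus divide_inverse mult.commute ennreal_power exp_of_nat2_mult flip: ennreal_mult)
  finally show "measure (PiM {..<n} (\<lambda>_. M)) ?A \<le> exp (n * c - s)"
    by (simp add: P.emeasure_eq_measure)
qed

text \<open>The exponential moment is at most 2, hence at most exp 1, which gives the exponent (1 -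
  t) n.\<close>

lemma upper_tail:
  fixes n :: nat and t :: real
  assumes "dot p u u \<le> 1"
  shows "{R \<in> space (PiM {..<n} (\<lambda>_. M)). t * n * T\<^sup>2 \<le> (\<Sum>i<n. (dot p (R i) u)\<^sup>2)} \<in> sets (PiM {..<n} (\<lambda>_. M))"
    and "measure (PiM {..<n} (\<lambda>_. M)) {R \<in> space (PiM {..<n} (\<lambda>_. M)). t * n * T\<^sup>2 \<le> (\<Sum>i<n. (dot p (R i) u)\<^sup>2)} \<le> exp ((1 - t) * n)"
proof -
  have eq: "t * n * T\<^sup>2 \<le> (\<Sum>i<n. (dot p (R i) u)\<^sup>2) \<longleftrightarrow> t * n \<le> (\<Sum>i<n. (dot p (R i) u / T)\<^sup>2)" for R
    using T_pos by (simp add: power_divide pos_le_divide_eq flip: sum_divide_distrib)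
  have "(2::ennreal) \<le> ennreal (exp 1)"
    using ennreal_leI[OF exp_ge_add_one_self[of 1]] by simp
  then have le: "(\<integral>\<^sup>+a. ennreal (exp ((dot p a u / T)\<^sup>2)) \<partial>M) \<le> ennreal (exp 1)"
    by (rule order_trans[OF subgaussian[OF assms]])
  have m: "(\<lambda>a. (dot p a u / T)\<^sup>2) \<in> borel_measurable M"
    by measurable
  show "{R \<in> space (PiM {..<n} (\<lambda>_. M)). t * n * T\<^sup>2 \<le> (\<Sum>i<n. (dot p (R i) u)\<^sup>2)} \<in> sets (PiM {..<n} (\<lambda>_. M))"
    unfolding eq by (rule product_markov(1)[OF m le])
  show "measure (PiM {..<n} (\<lambda>_. M)) {R \<in> space (PiM {..<n} (\<lambda>_. M)). t * n * T\<^sup>2 \<le> (\<Sum>i<n. (dot p (R i) u)\<^sup>2)} \<le> exp ((1 - t) * n)"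
    unfolding eq using product_markov(2)[OF m le, of n "t * n"] by (simp add: algebra_simps)
qed

text \<open>A nonnegative variable always has negative exponential moments. The quadratic bound on
  exp (-y) controls them by the second moment, which is at least c, and by the fourth, which is at
  most \<kappa>4.\<close>

lemma lower_tail:
  fixes n :: nat
  assumes c: "0 < c" "\<And>j. j < p \<Longrightarrow> c \<le> \<Lambda> j" and u: "0 < dot p u u"
  defines "\<kappa>4 \<equiv> 1 + 512 * T ^ 8"
  shows "{R \<in> space (PiM {..<n} (\<lambda>_. M)). (\<Sum>i<n. (dot p (R i) u)\<^sup>2) \<le> c * n * dot p u u / 4} \<in> sets (PiM {..<n} (\<lambda>_. M))"
    and "measure (PiM {..<n} (\<lambda>_. M)) {R \<in> space (PiM {..<n} (\<lambda>_. M)). (\<Sum>i<n. (dot p (R i) u)\<^sup>2) \<le> c * n * dot p u u / 4}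
      \<le> exp (- c\<^sup>2 / (8 * \<kappa>4) * n)"
proof -
  define s where "s = sqrt (dot p u u)"
  have s: "0 < s" "s\<^sup>2 = dot p u u"
    using u by (auto simp: s_def)
  define v where "v = (\<lambda>j. (1/s) * u j)"
  have dv: "dot p a v = dot p a u / s" for a
    unfolding v_def dot_scale_right by simp
  have v1: "dot p v v = 1"
    unfolding dv unfolding v_def dot_scale_left using s u by (simp add: power2_eq_square flip: s(2))
  \<comment> \<open>This minimizes -\<theta> c + \<theta>^2 \<kappa>4, with value -c^2 / (4
    \<kappa>4). The threshold c / 4 gives back half of that exponent.\<close>
  define \<theta> where "\<theta> = c / (2 * \<kappa>4)"
  have \<kappa>4: "1 \<le> \<kappa>4"
    by (simp add: \<kappa>4_def)
  then have \<theta>: "0 < \<theta>"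
    using c by (simp add: \<theta>_def)
  have eq: "(\<Sum>i<n. (dot p (R i) u)\<^sup>2) \<le> c * n * dot p u u / 4 \<longleftrightarrow>
      - \<theta> * (c * n / 4) \<le> (\<Sum>i<n. - \<theta> * (dot p (R i) v)\<^sup>2)" for R
  proof -
    have "(\<Sum>i<n. (dot p (R i) u)\<^sup>2) = (\<Sum>i<n. (dot p (R i) v)\<^sup>2) * dot p u u"
      using s u by (simp add: dv power_divide sum_distrib_right)
    then have "(\<Sum>i<n. (dot p (R i) u)\<^sup>2) \<le> c * n * dot p u u / 4 \<longleftrightarrow> (\<Sum>i<n. (dot p (R i) v)\<^sup>2) * dot p u u \<le> (c * n / 4) * dot p u u"
      by simp
    also have "\<dots> \<longleftrightarrow> (\<Sum>i<n. (dot p (R i) v)\<^sup>2) \<le> c * n / 4"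
      using u by (rule mult_le_cancel_right_pos)
    also have "\<dots> \<longleftrightarrow> - \<theta> * (c * n / 4) \<le> - \<theta> * (\<Sum>i<n. (dot p (R i) v)\<^sup>2)"
      using \<theta> by simp
    finally show ?thesis
      by (simp only: sum_distrib_left)
  qed
  have i2: "integrable M (\<lambda>a. (dot p a v)\<^sup>2)" and e2: "(\<integral>a. (dot p a v)\<^sup>2 \<partial>M) = (\<Sum>j<p. (v j)\<^sup>2 * \<Lambda> j)"
    using integrable_residual_square[of v 0] residual_square_eq[of v 0] by simp_all
  have c2: "c \<le> (\<integral>a. (dot p a v)\<^sup>2 \<partial>M)"
  proof -
    have "c = (\<Sum>j<p. (v j)\<^sup>2 * c)"
      using v1 by (simp add: dot_def power2_eq_square flip: sum_distrib_right)
    also have "\<dots> \<le> (\<Sum>j<p. (v j)\<^sup>2 * \<Lambda> j)"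
      using c by (intro sum_mono mult_left_mono) auto
    finally show ?thesis
      by (simp add: e2)
  qed
  have le4: "(dot p a v) ^ 4 \<le> 1 + (dot p a v) ^ 8" for a
    using power_le_power8[of 4 "dot p a v"] by simp
  have i8: "integrable M (\<lambda>a. 1 + (dot p a v) ^ 8)"
    by (intro Bochner_Integration.integrable_add integrable_const integrable_dot_power8)
  have i4: "integrable M (\<lambda>a. (dot p a v) ^ 4)"
    by (rule Bochner_Integration.integrable_bound[OF i8])
       (use le4 in \<open>auto intro!: AE_I2 intro: order_trans[OF _ abs_ge_self]\<close>)
  have "(\<integral>a. (dot p a v) ^ 4 \<partial>M) \<le> (\<integral>a. 1 + (dot p a v) ^ 8 \<partial>M)"
    by (intro integral_mono i4 i8 le4)
  also have "\<dots> \<le> \<kappa>4"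
    using dot_power8_le[of v] v1 by (simp add: \<kappa>4_def integrable_dot_power8 prob_space)
  finally have e4: "(\<integral>a. (dot p a v) ^ 4 \<partial>M) \<le> \<kappa>4" .
  have m: "(\<lambda>a. - \<theta> * (dot p a v)\<^sup>2) \<in> borel_measurable M"
    by measurable
  have ie: "integrable M (\<lambda>a. exp (- \<theta> * (dot p a v)\<^sup>2))"
    by (rule integrable_const_bound[of _ 1]) (use \<theta> in auto)
  have "(\<integral>a. exp (- \<theta> * (dot p a v)\<^sup>2) \<partial>M) \<le> (\<integral>a. 1 - \<theta> * (dot p a v)\<^sup>2 + \<theta>\<^sup>2 * (dot p a v) ^ 4 \<partial>M)"
  proof (rule integral_mono[OF ie])
    show "integrable M (\<lambda>a. 1 - \<theta> * (dot p a v)\<^sup>2 + \<theta>\<^sup>2 * (dot p a v) ^ 4)"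
      by (intro Bochner_Integration.integrable_add Bochner_Integration.integrable_diff integrable_mult_right i2 i4 integrable_const)
    fix a
    show "exp (- \<theta> * (dot p a v)\<^sup>2) \<le> 1 - \<theta> * (dot p a v)\<^sup>2 + \<theta>\<^sup>2 * (dot p a v) ^ 4"
      using exp_neg_le[of "\<theta> * (dot p a v)\<^sup>2"] \<theta> by (simp add: power_mult_distrib flip: power_mult)
  qed
  also have "\<dots> = 1 - \<theta> * (\<integral>a. (dot p a v)\<^sup>2 \<partial>M) + \<theta>\<^sup>2 * (\<integral>a. (dot p a v) ^ 4 \<partial>M)"
    using i2 i4 by (simp add: prob_space)
  also have "\<dots> \<le> 1 - \<theta> * c + \<theta>\<^sup>2 * \<kappa>4"
    using \<theta> c2 e4 by (intro add_mono diff_mono mult_left_mono) auto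
  also have "\<dots> = 1 + (- c\<^sup>2 / (4 * \<kappa>4))"
    using \<kappa>4 by (simp add: \<theta>_def field_simps power2_eq_square)
  also have "\<dots> \<le> exp (- c\<^sup>2 / (4 * \<kappa>4))"
    by (rule exp_ge_add_one_self)
  finally have "(\<integral>\<^sup>+a. ennreal (exp (- \<theta> * (dot p a v)\<^sup>2)) \<partial>M) \<le> ennreal (exp (- c\<^sup>2 / (4 * \<kappa>4)))"
    using ie by (subst nn_integral_eq_integral) auto
  note pm = product_markov[OF m this, of n "- \<theta> * (c * n / 4)"]
  have "n * (- c\<^sup>2 / (4 * \<kappa>4)) - - \<theta> * (c * n / 4) = - c\<^sup>2 / (8 * \<kappa>4) * n"
    using \<kappa>4 by (simp add: \<theta>_def field_simps power2_eq_square)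
  then show "{R \<in> space (PiM {..<n} (\<lambda>_. M)). (\<Sum>i<n. (dot p (R i) u)\<^sup>2) \<le> c * n * dot p u u / 4} \<in> sets (PiM {..<n} (\<lambda>_. M))"
    "measure (PiM {..<n} (\<lambda>_. M)) {R \<in> space (PiM {..<n} (\<lambda>_. M)). (\<Sum>i<n. (dot p (R i) u)\<^sup>2) \<le> c * n * dot p u u / 4}
      \<le> exp (- c\<^sup>2 / (8 * \<kappa>4) * n)"
    unfolding eq using pm by simp_all
qed

end

section \<open>From integer grids to all vectors\<close>

definition rnorm :: "nat \<Rightarrow> nat \<Rightarrow> (nat \<Rightarrow> nat \<Rightarrow> real) \<Rightarrow> (nat \<Rightarrow> real) \<Rightarrow> real" where
  "rnorm n p R v = L2_set (\<lambda>i. dot p (R i) v) {..<n}"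

lemma rnorm_nonneg: "0 \<le> rnorm n p R v"
  by (simp add: rnorm_def)

lemma rnorm_sq: "(rnorm n p R v)\<^sup>2 = (\<Sum>i<n. (dot p (R i) v)\<^sup>2)"
  by (simp add: rnorm_def L2_set_def sum_nonneg)

lemma rnorm_add: "rnorm n p R (\<lambda>j. v j + w j) \<le> rnorm n p R v + rnorm n p R w"
  unfolding rnorm_def dot_add_right by (rule L2_set_triangle_ineq)

lemma rnorm_scale: "rnorm n p R (\<lambda>j. c * v j) = \<bar>c\<bar> * rnorm n p R v"
  by (simp add: rnorm_def dot_scale_right L2_set_def power_mult_distrib real_sqrt_mult flip: sum_distrib_left)

lemma rnorm_le: "rnorm n p R v \<le> sqrt (\<Sum>i<n. dot p (R i) (R i)) * sqrt (dot p v v)"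
proof -
  have "(\<Sum>i<n. (dot p (R i) v)\<^sup>2) \<le> (\<Sum>i<n. dot p (R i) (R i) * dot p v v)"
    by (intro sum_mono dot_cs)
  then show ?thesis
    by (simp add: rnorm_def L2_set_def sum_distrib_right flip: real_sqrt_mult)
qed

lemma sqrt_dot_add: "sqrt (dot p (\<lambda>j. v j + w j) (\<lambda>j. v j + w j)) \<le> sqrt (dot p v v) + sqrt (dot p w w)"
  using L2_set_triangle_ineq[of v w "{..<p}"] by (simp add: L2_set_def dot_def power2_eq_square)

text \<open>Rounding toward zero, not to the nearest integer: it never increases absolute values, so
  grid points inherit the norm bounds, and it sends everything in (-1, 1) to 0, so |k| \<le>
  t^2.\<close>

definition toward_zero :: "real \<Rightarrow> int" where
  "toward_zero t = (if 0 \<le> t then \<lfloor>t\<rfloor> else \<lceil>t\<rceil>)"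

lemma toward_zero:
  shows abs_toward_zero_le: "\<bar>real_of_int (toward_zero t)\<bar> \<le> \<bar>t\<bar>"
    and toward_zero_error: "\<bar>t - real_of_int (toward_zero t)\<bar> \<le> 1" "\<bar>t - real_of_int (toward_zero t)\<bar> \<le> \<bar>t\<bar>"
    and abs_toward_zero_le_sq: "\<bar>real_of_int (toward_zero t)\<bar> \<le> t\<^sup>2"
proof -
  let ?k = "real_of_int (toward_zero t)"
  have k: "0 \<le> t \<and> 0 \<le> ?k \<and> ?k \<le> t \<and> t < ?k + 1 \<or> t < 0 \<and> ?k \<le> 0 \<and> t \<le> ?k \<and> ?k < t + 1"
  proof (cases "0 \<le> t")
    case True
    then show ?thesis
      by (simp add: toward_zero_def)
  next
    case False
    then have "?k = real_of_int \<lceil>t\<rceil>" "real_of_int \<lceil>t\<rceil> \<le> 0"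
      by (simp_all add: toward_zero_def)
    then show ?thesis
      using False ceiling_correct[of t] by linarith
  qed
  then show 1: "\<bar>?k\<bar> \<le> \<bar>t\<bar>"
    by linarith
  show "\<bar>t - ?k\<bar> \<le> 1" "\<bar>t - ?k\<bar> \<le> \<bar>t\<bar>"
    using k by linarith+
  have "\<bar>k\<bar> \<le> k\<^sup>2" for k :: int
    using mult_right_mono[of 1 "\<bar>k\<bar>" "\<bar>k\<bar>"] by (cases "k = 0") (auto simp: power2_eq_square simp flip: abs_mult)
  then have "\<bar>real_of_int (toward_zero t)\<bar> \<le> \<bar>real_of_int (toward_zero t)\<bar>\<^sup>2"
    by (metis of_int_abs of_int_le_iff of_int_power power2_abs)
  also have "\<dots> \<le> \<bar>t\<bar>\<^sup>2"
    by (intro power_mono 1) simp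
  finally show "\<bar>real_of_int (toward_zero t)\<bar> \<le> t\<^sup>2"
    by simp
qed

definition grid_round :: "nat \<Rightarrow> (nat \<Rightarrow> real) \<Rightarrow> nat \<Rightarrow> int" where
  "grid_round p v = (\<lambda>j\<in>{..<p}. toward_zero (v j))"

lemma grid_round_dot_le: "dot p (\<lambda>j. real_of_int (grid_round p v j)) (\<lambda>j. real_of_int (grid_round p v j)) \<le> dot p v v"
  unfolding dot_def grid_round_def
  by (intro sum_mono) (simp, metis abs_le_square_iff abs_toward_zero_le power2_eq_square)

text \<open>
  Rounding a vector of the ball of radius \<open>2 * sqrt p\<close> leaves an error in the ball of half that radius,
  so the supremum over the ball is at most the maximum over the grid plus half of itself.
\<close>

lemma rnorm_le_of_grid:
  assumes grid: "\<And>k. k \<in> int_grid p (4 * p) \<Longrightarrow> dot p (\<lambda>j. real_of_int (k j)) (\<lambda>j. real_of_int (k j)) \<le> 4 * p \<Longrightarrow>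
      rnorm n p R (\<lambda>j. real_of_int (k j)) \<le> Q"
    and v: "dot p v v \<le> 4 * p"
  shows "rnorm n p R v \<le> 2 * Q"
proof -
  define A where "A = rnorm n p R ` {v. dot p v v \<le> 4 * p}"
  \<comment> \<open>The crude Frobenius bound serves only to make the supremum finite, so that Sup A
    \<le> Q + Sup A / 2 can be solved for Sup A.\<close>
  have bdd: "bdd_above A"
    unfolding A_def
  proof (rule bdd_aboveI2)
    fix w assume "w \<in> {v. dot p v v \<le> real (4 * p)}"
    then show "rnorm n p R w \<le> sqrt (\<Sum>i<n. dot p (R i) (R i)) * sqrt (4 * p)"
      by (intro order_trans[OF rnorm_le] mult_left_mono) (auto simp: sum_nonneg)
  qed
  have "Sup A \<le> Q + Sup A / 2"
  proof (rule cSup_least)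
    show "A \<noteq> {}"
      using v by (auto simp: A_def)
    fix x assume "x \<in> A"
    then obtain w where w: "dot p w w \<le> 4 * p" and x: "x = rnorm n p R w"
      by (auto simp: A_def)
    let ?k = "grid_round p w"
    have k1: "?k \<in> int_grid p (4 * p)"
    proof -
      have "(\<Sum>j<p. \<bar>real_of_int (?k j)\<bar>) \<le> (\<Sum>j<p. (w j)\<^sup>2)"
        by (intro sum_mono) (simp add: grid_round_def abs_toward_zero_le_sq)
      then show ?thesis
        using w by (simp add: int_grid_def dot_def power2_eq_square grid_round_def)
    qed
    define e where "e = (\<lambda>j. w j - real_of_int (?k j))"
    have "dot p e e \<le> (\<Sum>j<p. 1)"
      unfolding dot_def e_def
    proof (rule sum_mono)
      fix j assume "j \<in> {..<p}"
      then have "\<bar>w j - real_of_int (?k j)\<bar> \<le> 1"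
        by (simp add: grid_round_def toward_zero_error)
      then show "(w j - real_of_int (?k j)) * (w j - real_of_int (?k j)) \<le> 1"
        by (metis abs_square_le_1 power2_eq_square)
    qed
    then have "dot p (\<lambda>j. 2 * e j) (\<lambda>j. 2 * e j) \<le> 4 * p"
      by (simp add: dot_scale_left dot_scale_right)
    then have "rnorm n p R (\<lambda>j. 2 * e j) \<le> Sup A"
      by (intro cSup_upper bdd) (simp add: A_def)
    then have "rnorm n p R e \<le> Sup A / 2"
      by (simp add: rnorm_scale)
    moreover have "rnorm n p R (\<lambda>j. real_of_int (?k j)) \<le> Q"
      using k1 w grid_round_dot_le[of p w] by (intro grid) auto
    moreover have "rnorm n p R w \<le> rnorm n p R (\<lambda>j. real_of_int (?k j)) + rnorm n p R e"
      using rnorm_add[of n p R "\<lambda>j. real_of_int (?k j)" e] by (simp add: e_def)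
    ultimately show "x \<le> Q + Sup A / 2"
      using x by linarith
  qed
  moreover have "rnorm n p R v \<le> Sup A"
    using v by (intro cSup_upper bdd) (simp add: A_def)
  ultimately show ?thesis
    by linarith
qed

text \<open>The rounding error has coordinates at most min(1, |v_j|), so its squared Euclidean norm
  is at most the l1 norm of v, hence at most m. The operator bound \<open>D\<close> controls the
  image of this error.\<close>

lemma rnorm_lower_of_grid:
  assumes op: "\<And>v. rnorm n p R v \<le> D * sqrt (dot p v v)" and D: "0 \<le> D" "0 \<le> s"
    and grid: "\<And>k. k \<in> int_grid p m \<Longrightarrow>
      s * sqrt (dot p (\<lambda>j. real_of_int (k j)) (\<lambda>j. real_of_int (k j))) \<le> rnorm n p R (\<lambda>j. real_of_int (k j))"
    and v: "(\<Sum>j<p. \<bar>v j\<bar>) \<le> m"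
  shows "s * sqrt (dot p v v) - (s + D) * sqrt m \<le> rnorm n p R v"
proof -
  define k where "k = (\<lambda>j. real_of_int (grid_round p v j))"
  define e where "e = (\<lambda>j. v j - k j)"
  have "(\<Sum>j<p. \<bar>k j\<bar>) \<le> (\<Sum>j<p. \<bar>v j\<bar>)"
    by (intro sum_mono) (simp add: k_def grid_round_def abs_toward_zero_le)
  then have "grid_round p v \<in> int_grid p m"
    using v by (simp add: int_grid_def k_def grid_round_def)
  then have 1: "s * sqrt (dot p k k) \<le> rnorm n p R k"
    unfolding k_def by (rule grid)
  have "dot p e e \<le> (\<Sum>j<p. \<bar>v j\<bar>)"
    unfolding dot_def
  proof (rule sum_mono)
    fix j assume "j \<in> {..<p}"
    then have "\<bar>e j\<bar> \<le> 1" "\<bar>e j\<bar> \<le> \<bar>v j\<bar>"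
      by (simp_all add: e_def k_def grid_round_def toward_zero_error)
    then have "\<bar>e j\<bar> * \<bar>e j\<bar> \<le> 1 * \<bar>v j\<bar>"
      by (intro mult_mono) auto
    then show "e j * e j \<le> \<bar>v j\<bar>"
      by (simp flip: abs_mult)
  qed
  then have e: "sqrt (dot p e e) \<le> sqrt m"
    using v by simp
  have "sqrt (dot p v v) \<le> sqrt (dot p k k) + sqrt (dot p e e)"
    using sqrt_dot_add[of p k e] by (simp add: e_def)
  then have "sqrt (dot p v v) \<le> sqrt (dot p k k) + sqrt m"
    using e by linarith
  then have "s * sqrt (dot p v v) \<le> s * sqrt (dot p k k) + s * sqrt m"
    using mult_left_mono[OF _ D(2)] by (simp flip: distrib_left)
  moreover have "rnorm n p R k \<le> rnorm n p R v + rnorm n p R e"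
    using rnorm_add[of n p R v "\<lambda>j. - 1 * e j"] unfolding rnorm_scale by (simp add: e_def)
  moreover have "rnorm n p R e \<le> D * sqrt m"
    using e D by (intro order_trans[OF op] mult_left_mono) auto
  ultimately show ?thesis
    using 1 by (simp add: distrib_right)
qed

text \<open>Scale v to Euclidean norm sqrt n. If the l1 norm then exceeds \<delta> n, it dominates
  the Euclidean norm by itself; otherwise the grid bound applies, and the condition on \<delta> lets
  the rounding error use up at most half of it.\<close>

lemma restricted_lower_bound:
  assumes n: "0 < n" and c: "0 < c" and D: "0 \<le> D" and \<delta>: "0 < \<delta>" "(sqrt c / 2 + D) * sqrt \<delta> \<le> sqrt c / 4"
    and op: "\<And>v. rnorm n p R v \<le> D * sqrt n * sqrt (dot p v v)"
    and grid: "\<And>k. k \<in> int_grid p (\<delta> * n) \<Longrightarrow>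
      sqrt c / 2 * sqrt n * sqrt (dot p (\<lambda>j. real_of_int (k j)) (\<lambda>j. real_of_int (k j))) \<le> rnorm n p R (\<lambda>j. real_of_int (k j))"
  shows "dot p v v \<le> (1 / \<delta>\<^sup>2 + 16 / c) / n * ((\<Sum>j<p. \<bar>v j\<bar>)\<^sup>2 + (rnorm n p R v)\<^sup>2)"
proof (cases "dot p v v = 0")
  case True
  then show ?thesis
    using c by simp
next
  case False
  define s where "s = sqrt (dot p v v)"
  define l where "l = (\<Sum>j<p. \<bar>v j\<bar>)"
  have s: "0 < s" "s\<^sup>2 = dot p v v"
    using False dot_self_nonneg[of p v] by (auto simp: s_def less_le simp del: dot_self_nonneg)
  have l: "0 \<le> l"
    by (simp add: l_def sum_nonneg)
  have "s\<^sup>2 \<le> (1 / \<delta>\<^sup>2) / n * l\<^sup>2 \<or> s\<^sup>2 \<le> (16 / c) / n * (rnorm n p R v)\<^sup>2"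
  proof (cases "sqrt n / s * l \<le> \<delta> * n")
    case True
    define w where "w = (\<lambda>j. sqrt n / s * v j)"
    have "(\<Sum>j<p. \<bar>w j\<bar>) = sqrt n / s * l"
      using s by (simp add: w_def l_def abs_mult sum_distrib_left)
    then have w: "(\<Sum>j<p. \<bar>w j\<bar>) \<le> \<delta> * n"
      using True by simp
    have "dot p w w = sqrt n / s * (sqrt n / s * s\<^sup>2)"
      unfolding w_def dot_scale_left dot_scale_right s(2) ..
    then have ww: "dot p w w = n"
      using s(1) by (simp add: power2_eq_square)
    have "sqrt c / 2 * sqrt n * sqrt (dot p w w) - (sqrt c / 2 * sqrt n + D * sqrt n) * sqrt (\<delta> * n) \<le> rnorm n p R w"
      using c D by (intro rnorm_lower_of_grid op grid w) auto
    moreover have "sqrt c / 2 * sqrt n * sqrt (dot p w w) - (sqrt c / 2 * sqrt n + D * sqrt n) * sqrt (\<delta> * n) =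
        (sqrt c / 2 - (sqrt c / 2 + D) * sqrt \<delta>) * n"
    proof -
      have "sqrt (\<delta> * n) = sqrt \<delta> * sqrt n"
        by (rule real_sqrt_mult)
      then have "sqrt c / 2 * sqrt n * sqrt (dot p w w) - (sqrt c / 2 * sqrt n + D * sqrt n) * sqrt (\<delta> * n) =
        (sqrt c / 2 - (sqrt c / 2 + D) * sqrt \<delta>) * (sqrt n * sqrt n)"
        unfolding ww by (simp only:) (simp add: algebra_simps del: real_sqrt_mult_self)
      then show ?thesis
        by simp
    qed
    moreover have "sqrt c / 4 * n \<le> (sqrt c / 2 - (sqrt c / 2 + D) * sqrt \<delta>) * n"
      using \<delta> by (intro mult_right_mono) auto
    moreover have "rnorm n p R w = sqrt n / s * rnorm n p R v"
      unfolding w_def rnorm_scale using s by simp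
    ultimately have "sqrt c / 4 * n \<le> sqrt n / s * rnorm n p R v"
      by linarith
    then have "(sqrt c / 4 * n)\<^sup>2 \<le> (sqrt n / s * rnorm n p R v)\<^sup>2"
      using c by (intro power_mono) auto
    then have "c / 16 * (real n)\<^sup>2 \<le> n / s\<^sup>2 * (rnorm n p R v)\<^sup>2"
      using c by (simp add: power_mult_distrib power_divide)
    then have "s\<^sup>2 \<le> (16 / c) / n * (rnorm n p R v)\<^sup>2"
      using n c s(1) by (simp add: field_simps power2_eq_square)
    then show ?thesis ..
  next
    case False
    then have "\<delta> * n * s < sqrt n * l"
      using s by (simp add: field_simps)
    then have "(\<delta> * n * s)\<^sup>2 \<le> (sqrt n * l)\<^sup>2"
      using \<delta> s by (intro power_mono) auto
    moreover have "(\<delta> * n * s)\<^sup>2 = real n * (\<delta>\<^sup>2 * n * s\<^sup>2)" "(sqrt n * l)\<^sup>2 = real n * l\<^sup>2"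
      by (simp_all add: power2_eq_square mult_ac)
    ultimately have "\<delta>\<^sup>2 * n * s\<^sup>2 \<le> l\<^sup>2"
      using n by simp
    then have "s\<^sup>2 \<le> (1 / \<delta>\<^sup>2) / n * l\<^sup>2"
      using n \<delta> by (simp add: field_simps)
    then show ?thesis ..
  qed
  moreover have "0 \<le> (1 / \<delta>\<^sup>2) / n * l\<^sup>2" "0 \<le> (1 / \<delta>\<^sup>2) / n * (rnorm n p R v)\<^sup>2"
    "0 \<le> (16 / c) / n * l\<^sup>2" "0 \<le> (16 / c) / n * (rnorm n p R v)\<^sup>2"
    using c by auto
  moreover have "(1 / \<delta>\<^sup>2 + 16 / c) / n * (l\<^sup>2 + (rnorm n p R v)\<^sup>2) =
      (1 / \<delta>\<^sup>2) / n * l\<^sup>2 + (1 / \<delta>\<^sup>2) / n * (rnorm n p R v)\<^sup>2 + (16 / c) / n * l\<^sup>2 + (16 / c) / n * (rnorm n p R v)\<^sup>2"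
    by (simp add: algebra_simps add_divide_distrib)
  ultimately show ?thesis
    unfolding l_def[symmetric] s(2)[symmetric] by linarith
qed

lemma (in finite_measure) measure_UNION_le_card:
  fixes b :: real
  assumes "finite I" "\<And>i. i \<in> I \<Longrightarrow> A i \<in> sets M" "\<And>i. i \<in> I \<Longrightarrow> measure M (A i) \<le> b"
  shows "measure M (\<Union>i\<in>I. A i) \<le> card I * b"
proof -
  have "measure M (\<Union>i\<in>I. A i) \<le> (\<Sum>i\<in>I. measure M (A i))"
    using assms by (intro finite_measure_subadditive_finite) auto
  also have "\<dots> \<le> (\<Sum>i\<in>I. b)"
    by (intro sum_mono assms)
  finally show ?thesis
    by simp
qed

text \<open>The exceptional event is the union, over two integer grids, of the tail events of single
  grid points. \<open>K\<close> and \<open>a\<close> are obtained before the law, \<open>p\<close>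
  and \<open>n\<close>, so they serve both designs and all sample sizes.\<close>

lemma restricted_lower_bound_event:
  fixes c T \<kappa> :: real
  assumes c: "0 < c" and T: "0 < T" and \<kappa>: "0 \<le> \<kappa>"
  obtains K a where "0 < K" "0 < a"
    "\<And>M p \<Lambda> n. subgaussian_law M p T \<Lambda> \<Longrightarrow> 0 < n \<Longrightarrow> p \<le> \<kappa> * n \<Longrightarrow> (\<And>j. j < p \<Longrightarrow> c \<le> \<Lambda> j) \<Longrightarrow>
      \<exists>E\<in>sets (PiM {..<n} (\<lambda>_. M)). measure (PiM {..<n} (\<lambda>_. M)) E \<le> 2 * exp (- a * n) \<and>
        (\<forall>R\<in>space (PiM {..<n} (\<lambda>_. M)) - E. \<forall>v. dot p v v \<le> K / n * ((\<Sum>j<p. \<bar>v j\<bar>)\<^sup>2 + (rnorm n p R v)\<^sup>2))"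
proof -
  \<comment> \<open>The grid for the operator norm has at most exp (6 p) points, and t is large
    enough for the upper tail to beat that number. \<open>D\<close> is the resulting operator bound;
    its factor 2 comes from passing from the grid to the ball.\<close>
  define t where "t = 6 * \<kappa> + 2"
  define D where "D = 2 * T * sqrt t"
  define B where "B = c\<^sup>2 / (8 * (1 + 512 * T ^ 8))"
  \<comment> \<open>The grid for the lower bound has at most exp (s \<delta> n + 4 exp (-s) p)
    points. A large s and then a small \<delta> make each summand at most B n / 4, which leaves half
    of the tail exponent B n; \<delta> also meets the rounding condition.\<close>
  define s where "s = max 1 (ln (16 * \<kappa> / B + 1))"
  define \<delta> where "\<delta> = min (B / (4 * s)) ((sqrt c / 4 / (sqrt c / 2 + D))\<^sup>2)"
  define K where "K = 1 / \<delta>\<^sup>2 + 16 / c"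
  define a where "a = min 1 (B / 2)"
  have D: "0 \<le> D"
    using T \<kappa> by (simp add: D_def t_def)
  have "0 < 1 + 512 * T ^ 8"
    by (intro add_pos_nonneg) auto
  then have B: "0 < B"
    using c by (simp add: B_def)
  have s1: "1 \<le> s"
    by (simp add: s_def)
  have cD: "0 < sqrt c / 2 + D"
    using c D by (intro add_pos_nonneg) auto
  have \<delta>: "0 < \<delta>"
    using B s1 c cD by (simp add: \<delta>_def)
  have \<delta>2: "(sqrt c / 2 + D) * sqrt \<delta> \<le> sqrt c / 4"
  proof -
    have "sqrt \<delta> \<le> sqrt ((sqrt c / 4 / (sqrt c / 2 + D))\<^sup>2)"
      by (intro real_sqrt_le_mono) (simp only: \<delta>_def min.cobounded2)
    also have "\<dots> = sqrt c / 4 / (sqrt c / 2 + D)"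
      using cD c by simp
    finally show ?thesis
      by (subst mult.commute) (rule iffD1[OF pos_le_divide_eq[OF cD]])
  qed
  have s\<delta>: "s * \<delta> \<le> B / 4"
  proof -
    have "\<delta> \<le> B / (4 * s)"
      by (simp add: \<delta>_def)
    then show ?thesis
      using s1 by (simp add: field_simps)
  qed
  have es: "4 * exp (- s) * \<kappa> \<le> B / 4"
  proof -
    have pos: "0 < 16 * \<kappa> / B + 1"
      using B \<kappa> by (intro add_nonneg_pos) auto
    have "exp (- s) \<le> exp (- ln (16 * \<kappa> / B + 1))"
      by (simp add: s_def)
    also have "\<dots> = 1 / (16 * \<kappa> / B + 1)"
      using pos by (simp add: exp_minus inverse_eq_divide)
    finally have "4 * exp (- s) * \<kappa> \<le> 4 * (1 / (16 * \<kappa> / B + 1)) * \<kappa>"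
      using \<kappa> by (intro mult_right_mono mult_left_mono) auto
    also have "\<dots> \<le> B / 4"
      using pos B \<kappa> by (simp add: field_simps)
    finally show ?thesis .
  qed
  have K: "0 < K"
    using \<delta> c by (simp add: K_def add_pos_pos)
  have a: "0 < a"
    using B by (simp add: a_def)
  show thesis
  proof (rule that[OF K a])
    fix M :: "(nat \<Rightarrow> real) measure" and p n :: nat and \<Lambda>
    assume law: "subgaussian_law M p T \<Lambda>" and n: "0 < n" and p: "p \<le> \<kappa> * n" and \<Lambda>: "\<And>j. j < p \<Longrightarrow> c \<le> \<Lambda> j"
    interpret subgaussian_law M p T \<Lambda> by fact
    interpret P: product_prob_space "\<lambda>_. M" "{..<n}"
      by (intro product_prob_spaceI prob_space_axioms)
    let ?P = "PiM {..<n} (\<lambda>_. M)"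
    let ?r = "\<lambda>k::nat \<Rightarrow> int. \<lambda>j. real_of_int (k j)"
    define G1 where "G1 = {k \<in> int_grid p (4 * p). dot p (?r k) (?r k) \<le> 4 * p}"
    \<comment> \<open>The zero vector is left out because \<open>lower_tail\<close> needs a positive
      norm; for it the bound is trivial.\<close>
    define G2 where "G2 = {k \<in> int_grid p (\<delta> * n). 0 < dot p (?r k) (?r k)}"
    define u where "u = (\<lambda>k j. 1 / (2 * sqrt p) * ?r k j)"
    define A1 where "A1 = (\<lambda>k. {R \<in> space ?P. t * n * T\<^sup>2 \<le> (\<Sum>i<n. (dot p (R i) (u k))\<^sup>2)})"
    define A2 where "A2 = (\<lambda>k. {R \<in> space ?P. (\<Sum>i<n. (dot p (R i) (?r k))\<^sup>2) \<le> c * n * dot p (?r k) (?r k) / 4})"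
    have fin: "finite G1" "finite G2"
      unfolding G1_def G2_def using finite_int_grid[OF s1] \<delta> by auto
    have u: "dot p (u k) (u k) \<le> 1" if "k \<in> G1" for k
    proof (cases "p = 0")
      case False
      have "dot p (u k) (u k) = dot p (?r k) (?r k) / (4 * p)"
        unfolding u_def dot_scale_left dot_scale_right by simp
      then show ?thesis
        using that False by (simp add: G1_def)
    qed (simp add: dot_def)
    have A1: "A1 k \<in> sets ?P" "measure ?P (A1 k) \<le> exp ((1 - t) * n)" if "k \<in> G1" for k
      unfolding A1_def by (rule upper_tail[OF u[OF that]])+
    have A2: "A2 k \<in> sets ?P" "measure ?P (A2 k) \<le> exp (- B * n)" if "k \<in> G2" for k
      using lower_tail[OF c \<Lambda>, of "?r k" n] that by (auto simp: A2_def G2_def B_def)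
    define E where "E = (\<Union>k\<in>G1. A1 k) \<union> (\<Union>k\<in>G2. A2 k)"
    have m1: "measure ?P (\<Union>k\<in>G1. A1 k) \<le> exp (- a * n)"
    proof -
      have "measure ?P (\<Union>k\<in>G1. A1 k) \<le> card G1 * exp ((1 - t) * n)"
        by (intro P.measure_UNION_le_card fin A1)
      also have "\<dots> \<le> card (int_grid p (4 * p)) * exp ((1 - t) * n)"
        unfolding G1_def by (intro mult_right_mono of_nat_mono card_mono finite_int_grid[OF order_refl]) auto
      also have "\<dots> \<le> exp (1 * real (4 * p) + 4 * exp (- 1) * p) * exp ((1 - t) * n)"
        by (intro mult_right_mono card_int_grid) auto
      also have "\<dots> = exp (real (4 * p) + 4 * exp (- 1) * p + (1 - t) * n)"
        by (simp add: exp_add)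
      also have "\<dots> \<le> exp (- a * n)"
      proof -
        have "2 \<le> exp (1::real)"
          using exp_ge_add_one_self[of 1] by simp
        then have "4 * exp (- 1) \<le> (2::real)"
          by (simp add: exp_minus field_simps)
        then have "4 * exp (- 1) * p \<le> 2 * real p"
          by (rule mult_right_mono) simp
        moreover have "(1 - t) * n = - (6 * (\<kappa> * n)) - n"
          by (simp add: t_def algebra_simps)
        moreover have "a * n \<le> 1 * real n"
          by (intro mult_right_mono) (auto simp: a_def)
        ultimately show ?thesis
          using p by (subst exp_le_cancel_iff) linarith
      qed
      finally show ?thesis .
    qed
    have m2: "measure ?P (\<Union>k\<in>G2. A2 k) \<le> exp (- a * n)"
    proof -
      have "measure ?P (\<Union>k\<in>G2. A2 k) \<le> card G2 * exp (- B * n)"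
        by (intro P.measure_UNION_le_card fin A2)
      also have "\<dots> \<le> card (int_grid p (\<delta> * n)) * exp (- B * n)"
        unfolding G2_def using \<delta> by (intro mult_right_mono of_nat_mono card_mono finite_int_grid[OF s1]) auto
      also have "\<dots> \<le> exp (s * (\<delta> * n) + 4 * exp (- s) * p) * exp (- B * n)"
        using \<delta> by (intro mult_right_mono card_int_grid s1) auto
      also have "\<dots> = exp (s * (\<delta> * n) + 4 * exp (- s) * p - B * n)"
        by (simp add: exp_add exp_diff exp_minus divide_inverse)
      also have "\<dots> \<le> exp (- a * n)"
      proof -
        have "s * (\<delta> * n) \<le> B / 4 * n"
          using mult_right_mono[OF s\<delta>, of n] by (simp add: mult.assoc)
        moreover have "4 * exp (- s) * p \<le> B / 4 * n"
        proof -
          have "4 * exp (- s) * p \<le> 4 * exp (- s) * (\<kappa> * n)"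
            using p by (intro mult_left_mono) auto
          also have "\<dots> \<le> B / 4 * n"
            using mult_right_mono[OF es, of n] by (simp add: mult.assoc)
          finally show ?thesis .
        qed
        moreover have "a * n \<le> B / 2 * n"
          by (intro mult_right_mono) (auto simp: a_def)
        ultimately show ?thesis
          by (subst exp_le_cancel_iff) linarith
      qed
      finally show ?thesis .
    qed
    have sets1: "(\<Union>k\<in>G1. A1 k) \<in> sets ?P" and sets2: "(\<Union>k\<in>G2. A2 k) \<in> sets ?P"
      using fin A1 A2 by auto
    have "measure ?P E \<le> 2 * exp (- a * n)"
      unfolding E_def using measure_Un_le[OF sets1 sets2] m1 m2 by linarith
    moreover have "dot p v v \<le> K / n * ((\<Sum>j<p. \<bar>v j\<bar>)\<^sup>2 + (rnorm n p R v)\<^sup>2)" if R: "R \<in> space ?P - E" for R v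
      unfolding K_def
    proof (rule restricted_lower_bound[OF n c D \<delta> \<delta>2])
      fix k assume k: "k \<in> int_grid p (\<delta> * n)"
      show "sqrt c / 2 * sqrt n * sqrt (dot p (?r k) (?r k)) \<le> rnorm n p R (?r k)"
      proof (cases "0 < dot p (?r k) (?r k)")
        case True
        then have "c * n * dot p (?r k) (?r k) / 4 \<le> (rnorm n p R (?r k))\<^sup>2"
          using R k by (auto simp: E_def G2_def A2_def rnorm_sq)
        then have "sqrt (c * n * dot p (?r k) (?r k) / 4) \<le> rnorm n p R (?r k)"
          by (rule real_le_lsqrt[OF rnorm_nonneg])
        then show ?thesis
          by (simp add: real_sqrt_mult real_sqrt_divide)
      next
        case False
        then have "dot p (?r k) (?r k) = 0"
          using dot_self_nonneg[of p "?r k"] by linarith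
        then show ?thesis
          by (simp add: rnorm_nonneg)
      qed
    next
      fix v
      show "rnorm n p R v \<le> D * sqrt n * sqrt (dot p v v)"
      proof (cases "dot p v v = 0")
        case True
        then show ?thesis
          using rnorm_le[of n p R v] by simp
      next
        case False
        then have p0: "0 < p"
          by (auto simp: dot_def intro: gr0I)
        define l where "l = sqrt (dot p v v)"
        have l: "0 < l" "l\<^sup>2 = dot p v v"
          using False dot_self_nonneg[of p v] by (auto simp: l_def less_le simp del: dot_self_nonneg)
        define Q where "Q = 2 * sqrt p * (sqrt t * sqrt n * T)"
        have "rnorm n p R (\<lambda>j. 2 * sqrt p / l * v j) \<le> 2 * Q"
        proof (rule rnorm_le_of_grid)
          show "dot p (\<lambda>j. 2 * sqrt p / l * v j) (\<lambda>j. 2 * sqrt p / l * v j) \<le> real (4 * p)"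
            unfolding dot_scale_left dot_scale_right l(2)[symmetric] using l(1) by (simp add: power2_eq_square)
          fix k assume "k \<in> int_grid p (4 * p)" "dot p (?r k) (?r k) \<le> real (4 * p)"
          then have "k \<in> G1"
            by (simp add: G1_def)
          then have "(rnorm n p R (u k))\<^sup>2 \<le> t * n * T\<^sup>2"
            using R by (auto simp: E_def A1_def rnorm_sq)
          then have "rnorm n p R (u k) \<le> sqrt (t * n * T\<^sup>2)"
            by (rule real_le_rsqrt)
          also have "\<dots> = sqrt t * sqrt n * T"
            using T by (simp add: real_sqrt_mult)
          finally have "rnorm n p R (u k) \<le> sqrt t * sqrt n * T" .
          moreover have "rnorm n p R (u k) = 1 / (2 * sqrt p) * rnorm n p R (?r k)"
            unfolding u_def rnorm_scale by simp
          ultimately show "rnorm n p R (?r k) \<le> Q"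
            using p0 by (simp add: Q_def field_simps)
        qed
        moreover have "rnorm n p R (\<lambda>j. 2 * sqrt p / l * v j) = 2 * sqrt p / l * rnorm n p R v"
          unfolding rnorm_scale using l by simp
        ultimately have "2 * sqrt p / l * rnorm n p R v \<le> 2 * (2 * sqrt p * (sqrt t * sqrt n * T))"
          by (simp add: Q_def)
        then have "rnorm n p R v \<le> 2 * (sqrt t * sqrt n * T) * l"
          using p0 l(1) by (simp add: field_simps)
        then show ?thesis
          by (simp add: D_def l_def mult_ac)
      qed
    qed
    ultimately show "\<exists>E\<in>sets ?P. measure ?P E \<le> 2 * exp (- a * n) \<and>
        (\<forall>R\<in>space ?P - E. \<forall>v. dot p v v \<le> K / n * ((\<Sum>j<p. \<bar>v j\<bar>)\<^sup>2 + (rnorm n p R v)\<^sup>2))"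
      using sets1 sets2 by (intro bexI[of _ E]) (auto simp: E_def)
  qed
qed

section \<open>Smoothing the Lasso penalty\<close>

lemma smooth_penalty_ridge:
  assumes "0 < lam"
  shows "smooth_penalty (\<lambda>t. lam * t\<^sup>2 / 2) (\<lambda>t. lam * t) (\<lambda>_. lam) lam 0"
  by unfold_locales (use assms in \<open>auto intro!: derivative_eq_intros\<close>)

text \<open>The square root removes the kink at 0 and the quadratic term supplies strong convexity
  with modulus \<open>e\<close>.\<close>

definition smoothed_abs :: "real \<Rightarrow> real \<Rightarrow> real \<Rightarrow> real" where
  "smoothed_abs lam e t = lam * sqrt (t\<^sup>2 + e\<^sup>2) + e * t\<^sup>2 / 2"

lemma sqrt_sum_squares_lipschitz: "\<bar>sqrt (x\<^sup>2 + e\<^sup>2) - sqrt (y\<^sup>2 + e\<^sup>2)\<bar> \<le> \<bar>x - y\<bar>"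
proof -
  have "sqrt (x\<^sup>2 + e\<^sup>2) \<le> sqrt (y\<^sup>2 + e\<^sup>2) + \<bar>x - y\<bar>" for x y :: real
    using real_sqrt_sum_squares_triangle_ineq[of y "x - y" e 0] by simp
  from this[of x y] this[of y x] show ?thesis
    by linarith
qed

lemma smooth_penalty_smoothed_abs:
  assumes lam: "0 < lam" and e: "0 < e"
  shows "smooth_penalty (smoothed_abs lam e) (\<lambda>t. lam * (t / sqrt (t\<^sup>2 + e\<^sup>2)) + e * t)
    (\<lambda>t. lam * (e\<^sup>2 / sqrt (t\<^sup>2 + e\<^sup>2) ^ 3) + e) e (3 * lam / e\<^sup>2)"
proof
  fix x y :: real
  have pos: "0 < t\<^sup>2 + e\<^sup>2" for t :: real
    using e by (intro add_nonneg_pos) auto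
  define s where "s = (\<lambda>t. sqrt (t\<^sup>2 + e\<^sup>2))"
  have s: "0 < s t" "(s t)\<^sup>2 = t\<^sup>2 + e\<^sup>2" "e \<le> s t" for t
    using pos[of t] e by (auto simp: s_def intro: real_le_rsqrt)
  have ds: "(s has_real_derivative t / s t) (at t)" for t
    unfolding s_def using pos[of t] by (auto intro!: derivative_eq_intros simp: field_simps)
  show "(smoothed_abs lam e has_real_derivative lam * (x / sqrt (x\<^sup>2 + e\<^sup>2)) + e * x) (at x)"
  proof -
    have "((\<lambda>t. lam * s t + e * t\<^sup>2 / 2) has_real_derivative lam * (x / s x) + e * x) (at x)"
      by (auto intro!: derivative_eq_intros ds)
    then show ?thesis
      by (simp add: s_def smoothed_abs_def[abs_def])
  qed
  show "((\<lambda>t. lam * (t / sqrt (t\<^sup>2 + e\<^sup>2)) + e * t) has_real_derivative lam * (e\<^sup>2 / sqrt (x\<^sup>2 + e\<^sup>2) ^ 3) + e) (at x)"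
  proof -
    have "((\<lambda>t. lam * (t / s t) + e * t) has_real_derivative lam * ((s x - x * (x / s x)) / (s x * s x)) + e) (at x)"
      using s(1)[of x] by (auto intro!: derivative_eq_intros ds simp: right_diff_distrib)
    moreover have "(s x - x * (x / s x)) / (s x * s x) = e\<^sup>2 / s x ^ 3"
      using s(1)[of x] s(2)[of x] by (simp add: field_simps power2_eq_square power3_eq_cube)
    ultimately show ?thesis
      by (simp only: s_def)
  qed
  show "0 < e"
    by fact
  show "e \<le> lam * (e\<^sup>2 / sqrt (x\<^sup>2 + e\<^sup>2) ^ 3) + e"
    using lam by simp
  show "lam * (0 / sqrt (0\<^sup>2 + e\<^sup>2)) + e * 0 = 0"
    by simp
  have "\<bar>1 / s x ^ 3 - 1 / s y ^ 3\<bar> \<le> 3 / e ^ 4 * \<bar>x - y\<bar>"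
  proof -
    let ?a = "s x" and ?b = "s y"
    \<comment> \<open>The difference of the inverse cubes is factored so that ?b - ?a appears, which
      is 1-Lipschitz in the argument. Each of the three cofactors is at most e^(-4) because
      \<open>s\<close> is at least \<open>e\<close>.\<close>
    have "1 / ?a ^ 3 - 1 / ?b ^ 3 = (?b - ?a) * (1 / (?a * ?b ^ 3) + 1 / (?a\<^sup>2 * ?b\<^sup>2) + 1 / (?a ^ 3 * ?b))"
      using s(1)[of x] s(1)[of y] by (simp add: field_simps power2_eq_square power3_eq_cube)
    also have "\<bar>\<dots>\<bar> = \<bar>?b - ?a\<bar> * (1 / (?a * ?b ^ 3) + 1 / (?a\<^sup>2 * ?b\<^sup>2) + 1 / (?a ^ 3 * ?b))"
      using s(1)[of x] s(1)[of y] by (subst abs_mult) (auto intro!: add_nonneg_nonneg)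
    also have "\<dots> \<le> \<bar>x - y\<bar> * (1 / (e * e ^ 3) + 1 / (e\<^sup>2 * e\<^sup>2) + 1 / (e ^ 3 * e))"
      using sqrt_sum_squares_lipschitz[of y e x] s e
      by (intro mult_mono add_mono divide_left_mono power_mono mult_pos_pos)
         (auto simp: s_def abs_minus_commute intro!: add_nonneg_nonneg)
    also have "\<dots> = 3 / e ^ 4 * \<bar>x - y\<bar>"
      using e by (simp add: power2_eq_square power3_eq_cube power4_eq_xxxx mult_ac)
    finally show ?thesis .
  qed
  then have "lam * e\<^sup>2 * \<bar>1 / s x ^ 3 - 1 / s y ^ 3\<bar> \<le> lam * e\<^sup>2 * (3 / e ^ 4 * \<bar>x - y\<bar>)"
    using lam by (intro mult_left_mono) auto
  moreover have "lam * e\<^sup>2 * (3 / e ^ 4 * \<bar>x - y\<bar>) = 3 * lam / e\<^sup>2 * \<bar>x - y\<bar>"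
    using e by (simp add: power2_eq_square power4_eq_xxxx)
  moreover have "(lam * (e\<^sup>2 / s x ^ 3) + e) - (lam * (e\<^sup>2 / s y ^ 3) + e) = lam * e\<^sup>2 * (1 / s x ^ 3 - 1 / s y ^ 3)"
    by (simp add: algebra_simps)
  moreover have "0 \<le> lam * e\<^sup>2"
    using lam by simp
  ultimately show "\<bar>lam * (e\<^sup>2 / sqrt (x\<^sup>2 + e\<^sup>2) ^ 3) + e - (lam * (e\<^sup>2 / sqrt (y\<^sup>2 + e\<^sup>2) ^ 3) + e)\<bar> \<le> 3 * lam / e\<^sup>2 * \<bar>x - y\<bar>"
    using lam by (simp add: s_def abs_mult)
qed

lemma coercive_abs: "0 < lam \<Longrightarrow> coercive (\<lambda>t. lam * \<bar>t\<bar>)"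
  unfolding coercive_def by (intro conjI continuous_intros exI[of _ lam] exI[of _ 0]) auto

lemma ploss_mono: "(\<And>t. \<rho> t \<le> \<rho>' t) \<Longrightarrow> ploss \<rho> p I z y b \<le> ploss \<rho>' p I z y b"
  by (simp add: ploss_def sum_mono)

text \<open>The smoothed penalty lies above the Lasso penalty, so its minimum is no smaller.
  Conversely, inserting the Lasso minimizer b costs p lam e + e |b|^2 / 2. Comparison with the zero
  vector bounds the l1 norm of b and its fitted values, and \<open>good\<close> turns this into a
  bound of order n on |b|^2.\<close>

lemma lasso_elastic:
  fixes n p :: nat and \<xi> \<beta> :: "nat \<Rightarrow> real" and R :: "nat \<Rightarrow> nat \<Rightarrow> real" and lam e K :: real
  assumes n: "0 < n" and lam: "0 < lam" and e: "0 < e" and K: "0 \<le> K"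
    and good: "\<And>v. dot p v v \<le> K / n * ((\<Sum>j<p. \<bar>v j\<bar>)\<^sup>2 + (rnorm n p R v)\<^sup>2)"
  defines "Z \<equiv> (\<Sum>i<n. (\<xi> i + dot p (R i) \<beta>) ^ 8) / n"
  shows "\<bar>opt_risk (smoothed_abs lam e) n p \<beta> \<xi> R - opt_risk (\<lambda>t. lam * \<bar>t\<bar>) n p \<beta> \<xi> R\<bar>
    \<le> e * (lam * p / n + K * (1 / lam\<^sup>2 + 4) * (1 + Z))"
proof -
  define z where "z = (\<lambda>i j. R i j / sqrt n)"
  define y where "y = (\<lambda>i. \<xi> i + dot p (R i) \<beta>)"
  define Y where "Y = (\<Sum>i<n. (y i)\<^sup>2)"
  let ?\<rho> = "\<lambda>t. lam * \<bar>t\<bar>" and ?\<rho>e = "smoothed_abs lam e"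
  have ce: "coercive ?\<rho>e"
    using smooth_penalty_smoothed_abs[OF lam e] by (rule smooth_penalty.coercive)
  obtain b where b: "\<And>b'. ploss ?\<rho> p {..<n} z y b \<le> ploss ?\<rho> p {..<n} z y b'"
    and bmin: "pmin ?\<rho> p {..<n} z y = ploss ?\<rho> p {..<n} z y b"
    using ploss_minimizer[OF coercive_abs[OF lam]] by blast
  have lower: "?\<rho> t \<le> ?\<rho>e t" for t
  proof -
    have "\<bar>t\<bar> \<le> sqrt (t\<^sup>2 + e\<^sup>2)"
      by (rule real_le_rsqrt) simp
    then have "lam * \<bar>t\<bar> \<le> lam * sqrt (t\<^sup>2 + e\<^sup>2)"
      using lam by simp
    then show ?thesis
      using e by (simp add: smoothed_abs_def add_increasing2)
  qed
  have upper: "?\<rho>e t \<le> ?\<rho> t + lam * e + e * t\<^sup>2 / 2" for t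
  proof -
    have "sqrt (t\<^sup>2 + e\<^sup>2) \<le> \<bar>t\<bar> + e"
      using sqrt_sum_squares_le_sum_abs[of t e] e by simp
    then have "lam * sqrt (t\<^sup>2 + e\<^sup>2) \<le> lam * (\<bar>t\<bar> + e)"
      using lam by simp
    then show ?thesis
      by (simp add: smoothed_abs_def distrib_left)
  qed
  have 1: "pmin ?\<rho> p {..<n} z y \<le> pmin ?\<rho>e p {..<n} z y"
    by (rule pmin_ge) (intro order_trans[OF pmin_le[OF coercive_abs[OF lam]] ploss_mono] lower)
  have 2: "pmin ?\<rho>e p {..<n} z y \<le> pmin ?\<rho> p {..<n} z y + p * (lam * e) + e / 2 * dot p b b"
  proof -
    have "pmin ?\<rho>e p {..<n} z y \<le> ploss ?\<rho>e p {..<n} z y b"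
      by (rule pmin_le[OF ce])
    also have "\<dots> \<le> (\<Sum>i<n. (dot p (z i) b - y i)\<^sup>2) / 2 + (\<Sum>j<p. ?\<rho> (b j) + lam * e + e * (b j)\<^sup>2 / 2)"
      unfolding ploss_def by (intro add_left_mono sum_mono upper)
    also have "\<dots> = ploss ?\<rho> p {..<n} z y b + p * (lam * e) + e / 2 * dot p b b"
      by (simp add: ploss_def sum.distrib dot_def sum_distrib_left power2_eq_square)
    finally show ?thesis
      by (simp add: bmin)
  qed
  have "ploss ?\<rho> p {..<n} z y b \<le> ploss ?\<rho> p {..<n} z y (\<lambda>_. 0)"
    by (rule b)
  then have val: "(\<Sum>i<n. (dot p (z i) b - y i)\<^sup>2) / 2 + lam * (\<Sum>j<p. \<bar>b j\<bar>) \<le> Y / 2"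
    by (simp add: ploss_def Y_def sum_distrib_left)
  have nn: "0 \<le> (\<Sum>i<n. (dot p (z i) b - y i)\<^sup>2)" "0 \<le> (\<Sum>j<p. \<bar>b j\<bar>)" "0 \<le> Y"
    by (auto simp: Y_def intro: sum_nonneg)
  have l1: "(\<Sum>j<p. \<bar>b j\<bar>) \<le> Y / (2 * lam)"
    using val nn lam by (simp add: field_simps)
  have res: "(\<Sum>i<n. (dot p (z i) b - y i)\<^sup>2) \<le> Y"
    using val nn lam mult_nonneg_nonneg[of lam "\<Sum>j<p. \<bar>b j\<bar>"] by linarith
  \<comment> \<open>\<open>good\<close> speaks of the unscaled design \<open>R\<close>, the loss of
    \<open>z\<close> = R / sqrt n; the squared norm picks up the factor n.\<close>
  have "(rnorm n p R b)\<^sup>2 = n * (\<Sum>i<n. (dot p (z i) b)\<^sup>2)"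
  proof -
    have "dot p (R i) b = sqrt n * dot p (z i) b" for i
      using n by (simp add: z_def dot_def sum_distrib_left)
    then show ?thesis
      by (simp add: rnorm_sq power_mult_distrib sum_distrib_left)
  qed
  also have "(\<Sum>i<n. (dot p (z i) b)\<^sup>2) \<le> (\<Sum>i<n. 2 * (dot p (z i) b - y i)\<^sup>2 + 2 * (y i)\<^sup>2)"
  proof (rule sum_mono)
    fix i
    have "0 \<le> (dot p (z i) b - 2 * y i)\<^sup>2"
      by simp
    then show "(dot p (z i) b)\<^sup>2 \<le> 2 * (dot p (z i) b - y i)\<^sup>2 + 2 * (y i)\<^sup>2"
      by (simp add: power2_eq_square algebra_simps)
  qed
  also have "\<dots> = 2 * (\<Sum>i<n. (dot p (z i) b - y i)\<^sup>2) + 2 * Y"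
    by (simp add: sum.distrib sum_distrib_left Y_def)
  also have "\<dots> \<le> 4 * Y"
    using res by simp
  finally have r: "(rnorm n p R b)\<^sup>2 \<le> n * (4 * Y)"
    by (simp add: mult_left_mono)
  define w where "w = Y / n"
  have w: "0 \<le> w" "Y = w * n"
    using nn n by (auto simp: w_def)
  have "dot p b b \<le> K / n * ((Y / (2 * lam))\<^sup>2 + n * (4 * Y))"
    using l1 nn r K by (intro order_trans[OF good] mult_left_mono add_mono power_mono) auto
  also have "\<dots> = n * (K * (w\<^sup>2 / (4 * lam\<^sup>2) + 4 * w))"
    using n lam unfolding w(2) by (simp add: field_simps power2_eq_square)
  also have "\<dots> \<le> n * (K * (1 / lam\<^sup>2 + 4) * (1 + Z))"
  proof -
    have "w ^ 4 = Y ^ 4 / real n ^ 4"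
      by (simp add: w_def power_divide)
    also have "\<dots> \<le> (real n ^ 3 * (\<Sum>i<n. ((y i)\<^sup>2) ^ 4)) / real n ^ 4"
      unfolding Y_def using sum_power4_le[of "{..<n}" "\<lambda>i. (y i)\<^sup>2"] by (intro divide_right_mono) auto
    also have "\<dots> = Z"
    proof -
      have "(\<Sum>i<n. ((y i)\<^sup>2) ^ 4) = n * Z"
        using n by (simp add: Z_def y_def flip: power_mult)
      then show ?thesis
        using n by (simp only:) (simp add: power3_eq_cube power4_eq_xxxx)
    qed
    finally have wZ: "w ^ 4 \<le> Z" .
    have sq: "s \<le> 1 + s\<^sup>2" for s :: real
      using zero_le_power2[of "s - 1/2"] by (simp add: power2_eq_square algebra_simps)
    have w2: "w\<^sup>2 \<le> 1 + Z"
      using sq[of "w\<^sup>2"] wZ by (simp flip: power_mult)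
    have w1: "w \<le> 1 + Z"
    proof (cases "w \<le> 1")
      case True
      moreover have "0 \<le> w ^ 4"
        by simp
      ultimately show ?thesis
        using wZ by linarith
    next
      case False
      then have "w ^ 1 \<le> w ^ 4"
        by (intro power_increasing) auto
      then show ?thesis
        using wZ by simp
    qed
    have "w\<^sup>2 / (4 * lam\<^sup>2) + 4 * w \<le> (1 + Z) / lam\<^sup>2 + 4 * (1 + Z)"
    proof (intro add_mono)
      have "w\<^sup>2 / (4 * lam\<^sup>2) \<le> w\<^sup>2 / lam\<^sup>2"
        using lam by (intro divide_left_mono) auto
      also have "\<dots> \<le> (1 + Z) / lam\<^sup>2"
        using w2 by (rule divide_right_mono) simp
      finally show "w\<^sup>2 / (4 * lam\<^sup>2) \<le> (1 + Z) / lam\<^sup>2" .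
    qed (use w1 in simp)
    also have "\<dots> = (1 / lam\<^sup>2 + 4) * (1 + Z)"
      by (simp add: distrib_right)
    finally show ?thesis
      using K by (simp only: mult.assoc) (intro mult_left_mono; simp)
  qed
  finally have bb: "dot p b b \<le> n * (K * (1 / lam\<^sup>2 + 4) * (1 + Z))" .
  have "0 \<le> dot p b b / n"
    by simp
  moreover have "dot p b b / n \<le> K * (1 / lam\<^sup>2 + 4) * (1 + Z)"
    using bb n by (simp add: field_simps)
  moreover have "s / 2 \<le> t" if "0 \<le> s" "s \<le> t" for s t :: real
    using that by simp
  ultimately have "dot p b b / n / 2 \<le> K * (1 / lam\<^sup>2 + 4) * (1 + Z)"
    by blast
  then have "e * (dot p b b / n / 2) \<le> e * (K * (1 / lam\<^sup>2 + 4) * (1 + Z))"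
    using e by (intro mult_left_mono) auto
  then have "(p * (lam * e) + e / 2 * dot p b b) / n \<le> e * (lam * p / n + K * (1 / lam\<^sup>2 + 4) * (1 + Z))"
    using n by (simp add: add_divide_distrib distrib_left mult_ac)
  moreover have "opt_risk ?\<rho>e n p \<beta> \<xi> R = pmin ?\<rho>e p {..<n} z y / n" "opt_risk ?\<rho> n p \<beta> \<xi> R = pmin ?\<rho> p {..<n} z y / n"
    by (simp_all add: opt_risk_def z_def y_def)
  moreover have "pmin ?\<rho> p {..<n} z y / n \<le> pmin ?\<rho>e p {..<n} z y / n"
    using 1 by (rule divide_right_mono) simp
  moreover have "pmin ?\<rho>e p {..<n} z y / n \<le> pmin ?\<rho> p {..<n} z y / n + (p * (lam * e) + e / 2 * dot p b b) / n"
    using 2 by (simp add: add_divide_distrib[symmetric] divide_right_mono add.assoc)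
  ultimately show ?thesis
    by simp
qed

text \<open>On the exceptional event E the two values of \<psi> differ by at most twice their bound;
  off E the pointwise estimate and the Lipschitz bound of \<psi> apply.\<close>

lemma (in subgaussian_law) lasso_elastic_expectation:
  fixes n :: nat and \<beta> \<xi> :: "nat \<Rightarrow> real" and lam e K b :: real
  assumes \<psi>: "test_function \<psi> C\<psi> L\<psi>" and n: "0 < n" and lam: "0 < lam" and e: "0 < e" and K: "0 \<le> K" and b: "dot p \<beta> \<beta> \<le> b"
    and E: "E \<in> sets (PiM {..<n} (\<lambda>_. M))"
    and good: "\<And>R v. R \<in> space (PiM {..<n} (\<lambda>_. M)) - E \<Longrightarrow> dot p v v \<le> K / n * ((\<Sum>j<p. \<bar>v j\<bar>)\<^sup>2 + (rnorm n p R v)\<^sup>2)"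
  shows "\<bar>(\<integral>R. \<psi> (opt_risk (smoothed_abs lam e) n p \<beta> \<xi> R) \<partial>PiM {..<n} (\<lambda>_. M))
      - (\<integral>R. \<psi> (opt_risk (\<lambda>t. lam * \<bar>t\<bar>) n p \<beta> \<xi> R) \<partial>PiM {..<n} (\<lambda>_. M))\<bar>
    \<le> C\<psi> * (2 * measure (PiM {..<n} (\<lambda>_. M)) E
        + e * (lam * p / n + K * (1 / lam\<^sup>2 + 4) * (1 + 128 * ((\<Sum>i<n. (\<xi> i) ^ 8) / n + 512 * T ^ 8 * b ^ 4))))"
proof -
  interpret test_function \<psi> C\<psi> L\<psi> by fact
  interpret P: product_prob_space "\<lambda>_. M" "{..<n}"
    by (intro product_prob_spaceI prob_space_axioms)
  let ?P = "PiM {..<n} (\<lambda>_. M)"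
  let ?\<rho> = "\<lambda>t. lam * \<bar>t\<bar>" and ?\<rho>e = "smoothed_abs lam e"
  have ce: "coercive ?\<rho>e"
    using smooth_penalty_smoothed_abs[OF lam e] by (rule smooth_penalty.coercive)
  define Z where "Z = (\<lambda>R. (\<Sum>i<n. (\<xi> i + dot p (R i) \<beta>) ^ 8) / n)"
  define K' where "K' = K * (1 / lam\<^sup>2 + 4)"
  have K': "0 \<le> K'"
    using K by (simp add: K'_def)
  define H where "H = (\<lambda>R. C\<psi> * (2 * indicator E R + e * (lam * p / n + K' * (1 + Z R))))"
  have int: "integrable ?P (\<lambda>R. \<psi> (opt_risk \<rho> n p \<beta> \<xi> R))" if "coercive \<rho>" for \<rho>
  proof (rule P.integrable_const_bound[of _ C\<psi>])
    have "opt_risk \<rho> n p \<beta> \<xi> \<in> borel_measurable ?P"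
      by (intro opt_risk_measurable that row_coord_measurable coord_measurable) auto
    then show "(\<lambda>R. \<psi> (opt_risk \<rho> n p \<beta> \<xi> R)) \<in> borel_measurable ?P"
      by (rule measurable_compose[OF _ measurable_test])
  qed (simp add: bounded)
  have y8: "integrable ?P (\<lambda>R. (\<xi> i + dot p (R i) \<beta>) ^ 8)"
    "(\<integral>R. (\<xi> i + dot p (R i) \<beta>) ^ 8 \<partial>?P) \<le> 128 * ((\<xi> i) ^ 8 + 512 * T ^ 8 * b ^ 4)" if i: "i < n" for i
  proof -
    have "i \<in> {..<n}"
      using i by simp
    note comp = PiM_component_integral[of "{..<n}" "\<lambda>_. M", OF prob_space_axioms this integrable_response_power8]
    show "integrable ?P (\<lambda>R. (\<xi> i + dot p (R i) \<beta>) ^ 8)"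
      by (rule comp(1))
    have "(\<integral>R. (\<xi> i + dot p (R i) \<beta>) ^ 8 \<partial>?P) \<le> 128 * ((\<xi> i) ^ 8 + 512 * T ^ 8 * (dot p \<beta> \<beta>) ^ 4)"
      unfolding comp(2) by (rule response_power8_le)
    also have "\<dots> \<le> 128 * ((\<xi> i) ^ 8 + 512 * T ^ 8 * b ^ 4)"
      by (intro mult_left_mono add_left_mono power_mono b) auto
    finally show "(\<integral>R. (\<xi> i + dot p (R i) \<beta>) ^ 8 \<partial>?P) \<le> 128 * ((\<xi> i) ^ 8 + 512 * T ^ 8 * b ^ 4)" .
  qed
  have Zint: "integrable ?P Z"
    unfolding Z_def by (intro integrable_divide Bochner_Integration.integrable_sum y8) auto
  have EZ: "(\<integral>R. Z R \<partial>?P) \<le> 128 * ((\<Sum>i<n. (\<xi> i) ^ 8) / n + 512 * T ^ 8 * b ^ 4)"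
  proof -
    have "(\<integral>R. Z R \<partial>?P) = (\<Sum>i<n. (\<integral>R. (\<xi> i + dot p (R i) \<beta>) ^ 8 \<partial>?P)) / n"
      unfolding Z_def using y8(1) by simp
    also have "\<dots> \<le> (\<Sum>i<n. 128 * ((\<xi> i) ^ 8 + 512 * T ^ 8 * b ^ 4)) / n"
      by (intro divide_right_mono sum_mono y8(2)) auto
    also have "\<dots> = 128 * ((\<Sum>i<n. (\<xi> i) ^ 8) / n + 512 * T ^ 8 * b ^ 4)"
      using n unfolding sum_distrib_left[symmetric] sum.distrib by (simp add: field_simps)
    finally show ?thesis .
  qed
  have indint: "integrable ?P (indicator E :: _ \<Rightarrow> real)"
    using E by (intro integrable_real_indicator) (auto simp: P.P.emeasure_eq_measure)
  have Hint: "integrable ?P H"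
    unfolding H_def by (intro integrable_mult_right Bochner_Integration.integrable_add P.integrable_const Zint indint)
  have pt: "\<bar>\<psi> (opt_risk ?\<rho>e n p \<beta> \<xi> R) - \<psi> (opt_risk ?\<rho> n p \<beta> \<xi> R)\<bar> \<le> H R" if R: "R \<in> space ?P" for R
  proof (cases "R \<in> E")
    case True
    have "0 \<le> Z R"
      unfolding Z_def by (intro divide_nonneg_nonneg sum_nonneg) auto
    then have "0 \<le> e * (lam * p / n + K' * (1 + Z R))"
      using e lam K' by simp
    then have "C\<psi> * 2 \<le> H R"
      unfolding H_def using True C_nonneg by (intro mult_left_mono) auto
    then show ?thesis
      using bounded[of "opt_risk ?\<rho>e n p \<beta> \<xi> R"] bounded[of "opt_risk ?\<rho> n p \<beta> \<xi> R"] by linarith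
  next
    case False
    have "\<bar>\<psi> (opt_risk ?\<rho>e n p \<beta> \<xi> R) - \<psi> (opt_risk ?\<rho> n p \<beta> \<xi> R)\<bar> \<le>
        C\<psi> * \<bar>opt_risk ?\<rho>e n p \<beta> \<xi> R - opt_risk ?\<rho> n p \<beta> \<xi> R\<bar>"
      by (rule lipschitz)
    also have "\<dots> \<le> C\<psi> * (e * (lam * p / n + K' * (1 + Z R)))"
      unfolding K'_def Z_def using R False C_nonneg good[of R]
      by (intro mult_left_mono lasso_elastic n lam e K) auto
    finally show ?thesis
      using False by (simp add: H_def)
  qed
  have "\<bar>(\<integral>R. \<psi> (opt_risk ?\<rho>e n p \<beta> \<xi> R) \<partial>?P) - (\<integral>R. \<psi> (opt_risk ?\<rho> n p \<beta> \<xi> R) \<partial>?P)\<bar> =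
      \<bar>\<integral>R. \<psi> (opt_risk ?\<rho>e n p \<beta> \<xi> R) - \<psi> (opt_risk ?\<rho> n p \<beta> \<xi> R) \<partial>?P\<bar>"
    using int[OF ce] int[OF coercive_abs[OF lam]] by simp
  also have "\<dots> \<le> (\<integral>R. \<bar>\<psi> (opt_risk ?\<rho>e n p \<beta> \<xi> R) - \<psi> (opt_risk ?\<rho> n p \<beta> \<xi> R)\<bar> \<partial>?P)"
    by (rule integral_abs_bound)
  also have "\<dots> \<le> (\<integral>R. H R \<partial>?P)"
    using int[OF ce] int[OF coercive_abs[OF lam]] Hint by (intro integral_mono pt) auto
  also have "\<dots> = C\<psi> * (2 * measure ?P E + e * (lam * p / n + K' * (1 + (\<integral>R. Z R \<partial>?P))))"
    unfolding H_def using Zint indint E by (simp add: P.P.prob_space)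
  also have "\<dots> \<le> C\<psi> * (2 * measure ?P E + e * (lam * p / n + K' * (1 + 128 * ((\<Sum>i<n. (\<xi> i) ^ 8) / n + 512 * T ^ 8 * b ^ 4))))"
    using C_nonneg e K' EZ by (intro mult_left_mono add_left_mono) auto
  finally show ?thesis
    by (simp add: K'_def)
qed

section \<open>Quadratic forms in independent blocks\<close>

lemma integrable_mult_of_squares:
  fixes f g :: "'a \<Rightarrow> real"
  assumes [measurable]: "f \<in> borel_measurable M" "g \<in> borel_measurable M"
    and "integrable M (\<lambda>x. (f x)\<^sup>2)" "integrable M (\<lambda>x. (g x)\<^sup>2)"
  shows "integrable M (\<lambda>x. f x * g x)"
proof (rule Bochner_Integration.integrable_bound)
  show "integrable M (\<lambda>x. (f x)\<^sup>2 + (g x)\<^sup>2)"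
    using assms by (intro Bochner_Integration.integrable_add)
  have "\<bar>f x * g x\<bar> \<le> (f x)\<^sup>2 + (g x)\<^sup>2" for x
  proof -
    have "2 * \<bar>f x * g x\<bar> \<le> (f x)\<^sup>2 + (g x)\<^sup>2"
      using sum_squares_bound[of "\<bar>f x\<bar>" "\<bar>g x\<bar>"] by (simp add: abs_mult)
    then show ?thesis
      using abs_ge_zero[of "f x * g x"] by linarith
  qed
  then show "AE x in M. norm (f x * g x) \<le> norm ((f x)\<^sup>2 + (g x)\<^sup>2)"
    by (intro AE_I2) simp
qed measurable

text \<open>Extension by zero keeps a subvector in dimension \<open>p\<close>, so \<open>dot\<close>
  and \<open>mv\<close> can be used unchanged on unions of blocks.\<close>

definition mask :: "nat set \<Rightarrow> (nat \<Rightarrow> real) \<Rightarrow> nat \<Rightarrow> real" where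
  "mask U v = (\<lambda>j. if j \<in> U then v j else 0)"

lemma mask_restrict [simp]: "mask U (restrict a U) = mask U a"
  by (simp add: mask_def fun_eq_iff)

lemma mask_Un: "U \<inter> S = {} \<Longrightarrow> mask (U \<union> S) a = (\<lambda>j. mask U a j + mask S a j)"
  by (auto simp: mask_def fun_eq_iff)

lemma mask_measurable [measurable]:
  "(\<lambda>a. mask U a j) \<in> borel_measurable (PiM U (\<lambda>_. borel))"
  unfolding mask_def by (cases "j \<in> U") simp_all

lemma dot_mask_le: "dot p (mask U v) (mask U v) \<le> dot p v v"
  unfolding dot_def mask_def by (intro sum_mono) auto

locale block_law = subgaussian_law M p T \<Lambda> for M p T \<Lambda> +
  fixes \<S> :: "nat set set"
  assumes partition: "partition_on {..<p} \<S>"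
    and indep: "indep_vars (\<lambda>S. PiM S (\<lambda>_. borel)) (\<lambda>S a. restrict a S) \<S>"
begin

lemma blocks_sub: "S \<in> \<S> \<Longrightarrow> S \<subseteq> {..<p}"
  using partition by (auto simp: partition_on_def)

lemma mask_measurable_M [measurable]:
  assumes "U \<subseteq> {..<p}"
  shows "(\<lambda>a. mask U a j) \<in> borel_measurable M"
  unfolding mask_def using assms by (cases "j \<in> U") auto

text \<open>The equations for \<open>f\<close> and \<open>g\<close> under \<open>restrict\<close>
  say that they depend only on the coordinates of S and of the union of \<U>. Disjoint groups of
  independent blocks are independent, so the expectation of the product factorizes.\<close>

lemma factorize:
  assumes S: "S \<in> \<S>" "\<U> \<subseteq> \<S>" "S \<notin> \<U>"
    and f: "f \<in> borel_measurable (PiM S (\<lambda>_. borel))" "\<And>a. f (restrict a S) = f a" "integrable M f"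
    and g: "g \<in> borel_measurable (PiM (\<Union>\<U>) (\<lambda>_. borel))" "\<And>a. g (restrict a (\<Union>\<U>)) = g a" "integrable M g"
  shows "integrable M (\<lambda>a. f a * (g a :: real))" and "(\<integral>a. f a * g a \<partial>M) = (\<integral>a. f a \<partial>M) * (\<integral>a. g a \<partial>M)"
proof -
  let ?M' = "\<lambda>S. PiM S (\<lambda>_. borel :: real measure)"
  have ex: "\<exists>T. T \<in> \<U> \<and> j \<in> T" if "j \<in> \<Union>\<U>" for j
    using that by blast
  \<comment> \<open>A vector on the union of \<U> has to be reassembled from the family of its
    blocks; \<open>blk j\<close> picks a block that contains coordinate j.\<close>
  define blk where "blk = (\<lambda>j. SOME T. T \<in> \<U> \<and> j \<in> T)"
  have blk: "blk j \<in> \<U>" "j \<in> blk j" if "j \<in> \<Union>\<U>" for j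
    unfolding blk_def using someI_ex[OF ex[OF that]] by auto
  have iv: "indep_var (PiM {S} ?M') (\<lambda>a. restrict (\<lambda>S. restrict a S) {S}) (PiM \<U> ?M') (\<lambda>a. restrict (\<lambda>S. restrict a S) \<U>)"
    by (rule indep_var_restrict[OF indep]) (use S in auto)
  define F where "F = (\<lambda>x :: nat set \<Rightarrow> nat \<Rightarrow> real. f (x S))"
  define G where "G = (\<lambda>x :: nat set \<Rightarrow> nat \<Rightarrow> real. g (\<lambda>j\<in>\<Union>\<U>. x (blk j) j))"
  have F: "F \<in> borel_measurable (PiM {S} ?M')"
  proof -
    have "(\<lambda>x. x S) \<in> measurable (PiM {S} ?M') (PiM S (\<lambda>_. borel))"
      using measurable_component_singleton[of S "{S}" ?M'] by simp
    from measurable_comp[OF this f(1)] show ?thesis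
      unfolding F_def comp_def .
  qed
  have "(\<lambda>x. \<lambda>j\<in>\<Union>\<U>. x (blk j) j) \<in> measurable (PiM \<U> ?M') (PiM (\<Union>\<U>) (\<lambda>_. borel))"
  proof (rule measurable_restrict)
    fix j assume j: "j \<in> \<Union>\<U>"
    show "(\<lambda>x. x (blk j) j) \<in> measurable (PiM \<U> ?M') borel"
      by (rule row_coord_measurable[OF blk(1)[OF j]]) (rule measurable_component_singleton[OF blk(2)[OF j], of "\<lambda>_. borel"])
  qed
  from measurable_comp[OF this g(1)] have G: "G \<in> borel_measurable (PiM \<U> ?M')"
    unfolding G_def comp_def .
  have "F \<circ> (\<lambda>a. restrict (\<lambda>S. restrict a S) {S}) = f"
    by (rule ext) (simp add: F_def f(2))
  moreover have "G \<circ> (\<lambda>a. restrict (\<lambda>S. restrict a S) \<U>) = g"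
  proof
    fix a :: "nat \<Rightarrow> real"
    have "(\<lambda>j\<in>\<Union>\<U>. restrict (\<lambda>S. restrict a S) \<U> (blk j) j) = restrict a (\<Union>\<U>)"
      by (rule restrict_ext) (simp add: blk)
    then have "(G \<circ> (\<lambda>a. restrict (\<lambda>S. restrict a S) \<U>)) a = g (restrict a (\<Union>\<U>))"
      unfolding G_def comp_def by (simp only:)
    then show "(G \<circ> (\<lambda>a. restrict (\<lambda>S. restrict a S) \<U>)) a = g a"
      by (simp only: g(2))
  qed
  ultimately have "indep_var borel f borel g"
    using indep_var_compose[OF iv F G] by simp
  then show "integrable M (\<lambda>a. f a * g a)" "(\<integral>a. f a * g a \<partial>M) = (\<integral>a. f a \<partial>M) * (\<integral>a. g a \<partial>M)"
    using f(3) g(3) by (auto intro: indep_var_integrable indep_var_lebesgue_integral)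
qed

definition Q :: "(nat \<Rightarrow> nat \<Rightarrow> real) \<Rightarrow> nat set \<Rightarrow> (nat \<Rightarrow> real) \<Rightarrow> real" where
  "Q B U a = dot p (mask U a) (mv p B (mask U a))"

definition Q0 :: "(nat \<Rightarrow> nat \<Rightarrow> real) \<Rightarrow> nat set \<Rightarrow> real" where
  "Q0 B U = (\<Sum>j<p. if j \<in> U then B j j * \<Lambda> j else 0)"

lemma expectation_Q:
  assumes U: "U \<subseteq> {..<p}"
  shows "(\<integral>a. Q B U a \<partial>M) = Q0 B U"
proof -
  let ?c = "\<lambda>j k. (if j \<in> U \<and> k \<in> U then B j k else 0)"
  have "Q B U a = (\<Sum>j<p. \<Sum>k<p. ?c j k * (a j * a k))" for a
    unfolding Q_def dot_def mv_def mask_def sum_distrib_left by (intro sum.cong refl) auto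
  then have "(\<integral>a. Q B U a \<partial>M) = (\<integral>a. (\<Sum>j<p. \<Sum>k<p. ?c j k * (a j * a k)) \<partial>M)"
    by simp
  also have "\<dots> = (\<Sum>j<p. (\<integral>a. (\<Sum>k<p. ?c j k * (a j * a k)) \<partial>M))"
    by (intro Bochner_Integration.integral_sum Bochner_Integration.integrable_sum integrable_mult_right integrable_coord_prod) auto
  also have "\<dots> = (\<Sum>j<p. \<Sum>k<p. (\<integral>a. ?c j k * (a j * a k) \<partial>M))"
    by (intro sum.cong refl Bochner_Integration.integral_sum integrable_mult_right integrable_coord_prod) auto
  also have "\<dots> = (\<Sum>j<p. \<Sum>k<p. ?c j k * (if j = k then \<Lambda> j else 0))"
    by (intro sum.cong refl) (simp add: cov)
  also have "\<dots> = (\<Sum>j<p. \<Sum>k<p. if j = k then ?c j j * \<Lambda> j else 0)"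
    by (intro sum.cong refl) auto
  also have "\<dots> = Q0 B U"
    unfolding Q0_def by (intro sum.cong refl) auto
  finally show ?thesis .
qed

context
  fixes B
  assumes sym: "\<And>j k. B j k = B k j" and contr: "\<And>v. dot p (mv p B v) (mv p B v) \<le> dot p v v"
begin

lemma Q_measurable:
  "Q B U \<in> borel_measurable (PiM U (\<lambda>_. borel))"
  "U \<subseteq> {..<p} \<Longrightarrow> Q B U \<in> borel_measurable M"
  unfolding Q_def by measurable

lemma Q_sq_le: "(Q B U a)\<^sup>2 \<le> (dot p (mask U a) (mask U a))\<^sup>2"
  unfolding Q_def by (rule dot_mv_sq_le[OF contr])

lemma integrable_Q_sq:
  assumes U: "U \<subseteq> {..<p}"
  shows "integrable M (\<lambda>a. (Q B U a - c)\<^sup>2)"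
proof (rule Bochner_Integration.integrable_bound)
  show "integrable M (\<lambda>a. 2 * (dot p a a)\<^sup>2 + 2 * c\<^sup>2)"
    by (intro Bochner_Integration.integrable_add integrable_mult_right integrable_dot_self_sq integrable_const)
  have "(Q B U a - c)\<^sup>2 \<le> 2 * (dot p a a)\<^sup>2 + 2 * c\<^sup>2" for a
  proof -
    have "(Q B U a)\<^sup>2 \<le> (dot p a a)\<^sup>2"
      using Q_sq_le dot_mask_le by (rule order_trans[OF _ power_mono]) auto
    moreover have "0 \<le> (Q B U a + c)\<^sup>2"
      by simp
    then have "(Q B U a - c)\<^sup>2 \<le> 2 * (Q B U a)\<^sup>2 + 2 * c\<^sup>2"
      by (simp add: power2_diff power2_sum)
    ultimately show ?thesis
      by linarith
  qed
  then show "AE a in M. norm ((Q B U a - c)\<^sup>2) \<le> norm (2 * (dot p a a)\<^sup>2 + 2 * c\<^sup>2)"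
    by (intro AE_I2) simp
qed (use Q_measurable(2)[OF U] in measurable)

lemma integrable_Q:
  assumes U: "U \<subseteq> {..<p}"
  shows "integrable M (Q B U)"
  using integrable_mult_of_squares[OF Q_measurable(2)[OF U] borel_measurable_const[of 1] _ integrable_const]
    integrable_Q_sq[OF U, of 0] by simp

text \<open>Inside a block no independence is available. The variance is bounded by the second
  moment, hence by the squared norm of the block squared, and Cauchy-Schwarz leaves fourth moments
  of coordinates. This is where the block size \<open>d\<close> enters the variance.\<close>

lemma block_diagonal:
  assumes S: "S \<in> \<S>" "card S \<le> d"
  shows "(\<integral>a. (Q B S a - Q0 B S)\<^sup>2 \<partial>M) \<le> card S * (d * (1 + 512 * T ^ 8))"
proof -
  have sub: "S \<subseteq> {..<p}" and fin: "finite S"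
    using blocks_sub[OF S(1)] finite_subset by auto
  have i4: "integrable M (\<lambda>a. (a j) ^ 4)" "(\<integral>a. (a j) ^ 4 \<partial>M) \<le> 1 + 512 * T ^ 8" if "j < p" for j
  proof -
    let ?u = "\<lambda>i. if i = j then 1 else 0 :: real"
    have u: "dot p a ?u = a j" "dot p ?u ?u = 1" for a
      using that by (simp_all add: dot_def if_distrib cong: if_cong)
    have i8: "integrable M (\<lambda>a. 1 + (a j) ^ 8)"
      by (intro Bochner_Integration.integrable_add integrable_const integrable_coord_power8 that)
    have le: "(a j) ^ 4 \<le> 1 + (a j) ^ 8" for a :: "nat \<Rightarrow> real"
      using power_le_power8[of 4 "a j"] by simp
    have [measurable]: "(\<lambda>a. a j) \<in> borel_measurable M"
      by (rule coord_measurable[OF that])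
    show i: "integrable M (\<lambda>a. (a j) ^ 4)"
      by (rule Bochner_Integration.integrable_bound[OF i8])
         (use le in \<open>auto intro!: AE_I2 intro: order_trans[OF _ abs_ge_self]\<close>)
    have "(\<integral>a. (a j) ^ 4 \<partial>M) \<le> (\<integral>a. 1 + (a j) ^ 8 \<partial>M)"
      by (intro integral_mono i i8 le)
    also have "\<dots> \<le> 1 + 512 * T ^ 8"
      using dot_power8_le[of ?u] integrable_coord_power8[OF that] by (simp add: u prob_space)
    finally show "(\<integral>a. (a j) ^ 4 \<partial>M) \<le> 1 + 512 * T ^ 8" .
  qed
  have iQ: "integrable M (\<lambda>a. (Q B S a)\<^sup>2)"
    using integrable_Q_sq[OF sub, of 0] by simp
  have "(\<integral>a. (Q B S a - Q0 B S)\<^sup>2 \<partial>M) = (\<integral>a. (Q B S a)\<^sup>2 \<partial>M) - (Q0 B S)\<^sup>2"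
  proof -
    have "(\<integral>a. (Q B S a - Q0 B S)\<^sup>2 \<partial>M) = (\<integral>a. (Q B S a)\<^sup>2 - (2 * Q0 B S) * Q B S a + (Q0 B S)\<^sup>2 \<partial>M)"
      by (intro Bochner_Integration.integral_cong refl) (simp add: power2_eq_square algebra_simps)
    also have "\<dots> = (\<integral>a. (Q B S a)\<^sup>2 \<partial>M) - (2 * Q0 B S) * (\<integral>a. Q B S a \<partial>M) + (Q0 B S)\<^sup>2"
      using iQ integrable_Q[OF sub] by (simp add: prob_space)
    finally show ?thesis
      by (simp add: expectation_Q[OF sub] power2_eq_square)
  qed
  also have "\<dots> \<le> (\<integral>a. (Q B S a)\<^sup>2 \<partial>M)"
    by simp
  also have "\<dots> \<le> (\<integral>a. card S * (\<Sum>j\<in>S. (a j) ^ 4) \<partial>M)"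
  proof (rule integral_mono[OF iQ])
    show "integrable M (\<lambda>a. card S * (\<Sum>j\<in>S. (a j) ^ 4))"
      using sub by (intro integrable_mult_right Bochner_Integration.integrable_sum i4) auto
    fix a
    have eq: "dot p (mask S a) (mask S a) = (\<Sum>j\<in>S. (a j)\<^sup>2)"
    proof -
      have "(\<Sum>j\<in>S. (a j)\<^sup>2) = (\<Sum>j\<in>S. mask S a j * mask S a j)"
        by (intro sum.cong) (auto simp: mask_def power2_eq_square)
      also have "\<dots> = dot p (mask S a) (mask S a)"
        unfolding dot_def using sub by (intro sum.mono_neutral_left) (auto simp: mask_def)
      finally show ?thesis ..
    qed
    have "(Q B S a)\<^sup>2 \<le> (\<Sum>j\<in>S. (a j)\<^sup>2)\<^sup>2"
      using Q_sq_le[of S a] by (simp only: eq)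
    also have "\<dots> \<le> (\<Sum>j\<in>S. ((a j)\<^sup>2)\<^sup>2) * card S"
      by (rule sum_squared_le_sum_of_squares)
    also have "\<dots> = card S * (\<Sum>j\<in>S. (a j) ^ 4)"
      by (simp flip: power_mult)
    finally show "(Q B S a)\<^sup>2 \<le> card S * (\<Sum>j\<in>S. (a j) ^ 4)" .
  qed
  also have "\<dots> = card S * (\<Sum>j\<in>S. (\<integral>a. (a j) ^ 4 \<partial>M))"
    using sub i4(1) by (subst integral_mult_right_zero) (subst Bochner_Integration.integral_sum, auto)
  also have "\<dots> \<le> card S * (\<Sum>j\<in>S. 1 + 512 * T ^ 8)"
    using sub by (intro mult_left_mono sum_mono i4(2)) auto
  also have "\<dots> \<le> card S * (d * (1 + 512 * T ^ 8))"
    using S(2) by (simp add: mult_left_mono mult_right_mono add_nonneg_nonneg)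
  finally show ?thesis .
qed

text \<open>
  Blocks are added one at a time.  As the blocks are independent and centered, the centered form of the
  old blocks, the cross term and the centered form of the new block are pairwise uncorrelated.
\<close>

lemma block_step:
  assumes S: "S \<in> \<S>" "\<U> \<subseteq> \<S>" "S \<notin> \<U>" "card S \<le> d" and C: "\<And>j. j < p \<Longrightarrow> \<Lambda> j \<le> C"
  shows "(\<integral>a. (Q B (\<Union>\<U> \<union> S) a - Q0 B (\<Union>\<U> \<union> S))\<^sup>2 \<partial>M) \<le>
    (\<integral>a. (Q B (\<Union>\<U>) a - Q0 B (\<Union>\<U>))\<^sup>2 \<partial>M) + card S * (d * (1 + 512 * T ^ 8) + 4 * C\<^sup>2)"
proof -
  define U where "U = \<Union>\<U>"
  have sub: "S \<subseteq> {..<p}" "U \<subseteq> {..<p}" and fin: "finite S"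
    using blocks_sub S finite_subset[of S "{..<p}"] by (auto simp: U_def)
  have disj: "U \<inter> S = {}"
  proof -
    have "T \<inter> S = {}" if "T \<in> \<U>" for T
      using partition_onD2[OF partition] that S by (intro disjointD) auto
    then show ?thesis
      by (auto simp: U_def)
  qed
  have Scase: "j \<in> S \<Longrightarrow> j < p" for j
    using sub by auto
  have C0: "0 \<le> C" if "j < p" for j
    using C[OF that] Lambda_nonneg[OF that] by linarith
  define h where "h = (\<lambda>j a. mv p B (mask U a) j)"
  define g where "g = (\<lambda>k a. mv p B (mask S a) k)"
  define qU where "qU = (\<lambda>a. Q B U a - Q0 B U)"
  define qS where "qS = (\<lambda>a. Q B S a - Q0 B S)"
  define X where "X = (\<lambda>a. \<Sum>j\<in>S. a j * h j a)"
  have maskM [measurable]: "(\<lambda>a. mask U a j) \<in> borel_measurable M" "(\<lambda>a. mask S a j) \<in> borel_measurable M" for j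
    using sub by auto
  have QM [measurable]: "Q B U \<in> borel_measurable M" "Q B S \<in> borel_measurable M"
    using sub by (auto intro: Q_measurable)
  have hM [measurable]: "h j \<in> borel_measurable M" "h j \<in> borel_measurable (PiM U (\<lambda>_. borel))" for j
    unfolding h_def by measurable
  have gM [measurable]: "g j \<in> borel_measurable M" "g j \<in> borel_measurable (PiM S (\<lambda>_. borel))" for j
    unfolding g_def by measurable
  have coordM [measurable]: "(\<lambda>a. a j) \<in> borel_measurable M" if "j \<in> U \<union> S" for j
    using that sub by (intro coord_measurable) auto
  have hr: "h j (restrict a U) = h j a" for j a
    by (simp add: h_def)
  have gr: "g j (restrict a S) = g j a" for j a
    by (simp add: g_def)
  have qUM: "qU \<in> borel_measurable M" "qU \<in> borel_measurable (PiM U (\<lambda>_. borel))" "\<And>a. qU (restrict a U) = qU a"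
    unfolding qU_def using Q_measurable(1) by (auto simp: Q_def)
  have qSM: "qS \<in> borel_measurable M" "qS \<in> borel_measurable (PiM S (\<lambda>_. borel))" "\<And>a. qS (restrict a S) = qS a"
    unfolding qS_def using Q_measurable(1) by (auto simp: Q_def)
  have qU2: "integrable M (\<lambda>a. (qU a)\<^sup>2)" and qS2: "integrable M (\<lambda>a. (qS a)\<^sup>2)"
    unfolding qU_def qS_def by (intro integrable_Q_sq sub)+
  have h_dot: "h j a = dot p a (mask U (B j))" for j a
    unfolding h_def mv_def dot_def mask_def by (intro sum.cong) auto
  have g_dot: "g j a = dot p a (mask S (B j))" for j a
    unfolding g_def mv_def dot_def mask_def by (intro sum.cong) auto
  have h2: "integrable M (\<lambda>a. (h j a)\<^sup>2)" and g2: "integrable M (\<lambda>a. (g j a)\<^sup>2)" for j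
    using integrable_residual_square[of "mask U (B j)" 0] integrable_residual_square[of "mask S (B j)" 0]
    by (simp_all add: h_dot g_dot)
  have c2: "integrable M (\<lambda>a. (a j)\<^sup>2)" if "j \<in> U \<union> S" for j
    using integrable_coord_prod[of j j] that sub by (auto simp: power2_eq_square)
  \<comment> \<open>Row j of a symmetric contraction has norm at most 1, being the image of a unit
    vector; masking it only shortens it.\<close>
  have hj2: "(\<integral>a. (h j a)\<^sup>2 \<partial>M) \<le> C" if j: "j < p" for j
  proof -
    have "(\<integral>a. (h j a)\<^sup>2 \<partial>M) = (\<Sum>k<p. (mask U (B j) k)\<^sup>2 * \<Lambda> k)"
      using residual_square_eq[of "mask U (B j)" 0] by (simp add: h_dot)
    also have "\<dots> \<le> (\<Sum>k<p. (B j k)\<^sup>2 * C)"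
      using C Lambda_nonneg by (intro sum_mono mult_mono) (auto simp: mask_def)
    also have "\<dots> = dot p (B j) (B j) * C"
      by (simp add: dot_def power2_eq_square sum_distrib_right)
    also have "\<dots> \<le> 1 * C"
    proof (rule mult_right_mono[OF _ C0[OF j]])
      let ?u = "\<lambda>i. if i = j then 1 else 0 :: real"
      have "mv p B ?u = B j"
        using j by (auto simp: mv_unit sym)
      moreover have "dot p ?u ?u = 1"
        using j by (simp add: dot_def if_distrib cong: if_cong)
      ultimately show "dot p (B j) (B j) \<le> 1"
        using contr[of ?u] by simp
    qed
    finally show ?thesis
      by simp
  qed
  note fac = factorize[OF S(1-3), folded U_def]
  have coordS: "(\<lambda>a. a j) \<in> borel_measurable (PiM S (\<lambda>_. borel))" "\<And>a :: nat \<Rightarrow> real. restrict a S j = a j"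
    "integrable M (\<lambda>a. a j)" if "j \<in> S" for j
    using that Scase by (auto intro: integrable_coord)
  have coordU: "(\<lambda>a. a j) \<in> borel_measurable (PiM U (\<lambda>_. borel))" "\<And>a :: nat \<Rightarrow> real. restrict a U j = a j"
    "integrable M (\<lambda>a. a j)" if "j \<in> U" for j
    using that sub by (auto intro: integrable_coord)
  \<comment> \<open>Each summand is a coordinate of the new block times a function of the old
    blocks; that coordinate has mean 0.\<close>
  have UX: "integrable M (\<lambda>a. qU a * X a)" "(\<integral>a. qU a * X a \<partial>M) = 0"
  proof -
    have ihq: "integrable M (\<lambda>a. h j a * qU a)" for j
      by (intro integrable_mult_of_squares hM qUM h2 qU2)
    have f: "integrable M (\<lambda>a. a j * (h j a * qU a))" "(\<integral>a. a j * (h j a * qU a) \<partial>M) = 0" if j: "j \<in> S" for j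
    proof -
      have m: "(\<lambda>a. h j a * qU a) \<in> borel_measurable (PiM U (\<lambda>_. borel))"
        using hM(2) qUM(2) by measurable
      show "integrable M (\<lambda>a. a j * (h j a * qU a))"
        by (rule fac(1)[OF coordS[OF j] m _ ihq]) (simp add: hr qUM(3))
      have "(\<integral>a. a j * (h j a * qU a) \<partial>M) = (\<integral>a. a j \<partial>M) * (\<integral>a. h j a * qU a \<partial>M)"
        by (rule fac(2)[OF coordS[OF j] m _ ihq]) (simp add: hr qUM(3))
      then show "(\<integral>a. a j * (h j a * qU a) \<partial>M) = 0"
        using mean[OF Scase[OF j]] by simp
    qed
    have eq: "qU a * X a = (\<Sum>j\<in>S. a j * (h j a * qU a))" for a
      by (simp add: X_def sum_distrib_left mult_ac)
    show "integrable M (\<lambda>a. qU a * X a)"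
      unfolding eq by (intro Bochner_Integration.integrable_sum f)
    show "(\<integral>a. qU a * X a \<partial>M) = 0"
      unfolding eq using f by (subst Bochner_Integration.integral_sum) auto
  qed
  have X_mask: "X a = dot p (mask S a) (mv p B (mask U a))" for a
  proof -
    have "X a = (\<Sum>j\<in>S. mask S a j * h j a)"
      unfolding X_def by (intro sum.cong) (auto simp: mask_def)
    also have "\<dots> = dot p (mask S a) (mv p B (mask U a))"
      unfolding dot_def h_def using sub by (intro sum.mono_neutral_left) (auto simp: mask_def)
    finally show ?thesis .
  qed
  \<comment> \<open>By symmetry of B the cross term can also be grouped by coordinates of the old
    blocks. In its product with \<open>qS\<close> these coordinates are the factors of mean
    0.\<close>
  have X_alt: "X a = (\<Sum>k\<in>U. g k a * a k)" for a
  proof -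
    have "X a = dot p (mask S a) (mv p B (mask U a))"
      by (rule X_mask)
    also have "\<dots> = dot p (mv p B (mask S a)) (mask U a)"
      by (rule dot_mv_sym[OF sym])
    also have "\<dots> = (\<Sum>k\<in>U. mv p B (mask S a) k * mask U a k)"
      unfolding dot_def using sub by (intro sum.mono_neutral_right) (auto simp: mask_def)
    also have "\<dots> = (\<Sum>k\<in>U. g k a * a k)"
      unfolding g_def by (intro sum.cong) (auto simp: mask_def)
    finally show ?thesis .
  qed
  have SX: "integrable M (\<lambda>a. X a * qS a)" "(\<integral>a. X a * qS a \<partial>M) = 0"
  proof -
    have igq: "integrable M (\<lambda>a. g k a * qS a)" for k
      by (intro integrable_mult_of_squares gM qSM g2 qS2)
    have f: "integrable M (\<lambda>a. (g k a * qS a) * a k)" "(\<integral>a. (g k a * qS a) * a k \<partial>M) = 0" if k: "k \<in> U" for k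
    proof -
      have m: "(\<lambda>a. g k a * qS a) \<in> borel_measurable (PiM S (\<lambda>_. borel))"
        using gM(2) qSM(2) by measurable
      show "integrable M (\<lambda>a. (g k a * qS a) * a k)"
        by (rule fac(1)[OF m _ igq coordU[OF k]]) (simp add: gr qSM(3))
      have "(\<integral>a. (g k a * qS a) * a k \<partial>M) = (\<integral>a. g k a * qS a \<partial>M) * (\<integral>a. a k \<partial>M)"
        by (rule fac(2)[OF m _ igq coordU[OF k]]) (simp add: gr qSM(3))
      then show "(\<integral>a. (g k a * qS a) * a k \<partial>M) = 0"
        using mean[of k] k sub by auto
    qed
    have eq: "X a * qS a = (\<Sum>k\<in>U. (g k a * qS a) * a k)" for a
      by (simp add: X_alt sum_distrib_left mult_ac)
    show "integrable M (\<lambda>a. X a * qS a)"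
      unfolding eq by (intro Bochner_Integration.integrable_sum f)
    show "(\<integral>a. X a * qS a \<partial>M) = 0"
      unfolding eq using f by (subst Bochner_Integration.integral_sum) auto
  qed
  have iqU: "integrable M qU" and iqS: "integrable M qS"
    unfolding qU_def qS_def using integrable_Q sub by auto
  have "(\<integral>a. qU a \<partial>M) = 0"
    unfolding qU_def using integrable_Q[OF sub(2)] expectation_Q[OF sub(2)] by (simp add: prob_space)
  then have US: "integrable M (\<lambda>a. qS a * qU a)" "(\<integral>a. qS a * qU a \<partial>M) = 0"
    using fac[OF qSM(2,3) iqS qUM(2,3) iqU] by auto
  \<comment> \<open>Within the block the covariance is diagonal, so only the terms with j = k
    survive; this gives a bound linear, not quadratic, in the block size.\<close>
  have XX: "integrable M (\<lambda>a. (X a)\<^sup>2)" "(\<integral>a. (X a)\<^sup>2 \<partial>M) \<le> card S * C\<^sup>2"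
  proof -
    have f: "integrable M (\<lambda>a. (a j * a k) * (h j a * h k a))"
      "(\<integral>a. (a j * a k) * (h j a * h k a) \<partial>M) = (if j = k then \<Lambda> j * (\<integral>a. (h j a)\<^sup>2 \<partial>M) else 0)" if jk: "j \<in> S" "k \<in> S" for j k
    proof -
      have m1: "(\<lambda>a. a j * a k) \<in> borel_measurable (PiM S (\<lambda>_. borel :: real measure))"
        using jk by measurable
      have m2: "(\<lambda>a. h j a * h k a) \<in> borel_measurable (PiM U (\<lambda>_. borel))"
        using hM(2) by measurable
      have i1: "integrable M (\<lambda>a. a j * a k)"
        using jk Scase by (intro integrable_coord_prod) auto
      have i2: "integrable M (\<lambda>a. h j a * h k a)"
        by (intro integrable_mult_of_squares hM h2)
      show "integrable M (\<lambda>a. (a j * a k) * (h j a * h k a))"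
        by (rule fac(1)[OF m1 _ i1 m2 _ i2]) (use jk in \<open>simp_all add: hr\<close>)
      have "(\<integral>a. (a j * a k) * (h j a * h k a) \<partial>M) = (\<integral>a. a j * a k \<partial>M) * (\<integral>a. h j a * h k a \<partial>M)"
        by (rule fac(2)[OF m1 _ i1 m2 _ i2]) (use jk in \<open>simp_all add: hr\<close>)
      then show "(\<integral>a. (a j * a k) * (h j a * h k a) \<partial>M) = (if j = k then \<Lambda> j * (\<integral>a. (h j a)\<^sup>2 \<partial>M) else 0)"
        using cov[OF Scase[OF jk(1)] Scase[OF jk(2)]] by (auto simp: power2_eq_square)
    qed
    have eq: "(X a)\<^sup>2 = (\<Sum>j\<in>S. \<Sum>k\<in>S. (a j * a k) * (h j a * h k a))" for a
      unfolding X_def power2_eq_square sum_product by (simp add: mult_ac)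
    show "integrable M (\<lambda>a. (X a)\<^sup>2)"
      unfolding eq by (intro Bochner_Integration.integrable_sum f)
    have "(\<integral>a. (X a)\<^sup>2 \<partial>M) = (\<Sum>j\<in>S. (\<integral>a. (\<Sum>k\<in>S. (a j * a k) * (h j a * h k a)) \<partial>M))"
      unfolding eq by (intro Bochner_Integration.integral_sum Bochner_Integration.integrable_sum f)
    also have "\<dots> = (\<Sum>j\<in>S. \<Sum>k\<in>S. (\<integral>a. (a j * a k) * (h j a * h k a) \<partial>M))"
      by (intro sum.cong refl Bochner_Integration.integral_sum f)
    also have "\<dots> = (\<Sum>j\<in>S. \<Sum>k\<in>S. if j = k then \<Lambda> j * (\<integral>a. (h j a)\<^sup>2 \<partial>M) else 0)"
      by (intro sum.cong refl f(2))
    also have "\<dots> = (\<Sum>j\<in>S. \<Lambda> j * (\<integral>a. (h j a)\<^sup>2 \<partial>M))"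
      using fin by (intro sum.cong refl) simp
    also have "\<dots> \<le> (\<Sum>j\<in>S. C * C)"
    proof (rule sum_mono)
      fix j assume "j \<in> S"
      note j = Scase[OF this]
      show "\<Lambda> j * (\<integral>a. (h j a)\<^sup>2 \<partial>M) \<le> C * C"
        using C[OF j] C0[OF j] hj2[OF j] by (intro mult_mono) auto
    qed
    finally show "(\<integral>a. (X a)\<^sup>2 \<partial>M) \<le> card S * C\<^sup>2"
      by (simp add: power2_eq_square)
  qed
  have tot: "Q B (U \<union> S) a - Q0 B (U \<union> S) = qU a + 2 * X a + qS a" for a
  proof -
    have "dot p (mask S a) (mv p B (mask U a)) = X a"
      by (simp only: X_mask)
    moreover have "dot p (mask U a) (mv p B (mask S a)) = dot p (mask S a) (mv p B (mask U a))"
      using dot_mv_sym[OF sym, where u = "mask U a" and v = "mask S a"] by (simp add: dot_commute)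
    moreover have "mv p B (\<lambda>j. mask U a j + mask S a j) = (\<lambda>j. mv p B (mask U a) j + mv p B (mask S a) j)"
      by (rule ext) (simp add: mv_def dot_add_right)
    moreover have "dot p (\<lambda>j. mask U a j + mask S a j) w = dot p (mask U a) w + dot p (mask S a) w" for w
      by (simp add: dot_def distrib_right sum.distrib)
    ultimately have "Q B (U \<union> S) a = Q B U a + 2 * X a + Q B S a"
      unfolding Q_def mask_Un[OF disj] by (simp add: dot_add_right)
    moreover have "Q0 B (U \<union> S) = Q0 B U + Q0 B S"
      unfolding Q0_def sum.distrib[symmetric] using disj by (intro sum.cong) auto
    ultimately show ?thesis
      by (simp add: qU_def qS_def)
  qed
  have "(qU a + 2 * X a + qS a)\<^sup>2 = (qU a)\<^sup>2 + 4 * (X a)\<^sup>2 + (qS a)\<^sup>2 + 4 * (qU a * X a) + 2 * (qS a * qU a) + 4 * (X a * qS a)" for a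
    by (simp add: power2_eq_square algebra_simps)
  then have "(\<integral>a. (Q B (U \<union> S) a - Q0 B (U \<union> S))\<^sup>2 \<partial>M) =
      (\<integral>a. (qU a)\<^sup>2 \<partial>M) + 4 * (\<integral>a. (X a)\<^sup>2 \<partial>M) + (\<integral>a. (qS a)\<^sup>2 \<partial>M)"
    unfolding tot using qU2 qS2 XX(1) UX SX US by simp
  also have "\<dots> \<le> (\<integral>a. (qU a)\<^sup>2 \<partial>M) + 4 * (card S * C\<^sup>2) + card S * (d * (1 + 512 * T ^ 8))"
    using XX(2) block_diagonal[OF S(1,4)] by (intro add_mono) (auto simp: qS_def)
  finally show ?thesis
    by (simp add: U_def[symmetric] qU_def algebra_simps)
qed

text \<open>Starting from the empty union, the increments of \<open>block_step\<close> are
  proportional to the block sizes, which add up to p.\<close>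

lemma quadratic_form_variance:
  assumes d: "\<And>S. S \<in> \<S> \<Longrightarrow> card S \<le> d" and C: "\<And>j. j < p \<Longrightarrow> \<Lambda> j \<le> C"
  shows "(\<integral>a. (dot p a (mv p B a) - (\<Sum>j<p. B j j * \<Lambda> j))\<^sup>2 \<partial>M) \<le> p * (d * (1 + 512 * T ^ 8) + 4 * C\<^sup>2)"
proof -
  let ?c = "d * (1 + 512 * T ^ 8) + 4 * C\<^sup>2"
  have fin: "finite \<S>"
    using partition finite_elements[of "{..<p}"] by blast
  have "(\<integral>a. (Q B (\<Union>\<U>) a - Q0 B (\<Union>\<U>))\<^sup>2 \<partial>M) \<le> (\<Sum>S\<in>\<U>. card S * ?c)" if "\<U> \<subseteq> \<S>" for \<U>
    using finite_subset[OF that fin] that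
  proof (induction \<U> rule: finite_induct)
    case empty
    then show ?case
      by (simp add: Q_def Q0_def mask_def dot_def)
  next
    case (insert S \<U>)
    have "(\<integral>a. (Q B (\<Union>\<U> \<union> S) a - Q0 B (\<Union>\<U> \<union> S))\<^sup>2 \<partial>M) \<le>
        (\<integral>a. (Q B (\<Union>\<U>) a - Q0 B (\<Union>\<U>))\<^sup>2 \<partial>M) + card S * ?c"
      using insert by (intro block_step d C) auto
    then show ?case
      using insert by (simp add: Un_commute)
  qed
  from this[of \<S>] have "(\<integral>a. (Q B {..<p} a - Q0 B {..<p})\<^sup>2 \<partial>M) \<le> (\<Sum>S\<in>\<S>. card S * ?c)"
    using partition_onD1[OF partition] by simp
  also have "\<dots> = (\<Sum>S\<in>\<S>. card S) * ?c"
    by (simp add: sum_distrib_right)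
  also have "(\<Sum>S\<in>\<S>. card S) = p"
  proof -
    have "card (\<Union>\<S>) = (\<Sum>S\<in>\<S>. card S)"
      using partition blocks_sub by (intro card_Union_disjoint) (auto simp: partition_on_def disjoint_def pairwise_def disjnt_def intro: finite_subset)
    moreover have "card (\<Union>\<S>) = p"
      by (subst partition_onD1[OF partition, symmetric]) simp
    ultimately show ?thesis
      by simp
  qed
  also have "(\<lambda>a. (Q B {..<p} a - Q0 B {..<p})\<^sup>2) = (\<lambda>a. (dot p a (mv p B a) - (\<Sum>j<p. B j j * \<Lambda> j))\<^sup>2)"
  proof
    fix a
    have "mv p B (mask {..<p} a) j = mv p B a j" for j
      unfolding mv_def by (rule dot_cong) (auto simp: mask_def)
    then have "Q B {..<p} a = dot p a (mv p B a)"
      unfolding Q_def by (intro dot_cong) (auto simp: mask_def)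
    then show "(Q B {..<p} a - Q0 B {..<p})\<^sup>2 = (dot p a (mv p B a) - (\<Sum>j<p. B j j * \<Lambda> j))\<^sup>2"
      by (simp add: Q0_def)
  qed
  finally show ?thesis .
qed

end

lemma row_law:
  assumes "\<And>S. S \<in> \<S> \<Longrightarrow> card S \<le> d" "\<And>j. j < p \<Longrightarrow> \<Lambda> j \<le> C"
  shows "row_law M p T (p * (d * (1 + 512 * T ^ 8) + 4 * C\<^sup>2)) \<Lambda>"
  by unfold_locales (rule quadratic_form_variance[OF _ _ assms])

end

section \<open>Random designs\<close>

lemma opt_risk_cong:
  assumes "\<And>i. i < n \<Longrightarrow> \<xi> i = \<xi>' i" "\<And>i j. i < n \<Longrightarrow> j < p \<Longrightarrow> R i j = R' i j"
  shows "opt_risk \<rho> n p \<beta> \<xi> R = opt_risk \<rho> n p \<beta> \<xi>' R'"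
proof -
  have "ploss \<rho> p {..<n} (\<lambda>i j. R i j / sqrt n) (\<lambda>i. \<xi> i + dot p (R i) \<beta>) b =
      ploss \<rho> p {..<n} (\<lambda>i j. R' i j / sqrt n) (\<lambda>i. \<xi>' i + dot p (R' i) \<beta>) b" for b
    unfolding ploss_def dot_def using assms by (intro arg_cong2[where f = "(+)"] arg_cong2[where f = "(/)"] sum.cong refl) simp
  then show ?thesis
    by (simp add: opt_risk_def pmin_def)
qed

text \<open>The common interface of the block dependent and the Gaussian design; \<open>A\<close>
  already contains the column scaling, so \<open>\<Lambda>\<close> is the covariance of a
  row.\<close>

locale regular_design = prob_space N for N :: "'a measure" +
  fixes n p d :: nat and T :: real and \<Lambda> :: "nat \<Rightarrow> real" and A :: "'a \<Rightarrow> nat \<Rightarrow> nat \<Rightarrow> real"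
  assumes n_pos: "0 < n" and T_pos: "0 < T"
    and iid: "iid_rows N n p A"
    and blocks: "i < n \<Longrightarrow> block_dependent N p d (\<lambda>\<omega>. A \<omega> i)"
    and mean: "i < n \<Longrightarrow> j < p \<Longrightarrow> (\<integral>\<omega>. A \<omega> i j \<partial>N) = 0"
    and cov: "i < n \<Longrightarrow> j < p \<Longrightarrow> k < p \<Longrightarrow> (\<integral>\<omega>. A \<omega> i j * A \<omega> i k \<partial>N) = (if j = k then \<Lambda> j else 0)"
    and subgaussian: "i < n \<Longrightarrow> dot p u u \<le> 1 \<Longrightarrow> (\<integral>\<^sup>+\<omega>. ennreal (exp ((dot p (A \<omega> i) u / T)\<^sup>2)) \<partial>N) \<le> 2"
begin

abbreviation rowspace :: "(nat \<Rightarrow> real) measure" where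
  "rowspace \<equiv> PiM {..<p} (\<lambda>_. borel)"

definition row :: "nat \<Rightarrow> 'a \<Rightarrow> nat \<Rightarrow> real" where
  "row i = random_vector {..<p} (\<lambda>\<omega>. A \<omega> i)"

definition rows :: "'a \<Rightarrow> nat \<Rightarrow> nat \<Rightarrow> real" where
  "rows \<omega> = (\<lambda>i\<in>{..<n}. row i \<omega>)"

definition law :: "(nat \<Rightarrow> real) measure" where
  "law = distr N rowspace (row 0)"

lemma row_measurable: "i < n \<Longrightarrow> row i \<in> measurable N rowspace"
  using iid by (auto simp: iid_rows_def row_def indep_vars_def)

lemma row_eq: "j < p \<Longrightarrow> row i \<omega> j = A \<omega> i j"
  by (simp add: row_def random_vector_def)

lemma dot_row: "dot p (row i \<omega>) u = dot p (A \<omega> i) u"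
  by (rule dot_cong) (simp_all add: row_eq)

lemma distr_row: "i < n \<Longrightarrow> distr N rowspace (row i) = law"
  using iid n_pos unfolding iid_rows_def law_def row_def by blast

lemma subgaussian_law: "subgaussian_law law p T \<Lambda>"
proof -
  have m [measurable]: "row 0 \<in> measurable N rowspace"
    by (rule row_measurable[OF n_pos])
  interpret L: prob_space law
    unfolding law_def by (rule prob_space_distr[OF m])
  have c [measurable]: "(\<lambda>a. a j) \<in> borel_measurable rowspace" if "j < p" for j
    using that by simp
  show ?thesis
  proof
    show "sets law = sets rowspace"
      by (simp add: law_def)
    show "0 < T"
      by (rule T_pos)
    fix j assume j: "j < p"
    have "(\<integral>a. a j \<partial>law) = (\<integral>\<omega>. row 0 \<omega> j \<partial>N)"
      unfolding law_def by (rule integral_distr[OF m c[OF j]])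
    then show "(\<integral>a. a j \<partial>law) = 0"
      using mean[OF n_pos j] j by (simp add: row_eq)
    fix k assume k: "k < p"
    have "(\<integral>a. a j * a k \<partial>law) = (\<integral>\<omega>. row 0 \<omega> j * row 0 \<omega> k \<partial>N)"
      unfolding law_def by (rule integral_distr[OF m borel_measurable_times[OF c[OF j] c[OF k]]])
    then show "(\<integral>a. a j * a k \<partial>law) = (if j = k then \<Lambda> j else 0)"
      using cov[OF n_pos j k] j k by (simp add: row_eq)
  next
    fix u :: "nat \<Rightarrow> real" assume u: "dot p u u \<le> 1"
    have "(\<lambda>a. dot p a u) \<in> borel_measurable rowspace"
      by (rule dot_measurable) simp_all
    then have "(\<lambda>a. ennreal (exp ((dot p a u / T)\<^sup>2))) \<in> borel_measurable rowspace"
      by measurable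
    then have "(\<integral>\<^sup>+a. ennreal (exp ((dot p a u / T)\<^sup>2)) \<partial>law) = (\<integral>\<^sup>+\<omega>. ennreal (exp ((dot p (row 0 \<omega>) u / T)\<^sup>2)) \<partial>N)"
      unfolding law_def by (subst nn_integral_distr[OF m]) simp_all
    then show "(\<integral>\<^sup>+a. ennreal (exp ((dot p a u / T)\<^sup>2)) \<partial>law) \<le> 2"
      using subgaussian[OF n_pos u] by (simp add: dot_row)
  qed
qed

text \<open>Independence is moved from the sample space to the law of a row by reading it as
  equality of the joint law with the product of the marginals, an equality that push-forwards
  respect. That characterization needs a nonempty family, so p = 0 is treated separately.\<close>

lemma block_law: "\<exists>\<S>. block_law law p T \<Lambda> \<S> \<and> (\<forall>S\<in>\<S>. card S \<le> d)"
proof -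
  have m: "row 0 \<in> measurable N rowspace"
    by (rule row_measurable[OF n_pos])
  obtain \<S> where part: "partition_on {..<p} \<S>" and d: "\<forall>S\<in>\<S>. card S \<le> d"
    and ind: "indep_vars (\<lambda>S. PiM S (\<lambda>_. borel)) (\<lambda>S. random_vector S (\<lambda>\<omega>. A \<omega> 0)) \<S>"
    using blocks[OF n_pos] unfolding block_dependent_def by blast
  interpret L: subgaussian_law law p T \<Lambda>
    by (rule subgaussian_law)
  let ?M = "\<lambda>S. PiM S (\<lambda>_. borel :: real measure)"
  have sub: "S \<subseteq> {..<p}" if "S \<in> \<S>" for S
    using part that by (auto simp: partition_on_def)
  have r: "(\<lambda>a. restrict a S) \<in> measurable rowspace (?M S)" if "S \<in> \<S>" for S
    using sub[OF that] by (rule measurable_restrict_subset)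
  have rl: "(\<lambda>a. restrict a S) \<in> measurable law (?M S)" if "S \<in> \<S>" for S
    using r[OF that] by (simp add: law_def)
  have rr: "restrict (row 0 \<omega>) S = random_vector S (\<lambda>\<omega>. A \<omega> 0) \<omega>" if "S \<in> \<S>" for S \<omega>
    using sub[OF that] by (auto simp: row_def random_vector_def fun_eq_iff)
  have "L.indep_vars ?M (\<lambda>S a. restrict a S) \<S>"
  proof (cases "\<S> = {}")
    case True
    then show ?thesis
      by (simp add: L.indep_vars_def L.indep_sets_def)
  next
    case False
    have all: "(\<lambda>a. \<lambda>S\<in>\<S>. restrict a S) \<in> measurable rowspace (PiM \<S> ?M)"
      by (rule measurable_restrict) (rule r)
    have "distr law (PiM \<S> ?M) (\<lambda>a. \<lambda>S\<in>\<S>. restrict a S) = distr N (PiM \<S> ?M) (\<lambda>\<omega>. \<lambda>S\<in>\<S>. restrict (row 0 \<omega>) S)"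
      unfolding law_def by (subst distr_distr[OF all m]) (simp add: comp_def)
    also have "(\<lambda>\<omega>. \<lambda>S\<in>\<S>. restrict (row 0 \<omega>) S) = (\<lambda>\<omega>. \<lambda>S\<in>\<S>. random_vector S (\<lambda>\<omega>. A \<omega> 0) \<omega>)"
      by (rule ext, rule restrict_ext, rule rr)
    also have "distr N (PiM \<S> ?M) \<dots> = PiM \<S> (\<lambda>S. distr N (?M S) (random_vector S (\<lambda>\<omega>. A \<omega> 0)))"
      using ind indep_vars_iff_distr_eq_PiM'[OF False, where M' = ?M and X = "\<lambda>S. random_vector S (\<lambda>\<omega>. A \<omega> 0)"]
      by (simp add: indep_vars_def)
    also have "\<dots> = PiM \<S> (\<lambda>S. distr law (?M S) (\<lambda>a. restrict a S))"
    proof (rule PiM_cong[OF refl])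
      fix S assume S: "S \<in> \<S>"
      have "distr law (?M S) (\<lambda>a. restrict a S) = distr N (?M S) (\<lambda>\<omega>. restrict (row 0 \<omega>) S)"
        unfolding law_def by (subst distr_distr[OF r[OF S] m]) (simp add: comp_def)
      then show "distr N (?M S) (random_vector S (\<lambda>\<omega>. A \<omega> 0)) = distr law (?M S) (\<lambda>a. restrict a S)"
        by (simp add: rr[OF S])
    qed
    finally have eq: "distr law (PiM \<S> ?M) (\<lambda>a. \<lambda>S\<in>\<S>. restrict a S) = PiM \<S> (\<lambda>S. distr law (?M S) (\<lambda>a. restrict a S))" .
    show ?thesis
      by (rule iffD2[OF L.indep_vars_iff_distr_eq_PiM'[OF False]]) (erule rl, rule eq)
  qed
  then have "block_law law p T \<Lambda> \<S>"
    using part by unfold_locales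
  then show ?thesis
    using d by blast
qed

lemma row_law:
  assumes "\<And>j. j < p \<Longrightarrow> \<Lambda> j \<le> C"
  shows "row_law law p T (p * (d * (1 + 512 * T ^ 8) + 4 * C\<^sup>2)) \<Lambda>"
  using block_law block_law.row_law assms by blast

lemma distr_rows: "distr N (PiM {..<n} (\<lambda>_. rowspace)) rows = PiM {..<n} (\<lambda>_. law)"
proof -
  have "indep_vars (\<lambda>_. rowspace) row {..<n}"
    using iid unfolding iid_rows_def row_def[abs_def] by simp
  moreover have "{..<n} \<noteq> {}"
    using n_pos by auto
  ultimately have "distr N (PiM {..<n} (\<lambda>_. rowspace)) (\<lambda>\<omega>. \<lambda>i\<in>{..<n}. row i \<omega>) = PiM {..<n} (\<lambda>i. distr N rowspace (row i))"
    using indep_vars_iff_distr_eq_PiM'[where I = "{..<n}" and X = row and M' = "\<lambda>_. rowspace"] row_measurable by simp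
  also have "\<dots> = PiM {..<n} (\<lambda>_. law)"
    by (rule PiM_cong) (simp_all add: distr_row)
  finally show ?thesis
    by (simp add: rows_def[abs_def])
qed

lemma rows_measurable: "rows \<in> measurable N (PiM {..<n} (\<lambda>_. rowspace))"
  unfolding rows_def by (rule measurable_restrict) (simp add: row_measurable)

lemma coord_measurable:
  assumes "i < n" "j < p"
  shows "(\<lambda>\<omega>. A \<omega> i j) \<in> borel_measurable N"
proof -
  have "(\<lambda>a. a j) \<in> borel_measurable rowspace"
    using assms by simp
  from measurable_comp[OF row_measurable[OF assms(1)] this] show ?thesis
    using assms by (simp add: comp_def row_eq)
qed

context
  fixes \<xi> :: "'a \<Rightarrow> nat \<Rightarrow> real"
  assumes \<xi>: "random_vector {..<n} \<xi> \<in> measurable N (PiM {..<n} (\<lambda>_. borel))"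
    and ind: "independent_of_design N n p A \<xi>"
begin

abbreviation "noise \<equiv> distr N (PiM {..<n} (\<lambda>_. borel)) (random_vector {..<n} \<xi>)"

text \<open>Independence of noise and design gives the product formula on rectangles, and these
  determine the joint law.\<close>

lemma distr_noise_rows:
  "distr N (PiM {..<n} (\<lambda>_. borel) \<Otimes>\<^sub>M PiM {..<n} (\<lambda>_. rowspace)) (\<lambda>\<omega>. (random_vector {..<n} \<xi> \<omega>, rows \<omega>)) =
    noise \<Otimes>\<^sub>M PiM {..<n} (\<lambda>_. law)"
proof (rule pair_measure_eqI[symmetric])
  let ?E = "PiM {..<n} (\<lambda>_. borel :: real measure)" and ?R = "PiM {..<n} (\<lambda>_. rowspace)"
  show "sigma_finite_measure noise"
    by (intro prob_space_imp_sigma_finite prob_space_distr \<xi>)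
  have "prob_space (PiM {..<n} (\<lambda>_. law))"
    using subgaussian_law by (intro prob_space_PiM) (simp add: subgaussian_law_def)
  then show "sigma_finite_measure (PiM {..<n} (\<lambda>_. law))"
    by (rule prob_space_imp_sigma_finite)
  have s: "sets (PiM {..<n} (\<lambda>_. law)) = sets ?R"
    by (rule sets_PiM_cong) (simp_all add: law_def)
  then show "sets (noise \<Otimes>\<^sub>M PiM {..<n} (\<lambda>_. law)) =
      sets (distr N (?E \<Otimes>\<^sub>M ?R) (\<lambda>\<omega>. (random_vector {..<n} \<xi> \<omega>, rows \<omega>)))"
    by (simp cong: sets_pair_measure_cong)
  fix a b assume a: "a \<in> sets noise" and b: "b \<in> sets (PiM {..<n} (\<lambda>_. law))"
  have a': "a \<in> sets ?E" and b': "b \<in> sets ?R"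
    using a b s by simp_all
  \<comment> \<open>The independence assumption concerns the matrix indexed by pairs. As
    \<open>rows\<close> is the measurable image of that matrix under \<open>g\<close>, events about
    the rows belong to the sigma-algebra of the assumption.\<close>
  define g where "g = (\<lambda>x :: nat \<times> nat \<Rightarrow> real. \<lambda>i\<in>{..<n}. \<lambda>j\<in>{..<p}. x (i, j))"
  have g: "g \<in> measurable (PiM ({..<n} \<times> {..<p}) (\<lambda>_. borel)) ?R"
    unfolding g_def
    by (intro measurable_restrict measurable_component_singleton) auto
  have rows_g: "rows \<omega> = g (random_matrix n p A \<omega>)" for \<omega>
    by (auto simp: rows_def row_def random_vector_def g_def random_matrix_def fun_eq_iff)
  have rm: "random_matrix n p A \<omega> \<in> space (PiM ({..<n} \<times> {..<p}) (\<lambda>_. borel))" for \<omega>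
    by (auto simp: random_matrix_def space_PiM)
  have "random_matrix n p A -` (g -` b \<inter> space (PiM ({..<n} \<times> {..<p}) (\<lambda>_. borel))) \<inter> space N \<in>
      sets (vimage_algebra (space N) (random_matrix n p A) (PiM ({..<n} \<times> {..<p}) (\<lambda>_. borel)))"
    by (intro in_vimage_algebra measurable_sets[OF g b'])
  also have "random_matrix n p A -` (g -` b \<inter> space (PiM ({..<n} \<times> {..<p}) (\<lambda>_. borel))) \<inter> space N = rows -` b \<inter> space N"
    using rm by (auto simp: rows_g)
  finally have B: "rows -` b \<inter> space N \<in> sets (vimage_algebra (space N) (random_matrix n p A) (PiM ({..<n} \<times> {..<p}) (\<lambda>_. borel)))" .
  have A: "random_vector {..<n} \<xi> -` a \<inter> space N \<in> sets (vimage_algebra (space N) (random_vector {..<n} \<xi>) ?E)"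
    by (intro in_vimage_algebra a')
  have "prob ((rows -` b \<inter> space N) \<inter> (random_vector {..<n} \<xi> -` a \<inter> space N)) =
      prob (rows -` b \<inter> space N) * prob (random_vector {..<n} \<xi> -` a \<inter> space N)"
    using ind B A unfolding independent_of_design_def by (rule indep_setD)
  moreover have "(\<lambda>\<omega>. (random_vector {..<n} \<xi> \<omega>, rows \<omega>)) -` (a \<times> b) \<inter> space N =
      (rows -` b \<inter> space N) \<inter> (random_vector {..<n} \<xi> -` a \<inter> space N)"
    by auto
  moreover have "(\<lambda>\<omega>. (random_vector {..<n} \<xi> \<omega>, rows \<omega>)) \<in> measurable N (?E \<Otimes>\<^sub>M ?R)"
    by (intro measurable_Pair \<xi> rows_measurable)
  moreover have "a \<times> b \<in> sets (?E \<Otimes>\<^sub>M ?R)"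
    using a' b' by (rule pair_measureI)
  ultimately have "emeasure (distr N (?E \<Otimes>\<^sub>M ?R) (\<lambda>\<omega>. (random_vector {..<n} \<xi> \<omega>, rows \<omega>))) (a \<times> b) =
      ennreal (prob (rows -` b \<inter> space N) * prob (random_vector {..<n} \<xi> -` a \<inter> space N))"
    by (simp add: emeasure_distr emeasure_eq_measure)
  moreover have "emeasure noise a = ennreal (prob (random_vector {..<n} \<xi> -` a \<inter> space N))"
    using \<xi> a' by (simp add: emeasure_distr emeasure_eq_measure)
  moreover have "emeasure (PiM {..<n} (\<lambda>_. law)) b = ennreal (prob (rows -` b \<inter> space N))"
    unfolding distr_rows[symmetric] using rows_measurable b' by (simp add: emeasure_distr emeasure_eq_measure)
  ultimately show "emeasure noise a * emeasure (PiM {..<n} (\<lambda>_. law)) b =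
      emeasure (distr N (?E \<Otimes>\<^sub>M ?R) (\<lambda>\<omega>. (random_vector {..<n} \<xi> \<omega>, rows \<omega>))) (a \<times> b)"
    by (simp add: ennreal_mult mult.commute)
qed

text \<open>Fubini with the noise in the outer integral: the exchange of rows can be carried out for
  fixed noise, and the noise law is shared by both designs.\<close>

lemma expectation_opt_risk:
  fixes \<psi> :: "real \<Rightarrow> real"
  assumes \<rho>: "coercive \<rho>" and \<psi>: "\<psi> \<in> borel_measurable borel" "\<And>x. \<bar>\<psi> x\<bar> \<le> C"
  shows "(\<integral>\<omega>. \<psi> (opt_risk \<rho> n p \<beta> (\<xi> \<omega>) (A \<omega>)) \<partial>N) =
    (\<integral>x. (\<integral>R. \<psi> (opt_risk \<rho> n p \<beta> x R) \<partial>PiM {..<n} (\<lambda>_. law)) \<partial>noise)"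
    and "(\<lambda>x. \<integral>R. \<psi> (opt_risk \<rho> n p \<beta> x R) \<partial>PiM {..<n} (\<lambda>_. law)) \<in> borel_measurable noise"
proof -
  let ?E = "PiM {..<n} (\<lambda>_. borel :: real measure)" and ?R = "PiM {..<n} (\<lambda>_. rowspace)"
  let ?P = "PiM {..<n} (\<lambda>_. law)"
  define f where "f = (\<lambda>z :: (nat \<Rightarrow> real) \<times> (nat \<Rightarrow> nat \<Rightarrow> real). \<psi> (opt_risk \<rho> n p \<beta> (fst z) (snd z)))"
  have "(\<lambda>z. opt_risk \<rho> n p \<beta> (fst z) (snd z)) \<in> borel_measurable (?E \<Otimes>\<^sub>M ?R)"
  proof (rule opt_risk_measurable[OF \<rho>])
    fix i j assume ij: "i < n" "j < p"
    have "(\<lambda>R. R i j) \<in> borel_measurable ?R"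
      using ij by (intro row_coord_measurable) auto
    from measurable_comp[OF measurable_snd this] show "(\<lambda>z. snd z i j) \<in> borel_measurable (?E \<Otimes>\<^sub>M ?R)"
      by (simp add: comp_def)
  next
    fix i assume "i < n"
    then have "(\<lambda>x. x i) \<in> borel_measurable ?E"
      by simp
    from measurable_comp[OF measurable_fst this] show "(\<lambda>z. fst z i) \<in> borel_measurable (?E \<Otimes>\<^sub>M ?R)"
      by (simp add: comp_def)
  qed
  from measurable_comp[OF this \<psi>(1)] have f: "f \<in> borel_measurable (?E \<Otimes>\<^sub>M ?R)"
    by (simp add: f_def comp_def)
  interpret Z: prob_space noise
    by (intro prob_space_distr \<xi>)
  have "prob_space ?P"
    using subgaussian_law by (intro prob_space_PiM) (simp add: subgaussian_law_def)
  then interpret P: prob_space ?P .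
  interpret ZP: pair_prob_space noise ?P ..
  have sP: "sets ?P = sets ?R"
    by (rule sets_PiM_cong) (simp_all add: law_def)
  have f': "f \<in> borel_measurable (noise \<Otimes>\<^sub>M ?P)"
    using f sP by (simp cong: measurable_cong_sets sets_pair_measure_cong)
  have "(\<integral>\<omega>. \<psi> (opt_risk \<rho> n p \<beta> (\<xi> \<omega>) (A \<omega>)) \<partial>N) = (\<integral>\<omega>. f (random_vector {..<n} \<xi> \<omega>, rows \<omega>) \<partial>N)"
    unfolding f_def
    by (intro Bochner_Integration.integral_cong refl arg_cong[where f = \<psi>] opt_risk_cong)
       (simp_all add: random_vector_def rows_def row_eq)
  also have "\<dots> = (\<integral>z. f z \<partial>distr N (?E \<Otimes>\<^sub>M ?R) (\<lambda>\<omega>. (random_vector {..<n} \<xi> \<omega>, rows \<omega>)))"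
    using integral_distr[OF measurable_Pair[OF \<xi> rows_measurable] f] by simp
  also have "\<dots> = (\<integral>z. f z \<partial>(noise \<Otimes>\<^sub>M ?P))"
    by (simp only: distr_noise_rows)
  also have "\<dots> = (\<integral>x. (\<integral>R. f (x, R) \<partial>?P) \<partial>noise)"
    by (rule ZP.integral_fst'[symmetric]) (rule ZP.integrable_const_bound[of _ C], use \<psi> f' in \<open>auto simp: f_def\<close>)
  finally show "(\<integral>\<omega>. \<psi> (opt_risk \<rho> n p \<beta> (\<xi> \<omega>) (A \<omega>)) \<partial>N) =
    (\<integral>x. (\<integral>R. \<psi> (opt_risk \<rho> n p \<beta> x R) \<partial>PiM {..<n} (\<lambda>_. law)) \<partial>noise)"
    by (simp add: f_def)
  show "(\<lambda>x. \<integral>R. \<psi> (opt_risk \<rho> n p \<beta> x R) \<partial>PiM {..<n} (\<lambda>_. law)) \<in> borel_measurable noise"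
    using P.borel_measurable_lebesgue_integral[of "\<lambda>x R. f (x, R)" noise] f' by (simp add: f_def case_prod_beta')
qed

end

end

text \<open>The infimum in the norm need not be attained, so one unit of room is added to find an
  admissible t below s. The absolute value covers a negative K, for which \<open>ennreal K\<close>
  is 0.\<close>

lemma psi2_norm_bound:
  assumes "psi2_norm M Z \<le> ennreal K" "\<bar>K\<bar> + 1 \<le> s"
  shows "(\<integral>\<^sup>+\<omega>. ennreal (exp ((Z \<omega> / s)\<^sup>2)) \<partial>M) \<le> 2"
proof -
  have "ennreal K < ennreal (\<bar>K\<bar> + 1)"
    by (rule ennreal_lessI) auto
  then have "psi2_norm M Z < ennreal (\<bar>K\<bar> + 1)"
    using assms(1) by (rule order_le_less_trans[rotated])
  then obtain t where t: "0 < t" "(\<integral>\<^sup>+\<omega>. ennreal (exp ((Z \<omega> / t)\<^sup>2)) \<partial>M) \<le> 2" "ennreal t < ennreal (\<bar>K\<bar> + 1)"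
    unfolding psi2_norm_def INF_less_iff by auto
  have "t < \<bar>K\<bar> + 1"
    using t(3) by (subst (asm) ennreal_less_iff) (use t(1) in auto)
  then have ts: "t \<le> s"
    using assms(2) by linarith
  have "(\<integral>\<^sup>+\<omega>. ennreal (exp ((Z \<omega> / s)\<^sup>2)) \<partial>M) \<le> (\<integral>\<^sup>+\<omega>. ennreal (exp ((Z \<omega> / t)\<^sup>2)) \<partial>M)"
  proof (intro nn_integral_mono ennreal_leI)
    fix \<omega>
    have "(Z \<omega>)\<^sup>2 / s\<^sup>2 \<le> (Z \<omega>)\<^sup>2 / t\<^sup>2"
      using t(1) ts by (intro divide_left_mono power_mono mult_pos_pos) auto
    then show "exp ((Z \<omega> / s)\<^sup>2) \<le> exp ((Z \<omega> / t)\<^sup>2)"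
      by (simp add: power_divide)
  qed
  then show ?thesis
    using t(2) by (rule order_trans)
qed

lemma (in prob_space) power8_moment_of_psi2:
  assumes Z [measurable]: "Z \<in> borel_measurable M" and K: "psi2_norm M Z \<le> ennreal K"
  shows "integrable M (\<lambda>\<omega>. (Z \<omega>) ^ 8)" and "(\<integral>\<omega>. (Z \<omega>) ^ 8 \<partial>M) \<le> 512 * (\<bar>K\<bar> + 1) ^ 8"
proof -
  define s where "s = \<bar>K\<bar> + 1"
  have s: "0 < s"
    by (simp add: s_def)
  have le: "(Z \<omega>) ^ 8 \<le> (256 * s ^ 8) * exp ((Z \<omega> / s)\<^sup>2)" for \<omega>
  proof -
    have "(Z \<omega>) ^ 8 = (Z \<omega> / s) ^ 8 * s ^ 8"
      using s by (simp flip: power_mult_distrib)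
    also have "\<dots> \<le> (256 * exp ((Z \<omega> / s)\<^sup>2)) * s ^ 8"
      using s by (intro mult_right_mono power8_le_exp) auto
    finally show ?thesis
      by (simp add: mult_ac)
  qed
  have e: "(\<integral>\<^sup>+\<omega>. ennreal (exp ((Z \<omega> / s)\<^sup>2)) \<partial>M) \<le> ennreal 2"
    using psi2_norm_bound[OF K, of s] by (simp add: s_def)
  have "integrable M (\<lambda>\<omega>. (Z \<omega>) ^ 8)" "(\<integral>\<omega>. (Z \<omega>) ^ 8 \<partial>M) \<le> (256 * s ^ 8) * 2"
    by (rule integrable_of_nn_integral_bound[OF _ _ le _ _ e]; use s in \<open>simp; measurable\<close>)+
  then show "integrable M (\<lambda>\<omega>. (Z \<omega>) ^ 8)" "(\<integral>\<omega>. (Z \<omega>) ^ 8 \<partial>M) \<le> 512 * (\<bar>K\<bar> + 1) ^ 8"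
    by (simp_all add: s_def)
qed

section \<open>The block dependent and the Gaussian design as instances\<close>

lemma dot_scale_columns: "dot p (scale_columns \<Lambda> A i) u = dot p (A i) (\<lambda>j. sqrt (\<Lambda> j) * u j)"
  by (simp add: dot_def scale_columns_def mult_ac)

lemma dot_sqrt_le:
  assumes "\<And>j. j < p \<Longrightarrow> 0 \<le> \<Lambda> j \<and> \<Lambda> j \<le> C" "dot p u u \<le> 1" "0 \<le> C"
  shows "dot p (\<lambda>j. sqrt (\<Lambda> j) * u j) (\<lambda>j. sqrt (\<Lambda> j) * u j) \<le> C"
proof -
  have "dot p (\<lambda>j. sqrt (\<Lambda> j) * u j) (\<lambda>j. sqrt (\<Lambda> j) * u j) = (\<Sum>j<p. \<Lambda> j * (u j * u j))"
    unfolding dot_def using assms(1) by (intro sum.cong refl) (simp add: mult_ac flip: real_sqrt_mult)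
  also have "\<dots> \<le> (\<Sum>j<p. C * (u j * u j))"
    using assms(1) by (intro sum_mono mult_right_mono) auto
  also have "\<dots> = C * dot p u u"
    by (simp add: dot_def sum_distrib_left)
  also have "\<dots> \<le> C * 1"
    using assms by (intro mult_left_mono)
  finally show ?thesis
    by simp
qed

text \<open>The square root of \<Lambda> is moved from the row to the test vector, which maps the
  unit ball into the ball of radius sqrt C; hence the factor sqrt C in the condition on
  \<open>T\<close>.\<close>

lemma regular_design_subgaussian:
  fixes N :: "'a measure"
  assumes "prob_space N" and n: "0 < n" and c: "0 < c" and T: "(\<bar>K\<bar> + 1) * sqrt C \<le> T"
    and iid: "iid_rows N n p (\<lambda>\<omega>. scale_columns \<Lambda> (X \<omega>))"
    and blocks: "\<And>i. i < n \<Longrightarrow> block_dependent N p d (\<lambda>\<omega>. scale_columns \<Lambda> (X \<omega>) i)"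
    and mean: "\<And>i j. i < n \<Longrightarrow> j < p \<Longrightarrow> (\<integral>\<omega>. X \<omega> i j \<partial>N) = 0"
    and cov: "\<And>i j k. i < n \<Longrightarrow> j < p \<Longrightarrow> k < p \<Longrightarrow> (\<integral>\<omega>. X \<omega> i j * X \<omega> i k \<partial>N) = (if j = k then 1 else 0)"
    and psi2: "\<And>i. i < n \<Longrightarrow> psi2_norm_vec N p (\<lambda>\<omega>. X \<omega> i) \<le> ennreal K"
    and \<Lambda>: "\<And>j. j < p \<Longrightarrow> c \<le> \<Lambda> j \<and> \<Lambda> j \<le> C" and C: "0 < C"
  shows "regular_design N n p d T \<Lambda> (\<lambda>\<omega>. scale_columns \<Lambda> (X \<omega>))"
proof -
  interpret prob_space N by fact
  have "0 < (\<bar>K\<bar> + 1) * sqrt C"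
    using C by (intro mult_pos_pos) auto
  then have T_pos: "0 < T"
    using T by linarith
  show ?thesis
  proof
    show "0 < n" "0 < T" "iid_rows N n p (\<lambda>\<omega>. scale_columns \<Lambda> (X \<omega>))"
      using n T_pos iid by auto
    fix i assume i: "i < n"
    show "block_dependent N p d (\<lambda>\<omega>. scale_columns \<Lambda> (X \<omega>) i)"
      by (rule blocks[OF i])
    fix j assume j: "j < p"
    show "(\<integral>\<omega>. scale_columns \<Lambda> (X \<omega>) i j \<partial>N) = 0"
      using mean[OF i j] by (simp add: scale_columns_def)
    fix k assume k: "k < p"
    have "(\<integral>\<omega>. scale_columns \<Lambda> (X \<omega>) i j * scale_columns \<Lambda> (X \<omega>) i k \<partial>N) =
        (\<integral>\<omega>. (sqrt (\<Lambda> j) * sqrt (\<Lambda> k)) * (X \<omega> i j * X \<omega> i k) \<partial>N)"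
      by (simp add: scale_columns_def mult_ac)
    also have "\<dots> = (sqrt (\<Lambda> j) * sqrt (\<Lambda> k)) * (if j = k then 1 else 0)"
      using cov[OF i j k] by (subst integral_mult_right_zero) simp
    finally have *: "(\<integral>\<omega>. scale_columns \<Lambda> (X \<omega>) i j * scale_columns \<Lambda> (X \<omega>) i k \<partial>N) = (sqrt (\<Lambda> j) * sqrt (\<Lambda> k)) * (if j = k then 1 else 0)" .
    show "(\<integral>\<omega>. scale_columns \<Lambda> (X \<omega>) i j * scale_columns \<Lambda> (X \<omega>) i k \<partial>N) = (if j = k then \<Lambda> j else 0)"
    proof -
      have "0 \<le> \<Lambda> j" "0 \<le> \<Lambda> k"
        using \<Lambda>[OF j] \<Lambda>[OF k] c by linarith+
      then show ?thesis
        using * by simp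
    qed
  next
    fix i and u :: "nat \<Rightarrow> real" assume i: "i < n" and u: "dot p u u \<le> 1"
    define w where "w = (\<lambda>j. sqrt (\<Lambda> j) * u j)"
    have wC: "dot p w w \<le> C"
      unfolding w_def using \<Lambda> c C by (intro dot_sqrt_le u) force+
    show "(\<integral>\<^sup>+\<omega>. ennreal (exp ((dot p (scale_columns \<Lambda> (X \<omega>) i) u / T)\<^sup>2)) \<partial>N) \<le> 2"
    proof (cases "dot p w w = 0")
      case True
      have "(dot p a w)\<^sup>2 \<le> 0" for a
        using dot_cs[of p a w] True by simp
      then show ?thesis
        by (simp add: dot_scale_columns w_def[symmetric] emeasure_space_1)
    next
      case False
      define l where "l = sqrt (dot p w w)"
      have l: "0 < l" "l\<^sup>2 = dot p w w"
        using False dot_self_nonneg[of p w] by (auto simp: l_def less_le simp del: dot_self_nonneg)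
      define v where "v = (\<lambda>j. 1 / l * w j)"
      have v: "dot p a v = dot p a w / l" for a
        unfolding v_def dot_scale_right by simp
      have "dot p v v = 1"
        unfolding v unfolding v_def dot_scale_left using l False by (simp add: power2_eq_square flip: l(2))
      then have "psi2_norm N (\<lambda>\<omega>. \<Sum>j<p. v j * X \<omega> i j) \<le> psi2_norm_vec N p (\<lambda>\<omega>. X \<omega> i)"
        unfolding psi2_norm_vec_def by (intro SUP_upper) (simp add: dot_def power2_eq_square)
      also have "\<dots> \<le> ennreal K"
        by (rule psi2[OF i])
      also have "(\<lambda>\<omega>. \<Sum>j<p. v j * X \<omega> i j) = (\<lambda>\<omega>. dot p (X \<omega> i) v)"
        by (simp add: dot_def mult.commute)
      finally have P: "psi2_norm N (\<lambda>\<omega>. dot p (X \<omega> i) v) \<le> ennreal K" .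
      have "\<bar>K\<bar> + 1 \<le> T / l"
      proof -
        have "l \<le> sqrt C"
          unfolding l_def using wC by simp
        then have "(\<bar>K\<bar> + 1) * l \<le> (\<bar>K\<bar> + 1) * sqrt C"
          by (intro mult_left_mono) auto
        then show ?thesis
          using T l(1) by (simp add: field_simps)
      qed
      from psi2_norm_bound[OF P this] show ?thesis
        using l(1) by (simp add: v dot_scale_columns w_def[symmetric])
    qed
  qed
qed

text \<open>The normal density with variance s^2 times exp (x^2 / (4 s^2)) is sqrt 2 times the
  normal density with variance 2 s^2; therefore the integral is at most sqrt 2.\<close>

lemma (in prob_space) normal_exp_square:
  assumes Z: "distributed M lborel Z (normal_density 0 s)" and s: "0 < s" "4 * s\<^sup>2 \<le> T\<^sup>2"
  shows "(\<integral>\<^sup>+\<omega>. ennreal (exp ((Z \<omega> / T)\<^sup>2)) \<partial>M) \<le> 2"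
proof -
  have "0 < 4 * s\<^sup>2"
    using s by simp
  then have T: "0 < T\<^sup>2"
    using s by linarith
  have "(\<integral>\<^sup>+\<omega>. ennreal (exp ((Z \<omega> / T)\<^sup>2)) \<partial>M) = (\<integral>\<^sup>+x. ennreal (normal_density 0 s x) * ennreal (exp ((x / T)\<^sup>2)) \<partial>lborel)"
    by (rule distributed_nn_integral[OF Z, symmetric]) simp
  also have "\<dots> \<le> (\<integral>\<^sup>+x. ennreal (sqrt 2) * ennreal (normal_density 0 (sqrt 2 * s) x) \<partial>lborel)"
  proof (rule nn_integral_mono)
    fix x
    have "x\<^sup>2 / T\<^sup>2 \<le> x\<^sup>2 / (4 * s\<^sup>2)"
      using s T by (intro divide_left_mono) auto
    then have "normal_density 0 s x * exp ((x / T)\<^sup>2) \<le> normal_density 0 s x * exp (x\<^sup>2 / (4 * s\<^sup>2))"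
      by (intro mult_left_mono) (auto simp: power_divide)
    also have "\<dots> = 1 / sqrt (2 * pi * s\<^sup>2) * exp (- (x\<^sup>2 / (2 * s\<^sup>2)) + x\<^sup>2 / (4 * s\<^sup>2))"
      unfolding exp_add by (simp add: normal_density_def)
    also have "- (x\<^sup>2 / (2 * s\<^sup>2)) + x\<^sup>2 / (4 * s\<^sup>2) = - (x\<^sup>2 / (4 * s\<^sup>2))"
      using s by (simp add: field_simps)
    also have "1 / sqrt (2 * pi * s\<^sup>2) * exp (- (x\<^sup>2 / (4 * s\<^sup>2))) = sqrt 2 * normal_density 0 (sqrt 2 * s) x"
      using s by (simp add: normal_density_def power_mult_distrib real_sqrt_mult field_simps)
    finally show "ennreal (normal_density 0 s x) * ennreal (exp ((x / T)\<^sup>2)) \<le> ennreal (sqrt 2) * ennreal (normal_density 0 (sqrt 2 * s) x)"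
      by (simp add: ennreal_leI flip: ennreal_mult)
  qed
  also have "\<dots> = ennreal (sqrt 2) * (\<integral>\<^sup>+x. ennreal (normal_density 0 (sqrt 2 * s) x) \<partial>lborel)"
    by (rule nn_integral_cmult) simp
  also have "(\<integral>\<^sup>+x. ennreal (normal_density 0 (sqrt 2 * s) x) \<partial>lborel) = 1"
    using s by (subst nn_integral_eq_integral) auto
  also have "ennreal (sqrt 2) * 1 \<le> ennreal 2"
    using real_sqrt_le_iff[of 2 4] by (simp add: ennreal_leI del: ennreal_numeral)
  finally show ?thesis
    by simp
qed

text \<open>Independent entries form blocks of size 1, and a linear form in a row is normal with
  variance at most C, so its exponential moment is explicit.\<close>

lemma regular_design_gaussian:
  fixes N :: "'a measure" and G :: "'a \<Rightarrow> nat \<Rightarrow> nat \<Rightarrow> real"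
  assumes "prob_space N" and n: "0 < n" and c: "0 < c" and C: "0 < C" and T: "2 * sqrt C \<le> T"
    and ind: "prob_space.indep_vars N (\<lambda>_. borel) (\<lambda>(i, j) \<omega>. G \<omega> i j) ({..<n} \<times> {..<p})"
    and normal: "\<And>i j. i < n \<Longrightarrow> j < p \<Longrightarrow> distributed N lborel (\<lambda>\<omega>. G \<omega> i j) std_normal_density"
    and \<Lambda>: "\<And>j. j < p \<Longrightarrow> c \<le> \<Lambda> j \<and> \<Lambda> j \<le> C"
  shows "regular_design N n p 1 T \<Lambda> (\<lambda>\<omega>. scale_columns \<Lambda> (G \<omega>))"
proof -
  interpret prob_space N by fact
  let ?A = "\<lambda>\<omega>. scale_columns \<Lambda> (G \<omega>)"
  have "0 < 2 * sqrt C"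
    using C by simp
  then have T_pos: "0 < T"
    using T by linarith
  have m: "(\<lambda>\<omega>. G \<omega> i j) \<in> borel_measurable N" if "i < n" "j < p" for i j
    using ind that by (auto simp: indep_vars_def)
  have mA: "(\<lambda>\<omega>. ?A \<omega> i j) \<in> borel_measurable N" if "i < n" "j < p" for i j
    unfolding scale_columns_def using m[OF that] by measurable
  have indA: "indep_vars (\<lambda>_. borel) (\<lambda>(i, j) \<omega>. ?A \<omega> i j) ({..<n} \<times> {..<p})"
  proof -
    have "indep_vars (\<lambda>_. borel) (\<lambda>ij x. (\<lambda>t. t * sqrt (\<Lambda> (snd ij))) ((case ij of (i, j) \<Rightarrow> \<lambda>\<omega>. G \<omega> i j) x)) ({..<n} \<times> {..<p})"
      by (rule indep_vars_compose2[OF ind]) simp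
    then show ?thesis
      by (rule indep_vars_cong[THEN iffD1, rotated -1]) (auto simp: scale_columns_def)
  qed
  have row_indep: "indep_vars (\<lambda>_. borel) (\<lambda>j \<omega>. Y \<omega> i j) {..<p}"
    if i: "i < n" and Y: "indep_vars (\<lambda>_. borel) (\<lambda>(i, j) \<omega>. Y \<omega> i j) ({..<n} \<times> {..<p})" for i and Y :: "'a \<Rightarrow> nat \<Rightarrow> nat \<Rightarrow> real"
  proof -
    have "indep_vars (\<lambda>j. PiM {(i, j)} (\<lambda>_. borel)) (\<lambda>j \<omega>. restrict (\<lambda>ij. (case ij of (i, j) \<Rightarrow> \<lambda>\<omega>. Y \<omega> i j) \<omega>) {(i, j)}) {..<p}"
      by (rule indep_vars_restrict[OF Y]) (use i in \<open>auto simp: disjoint_family_on_def\<close>)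
    then have "indep_vars (\<lambda>_. borel) (\<lambda>j \<omega>. (\<lambda>x. x (i, j)) (restrict (\<lambda>ij. (case ij of (i, j) \<Rightarrow> \<lambda>\<omega>. Y \<omega> i j) \<omega>) {(i, j)})) {..<p}"
      by (rule indep_vars_compose2) simp
    then show ?thesis
      by simp
  qed
  have rows_indep: "indep_vars (\<lambda>_. PiM {..<p} (\<lambda>_. borel)) (\<lambda>i. random_vector {..<p} (\<lambda>\<omega>. ?A \<omega> i)) {..<n}"
  proof -
    let ?K = "\<lambda>i. {i} \<times> {..<p}"
    have "indep_vars (\<lambda>i. PiM (?K i) (\<lambda>_. borel)) (\<lambda>i \<omega>. restrict (\<lambda>ij. (case ij of (i, j) \<Rightarrow> \<lambda>\<omega>. ?A \<omega> i j) \<omega>) (?K i)) {..<n}"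
      by (rule indep_vars_restrict[OF indA]) (auto simp: disjoint_family_on_def)
    then have "indep_vars (\<lambda>_. PiM {..<p} (\<lambda>_. borel))
        (\<lambda>i \<omega>. (\<lambda>x. \<lambda>j\<in>{..<p}. x (i, j)) (restrict (\<lambda>ij. (case ij of (i, j) \<Rightarrow> \<lambda>\<omega>. ?A \<omega> i j) \<omega>) (?K i))) {..<n}"
      by (rule indep_vars_compose2) (intro measurable_restrict measurable_component_singleton, simp)
    then show ?thesis
      by (rule indep_vars_cong[THEN iffD1, rotated -1]) (auto simp: random_vector_def fun_eq_iff)
  qed
  have distr_entry: "distr N borel (\<lambda>\<omega>. ?A \<omega> i j) = distr (density lborel std_normal_density) borel (\<lambda>t. t * sqrt (\<Lambda> j))"
    if "i < n" "j < p" for i j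
  proof -
    have "distr (distr N lborel (\<lambda>\<omega>. G \<omega> i j)) borel (\<lambda>t. t * sqrt (\<Lambda> j)) = distr N borel (\<lambda>\<omega>. ?A \<omega> i j)"
      using m[OF that] by (subst distr_distr) (auto simp: comp_def scale_columns_def)
    then show ?thesis
      using distributed_distr_eq_density[OF normal[OF that]] by simp
  qed
  have distr_row: "distr N (PiM {..<p} (\<lambda>_. borel)) (random_vector {..<p} (\<lambda>\<omega>. ?A \<omega> i)) =
      distr N (PiM {..<p} (\<lambda>_. borel)) (random_vector {..<p} (\<lambda>\<omega>. ?A \<omega> i'))" if ii: "i < n" "i' < n" for i i'
  proof (cases "p = 0")
    case True
    then show ?thesis
      by (simp add: random_vector_def[abs_def] restrict_def)
  next
    case False
    have "distr N (PiM {..<p} (\<lambda>_. borel)) (\<lambda>\<omega>. \<lambda>j\<in>{..<p}. ?A \<omega> i j) = PiM {..<p} (\<lambda>j. distr (density lborel std_normal_density) borel (\<lambda>t. t * sqrt (\<Lambda> j)))"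
      if i: "i < n" for i
    proof -
      have "distr N (PiM {..<p} (\<lambda>_. borel)) (\<lambda>\<omega>. \<lambda>j\<in>{..<p}. ?A \<omega> i j) = PiM {..<p} (\<lambda>j. distr N borel (\<lambda>\<omega>. ?A \<omega> i j))"
        by (rule iffD1[OF indep_vars_iff_distr_eq_PiM' row_indep[OF i indA]]) (use False i mA in auto)
      also have "\<dots> = PiM {..<p} (\<lambda>j. distr (density lborel std_normal_density) borel (\<lambda>t. t * sqrt (\<Lambda> j)))"
        by (rule PiM_cong) (simp_all add: distr_entry[OF i])
      finally show ?thesis .
    qed
    from this[OF ii(1)] this[OF ii(2)] show ?thesis
      by (simp add: random_vector_def[abs_def] restrict_def)
  qed
  have EG: "integrable N (\<lambda>\<omega>. G \<omega> i j)" "(\<integral>\<omega>. G \<omega> i j \<partial>N) = 0" "(\<integral>\<omega>. (G \<omega> i j)\<^sup>2 \<partial>N) = 1" if ij: "i < n" "j < p" for i j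
  proof -
    note D = normal[OF ij]
    show "integrable N (\<lambda>\<omega>. G \<omega> i j)"
      using distributed_integrable[OF D, of "\<lambda>x. x"] integrable_std_normal_moment[of 1] by simp
    show z: "(\<integral>\<omega>. G \<omega> i j \<partial>N) = 0"
      by (rule standard_normal_distributed_expectation[OF D])
    show "(\<integral>\<omega>. (G \<omega> i j)\<^sup>2 \<partial>N) = 1"
      using standard_normal_distributed_variance[OF D] z by simp
  qed
  have cov: "(\<integral>\<omega>. G \<omega> i j * G \<omega> i k \<partial>N) = (if j = k then 1 else 0)" if i: "i < n" and j: "j < p" and k: "k < p" for i j k
  proof (cases "j = k")
    case True
    then show ?thesis
      using EG(3)[OF i j] by (simp add: power2_eq_square)
  next
    case False
    have "indep_vars (\<lambda>_. borel) (\<lambda>j \<omega>. G \<omega> i j) {j, k}"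
      by (rule indep_vars_subset[OF row_indep[OF i ind]]) (use j k in auto)
    then have "(\<integral>\<omega>. (\<Prod>l\<in>{j, k}. G \<omega> i l) \<partial>N) = (\<Prod>l\<in>{j, k}. (\<integral>\<omega>. G \<omega> i l \<partial>N))"
      using i j k EG(1) by (intro indep_vars_lebesgue_integral) auto
    then show ?thesis
      using False EG(2)[OF i j] by simp
  qed
  show ?thesis
  proof
    show "0 < n" "0 < T"
      using n T_pos by auto
    show "iid_rows N n p ?A"
      unfolding iid_rows_def using rows_indep distr_row by blast
    fix i assume i: "i < n"
    show "block_dependent N p 1 (\<lambda>\<omega>. ?A \<omega> i)"
      unfolding block_dependent_def
    proof (intro exI[of _ "(\<lambda>j. {j}) ` {..<p}"] conjI)
      show "partition_on {..<p} ((\<lambda>j. {j}) ` {..<p})"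
        by (auto simp: partition_on_def disjoint_def)
      show "\<forall>S\<in>(\<lambda>j. {j}) ` {..<p}. card S \<le> 1"
        by auto
      show "indep_vars (\<lambda>S. PiM S (\<lambda>_. borel)) (\<lambda>S. random_vector S (\<lambda>\<omega>. ?A \<omega> i)) ((\<lambda>j. {j}) ` {..<p})"
        unfolding random_vector_def[abs_def]
        by (rule indep_vars_restrict[OF row_indep[OF i indA]]) (auto simp: disjoint_family_on_def)
    qed
    fix j assume j: "j < p"
    show "(\<integral>\<omega>. ?A \<omega> i j \<partial>N) = 0"
      using EG(2)[OF i j] by (simp add: scale_columns_def)
    fix k assume k: "k < p"
    have "(\<integral>\<omega>. ?A \<omega> i j * ?A \<omega> i k \<partial>N) = (\<integral>\<omega>. (sqrt (\<Lambda> j) * sqrt (\<Lambda> k)) * (G \<omega> i j * G \<omega> i k) \<partial>N)"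
      by (simp add: scale_columns_def mult_ac)
    also have "\<dots> = (sqrt (\<Lambda> j) * sqrt (\<Lambda> k)) * (if j = k then 1 else 0)"
      using cov[OF i j k] by (subst integral_mult_right_zero) simp
    finally have *: "(\<integral>\<omega>. ?A \<omega> i j * ?A \<omega> i k \<partial>N) = (sqrt (\<Lambda> j) * sqrt (\<Lambda> k)) * (if j = k then 1 else 0)" .
    show "(\<integral>\<omega>. ?A \<omega> i j * ?A \<omega> i k \<partial>N) = (if j = k then \<Lambda> j else 0)"
    proof -
      have "0 \<le> \<Lambda> j" "0 \<le> \<Lambda> k"
        using \<Lambda>[OF j] \<Lambda>[OF k] c by linarith+
      then show ?thesis
        using * by simp
    qed
  next
    fix i and u :: "nat \<Rightarrow> real" assume i: "i < n" and u: "dot p u u \<le> 1"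
    define w where "w = (\<lambda>j. sqrt (\<Lambda> j) * u j)"
    have wC: "dot p w w \<le> C"
      unfolding w_def using \<Lambda> c C by (intro dot_sqrt_le u) force+
    \<comment> \<open>Coordinates with weight 0 are removed, since a normal law of variance 0 has no
      density and could not enter the sum of independent normals.\<close>
    define J where "J = {j. j < p \<and> w j \<noteq> 0}"
    have J: "finite J" "J \<subseteq> {..<p}"
      by (auto simp: J_def)
    have dotJ: "dot p a w = (\<Sum>j\<in>J. w j * a j)" for a
      unfolding dot_def using J by (intro sum.mono_neutral_cong_right) (auto simp: J_def)
    show "(\<integral>\<^sup>+\<omega>. ennreal (exp ((dot p (?A \<omega> i) u / T)\<^sup>2)) \<partial>N) \<le> 2"
    proof (cases "J = {}")
      case True
      then show ?thesis
        by (simp add: dot_scale_columns w_def[symmetric] dotJ emeasure_space_1)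
    next
      case False
      have "indep_vars (\<lambda>_. borel) (\<lambda>j \<omega>. (\<lambda>t. 0 + w j * t) (G \<omega> i j)) J"
        by (rule indep_vars_compose2[OF indep_vars_subset[OF row_indep[OF i ind] J(2)]]) simp
      moreover have "distributed N lborel (\<lambda>\<omega>. 0 + w j * G \<omega> i j) (normal_density (0 + w j * 0) (\<bar>w j\<bar> * 1))" if "j \<in> J" for j
        using that i by (intro normal_density_affine normal) (auto simp: J_def)
      ultimately have "distributed N lborel (\<lambda>\<omega>. \<Sum>j\<in>J. 0 + w j * G \<omega> i j) (normal_density (\<Sum>j\<in>J. 0 + w j * 0) (sqrt (\<Sum>j\<in>J. (\<bar>w j\<bar> * 1)\<^sup>2)))"
        using J(1) False by (intro sum_indep_normal) (auto simp: J_def)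
      moreover have "(\<Sum>j\<in>J. (w j)\<^sup>2) = dot p w w"
        by (simp add: dotJ power2_eq_square)
      ultimately have D: "distributed N lborel (\<lambda>\<omega>. dot p (G \<omega> i) w) (normal_density 0 (sqrt (dot p w w)))"
        by (simp add: dotJ)
      have pos: "0 < dot p w w"
      proof -
        have "0 < (\<Sum>j\<in>J. (w j)\<^sup>2)"
          using J(1) False by (intro sum_pos) (auto simp: J_def)
        then show ?thesis
          by (simp add: dotJ power2_eq_square)
      qed
      have "(2 * sqrt C)\<^sup>2 \<le> T\<^sup>2"
        using T C by (intro power_mono) auto
      then have "4 * (sqrt (dot p w w))\<^sup>2 \<le> T\<^sup>2"
        using wC C by (simp add: power_mult_distrib)
      then show ?thesis
        using normal_exp_square[OF D] pos by (simp add: dot_scale_columns w_def[symmetric])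
    qed
  qed
qed

section \<open>Universality of the minimal risk\<close>

text \<open>In the variable b = sqrt n (\<phi> + \<beta>) both penalties become 1/n times a
  separable sum free of n; for the Lasso this uses the factor 1 / sqrt n in its definition.\<close>

fun scaled_penalty :: "penalty_kind \<Rightarrow> real \<Rightarrow> real \<Rightarrow> real" where
  "scaled_penalty Ridge lam t = lam * t\<^sup>2 / 2"
| "scaled_penalty Lasso lam t = lam * \<bar>t\<bar>"

lemma risk_eq_ploss:
  assumes n: "0 < n"
  shows "risk K lam n p \<beta> A \<xi> \<phi> =
    ploss (scaled_penalty K lam) p {..<n} (\<lambda>i j. A i j / sqrt n) (\<lambda>i. \<xi> i + dot p (A i) \<beta>) (\<lambda>j. sqrt n * (\<phi> j + \<beta> j)) / n"
proof -
  have dot: "dot p (\<lambda>j. A i j / sqrt n) (\<lambda>j. sqrt n * (\<phi> j + \<beta> j)) = (\<Sum>j<p. A i j * \<phi> j) + dot p (A i) \<beta>" for i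
    using n by (simp add: dot_def distrib_left sum.distrib)
  have "lam * penalty K n p (\<lambda>j. \<phi> j + \<beta> j) = (\<Sum>j<p. scaled_penalty K lam (sqrt n * (\<phi> j + \<beta> j))) / n"
  proof (cases K)
    case Ridge
    then show ?thesis
      using n by (simp add: power_mult_distrib sum_distrib_left sum_divide_distrib)
  next
    case Lasso
    have "lam * (1 / sqrt n * (\<Sum>j<p. \<bar>\<phi> j + \<beta> j\<bar>)) = lam * (sqrt n * (\<Sum>j<p. \<bar>\<phi> j + \<beta> j\<bar>)) / n"
      using n by (simp add: field_simps)
    then show ?thesis
      using Lasso by (simp add: abs_mult sum_distrib_left)
  qed
  then show ?thesis
    using n by (simp add: risk_def ploss_def dot add_divide_distrib)
qed

text \<open>The map from \<phi> to b is invertible and the values differ by the factor 1/n only, so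
  a minimizer of the risk is carried to a minimizer of the loss.\<close>

lemma min_risk_eq_opt_risk:
  assumes n: "0 < n" and lam: "0 < lam"
  shows "min_risk K lam n p \<beta> A \<xi> = opt_risk (scaled_penalty K lam) n p \<beta> \<xi> A"
proof -
  let ?f = "ploss (scaled_penalty K lam) p {..<n} (\<lambda>i j. A i j / sqrt n) (\<lambda>i. \<xi> i + dot p (A i) \<beta>)"
  obtain \<phi> where eq: "risk K lam n p \<beta> A \<xi> \<phi> = min_risk K lam n p \<beta> A \<xi>"
    and le: "\<And>\<phi>'. risk K lam n p \<beta> A \<xi> \<phi> \<le> risk K lam n p \<beta> A \<xi> \<phi>'"
    using min_risk_attained[OF n lam] by metis
  have "?f (\<lambda>j. sqrt n * (\<phi> j + \<beta> j)) \<le> ?f b" for b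
  proof -
    have "(\<lambda>j. sqrt n * ((b j / sqrt n - \<beta> j) + \<beta> j)) = b"
      using n by simp
    then have "risk K lam n p \<beta> A \<xi> (\<lambda>j. b j / sqrt n - \<beta> j) = ?f b / n"
      using risk_eq_ploss[OF n, of K lam p \<beta> A \<xi> "\<lambda>j. b j / sqrt n - \<beta> j"] by simp
    then show ?thesis
      using le[of "\<lambda>j. b j / sqrt n - \<beta> j"] risk_eq_ploss[OF n, of K lam p \<beta> A \<xi> \<phi>] n
      by (simp add: divide_le_cancel)
  qed
  then have "pmin (scaled_penalty K lam) p {..<n} (\<lambda>i j. A i j / sqrt n) (\<lambda>i. \<xi> i + dot p (A i) \<beta>) = ?f (\<lambda>j. sqrt n * (\<phi> j + \<beta> j))"
    unfolding pmin_def by (intro cInf_eq_minimum) auto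
  then show ?thesis
    using eq risk_eq_ploss[OF n, of K lam p \<beta> A \<xi> \<phi>] by (simp add: opt_risk_def)
qed

lemma coercive_scaled_penalty: "0 < lam \<Longrightarrow> coercive (scaled_penalty K lam)"
  using smooth_penalty.coercive[OF smooth_penalty_ridge] coercive_abs
  by (cases K) (simp_all add: scaled_penalty.simps[abs_def])

section \<open>Integrating out the noise\<close>

lemma row_law_mono:
  assumes "row_law M p T V \<Lambda>" "V \<le> V'"
  shows "row_law M p T V' \<Lambda>"
  using assms by (auto simp: row_law_def row_law_axioms_def intro: order_trans)

locale noisy_design = regular_design N n p d T \<Lambda> A for N :: "'a measure" and n p d T \<Lambda> A +
  fixes \<xi> :: "'a \<Rightarrow> nat \<Rightarrow> real" and m8 :: real
  assumes noise_measurable: "random_vector {..<n} \<xi> \<in> measurable N (PiM {..<n} (\<lambda>_. borel))"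
    and noise_indep: "independent_of_design N n p A \<xi>"
    and noise_moment: "i < n \<Longrightarrow> integrable N (\<lambda>\<omega>. (\<xi> \<omega> i) ^ 8)" "i < n \<Longrightarrow> (\<integral>\<omega>. (\<xi> \<omega> i) ^ 8 \<partial>N) \<le> m8"
begin

abbreviation noise_law :: "(nat \<Rightarrow> real) measure" where
  "noise_law \<equiv> distr N (PiM {..<n} (\<lambda>_. borel)) (random_vector {..<n} \<xi>)"

lemma prob_space_noise: "prob_space noise_law"
  by (rule prob_space_distr[OF noise_measurable])

lemma noise_mean8:
  shows "integrable noise_law (\<lambda>x. (\<Sum>i<n. (x i) ^ 8) / n)"
    and "(\<integral>x. (\<Sum>i<n. (x i) ^ 8) / n \<partial>noise_law) \<le> m8"
proof -
  have m: "(\<lambda>x. (\<Sum>i<n. (x i) ^ 8) / n) \<in> borel_measurable (PiM {..<n} (\<lambda>_. borel :: real measure))"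
    by measurable
  have eq: "(\<Sum>i<n. (random_vector {..<n} \<xi> \<omega> i) ^ 8) / n = (\<Sum>i<n. (\<xi> \<omega> i) ^ 8) / n" for \<omega>
    by (simp add: random_vector_def)
  show "integrable noise_law (\<lambda>x. (\<Sum>i<n. (x i) ^ 8) / n)"
    unfolding integrable_distr_eq[OF noise_measurable m] eq
    by (intro integrable_divide Bochner_Integration.integrable_sum noise_moment) auto
  have "(\<integral>x. (\<Sum>i<n. (x i) ^ 8) / n \<partial>noise_law) = (\<Sum>i<n. (\<integral>\<omega>. (\<xi> \<omega> i) ^ 8 \<partial>N)) / n"
    unfolding integral_distr[OF noise_measurable m] eq using noise_moment(1) by simp
  also have "\<dots> \<le> (\<Sum>i<n. m8) / n"
    by (intro divide_right_mono sum_mono noise_moment(2)) auto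
  finally show "(\<integral>x. (\<Sum>i<n. (x i) ^ 8) / n \<partial>noise_law) \<le> m8"
    using n_pos by simp
qed

lemma opt_risk_random_variable: "coercive \<rho> \<Longrightarrow> (\<lambda>\<omega>. opt_risk \<rho> n p \<beta> (\<xi> \<omega>) (A \<omega>)) \<in> borel_measurable N"
proof (rule opt_risk_measurable)
  fix i assume i: "i < n"
  then have "(\<lambda>x. x i) \<in> borel_measurable (PiM {..<n} (\<lambda>_. borel :: real measure))"
    by simp
  from measurable_comp[OF noise_measurable this] show "(\<lambda>\<omega>. \<xi> \<omega> i) \<in> borel_measurable N"
    using i by (simp add: comp_def random_vector_def)
qed (auto intro: coord_measurable)

text \<open>The bound for fixed noise is affine and increasing in the average of eighth powers of
  the noise, so integration replaces that average by \<open>m8\<close>.\<close>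

lemma lasso_elastic_expectation:
  fixes lam e K b \<delta> :: real
  assumes \<psi>: "test_function \<psi> C\<psi> L\<psi>" and lam: "0 < lam" and e: "0 < e" and K: "0 \<le> K" and b: "dot p \<beta> \<beta> \<le> b"
    and E: "E \<in> sets (PiM {..<n} (\<lambda>_. law))" "measure (PiM {..<n} (\<lambda>_. law)) E \<le> \<delta>"
    and good: "\<And>R v. R \<in> space (PiM {..<n} (\<lambda>_. law)) - E \<Longrightarrow> dot p v v \<le> K / n * ((\<Sum>j<p. \<bar>v j\<bar>)\<^sup>2 + (rnorm n p R v)\<^sup>2)"
  shows "\<bar>(\<integral>\<omega>. \<psi> (opt_risk (smoothed_abs lam e) n p \<beta> (\<xi> \<omega>) (A \<omega>)) \<partial>N)
      - (\<integral>\<omega>. \<psi> (opt_risk (\<lambda>t. lam * \<bar>t\<bar>) n p \<beta> (\<xi> \<omega>) (A \<omega>)) \<partial>N)\<bar>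
    \<le> C\<psi> * (2 * \<delta> + e * (lam * p / n + K * (1 / lam\<^sup>2 + 4) * (1 + 128 * (m8 + 512 * T ^ 8 * b ^ 4))))"
proof -
  interpret test_function \<psi> C\<psi> L\<psi> by fact
  interpret L: subgaussian_law law p T \<Lambda>
    by (rule subgaussian_law)
  interpret Z: prob_space noise_law
    by (rule prob_space_noise)
  have ce: "coercive (smoothed_abs lam e)"
    using smooth_penalty_smoothed_abs[OF lam e] by (rule smooth_penalty.coercive)
  note ea = expectation_opt_risk[OF noise_measurable noise_indep _ measurable_test bounded, of _ \<beta>]
  define F where "F = (\<lambda>\<rho> x. \<integral>R. \<psi> (opt_risk \<rho> n p \<beta> x R) \<partial>PiM {..<n} (\<lambda>_. law))"
  have Fint: "integrable noise_law (F \<rho>)" if "coercive \<rho>" for \<rho>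
  proof (rule Z.integrable_const_bound[of _ C\<psi>])
    interpret P: prob_space "PiM {..<n} (\<lambda>_. law)"
      by (intro prob_space_PiM L.prob_space_axioms)
    show "AE x in noise_law. norm (F \<rho> x) \<le> C\<psi>"
      unfolding F_def real_norm_def by (intro AE_I2 P.abs_integral_le_const bounded)
    show "F \<rho> \<in> borel_measurable noise_law"
      unfolding F_def by (rule ea(2)[OF that])
  qed
  define X where "X = (\<lambda>x :: nat \<Rightarrow> real. (\<Sum>i<n. (x i) ^ 8) / n)"
  define B where "B = (\<lambda>X. C\<psi> * (2 * \<delta> + e * (lam * p / n + K * (1 / lam\<^sup>2 + 4) * (1 + 128 * (X + 512 * T ^ 8 * b ^ 4)))))"
  have pt: "\<bar>F (smoothed_abs lam e) x - F (\<lambda>t. lam * \<bar>t\<bar>) x\<bar> \<le> B (X x)" for x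
  proof -
    have "\<bar>F (smoothed_abs lam e) x - F (\<lambda>t. lam * \<bar>t\<bar>) x\<bar> \<le> C\<psi> * (2 * measure (PiM {..<n} (\<lambda>_. law)) E
        + e * (lam * p / n + K * (1 / lam\<^sup>2 + 4) * (1 + 128 * (X x + 512 * T ^ 8 * b ^ 4))))"
      unfolding F_def X_def by (rule L.lasso_elastic_expectation[OF \<psi> n_pos lam e K b E(1) good])
    also have "\<dots> \<le> B (X x)"
      unfolding B_def using C_nonneg E(2) by (intro mult_left_mono add_right_mono) auto
    finally show ?thesis .
  qed
  have Xint: "integrable noise_law X" "(\<integral>x. X x \<partial>noise_law) \<le> m8"
    unfolding X_def by (rule noise_mean8)+
  have Bint: "integrable noise_law (\<lambda>x. B (X x))"
    unfolding B_def by (intro integrable_mult_right Bochner_Integration.integrable_add Z.integrable_const Xint)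
  have "\<bar>(\<integral>\<omega>. \<psi> (opt_risk (smoothed_abs lam e) n p \<beta> (\<xi> \<omega>) (A \<omega>)) \<partial>N)
      - (\<integral>\<omega>. \<psi> (opt_risk (\<lambda>t. lam * \<bar>t\<bar>) n p \<beta> (\<xi> \<omega>) (A \<omega>)) \<partial>N)\<bar> =
      \<bar>\<integral>x. F (smoothed_abs lam e) x - F (\<lambda>t. lam * \<bar>t\<bar>) x \<partial>noise_law\<bar>"
    unfolding ea(1)[OF ce] ea(1)[OF coercive_abs[OF lam]]
    using Fint[OF ce] Fint[OF coercive_abs[OF lam]] by (simp add: F_def)
  also have "\<dots> \<le> (\<integral>x. \<bar>F (smoothed_abs lam e) x - F (\<lambda>t. lam * \<bar>t\<bar>) x\<bar> \<partial>noise_law)"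
    by (rule integral_abs_bound)
  also have "\<dots> \<le> (\<integral>x. B (X x) \<partial>noise_law)"
    using Fint[OF ce] Fint[OF coercive_abs[OF lam]] Bint by (intro integral_mono pt) auto
  also have "\<dots> = B (\<integral>x. X x \<partial>noise_law)"
    unfolding B_def using Xint(1) by (simp add: Z.prob_space[simplified])
  also have "\<dots> \<le> B m8"
    unfolding B_def using C_nonneg e K Xint(2) by (intro mult_left_mono add_left_mono add_right_mono) auto
  finally show ?thesis
    by (simp add: B_def)
qed

end

text \<open>The bound of \<open>swap_all_rows\<close> is integrated over the common noise law. The
  two designs may have different block sizes; the larger one gives a variance bound \<open>V\<close>
  valid for both row laws.\<close>

lemma (in smooth_penalty) universality:
  fixes N :: "'a measure" and n p :: nat and T :: real
  assumes \<psi>: "test_function \<psi> C\<psi> L\<psi>" and \<eta>: "0 < \<eta>" and b: "dot p \<beta> \<beta> \<le> b" and C: "\<And>j. j < p \<Longrightarrow> \<Lambda> j \<le> C"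
    and A: "noisy_design N n p d T \<Lambda> A \<xi> m8" and A': "noisy_design N n p d' T \<Lambda> A' \<xi> m8"
  defines "V \<equiv> p * (real (max d d') * (1 + 512 * T ^ 8) + 4 * C\<^sup>2)"
  defines "\<omega> \<equiv> C\<psi> * (p * (L + L\<^sup>2 / (2 * \<mu>)) / (n * sqrt n) + \<eta> + V / (\<eta> * \<mu>\<^sup>2 * (real n)\<^sup>2)) + L\<psi> / n"
  shows "\<bar>(\<integral>x. \<psi> (opt_risk \<rho> n p \<beta> (\<xi> x) (A x)) \<partial>N) - (\<integral>x. \<psi> (opt_risk \<rho> n p \<beta> (\<xi> x) (A' x)) \<partial>N)\<bar>
    \<le> 2 * \<omega> * moment_const \<mu> T b * (1 + 2 * m8)"
proof -
  interpret test_function \<psi> C\<psi> L\<psi> by fact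
  interpret D: noisy_design N n p d T \<Lambda> A \<xi> m8 by fact
  interpret D': noisy_design N n p d' T \<Lambda> A' \<xi> m8 by fact
  interpret Z: prob_space D.noise_law
    by (rule D.prob_space_noise)
  have V: "0 \<le> V"
    unfolding V_def by (intro mult_nonneg_nonneg add_nonneg_nonneg) auto
  have nn: "0 \<le> \<omega>"
    unfolding \<omega>_def using smooth_penalty.L_nonneg[OF smooth_penalty_axioms] mu_pos \<eta> V C_nonneg L_nonneg by auto
  have "1 + 512 * T ^ 8 \<ge> 0"
    by (intro add_nonneg_nonneg) auto
  then have "real p * (d * (1 + 512 * T ^ 8) + 4 * C\<^sup>2) \<le> V" "real p * (d' * (1 + 512 * T ^ 8) + 4 * C\<^sup>2) \<le> V"
    unfolding V_def by (auto intro!: mult_left_mono mult_right_mono add_right_mono)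
  then have M: "row_law D.law p T V \<Lambda>" "row_law D'.law p T V \<Lambda>"
    using D.row_law[OF C] D'.row_law[OF C] row_law_mono by blast+
  define F where "F = (\<lambda>M x. \<integral>R. \<psi> (opt_risk \<rho> n p \<beta> x R) \<partial>PiM {..<n} (\<lambda>_. M))"
  define X where "X = (\<lambda>x :: nat \<Rightarrow> real. (\<Sum>i<n. (x i) ^ 8) / n)"
  have pt: "\<bar>F D.law x - F D'.law x\<bar> \<le> 2 * \<omega> * moment_const \<mu> T b * (1 + 2 * X x)" for x
    unfolding F_def X_def \<omega>_def by (rule swap_all_rows[OF \<psi> D.n_pos \<eta> V b M])
  note ea = D.expectation_opt_risk[OF D.noise_measurable D.noise_indep coercive measurable_test bounded, of \<beta>]
  note ea' = D'.expectation_opt_risk[OF D'.noise_measurable D'.noise_indep coercive measurable_test bounded, of \<beta>]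
  have Fle: "\<bar>F M x\<bar> \<le> C\<psi>" if "prob_space M" for M x
    unfolding F_def using that by (intro prob_space.abs_integral_le_const prob_space_PiM bounded)
  have Fint: "integrable D.noise_law (F D.law)" "integrable D.noise_law (F D'.law)"
    using Fle[OF subgaussian_law.axioms(1)[OF D.subgaussian_law]] Fle[OF subgaussian_law.axioms(1)[OF D'.subgaussian_law]] ea(2) ea'(2)
    by (auto intro!: Z.integrable_const_bound[of _ C\<psi>] AE_I2 simp: F_def[abs_def])
  have Xint: "integrable D.noise_law X" "(\<integral>x. X x \<partial>D.noise_law) \<le> m8"
    unfolding X_def by (rule D.noise_mean8)+
  have mc: "0 \<le> moment_const \<mu> T b"
    unfolding moment_const_def using order_trans[OF dot_self_nonneg b] by (intro add_nonneg_nonneg mult_nonneg_nonneg) auto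
  have "\<bar>(\<integral>x. \<psi> (opt_risk \<rho> n p \<beta> (\<xi> x) (A x)) \<partial>N) - (\<integral>x. \<psi> (opt_risk \<rho> n p \<beta> (\<xi> x) (A' x)) \<partial>N)\<bar> =
      \<bar>\<integral>x. F D.law x - F D'.law x \<partial>D.noise_law\<bar>"
    unfolding ea(1) ea'(1) using Fint by (simp add: F_def)
  also have "\<dots> \<le> (\<integral>x. \<bar>F D.law x - F D'.law x\<bar> \<partial>D.noise_law)"
    by (rule integral_abs_bound)
  also have "\<dots> \<le> (\<integral>x. 2 * \<omega> * moment_const \<mu> T b * (1 + 2 * X x) \<partial>D.noise_law)"
    using Fint Xint by (intro integral_mono pt) auto
  also have "\<dots> = 2 * \<omega> * moment_const \<mu> T b * (1 + 2 * (\<integral>x. X x \<partial>D.noise_law))"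
    using Xint(1) by (simp add: Z.prob_space[simplified])
  also have "\<dots> \<le> 2 * \<omega> * moment_const \<mu> T b * (1 + 2 * m8)"
    using nn mc Xint(2) by (intro mult_left_mono) auto
  finally show ?thesis .
qed

section \<open>Limits along the sequence of experiments\<close>

locale block_model =
  fixes \<kappa> \<sigma> K\<^sub>\<xi> K\<^sub>0 K\<^sub>X c C :: real and M :: "nat \<Rightarrow> 'a measure" and p d :: "nat \<Rightarrow> nat"
    and \<Lambda> \<beta>\<^sub>0 :: "nat \<Rightarrow> nat \<Rightarrow> real" and \<mu> :: "(real \<times> real) measure"
    and X G :: "nat \<Rightarrow> 'a \<Rightarrow> nat \<Rightarrow> nat \<Rightarrow> real" and \<xi> :: "nat \<Rightarrow> 'a \<Rightarrow> nat \<Rightarrow> real"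
  assumes pos: "0 < \<kappa>" "0 < c" "0 < C"
    and model: "block_dependent_model \<kappa> \<sigma> K\<^sub>\<xi> K\<^sub>0 K\<^sub>X c C M p d \<Lambda> \<beta>\<^sub>0 \<mu> X G \<xi>"
begin

text \<open>One scale for both designs: it is at least (|K| + 1) sqrt C with K the sub-Gaussian
  bound of X, and at least 2 sqrt C as the Gaussian design requires.\<close>

definition T :: real where "T = (\<bar>K\<^sub>X\<bar> + 2) * sqrt C"

definition m8 :: real where "m8 = 512 * (\<bar>K\<^sub>\<xi>\<bar> + 1) ^ 8"

definition A :: "nat \<Rightarrow> 'a \<Rightarrow> nat \<Rightarrow> nat \<Rightarrow> real" where
  "A n \<omega> = scale_columns (\<Lambda> n) (X n \<omega>)"

definition A' :: "nat \<Rightarrow> 'a \<Rightarrow> nat \<Rightarrow> nat \<Rightarrow> real" where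
  "A' n \<omega> = scale_columns (\<Lambda> n) (G n \<omega>)"

lemma T_pos: "0 < T"
  unfolding T_def using pos by (intro mult_pos_pos) auto

lemma prob_space_M: "prob_space (M n)"
  using model by (simp add: block_dependent_model_def)

lemma aspect_ratio: "(\<lambda>n. p n / n) \<longlonglongrightarrow> \<kappa>"
  using model by (simp add: block_dependent_model_def)

lemma Lambda_bounds: "0 < n \<Longrightarrow> j < p n \<Longrightarrow> c \<le> \<Lambda> n j \<and> \<Lambda> n j \<le> C"
  using model by (simp add: block_dependent_model_def design_assumption_def)

lemma signal_norm:
  assumes n: "0 < n"
  shows "dot (p n) (\<beta>\<^sub>0 n) (\<beta>\<^sub>0 n) \<le> C / c"
proof -
  have "c * dot (p n) (\<beta>\<^sub>0 n) (\<beta>\<^sub>0 n) = (\<Sum>j<p n. c * (\<beta>\<^sub>0 n j)\<^sup>2)"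
    by (simp add: dot_def sum_distrib_left power2_eq_square)
  also have "\<dots> \<le> (\<Sum>j<p n. \<Lambda> n j * (\<beta>\<^sub>0 n j)\<^sup>2)"
    using Lambda_bounds[OF n] by (intro sum_mono mult_right_mono) auto
  also have "\<dots> \<le> C"
    using model n by (simp add: block_dependent_model_def signal_assumption_def)
  finally show ?thesis
    using pos by (simp add: field_simps)
qed

lemma noise:
  assumes n: "0 < n"
  shows "random_vector {..<n} (\<xi> n) \<in> measurable (M n) (PiM {..<n} (\<lambda>_. borel))"
    and "i < n \<Longrightarrow> integrable (M n) (\<lambda>\<omega>. (\<xi> n \<omega> i) ^ 8)"
    and "i < n \<Longrightarrow> (\<integral>\<omega>. (\<xi> n \<omega> i) ^ 8 \<partial>M n) \<le> m8"
proof -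
  interpret prob_space "M n"
    by (rule prob_space_M)
  have na: "indep_vars (\<lambda>_. borel) (\<lambda>i \<omega>. \<xi> n \<omega> i) {..<n}"
    "\<And>i. i < n \<Longrightarrow> psi2_norm (M n) (\<lambda>\<omega>. \<xi> n \<omega> i) \<le> ennreal K\<^sub>\<xi>"
    using model n by (auto simp: block_dependent_model_def noise_assumption_def)
  have m: "(\<lambda>\<omega>. \<xi> n \<omega> i) \<in> borel_measurable (M n)" if "i < n" for i
    using na(1) that by (simp add: indep_vars_def)
  then show "random_vector {..<n} (\<xi> n) \<in> measurable (M n) (PiM {..<n} (\<lambda>_. borel))"
    unfolding random_vector_def[abs_def] by (intro measurable_restrict) auto
  show "integrable (M n) (\<lambda>\<omega>. (\<xi> n \<omega> i) ^ 8)" "(\<integral>\<omega>. (\<xi> n \<omega> i) ^ 8 \<partial>M n) \<le> m8" if "i < n"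
    unfolding m8_def using power8_moment_of_psi2[OF m na(2)] that by auto
qed

lemma noisy_design_A:
  assumes n: "0 < n"
  shows "noisy_design (M n) n (p n) (d n) T (\<Lambda> n) (A n) (\<xi> n) m8"
proof -
  have "(\<bar>K\<^sub>X\<bar> + 1) * sqrt C \<le> T"
    unfolding T_def using pos by (intro mult_right_mono) auto
  then have "regular_design (M n) n (p n) (d n) T (\<Lambda> n) (\<lambda>\<omega>. scale_columns (\<Lambda> n) (X n \<omega>))"
    using model n pos Lambda_bounds[OF n]
    by (intro regular_design_subgaussian[OF prob_space_M n, where c = c and C = C and K = K\<^sub>X])
       (simp_all add: block_dependent_model_def design_assumption_def)
  moreover have "noisy_design_axioms (M n) n (p n) (\<lambda>\<omega>. scale_columns (\<Lambda> n) (X n \<omega>)) (\<xi> n) m8"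
    using noise[OF n] model n by unfold_locales (auto simp: block_dependent_model_def)
  ultimately show ?thesis
    unfolding noisy_design_def A_def[abs_def] by blast
qed

lemma noisy_design_A':
  assumes n: "0 < n"
  shows "noisy_design (M n) n (p n) 1 T (\<Lambda> n) (A' n) (\<xi> n) m8"
proof -
  have "2 * sqrt C \<le> T"
    unfolding T_def using pos by (intro mult_right_mono) auto
  then have "regular_design (M n) n (p n) 1 T (\<Lambda> n) (\<lambda>\<omega>. scale_columns (\<Lambda> n) (G n \<omega>))"
    using model n pos Lambda_bounds[OF n]
    by (intro regular_design_gaussian[OF prob_space_M n, where c = c and C = C])
       (simp_all add: block_dependent_model_def gaussian_design_def)
  moreover have "noisy_design_axioms (M n) n (p n) (\<lambda>\<omega>. scale_columns (\<Lambda> n) (G n \<omega>)) (\<xi> n) m8"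
    using noise[OF n] model n by unfold_locales (auto simp: block_dependent_model_def)
  ultimately show ?thesis
    unfolding noisy_design_def A'_def[abs_def] by blast
qed

definition gap :: "(real \<Rightarrow> real) \<Rightarrow> (real \<Rightarrow> real) \<Rightarrow> nat \<Rightarrow> real" where
  "gap \<psi> \<rho> n = (\<integral>\<omega>. \<psi> (opt_risk \<rho> n (p n) (\<beta>\<^sub>0 n) (\<xi> n \<omega>) (A n \<omega>)) \<partial>M n)
    - (\<integral>\<omega>. \<psi> (opt_risk \<rho> n (p n) (\<beta>\<^sub>0 n) (\<xi> n \<omega>) (A' n \<omega>)) \<partial>M n)"

lemma block_size_le: "eventually (\<lambda>n. real (d n) \<le> sqrt n) sequentially"
proof -
  have "(\<lambda>n. real (d n)) \<in> o(\<lambda>n. (real n / ln (real n)) powr (1/5))"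
    using model by (simp add: block_dependent_model_def design_assumption_def)
  from landau_o.smallD[OF this, of 1] have "eventually (\<lambda>n. real (d n) \<le> (real n / ln (real n)) powr (1/5)) sequentially"
    by simp
  moreover have "eventually (\<lambda>n::nat. (real n / ln (real n)) powr (1/5) \<le> sqrt n) sequentially"
    by real_asymp
  ultimately show ?thesis
    by eventually_elim linarith
qed

lemma gap_smooth_tendsto:
  assumes \<psi>: "test_function \<psi> C\<psi> L\<psi>" and \<rho>: "smooth_penalty \<rho> \<rho>1 \<rho>2 \<mu>' L"
  shows "gap \<psi> \<rho> \<longlonglongrightarrow> 0"
proof -
  \<comment> \<open>With d \<le> sqrt n eventually, V is of order n^(3/2), so V / (\<eta> n^2) is of
    order n^(-1/2) / \<eta>. The choice \<eta> = n^(-1/4) balances this against \<eta>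
    itself.\<close>
  define \<eta> where "\<eta> = (\<lambda>n::nat. 1 / sqrt (sqrt n))"
  define \<kappa>4 where "\<kappa>4 = 1 + 512 * T ^ 8"
  define V where "V = (\<lambda>n. p n * (real (max (d n) 1) * \<kappa>4 + 4 * C\<^sup>2))"
  define \<omega> where "\<omega> = (\<lambda>n. C\<psi> * (p n * (L + L\<^sup>2 / (2 * \<mu>')) / (n * sqrt n) + \<eta> n + V n / (\<eta> n * \<mu>'\<^sup>2 * (real n)\<^sup>2)) + L\<psi> / n)"
  have bound: "\<bar>gap \<psi> \<rho> n\<bar> \<le> 2 * \<omega> n * moment_const \<mu>' T (C / c) * (1 + 2 * m8)" if n: "0 < n" for n
    unfolding gap_def \<omega>_def V_def \<kappa>4_def
    by (rule smooth_penalty.universality[OF \<rho> \<psi> _ signal_norm[OF n] _ noisy_design_A[OF n] noisy_design_A'[OF n]])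
       (use n Lambda_bounds[OF n] in \<open>auto simp: \<eta>_def\<close>)
  have "\<omega> \<longlonglongrightarrow> C\<psi> * (\<kappa> * 0 + 0 + \<kappa> * ((0 * \<kappa>4 + 4 * C\<^sup>2 * 0) / \<mu>'\<^sup>2)) + 0"
  proof -
    have sq: "(\<lambda>n::nat. sqrt (sqrt n) / n) \<longlonglongrightarrow> 0"
      by real_asymp
    have dn: "(\<lambda>n. real (max (d n) 1) * (sqrt (sqrt n) / n)) \<longlonglongrightarrow> 0"
    proof (rule tendsto_sandwich[OF _ _ tendsto_const])
      show "eventually (\<lambda>n. 0 \<le> real (max (d n) 1) * (sqrt (sqrt n) / n)) sequentially"
        by simp
      show "eventually (\<lambda>n. real (max (d n) 1) * (sqrt (sqrt n) / n) \<le> (sqrt n + 1) * (sqrt (sqrt n) / n)) sequentially"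
        using block_size_le
      proof eventually_elim
        case (elim n)
        then show ?case
          by (intro mult_right_mono) (auto simp: max_def)
      qed
      show "(\<lambda>n::nat. (sqrt n + 1) * (sqrt (sqrt n) / n)) \<longlonglongrightarrow> 0"
        by real_asymp
    qed
    have "(\<lambda>n::nat. (L + L\<^sup>2 / (2 * \<mu>')) * (1 / sqrt n)) \<longlonglongrightarrow> (L + L\<^sup>2 / (2 * \<mu>')) * 0"
      by (intro tendsto_mult tendsto_const) real_asymp
    then have "(\<lambda>n. (p n / n) * ((L + L\<^sup>2 / (2 * \<mu>')) * (1 / sqrt n))) \<longlonglongrightarrow> \<kappa> * 0"
      by (intro tendsto_mult aspect_ratio) simp
    then have 1: "(\<lambda>n. p n * (L + L\<^sup>2 / (2 * \<mu>')) / (n * sqrt n)) \<longlonglongrightarrow> \<kappa> * 0"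
      by simp
    have 2: "\<eta> \<longlonglongrightarrow> 0"
      unfolding \<eta>_def by real_asymp
    have "(\<lambda>n. (p n / n) * ((real (max (d n) 1) * (sqrt (sqrt n) / n) * \<kappa>4 + 4 * C\<^sup>2 * (sqrt (sqrt n) / n)) / \<mu>'\<^sup>2))
        \<longlonglongrightarrow> \<kappa> * ((0 * \<kappa>4 + 4 * C\<^sup>2 * 0) / \<mu>'\<^sup>2)"
      using smooth_penalty.mu_pos[OF \<rho>] by (intro tendsto_intros aspect_ratio dn sq) auto
    moreover have "V n / (\<eta> n * \<mu>'\<^sup>2 * (real n)\<^sup>2) =
        (p n / n) * ((real (max (d n) 1) * (sqrt (sqrt n) / n) * \<kappa>4 + 4 * C\<^sup>2 * (sqrt (sqrt n) / n)) / \<mu>'\<^sup>2)" for n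
    proof (cases "n = 0")
      case False
      then show ?thesis
        using smooth_penalty.mu_pos[OF \<rho>] by (simp add: V_def \<eta>_def field_simps power2_eq_square)
    qed simp
    ultimately have 3: "(\<lambda>n. V n / (\<eta> n * \<mu>'\<^sup>2 * (real n)\<^sup>2)) \<longlonglongrightarrow> \<kappa> * ((0 * \<kappa>4 + 4 * C\<^sup>2 * 0) / \<mu>'\<^sup>2)"
      by simp
    have 4: "(\<lambda>n::nat. L\<psi> / n) \<longlonglongrightarrow> 0"
      by (rule lim_const_over_n)
    show ?thesis
      unfolding \<omega>_def by (intro tendsto_add tendsto_mult tendsto_const 1 2 3 4)
  qed
  then have "(\<lambda>n. 2 * \<omega> n * moment_const \<mu>' T (C / c) * (1 + 2 * m8)) \<longlonglongrightarrow> 2 * 0 * moment_const \<mu>' T (C / c) * (1 + 2 * m8)"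
    by (intro tendsto_mult tendsto_const) simp
  then have "(\<lambda>n. 2 * \<omega> n * moment_const \<mu>' T (C / c) * (1 + 2 * m8)) \<longlonglongrightarrow> 0"
    by simp
  then show ?thesis
    by (rule Lim_null_comparison[rotated]) (use bound in \<open>auto intro: eventually_mono[OF eventually_gt_at_top[of 0]]\<close>)
qed

text \<open>The smoothing parameter is fixed in terms of the target accuracy before n grows, because
  the error for the smoothed penalty is not uniform in it. The triangle inequality passes through
  the smoothed risks of both designs.\<close>

lemma gap_lasso_tendsto:
  assumes \<psi>: "test_function \<psi> C\<psi> L\<psi>" and lam: "0 < lam"
  shows "gap \<psi> (\<lambda>t. lam * \<bar>t\<bar>) \<longlonglongrightarrow> 0"
proof (rule LIMSEQ_I)
  fix r :: real assume r: "0 < r"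
  interpret test_function \<psi> C\<psi> L\<psi> by fact
  have \<kappa>: "0 \<le> \<kappa> + 1"
    using pos by simp
  obtain K a where K: "0 < K" and a: "0 < a"
    and event: "\<And>M p \<Lambda> n. subgaussian_law M p T \<Lambda> \<Longrightarrow> 0 < n \<Longrightarrow> p \<le> (\<kappa> + 1) * n \<Longrightarrow> (\<And>j. j < p \<Longrightarrow> c \<le> \<Lambda> j) \<Longrightarrow>
      \<exists>E\<in>sets (PiM {..<n} (\<lambda>_. M)). measure (PiM {..<n} (\<lambda>_. M)) E \<le> 2 * exp (- a * n) \<and>
        (\<forall>R\<in>space (PiM {..<n} (\<lambda>_. M)) - E. \<forall>v. dot p v v \<le> K / n * ((\<Sum>j<p. \<bar>v j\<bar>)\<^sup>2 + (rnorm n p R v)\<^sup>2))"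
    using restricted_lower_bound_event[OF pos(2) T_pos \<kappa>] by metis
  define b where "b = C / c"
  define D where "D = lam * (\<kappa> + 1) + K * (1 / lam\<^sup>2 + 4) * (1 + 128 * (m8 + 512 * T ^ 8 * b ^ 4))"
  have D: "0 \<le> D"
    unfolding D_def using lam \<kappa> K pos by (intro add_nonneg_nonneg mult_nonneg_nonneg) (auto simp: m8_def)
  \<comment> \<open>Of the budget r, one third goes to the gap of the smoothed problem and one third
    to each smoothing error. The latter is split into r / 6 for the bias and r / 6 for the
    exceptional event; the summand 1 keeps the denominator positive.\<close>
  define e where "e = r / (6 * (C\<psi> * D + 1))"
  have CD: "0 \<le> C\<psi> * D"
    using C_nonneg D by simp
  then have e: "0 < e"
    using r by (simp add: e_def)
  have eD: "C\<psi> * (e * D) \<le> r / 6"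
  proof -
    have "C\<psi> * (e * D) = r / 6 * (C\<psi> * D / (C\<psi> * D + 1))"
      using CD by (simp add: e_def)
    also have "\<dots> \<le> r / 6 * 1"
      using r CD by (intro mult_left_mono) (auto simp: divide_le_eq_1)
    finally show ?thesis
      by simp
  qed
  have "eventually (\<lambda>n. p n / n < \<kappa> + 1) sequentially"
    using aspect_ratio by (rule order_tendstoD) simp
  moreover have "eventually (\<lambda>n. \<bar>gap \<psi> (smoothed_abs lam e) n\<bar> < r / 3) sequentially"
    using tendstoD[OF gap_smooth_tendsto[OF \<psi> smooth_penalty_smoothed_abs[OF lam e]], of "r / 3"] r by (simp add: dist_real_def)
  moreover have "eventually (\<lambda>n. C\<psi> * (2 * (2 * exp (- a * real n))) < r / 6) sequentially"
  proof -
    have "(\<lambda>n::nat. exp (- a * real n)) \<longlonglongrightarrow> 0"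
      using a by real_asymp
    then have "(\<lambda>n::nat. C\<psi> * (2 * (2 * exp (- a * real n)))) \<longlonglongrightarrow> C\<psi> * (2 * (2 * 0))"
      by (intro tendsto_intros)
    then show ?thesis
      by (rule order_tendstoD) (use r in simp)
  qed
  moreover have "eventually (\<lambda>n::nat. 0 < n) sequentially"
    by (rule eventually_gt_at_top)
  ultimately have "eventually (\<lambda>n. norm (gap \<psi> (\<lambda>t. lam * \<bar>t\<bar>) n - 0) < r) sequentially"
  proof eventually_elim
    case (elim n)
    then have n: "0 < n" and pn: "p n \<le> (\<kappa> + 1) * n"
      by (simp_all add: divide_less_eq)
    let ?B = "C\<psi> * (2 * (2 * exp (- a * real n)) + e * D)"
    have approx: "\<bar>(\<integral>\<omega>. \<psi> (opt_risk (smoothed_abs lam e) n (p n) (\<beta>\<^sub>0 n) (\<xi> n \<omega>) (Y \<omega>)) \<partial>M n)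
      - (\<integral>\<omega>. \<psi> (opt_risk (\<lambda>t. lam * \<bar>t\<bar>) n (p n) (\<beta>\<^sub>0 n) (\<xi> n \<omega>) (Y \<omega>)) \<partial>M n)\<bar> \<le> ?B"
      if "noisy_design (M n) n (p n) d' T (\<Lambda> n) Y (\<xi> n) m8" for Y d'
    proof -
      interpret Y: noisy_design "M n" n "p n" d' T "\<Lambda> n" Y "\<xi> n" m8 by fact
      obtain E where E: "E \<in> sets (PiM {..<n} (\<lambda>_. Y.law))" "measure (PiM {..<n} (\<lambda>_. Y.law)) E \<le> 2 * exp (- a * n)"
        and good: "\<And>R v. R \<in> space (PiM {..<n} (\<lambda>_. Y.law)) - E \<Longrightarrow>
          dot (p n) v v \<le> K / n * ((\<Sum>j<p n. \<bar>v j\<bar>)\<^sup>2 + (rnorm n (p n) R v)\<^sup>2)"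
        using event[OF Y.subgaussian_law n pn] Lambda_bounds[OF n] by blast
      have "\<bar>(\<integral>\<omega>. \<psi> (opt_risk (smoothed_abs lam e) n (p n) (\<beta>\<^sub>0 n) (\<xi> n \<omega>) (Y \<omega>)) \<partial>M n)
          - (\<integral>\<omega>. \<psi> (opt_risk (\<lambda>t. lam * \<bar>t\<bar>) n (p n) (\<beta>\<^sub>0 n) (\<xi> n \<omega>) (Y \<omega>)) \<partial>M n)\<bar>
        \<le> C\<psi> * (2 * (2 * exp (- a * n)) + e * (lam * p n / n + K * (1 / lam\<^sup>2 + 4) * (1 + 128 * (m8 + 512 * T ^ 8 * b ^ 4))))"
        using K signal_norm[OF n] by (intro Y.lasso_elastic_expectation[OF \<psi> lam e _ _ E good]) (auto simp: b_def)
      also have "\<dots> \<le> ?B"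
      proof -
        have "lam * p n / n \<le> lam * (\<kappa> + 1)"
          using mult_left_mono[OF less_imp_le[OF elim(1)], of lam] lam by simp
        then show ?thesis
          unfolding D_def using C_nonneg e by (intro mult_left_mono add_left_mono add_right_mono) auto
      qed
      finally show ?thesis .
    qed
    have "?B < r / 3"
      using eD elim(3) by (simp add: distrib_left)
    then show ?case
      using approx[OF noisy_design_A[OF n]] approx[OF noisy_design_A'[OF n]] elim(2) unfolding gap_def real_norm_def by linarith
  qed
  then show "\<exists>no. \<forall>n\<ge>no. norm (gap \<psi> (\<lambda>t. lam * \<bar>t\<bar>) n - 0) < r"
    by (simp add: eventually_sequentially)
qed

lemma gap_tendsto:
  assumes "test_function \<psi> C\<psi> L\<psi>" "0 < lam"
  shows "gap \<psi> (scaled_penalty K lam) \<longlonglongrightarrow> 0"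
  using gap_smooth_tendsto[OF assms(1) smooth_penalty_ridge[OF assms(2)]] gap_lasso_tendsto[OF assms]
  by (cases K) (simp_all add: scaled_penalty.simps[abs_def])

end

text \<open>In u = (x - \<rho>)^2 the second derivative is (2 - 6 u) / (1 + u)^3, of absolute value
  at most 6, which is the Lipschitz constant of the derivative.\<close>

lemma test_function_bump: "test_function (\<lambda>x. (x - \<rho>)\<^sup>2 / (1 + (x - \<rho>)\<^sup>2)) 1 6"
proof -
  let ?f = "\<lambda>x. (x - \<rho>)\<^sup>2 / (1 + (x - \<rho>)\<^sup>2)"
  have pos: "0 < 1 + (x - \<rho>)\<^sup>2" for x
    by (intro add_pos_nonneg) auto
  have d1: "(?f has_real_derivative 2 * (x - \<rho>) / (1 + (x - \<rho>)\<^sup>2)\<^sup>2) (at x)" for x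
    using pos[of x] by (auto intro!: derivative_eq_intros simp: field_simps power2_eq_square)
  then have dd: "deriv ?f = (\<lambda>x. 2 * (x - \<rho>) / (1 + (x - \<rho>)\<^sup>2)\<^sup>2)"
    by (intro ext DERIV_imp_deriv)
  have d2: "((\<lambda>x. 2 * (x - \<rho>) / (1 + (x - \<rho>)\<^sup>2)\<^sup>2) has_real_derivative (2 - 6 * (x - \<rho>)\<^sup>2) / (1 + (x - \<rho>)\<^sup>2) ^ 3) (at x)" for x
  proof -
    define s where "s = 1 + (x - \<rho>)\<^sup>2"
    have s: "0 < s"
      using pos by (simp add: s_def)
    have "((\<lambda>x. 2 * (x - \<rho>) / (1 + (x - \<rho>)\<^sup>2)\<^sup>2) has_real_derivative
        (2 * s\<^sup>2 - 2 * (x - \<rho>) * (2 * s * (2 * (x - \<rho>)))) / (s\<^sup>2 * s\<^sup>2)) (at x)"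
      using s unfolding s_def by (auto intro!: derivative_eq_intros)
    moreover have "(2 * s\<^sup>2 - 2 * (x - \<rho>) * (2 * s * (2 * (x - \<rho>)))) / (s\<^sup>2 * s\<^sup>2) = (2 - 6 * (x - \<rho>)\<^sup>2) / s ^ 3"
    proof -
      have "2 * s\<^sup>2 - 2 * (x - \<rho>) * (2 * s * (2 * (x - \<rho>))) = s * (2 * s - 8 * (x - \<rho>)\<^sup>2)"
        by (simp add: power2_eq_square algebra_simps)
      also have "2 * s - 8 * (x - \<rho>)\<^sup>2 = 2 - 6 * (x - \<rho>)\<^sup>2"
        by (simp add: s_def)
      finally show ?thesis
        using s by (simp add: power2_eq_square power3_eq_cube)
    qed
    ultimately show ?thesis
      by (simp add: s_def)
  qed
  have bd2: "\<bar>(2 - 6 * (x - \<rho>)\<^sup>2) / (1 + (x - \<rho>)\<^sup>2) ^ 3\<bar> \<le> 6" for x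
  proof -
    have "(1 + (x - \<rho>)\<^sup>2) ^ 1 \<le> (1 + (x - \<rho>)\<^sup>2) ^ 3"
      by (intro power_increasing) auto
    then have "\<bar>2 - 6 * (x - \<rho>)\<^sup>2\<bar> \<le> 6 * (1 + (x - \<rho>)\<^sup>2) ^ 3"
      using zero_le_power2[of "x - \<rho>"] by (simp only: power_one_right)
    then show ?thesis
      using pos[of x] by (simp add: abs_divide divide_le_eq)
  qed
  show ?thesis
  proof
    fix x y :: real
    show "?f differentiable (at x)"
      using d1 real_differentiable_def by blast
    show "\<bar>?f x\<bar> \<le> 1"
      using pos[of x] by (simp add: divide_le_eq)
    show "\<bar>deriv ?f x\<bar> \<le> 1"
    proof -
      let ?u = "\<bar>x - \<rho>\<bar>"
      have "2 * ?u \<le> 1 + ?u\<^sup>2"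
        using zero_le_power2[of "?u - 1"] by (simp add: power2_diff)
      also have "\<dots> = (1 + (x - \<rho>)\<^sup>2) ^ 1"
        by simp
      also have "\<dots> \<le> (1 + (x - \<rho>)\<^sup>2)\<^sup>2"
        by (intro power_increasing) auto
      finally have "\<bar>2 * (x - \<rho>)\<bar> \<le> (1 + (x - \<rho>)\<^sup>2)\<^sup>2"
        unfolding abs_mult by simp
      then show ?thesis
        unfolding dd abs_divide using pos[of x] by (simp add: divide_le_eq)
    qed
    have "norm (deriv ?f x - deriv ?f y) \<le> 6 * norm (x - y)"
      unfolding dd by (rule field_differentiable_bound[of UNIV, OF _ d2[THEN has_field_derivative_at_within]]) (use bd2 in auto)
    then show "\<bar>deriv ?f x - deriv ?f y\<bar> \<le> 6 * \<bar>x - y\<bar>"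
      by simp
  qed
qed

text \<open>The function t / (1 + t) is increasing and bounded by t and by 1. So the bump is at most
  e^2 off the deviation event and at least e^2 / (1 + e^2) on it, the latter being Markov's
  inequality.\<close>

lemma (in prob_space) prob_deviation_le:
  assumes [measurable]: "Z \<in> borel_measurable M" and e: "0 < e"
  shows "(\<integral>\<omega>. (Z \<omega> - \<rho>)\<^sup>2 / (1 + (Z \<omega> - \<rho>)\<^sup>2) \<partial>M) \<le> e\<^sup>2 + prob {\<omega> \<in> space M. \<bar>Z \<omega> - \<rho>\<bar> > e}"
    and "prob {\<omega> \<in> space M. \<bar>Z \<omega> - \<rho>\<bar> > e} \<le> (1 + e\<^sup>2) / e\<^sup>2 * (\<integral>\<omega>. (Z \<omega> - \<rho>)\<^sup>2 / (1 + (Z \<omega> - \<rho>)\<^sup>2) \<partial>M)"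
proof -
  let ?f = "\<lambda>\<omega>. (Z \<omega> - \<rho>)\<^sup>2 / (1 + (Z \<omega> - \<rho>)\<^sup>2)"
  define E where "E = {\<omega> \<in> space M. \<bar>Z \<omega> - \<rho>\<bar> > e}"
  have E [measurable]: "E \<in> sets M"
    unfolding E_def by measurable
  have pos: "0 < 1 + t\<^sup>2" for t :: real
    by (intro add_pos_nonneg) auto
  have f1: "?f \<omega> \<le> 1" "0 \<le> ?f \<omega>" for \<omega>
    using pos[of "Z \<omega> - \<rho>"] by (auto simp: divide_le_eq)
  have fint: "integrable M ?f"
    by (rule integrable_const_bound[of _ 1]) (use f1 in auto)
  have Eint: "integrable M (indicator E :: _ \<Rightarrow> real)"
    by (intro integrable_real_indicator) (auto simp: emeasure_eq_measure)
  have up: "?f \<omega> \<le> e\<^sup>2 + indicator E \<omega>" if w: "\<omega> \<in> space M" for \<omega>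
  proof (cases "\<omega> \<in> E")
    case True
    then show ?thesis
      using f1(1)[of \<omega>] by (simp add: add_increasing)
  next
    case False
    then have "\<bar>Z \<omega> - \<rho>\<bar> \<le> e"
      using w by (simp add: E_def)
    then have "(Z \<omega> - \<rho>)\<^sup>2 \<le> e\<^sup>2"
      using e by (simp add: abs_le_square_iff[symmetric])
    moreover have "?f \<omega> \<le> (Z \<omega> - \<rho>)\<^sup>2 / 1"
      using pos[of "Z \<omega> - \<rho>"] by (intro divide_left_mono) auto
    ultimately show ?thesis
      using False by simp
  qed
  have low: "indicator E \<omega> \<le> (1 + e\<^sup>2) / e\<^sup>2 * ?f \<omega>" for \<omega>
  proof (cases "\<omega> \<in> E")
    case True
    define t where "t = (Z \<omega> - \<rho>)\<^sup>2"
    have "\<bar>e\<bar> \<le> \<bar>Z \<omega> - \<rho>\<bar>"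
      using True e by (simp add: E_def)
    then have "e\<^sup>2 \<le> t"
      unfolding t_def by (simp only: abs_le_square_iff)
    moreover have "0 < e\<^sup>2"
      using e by simp
    ultimately have "0 < e\<^sup>2 * (1 + t)" and "e\<^sup>2 * (1 + t) \<le> (1 + e\<^sup>2) * t"
      using mult_pos_pos[of "e\<^sup>2" "1 + t"] by (linarith, simp add: algebra_simps)
    then have "1 \<le> ((1 + e\<^sup>2) * t) / (e\<^sup>2 * (1 + t))"
      by (simp only: pos_le_divide_eq mult_1)
    then have "1 \<le> (1 + e\<^sup>2) / e\<^sup>2 * (t / (1 + t))"
      by simp
    then show ?thesis
      using True by (simp add: t_def)
  next
    case False
    then show ?thesis
      using e f1(2)[of \<omega>] by (intro order_trans[OF _ mult_nonneg_nonneg]) auto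
  qed
  have "(\<integral>\<omega>. ?f \<omega> \<partial>M) \<le> (\<integral>\<omega>. e\<^sup>2 + indicator E \<omega> \<partial>M)"
    using fint Eint up by (intro integral_mono) auto
  then show "(\<integral>\<omega>. ?f \<omega> \<partial>M) \<le> e\<^sup>2 + prob {\<omega> \<in> space M. \<bar>Z \<omega> - \<rho>\<bar> > e}"
    using Eint by (simp add: prob_space E_def)
  have "prob E = (\<integral>\<omega>. indicator E \<omega> \<partial>M)"
    by simp
  also have "\<dots> \<le> (\<integral>\<omega>. (1 + e\<^sup>2) / e\<^sup>2 * ?f \<omega> \<partial>M)"
    by (intro integral_mono Eint integrable_mult_right fint low)
  also have "\<dots> = (1 + e\<^sup>2) / e\<^sup>2 * (\<integral>\<omega>. ?f \<omega> \<partial>M)"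
    by (rule integral_mult_right_zero)
  finally show "prob {\<omega> \<in> space M. \<bar>Z \<omega> - \<rho>\<bar> > e} \<le> (1 + e\<^sup>2) / e\<^sup>2 * (\<integral>\<omega>. ?f \<omega> \<partial>M)"
    by (simp add: E_def)
qed

text \<open>Convergence in probability becomes the limit of one expectation, so a single smooth test
  function can carry it between the designs. Measurability is asked for n > 0 only, and a limit
  ignores n = 0.\<close>

lemma converges_in_probability_iff:
  assumes M: "\<And>n. prob_space (M n)" and Z: "\<And>n. 0 < n \<Longrightarrow> Z n \<in> borel_measurable (M n)"
  shows "converges_in_probability M Z \<rho> \<longleftrightarrow> (\<lambda>n. \<integral>\<omega>. (Z n \<omega> - \<rho>)\<^sup>2 / (1 + (Z n \<omega> - \<rho>)\<^sup>2) \<partial>M n) \<longlonglongrightarrow> 0"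
    (is "_ \<longleftrightarrow> ?I \<longlonglongrightarrow> 0")
proof
  assume conv: "converges_in_probability M Z \<rho>"
  show "?I \<longlonglongrightarrow> 0"
  proof (rule LIMSEQ_I)
    fix r :: real assume r: "0 < r"
    define e where "e = sqrt (r / 2)"
    have e: "0 < e" "e\<^sup>2 = r / 2"
      using r by (simp_all add: e_def)
    have "(\<lambda>n. measure (M n) {\<omega> \<in> space (M n). \<bar>Z n \<omega> - \<rho>\<bar> > e}) \<longlonglongrightarrow> 0"
      using conv e by (simp add: converges_in_probability_def)
    then have "eventually (\<lambda>n. measure (M n) {\<omega> \<in> space (M n). \<bar>Z n \<omega> - \<rho>\<bar> > e} < r / 2) sequentially"
      by (rule order_tendstoD) (use r in simp)
    then have "eventually (\<lambda>n. norm (?I n - 0) < r) sequentially"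
      using eventually_gt_at_top[of 0]
    proof eventually_elim
      case (elim n)
      have "0 \<le> ?I n"
        by (intro Bochner_Integration.integral_nonneg) (auto intro: divide_nonneg_pos add_pos_nonneg)
      then show ?case
        using prob_space.prob_deviation_le(1)[OF M Z[OF elim(2)] e(1), of \<rho>] elim(1) e(2) by simp
    qed
    then show "\<exists>no. \<forall>n\<ge>no. norm (?I n - 0) < r"
      by (simp add: eventually_sequentially)
  qed
next
  assume conv: "?I \<longlonglongrightarrow> 0"
  show "converges_in_probability M Z \<rho>"
    unfolding converges_in_probability_def
  proof (intro allI impI)
    fix e :: real assume e: "0 < e"
    have "(\<lambda>n. (1 + e\<^sup>2) / e\<^sup>2 * ?I n) \<longlonglongrightarrow> (1 + e\<^sup>2) / e\<^sup>2 * 0"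
      by (intro tendsto_mult tendsto_const conv)
    then have lim: "(\<lambda>n. (1 + e\<^sup>2) / e\<^sup>2 * ?I n) \<longlonglongrightarrow> 0"
      by (simp only: mult_zero_right)
    show "(\<lambda>n. measure (M n) {\<omega> \<in> space (M n). \<bar>Z n \<omega> - \<rho>\<bar> > e}) \<longlonglongrightarrow> 0"
    proof (rule Lim_null_comparison[OF _ lim])
      show "eventually (\<lambda>n. norm (measure (M n) {\<omega> \<in> space (M n). \<bar>Z n \<omega> - \<rho>\<bar> > e}) \<le> (1 + e\<^sup>2) / e\<^sup>2 * ?I n) sequentially"
        using eventually_gt_at_top[of 0]
      proof eventually_elim
        case (elim n)
        show ?case
          using prob_space.prob_deviation_le(2)[OF M Z[OF elim] e, of \<rho>]
          by (simp only: real_norm_def abs_of_nonneg measure_nonneg)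
      qed
    qed
  qed
qed

theorem corollary4p1:
  fixes \<kappa> \<sigma> K\<^sub>\<xi> K\<^sub>0 K\<^sub>X c C :: real
  assumes "0 < \<kappa>" and "0 < c" and "0 < C"
  shows "\<exists>lam\<^sub>0>0. \<forall>K lam (M :: nat \<Rightarrow> 'a measure) p d \<Lambda> \<beta>\<^sub>0 \<mu> X G \<xi>.
    0 < lam \<longrightarrow> (K = Lasso \<longrightarrow> lam\<^sub>0 \<le> lam) \<longrightarrow>
    block_dependent_model \<kappa> \<sigma> K\<^sub>\<xi> K\<^sub>0 K\<^sub>X c C M p d \<Lambda> \<beta>\<^sub>0 \<mu> X G \<xi> \<longrightarrow>
    (let R\<^sub>X = (\<lambda>n \<omega>. min_risk K lam n (p n) (\<beta>\<^sub>0 n) (scale_columns (\<Lambda> n) (X n \<omega>)) (\<xi> n \<omega>));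
         R\<^sub>G = (\<lambda>n \<omega>. min_risk K lam n (p n) (\<beta>\<^sub>0 n) (scale_columns (\<Lambda> n) (G n \<omega>)) (\<xi> n \<omega>))
     in (\<forall>\<psi> :: real \<Rightarrow> real.
           bounded (range \<psi>) \<longrightarrow> (\<forall>x. \<psi> differentiable (at x)) \<longrightarrow>
           bounded (range (deriv \<psi>)) \<longrightarrow> (\<exists>L. L-lipschitz_on UNIV (deriv \<psi>)) \<longrightarrow>
           (\<exists>\<gamma> :: nat \<Rightarrow> real. \<gamma> \<in> o(\<lambda>_. 1) \<and>
              (\<forall>n>0. \<bar>(\<integral>\<omega>. \<psi> (R\<^sub>X n \<omega>) \<partial>M n) - (\<integral>\<omega>. \<psi> (R\<^sub>G n \<omega>) \<partial>M n)\<bar> \<le> \<gamma> n))) \<and>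
        (\<forall>\<rho>. converges_in_probability M R\<^sub>G \<rho> \<longrightarrow> converges_in_probability M R\<^sub>X \<rho>))"
  unfolding Let_def
proof (intro exI[of _ 1] conjI allI impI)
  fix K and lam :: real and M :: "nat \<Rightarrow> 'a measure" and p d \<Lambda> \<beta>\<^sub>0 \<mu> X G \<xi>
  assume lam: "0 < lam" and model: "block_dependent_model \<kappa> \<sigma> K\<^sub>\<xi> K\<^sub>0 K\<^sub>X c C M p d \<Lambda> \<beta>\<^sub>0 \<mu> X G \<xi>"
  interpret block_model \<kappa> \<sigma> K\<^sub>\<xi> K\<^sub>0 K\<^sub>X c C M p d \<Lambda> \<beta>\<^sub>0 \<mu> X G \<xi>
    using assms model by unfold_locales
  let ?X = "\<lambda>n \<omega>. min_risk K lam n (p n) (\<beta>\<^sub>0 n) (scale_columns (\<Lambda> n) (X n \<omega>)) (\<xi> n \<omega>)"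
  let ?G = "\<lambda>n \<omega>. min_risk K lam n (p n) (\<beta>\<^sub>0 n) (scale_columns (\<Lambda> n) (G n \<omega>)) (\<xi> n \<omega>)"
  have X_eq: "?X n = (\<lambda>\<omega>. opt_risk (scaled_penalty K lam) n (p n) (\<beta>\<^sub>0 n) (\<xi> n \<omega>) (A n \<omega>))"
    and G_eq: "?G n = (\<lambda>\<omega>. opt_risk (scaled_penalty K lam) n (p n) (\<beta>\<^sub>0 n) (\<xi> n \<omega>) (A' n \<omega>))" if "0 < n" for n
    using min_risk_eq_opt_risk[OF that lam] by (simp_all add: A_def A'_def)
  have gap: "(\<lambda>n. (\<integral>\<omega>. \<psi> (?X n \<omega>) \<partial>M n) - (\<integral>\<omega>. \<psi> (?G n \<omega>) \<partial>M n)) \<longlonglongrightarrow> 0"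
    if "test_function \<psi> C\<psi> L\<psi>" for \<psi> C\<psi> L\<psi>
  proof (rule Lim_transform_eventually[OF gap_tendsto[OF that lam, of K]])
    show "eventually (\<lambda>n. gap \<psi> (scaled_penalty K lam) n = (\<integral>\<omega>. \<psi> (?X n \<omega>) \<partial>M n) - (\<integral>\<omega>. \<psi> (?G n \<omega>) \<partial>M n)) sequentially"
      by (rule eventually_mono[OF eventually_gt_at_top[of 0]]) (simp add: gap_def A_def A'_def min_risk_eq_opt_risk lam)
  qed
  {
    fix \<psi> :: "real \<Rightarrow> real"
    assume b: "bounded (range \<psi>)" and diff: "\<forall>x. \<psi> differentiable (at x)"
      and b': "bounded (range (deriv \<psi>))" and lip: "\<exists>L. L-lipschitz_on UNIV (deriv \<psi>)"
    obtain B where B: "\<And>x. \<bar>\<psi> x\<bar> \<le> B"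
      using b by (auto simp: bounded_iff)
    obtain B' where B': "\<And>x. \<bar>deriv \<psi> x\<bar> \<le> B'"
      using b' by (auto simp: bounded_iff)
    obtain L where L: "L-lipschitz_on UNIV (deriv \<psi>)"
      using lip by blast
    have "test_function \<psi> (max B B') L"
    proof
      fix x y
      show "\<psi> differentiable (at x)" "\<bar>\<psi> x\<bar> \<le> max B B'" "\<bar>deriv \<psi> x\<bar> \<le> max B B'"
        using diff B[of x] B'[of x] by auto
      show "\<bar>deriv \<psi> x - deriv \<psi> y\<bar> \<le> L * \<bar>x - y\<bar>"
        using lipschitz_onD[OF L, of x y] by (simp add: dist_real_def)
    qed
    \<comment> \<open>The absolute difference of the two expectations is itself taken as
      \<gamma>.\<close>
    from gap[OF this] show "\<exists>\<gamma> :: nat \<Rightarrow> real. \<gamma> \<in> o(\<lambda>_. 1) \<and>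
        (\<forall>n>0. \<bar>(\<integral>\<omega>. \<psi> (?X n \<omega>) \<partial>M n) - (\<integral>\<omega>. \<psi> (?G n \<omega>) \<partial>M n)\<bar> \<le> \<gamma> n)"
      by (intro exI[of _ "\<lambda>n. \<bar>(\<integral>\<omega>. \<psi> (?X n \<omega>) \<partial>M n) - (\<integral>\<omega>. \<psi> (?G n \<omega>) \<partial>M n)\<bar>"] conjI smalloI_tendsto)
         (auto simp: tendsto_rabs_zero_iff)
  }
  fix \<rho>
  assume G: "converges_in_probability M ?G \<rho>"
  have meas: "?X n \<in> borel_measurable (M n)" "?G n \<in> borel_measurable (M n)" if n: "0 < n" for n
    unfolding X_eq[OF n] G_eq[OF n]
    by (intro noisy_design.opt_risk_random_variable[OF noisy_design_A[OF n]] noisy_design.opt_risk_random_variable[OF noisy_design_A'[OF n]]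
        coercive_scaled_penalty lam)+
  have "(\<lambda>n. \<integral>\<omega>. (?G n \<omega> - \<rho>)\<^sup>2 / (1 + (?G n \<omega> - \<rho>)\<^sup>2) \<partial>M n) \<longlonglongrightarrow> 0"
    using G converges_in_probability_iff[where M = M and Z = ?G, OF prob_space_M meas(2)] by blast
  \<comment> \<open>The bump expectation for X is the one for G plus the difference of the two, and
    both summands tend to 0.\<close>
  from tendsto_add[OF this gap[OF test_function_bump[of \<rho>]]]
  have "(\<lambda>n. \<integral>\<omega>. (?X n \<omega> - \<rho>)\<^sup>2 / (1 + (?X n \<omega> - \<rho>)\<^sup>2) \<partial>M n) \<longlonglongrightarrow> 0"
    by simp
  then show "converges_in_probability M ?X \<rho>"
    using converges_in_probability_iff[where M = M and Z = ?X, OF prob_space_M meas(1)] by blast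
qed simp

end
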